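(* Let $\Omega\subset\mathbb{C}$ be a Jordan domain with three distinct boundary points $p,q,r$ specified. Let $\triangle ABC$ be a (closed) equilateral Euclidean triangle with unit edge length, with vertices labelled so that $A,B,C$ have the same cyclic orientation on the boundary as $p,q,r$, and let $f:\triangle ABC\to\overline{\Omega}$ be the Riemann mapping for $(\Omega,(p,q,r))$, i.e. the homeomorphism that is conformal from the interior of $\triangle ABC$ onto $\Omega$ and satisfies $f(A)=p$, $f(B)=q$, $f(C)=r$. Then there exists a sequence of weighted triangulated polygonal disks $(\Omega_n,\mathcal{T}_n,I_n,(p_n,q_n,r_n))$, $n\ge 1$, with inversive distance circle packing metrics $l_n$, where $\mathcal{T}_n$ is a triangulation of $\Omega_n$, $I_n:E(\mathcal{T}_n)\to(1,+\infty)$ is a weight, and $p_n,q_n,r_n$ are three distinct boundary vertices of $\mathcal{T}_n$, such that: (a) $\Omega=\bigcup_{n=1}^{\infty}\Omega_n$ with $\Omega_n\subset\Omega_{n+1}$ for all $n$, and $\lim_n p_n=p$, $\lim_n q_n=q$, $\lim_n r_n=r$; (b) for every $n$ the discrete conformal map $f_n$ from $\triangle ABC$ to $(\Omega_n,\mathcal{T}_n,I_n,l_n)$ with $f_n(A)=p_n$, $f_n(B)=q_n$, $f_n(C)=r_n$ exists; (c) the discrete conformal maps $f_n$ converge uniformly on $\triangle ABC$ to the Riemann mapping $f$.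
   Context: **PL metrics and curvature.** Let $S$ be a surface, possibly with boundary, with a triangulation $\mathcal{T}$ having vertex, edge and face sets $V,E,F$. A PL metric on $(S,\mathcal{T})$ is a function $l:E\to\mathbb{R}_{>0}$ satisfying the strict triangle inequality on every face; it gives the flat cone metric obtained by gluing Euclidean triangles with edge lengths $l$. The combinatorial curvature $K(v)$ of $l$ at a vertex $v$ is $2\pi$ minus the sum of the angles at $v$ if $v$ is an interior vertex, and $\pi$ minus the sum of the angles at $v$ if $v$ is a boundary vertex. A vertex $v$ is flat if $K(v)=0$; a PL metric is flat if all interior vertices are flat. **Inversive distance circle packing metrics.** Given a weight $I:E\to(1,+\infty)$, a PL metric $l$ is an inversive distance circle packing metric on $(S,\mathcal{T},I)$ if there is a function $u:V\to\mathbb{R}$ (a label) such that for every edge $e$ with endpoints $v,v'$, $$l(e)=\sqrt{e^{2u(v)}+e^{2u(v')}+2I(e)e^{u(v)+u(v')}}.$$ For $w:V\to\mathbb{R}$, $w*l$ denotes the function on edges given by the same formula with the same weight $I$ and with $u$ replaced by $u+w$; when it satisfies the triangle inequalities, it is an inversive distance circle packing metric conformally equivalent to $l$. **Discrete conformal map.** Let $(D,\mathcal{T},I)$ be an oriented polygonal disk in the plane, triangulated by $\mathcal{T}$ into Euclidean triangles, with weight $I$ and three distinct boundary vertices $p,q,r$. Let $l$ be a flat inversive distance circle packing metric on $(D,\mathcal{T},I)$ which is the Euclidean metric of $D$ (so $l$ gives the Euclidean edge lengths of $\mathcal{T}$). Suppose there is $w:V\to\mathbb{R}$ such that $l^*=w*l$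 is an inversive distance circle packing metric on $(D,\mathcal{T},I)$ with total area $\frac{\sqrt3}{4}$, combinatorial curvature $\frac{2\pi}{3}$ at $p,q,r$, and curvature $0$ at all other vertices. Then $(D,\mathcal{T},l^* )$ is isometric to the unit equilateral triangle $\triangle ABC$ with some geodesic triangulation $\mathcal{T}'$ combinatorially equivalent to $\mathcal{T}$, with $A,B,C$ corresponding to $p,q,r$. The discrete conformal map associated to $(D,\mathcal{T},I,l,\{p,q,r\})$ is the orientation-preserving piecewise linear map from $\triangle ABC$ to $D$, linear on each triangle of $\mathcal{T}'$, which sends each vertex of $\mathcal{T}'$ to the corresponding vertex of $\mathcal{T}$; in particular it sends $A,B,C$ to $p,q,r$. The discrete conformal map is said to exist if such a $w$ exists. *)

theory Defs
  imports "HOL-Complex_Analysis.Complex_Analysis"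
begin

section \<open>Triangulations and PL metrics\<close>

text \<open>A combinatorial triangulation is given by its set \<open>F\<close> of faces, each face being the set of
  its three vertices. Edges are two-element sets of vertices; edge functions (lengths, weights) are
  functions on vertex sets, of which only the values on \<open>edges_of F\<close> matter.\<close>

definition vertices_of :: "'v set set \<Rightarrow> 'v set"
  where "vertices_of F = \<Union>F"

definition edges_of :: "'v set set \<Rightarrow> 'v set set"
  where "edges_of F = {e. card e = 2 \<and> (\<exists>t\<in>F. e \<subseteq> t)}"

definition boundary_edges :: "'v set set \<Rightarrow> 'v set set"
  where "boundary_edges F = {e \<in> edges_of F. card {t \<in> F. e \<subseteq> t} = 1}"

definition boundary_vertices :: "'v set set \<Rightarrow> 'v set"
  where "boundary_vertices F = \<Union>(boundary_edges F)"

definition pl_metric :: "'v set set \<Rightarrow> ('v set \<Rightarrow> real) \<Rightarrow> bool"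
  where "pl_metric F l \<longleftrightarrow>
    (\<forall>e\<in>edges_of F. 0 < l e) \<and>
    (\<forall>x y z. {x, y, z} \<in> F \<and> distinct [x, y, z] \<longrightarrow> l {x, z} < l {x, y} + l {y, z})"

text \<open>Law of cosines for the angle at \<open>v\<close> of a Euclidean triangle with vertex set \<open>t\<close>, whose side
  opposite to \<open>v\<close> is \<open>t - {v}\<close>; see \<open>corner_angle_eq\<close> below.\<close>

definition corner_angle :: "('v set \<Rightarrow> real) \<Rightarrow> 'v set \<Rightarrow> 'v \<Rightarrow> real"
  where "corner_angle l t v =
    arccos (((\<Sum>x\<in>t - {v}. (l {v, x})\<^sup>2) - (l (t - {v}))\<^sup>2) / (2 * (\<Prod>x\<in>t - {v}. l {v, x})))"

definition curvature :: "'v set set \<Rightarrow> ('v set \<Rightarrow> real) \<Rightarrow> 'v \<Rightarrow> real"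
  where "curvature F l v =
    (if v \<in> boundary_vertices F then pi else 2 * pi) - (\<Sum>t | t \<in> F \<and> v \<in> t. corner_angle l t v)"

definition flat_metric :: "'v set set \<Rightarrow> ('v set \<Rightarrow> real) \<Rightarrow> bool"
  where "flat_metric F l \<longleftrightarrow>
    pl_metric F l \<and> (\<forall>v \<in> vertices_of F - boundary_vertices F. curvature F l v = 0)"

text \<open>Heron's formula; see \<open>triangle_area_eq\<close> below.\<close>

definition triangle_area :: "('v set \<Rightarrow> real) \<Rightarrow> 'v set \<Rightarrow> real"
  where "triangle_area l t =
    (let s = (\<Sum>e\<in>edges_of {t}. l e) / 2 in sqrt (s * (\<Prod>e\<in>edges_of {t}. s - l e)))"

definition total_area :: "'v set set \<Rightarrow> ('v set \<Rightarrow> real) \<Rightarrow> real"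
  where "total_area F l = (\<Sum>t\<in>F. triangle_area l t)"

lemma corner_angle_eq:
  assumes "distinct [v, x, y]"
  shows "corner_angle l {v, x, y} v =
    arccos (((l {v, x})\<^sup>2 + (l {v, y})\<^sup>2 - (l {x, y})\<^sup>2) / (2 * (l {v, x} * l {v, y})))"
proof -
  have "{v, x, y} - {v} = {x, y}" using assms by auto
  then show ?thesis using assms by (simp add: corner_angle_def)
qed

lemma triangle_area_eq:
  assumes "distinct [x, y, z]"
    and s: "s = (l {x, y} + l {y, z} + l {z, x}) / 2"
  shows "triangle_area l {x, y, z} =
    sqrt (s * ((s - l {x, y}) * (s - l {y, z}) * (s - l {z, x})))"
proof -
  have "edges_of {{x, y, z}} = {{x, y}, {y, z}, {z, x}}"
  proof (intro equalityI subsetI)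
    fix e assume "e \<in> edges_of {{x, y, z}}"
    then have "card e = 2" and sub: "e \<subseteq> {x, y, z}" by (auto simp: edges_of_def)
    then obtain a b where "e = {a, b}" "a \<noteq> b" by (auto simp: card_2_iff)
    with sub show "e \<in> {{x, y}, {y, z}, {z, x}}" by auto
  next
    fix e assume "e \<in> {{x, y}, {y, z}, {z, x}}"
    with assms(1) show "e \<in> edges_of {{x, y, z}}" by (auto simp: edges_of_def)
  qed
  moreover have "{x, y} \<noteq> {y, z}" "{x, y} \<noteq> {z, x}" "{y, z} \<noteq> {z, x}"
    using assms(1) by (auto simp: doubleton_eq_iff)
  ultimately have "(\<Sum>e\<in>edges_of {{x, y, z}}. l e) / 2 = s"
    and "(\<Prod>e\<in>edges_of {{x, y, z}}. s - l e) =
      (s - l {x, y}) * (s - l {y, z}) * (s - l {z, x})"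
    by (simp_all add: s add.assoc mult.assoc)
  then show ?thesis by (simp only: triangle_area_def Let_def)
qed


section \<open>Inversive distance circle packing metrics\<close>

definition packing_label ::
  "'v set set \<Rightarrow> ('v set \<Rightarrow> real) \<Rightarrow> ('v set \<Rightarrow> real) \<Rightarrow> ('v \<Rightarrow> real) \<Rightarrow> bool"
  where "packing_label F I l u \<longleftrightarrow>
    (\<forall>v v'. {v, v'} \<in> edges_of F \<longrightarrow>
       l {v, v'} = sqrt (exp (2 * u v) + exp (2 * u v') + 2 * I {v, v'} * exp (u v + u v')))"

definition packing_metric :: "'v set set \<Rightarrow> ('v set \<Rightarrow> real) \<Rightarrow> ('v set \<Rightarrow> real) \<Rightarrow> bool"
  where "packing_metric F I l \<longleftrightarrow> pl_metric F l \<and> (\<exists>u. packing_label F I l u)"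

text \<open>\<open>ls\<close> is \<open>w * l\<close>, as a function on edges.\<close>

definition conformal_change ::
  "'v set set \<Rightarrow> ('v set \<Rightarrow> real) \<Rightarrow> ('v \<Rightarrow> real) \<Rightarrow> ('v set \<Rightarrow> real) \<Rightarrow> ('v set \<Rightarrow> real) \<Rightarrow> bool"
  where "conformal_change F I w l ls \<longleftrightarrow>
    (\<exists>u. packing_label F I l u \<and> packing_label F I ls (\<lambda>v. u v + w v))"


section \<open>Triangulated polygonal disks in the plane\<close>

text \<open>Here the vertices are points of the plane and a face stands for its convex hull;
  \<^const>\<open>triangulation\<close> says that any two of the triangles meet in a common face.\<close>

definition geodesic_triangulation :: "complex set \<Rightarrow> complex set set \<Rightarrow> bool"
  where "geodesic_triangulation D F \<longleftrightarrow>
    (\<forall>t\<in>F. card t = 3 \<and> \<not> affine_dependent t) \<and>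
    triangulation ((\<lambda>t. convex hull t) ` F) \<and>
    D = (\<Union>t\<in>F. convex hull t)"

definition triangulated_polygonal_disk :: "complex set \<Rightarrow> complex set set \<Rightarrow> bool"
  where "triangulated_polygonal_disk D F \<longleftrightarrow>
    geodesic_triangulation D F \<and> D homeomorphic (cball 0 1 :: complex set)"

definition weighted_triangulated_disk ::
  "complex set \<Rightarrow> complex set set \<Rightarrow> (complex set \<Rightarrow> real) \<Rightarrow> complex \<Rightarrow> complex \<Rightarrow> complex \<Rightarrow> bool"
  where "weighted_triangulated_disk D F I p q r \<longleftrightarrow>
    triangulated_polygonal_disk D F \<and>
    (\<forall>e\<in>edges_of F. 1 < I e) \<and>
    {p, q, r} \<subseteq> boundary_vertices F \<and> distinct [p, q, r]"

definition euclidean_packing_metric ::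
  "complex set set \<Rightarrow> (complex set \<Rightarrow> real) \<Rightarrow> (complex set \<Rightarrow> real) \<Rightarrow> bool"
  where "euclidean_packing_metric F I l \<longleftrightarrow>
    packing_metric F I l \<and> flat_metric F l \<and>
    (\<forall>v v'. {v, v'} \<in> edges_of F \<longrightarrow> l {v, v'} = dist v v')"


section \<open>Discrete conformal maps\<close>

definition uniformizes ::
  "'v set set \<Rightarrow> ('v set \<Rightarrow> real) \<Rightarrow> ('v set \<Rightarrow> real) \<Rightarrow> 'v \<Rightarrow> 'v \<Rightarrow> 'v \<Rightarrow>
   ('v \<Rightarrow> real) \<Rightarrow> ('v set \<Rightarrow> real) \<Rightarrow> bool"
  where "uniformizes F I l p q r w ls \<longleftrightarrow>
    conformal_change F I w l ls \<and> packing_metric F I ls \<and>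
    total_area F ls = sqrt 3 / 4 \<and>
    (\<forall>v\<in>{p, q, r}. curvature F ls v = 2 * pi / 3) \<and>
    (\<forall>v\<in>vertices_of F - {p, q, r}. curvature F ls v = 0)"

definition discrete_conformal_map_exists ::
  "complex set set \<Rightarrow> (complex set \<Rightarrow> real) \<Rightarrow> (complex set \<Rightarrow> real) \<Rightarrow>
   complex \<Rightarrow> complex \<Rightarrow> complex \<Rightarrow> bool"
  where "discrete_conformal_map_exists F I l p q r \<longleftrightarrow> (\<exists>w ls. uniformizes F I l p q r w ls)"

text \<open>For a real-linear map \<open>h\<close> of the plane, \<open>Im (cnj (h 1) * h \<i>)\<close> is its determinant.\<close>

definition orientation_preserving_affine_on :: "complex set \<Rightarrow> (complex \<Rightarrow> complex) \<Rightarrow> bool"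
  where "orientation_preserving_affine_on S g \<longleftrightarrow>
    (\<exists>h c. linear h \<and> 0 < Im (cnj (h 1) * h \<i>) \<and> (\<forall>z\<in>S. g z = h z + c))"

text \<open>\<open>\<phi>\<close> is the combinatorial isomorphism of \<open>F\<close> onto the geodesic triangulation \<open>T'\<close> of the triangle
  \<open>ABC\<close>. As \<open>T'\<close> has the edge lengths \<open>ls\<close>, it induces the isometry of \<open>(D, F, ls)\<close> onto \<open>ABC\<close>.
  The map \<open>g\<close> takes \<open>ABC\<close> onto the underlying set of \<open>F\<close>; its values off \<open>ABC\<close> are irrelevant.\<close>

definition discrete_conformal_map ::
  "complex \<Rightarrow> complex \<Rightarrow> complex \<Rightarrow>
   complex set set \<Rightarrow> (complex set \<Rightarrow> real) \<Rightarrow> (complex set \<Rightarrow> real) \<Rightarrow>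
   complex \<Rightarrow> complex \<Rightarrow> complex \<Rightarrow> (complex \<Rightarrow> complex) \<Rightarrow> bool"
  where "discrete_conformal_map A B C F I l p q r g \<longleftrightarrow>
    (\<exists>w ls \<phi> T'.
       uniformizes F I l p q r w ls \<and>
       inj_on \<phi> (vertices_of F) \<and> T' = (\<lambda>t. \<phi> ` t) ` F \<and>
       geodesic_triangulation (convex hull {A, B, C}) T' \<and>
       \<phi> p = A \<and> \<phi> q = B \<and> \<phi> r = C \<and>
       (\<forall>v v'. {v, v'} \<in> edges_of F \<longrightarrow> dist (\<phi> v) (\<phi> v') = ls {v, v'}) \<and>
       (\<forall>v\<in>vertices_of F. g (\<phi> v) = v) \<and>
       (\<forall>t\<in>T'. orientation_preserving_affine_on (convex hull t) g))"


section \<open>Jordan domains and Riemann mappings\<close>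

definition jordan_domain :: "complex set \<Rightarrow> bool"
  where "jordan_domain \<Omega> \<longleftrightarrow>
    (\<exists>\<gamma>. simple_path \<gamma> \<and> pathfinish \<gamma> = pathstart \<gamma> \<and> \<Omega> = inside (path_image \<gamma>))"

text \<open>A counterclockwise parametrization of the boundary starting at \<open>p\<close> meets \<open>q\<close> before \<open>r\<close>.\<close>

definition counterclockwise :: "complex set \<Rightarrow> complex \<Rightarrow> complex \<Rightarrow> complex \<Rightarrow> bool"
  where "counterclockwise \<Omega> p q r \<longleftrightarrow>
    (\<exists>\<gamma> s t. simple_path \<gamma> \<and> pathfinish \<gamma> = pathstart \<gamma> \<and> path_image \<gamma> = frontier \<Omega> \<and>
       (\<forall>z\<in>\<Omega>. winding_number \<gamma> z = 1) \<and>
       0 < s \<and> s < t \<and> t < 1 \<and> \<gamma> 0 = p \<and> \<gamma> s = q \<and> \<gamma> t = r)"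

definition riemann_mapping ::
  "complex \<Rightarrow> complex \<Rightarrow> complex \<Rightarrow> complex set \<Rightarrow> complex \<Rightarrow> complex \<Rightarrow> complex \<Rightarrow>
   (complex \<Rightarrow> complex) \<Rightarrow> bool"
  where "riemann_mapping A B C \<Omega> p q r f \<longleftrightarrow>
    (\<exists>g. homeomorphism (convex hull {A, B, C}) (closure \<Omega>) f g) \<and>
    f holomorphic_on interior (convex hull {A, B, C}) \<and>
    f ` interior (convex hull {A, B, C}) = \<Omega> \<and>
    f A = p \<and> f B = q \<and> f C = r"

end

theory Submission
  imports Defs
begin

text \<open>
  For \<open>\<rho> < 1\<close> the function \<open>G z = f (c + \<rho> (z - c))\<close>, with \<open>c\<close> inside the triangle, is univalent on a
  neighbourhood of the triangle and close to \<open>f\<close>; so no boundary behaviour of \<open>f\<close> enters. Subdivide the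
  triangle into \<open>n\<^sup>2\<close> equilateral triangles and put the constant inversive distance \<open>n\<^sup>2/2 - 1\<close> on all edges.
  Up to \<open>O(n\<^sup>-\<^sup>4)\<close> the radii proportional to \<open>exp w\<close> with \<open>w = ln \<bar>G'\<bar>\<close> are flat, because \<open>w\<close> is harmonic and the
  linearized flatness equation is the hexagonal discrete Laplacian. Since angles are monotone in the radii, the
  functions \<open>w \<plusminus> t n\<^sup>-\<^sup>2 (\<bar>z - A\<bar>\<^sup>2 - 1)\<close> are barriers, and Perron's method gives an exactly flat weight within
  \<open>O(n\<^sup>-\<^sup>2)\<close> of \<open>w\<close>. Its triangles are developed into the plane and compared with \<open>G\<close>: the piecewise linear
  interpolation of the developed vertices differs from \<open>G\<close> by a function with Lipschitz constant \<open>O(1/n)\<close>, so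
  that it is injective and uniformly close to \<open>G\<close>. Finally, a map uniformly close to \<open>f\<close> covers any given compact
  subset of \<open>\<Omega>\<close>, which allows choosing the images increasing.
\<close>

section \<open>Triangles with given squared side lengths\<close>

text \<open>The disks are built backwards from the target triangle. With \<kappa> =
  \<open>1 / n\<^sup>2\<close> and inversive distance \<open>1 / (2 * \<kappa>) - 1\<close>, the
  weight 0 gives every edge the length 1/n, so the subdivided unit triangle is itself a packing
  metric for the chosen weight on edges. If w is a flat weight realized in the plane, then -w leads
  back to it, and the discrete conformal map exists for free. Only flatness at inner vertices has to
  be solved; the boundary weights are merely confined between the barriers. The obstacle is
  accuracy. Developing multiplies O(n) shape factors, so each needs relative error O(n^-2) for edges
  of length O(1/n) to be right up to O(n^-2), which is what injectivity requires. Three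
  cancellations achieve this: chords of G match the geometric mean of the two end derivatives to
  fourth order; weights linear on the lattice close up exactly, which removes all terms in the
  gradient alone; mixed terms of gradient and second differences cancel around a hexagon. The
  packing differs from vertex scaling by \<kappa> times squared weight differences along edges,
  again O(n^-4).\<close>

text \<open>Arguments are squared side lengths, with \<open>Z\<close> opposite to the common vertex of the sides \<open>X\<close> and \<open>Y\<close>;
  \<open>tri_ratio X Y Z\<close> is the quotient of the sides \<open>Y\<close> and \<open>X\<close> as complex numbers.\<close>

definition heron16 :: "real \<Rightarrow> real \<Rightarrow> real \<Rightarrow> real"
  where "heron16 X Y Z = 4 * X * Y - (X + Y - Z)\<^sup>2"

definition tri_angle :: "real \<Rightarrow> real \<Rightarrow> real \<Rightarrow> real"
  where "tri_angle X Y Z = arccos ((X + Y - Z) / (2 * (sqrt X * sqrt Y)))"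

definition tri_ratio :: "real \<Rightarrow> real \<Rightarrow> real \<Rightarrow> complex"
  where "tri_ratio X Y Z = Complex ((X + Y - Z) / (2 * X)) (sqrt (heron16 X Y Z) / (2 * X))"

lemma heron16_rotate: "heron16 Z X Y = heron16 X Y Z" "heron16 Y Z X = heron16 X Y Z"
  by (simp_all add: heron16_def power2_eq_square algebra_simps)

lemma tri_angle_swap: "tri_angle X Y Z = tri_angle Y X Z"
  by (simp add: tri_angle_def add.commute mult.commute)

lemma tri_angle_scale: "t > 0 \<Longrightarrow> tri_angle (t * X) (t * Y) (t * Z) = tri_angle X Y Z"
proof -
  assume t: "t > 0"
  have "(t * X + t * Y - t * Z) / (2 * (sqrt (t * X) * sqrt (t * Y))) = (t * (X + Y - Z)) / (t * (2 * (sqrt X * sqrt Y)))"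
    using t by (simp add: real_sqrt_mult algebra_simps)
  also have "\<dots> = (X + Y - Z) / (2 * (sqrt X * sqrt Y))"
    using t by (subst mult_divide_mult_cancel_left) auto
  finally show ?thesis by (simp add: tri_angle_def)
qed

text \<open>\<open>heron16 X Y Z > 0\<close> reads (X + Y - Z)^2 < 4 X Y, which is the strict
  triangle inequality written in squared sides.\<close>

lemma tri_cos_less_1:
  assumes "X > 0" "Y > 0" "heron16 X Y Z > 0"
  shows "\<bar>(X + Y - Z) / (2 * (sqrt X * sqrt Y))\<bar> < 1"
proof -
  have e: "(2 * (sqrt X * sqrt Y))\<^sup>2 = 4 * X * Y"
    using assms(1,2) by (simp add: power_mult_distrib)
  have pos: "0 < 2 * (sqrt X * sqrt Y)" using assms(1,2) by simp
  have "\<bar>X + Y - Z\<bar>\<^sup>2 < (2 * (sqrt X * sqrt Y))\<^sup>2"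
    unfolding e power2_abs using assms(3) unfolding heron16_def by linarith
  then have "\<bar>X + Y - Z\<bar> < 2 * (sqrt X * sqrt Y)"
    using pos by (metis less_eq_real_def power2_less_imp_less)
  then have "\<bar>X + Y - Z\<bar> / (2 * (sqrt X * sqrt Y)) < 1"
    using pos by (subst divide_less_eq_1_pos)
  then show ?thesis using pos by (simp only: abs_divide abs_of_pos)
qed

lemma tri_angle_bounds:
  assumes "X > 0" "Y > 0" "heron16 X Y Z > 0"
  shows "0 < tri_angle X Y Z" "tri_angle X Y Z < pi"
proof -
  have "-1 < (X + Y - Z) / (2 * (sqrt X * sqrt Y))" "(X + Y - Z) / (2 * (sqrt X * sqrt Y)) < 1"
    using tri_cos_less_1[OF assms] by linarith+
  from arccos_lt_bounded[OF this] show "0 < tri_angle X Y Z" "tri_angle X Y Z < pi"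
    by (auto simp: tri_angle_def)
qed

text \<open>The bridge between angle sums and products of complex numbers. The imaginary part
  carries the sine, since 1 - cos^2 equals \<open>heron16 X Y Z / (4 * X * Y)\<close>.\<close>

lemma tri_ratio_polar:
  assumes "X > 0" "Y > 0" "heron16 X Y Z > 0"
  shows "tri_ratio X Y Z = of_real (sqrt Y / sqrt X) * cis (tri_angle X Y Z)"
proof -
  define N where "N = (X + Y - Z) / (2 * (sqrt X * sqrt Y))"
  have N: "\<bar>N\<bar> < 1" unfolding N_def by (rule tri_cos_less_1[OF assms])
  have "1 - N\<^sup>2 = heron16 X Y Z / (2 * (sqrt X * sqrt Y))\<^sup>2"
    using assms by (simp add: N_def heron16_def power_divide power_mult_distrib field_simps)
  then have "sqrt (1 - N\<^sup>2) = sqrt (heron16 X Y Z) / (2 * (sqrt X * sqrt Y))"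
    using assms by (simp add: real_sqrt_divide real_sqrt_mult)
  moreover have "sin (arccos N) = sqrt (1 - N\<^sup>2)"
    using N by (intro sin_arccos) auto
  moreover have "cos (arccos N) = N"
    using N by (intro cos_arccos) auto
  ultimately have "cis (tri_angle X Y Z) = Complex N (sqrt (heron16 X Y Z) / (2 * (sqrt X * sqrt Y)))"
    by (simp add: complex_eq_iff tri_angle_def N_def)
  then show ?thesis
    using assms by (simp add: complex_eq_iff tri_ratio_def N_def)
qed

lemma tri_ratio_nz:
  assumes "X > 0" "heron16 X Y Z > 0"
  shows "Im (tri_ratio X Y Z) > 0" "tri_ratio X Y Z \<noteq> 0" "1 - tri_ratio X Y Z \<noteq> 0"
proof -
  show im: "Im (tri_ratio X Y Z) > 0" using assms by (simp add: tri_ratio_def)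
  show "tri_ratio X Y Z \<noteq> 0" "1 - tri_ratio X Y Z \<noteq> 0"
    using im by (auto simp: complex_eq_iff)
qed

text \<open>Put the triangle at 0, 1, r: its shapes seen from 1 and from r are (0 - 1) / (r - 1) and
  (1 - r) / (0 - r).\<close>

lemma tri_ratio_rotate:
  assumes "X > 0" "Y > 0" "Z > 0" "heron16 X Y Z > 0"
  shows "tri_ratio Z X Y = 1 / (1 - tri_ratio X Y Z)"
    and "tri_ratio Y Z X = (tri_ratio X Y Z - 1) / tri_ratio X Y Z"
proof -
  define s where "s = sqrt (heron16 X Y Z)"
  have s: "s * s = 4 * X * Y - (X + Y - Z) * (X + Y - Z)"
    using assms by (simp add: s_def heron16_def power2_eq_square)
  have r: "tri_ratio X Y Z = Complex ((X + Y - Z) / (2 * X)) (s / (2 * X))"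
    "tri_ratio Z X Y = Complex ((Z + X - Y) / (2 * Z)) (s / (2 * Z))"
    "tri_ratio Y Z X = Complex ((Y + Z - X) / (2 * Y)) (s / (2 * Y))"
    by (simp_all add: tri_ratio_def heron16_rotate s_def)
  have "Re ((1 - tri_ratio X Y Z) * tri_ratio Z X Y)
      = ((X - Y + Z) * (Z + X - Y) + s * s) / (4 * X * Z)"
    using assms by (simp add: r field_simps)
  also have "\<dots> = 1" using assms by (simp add: s divide_simps; simp add: algebra_simps)
  finally have re: "Re ((1 - tri_ratio X Y Z) * tri_ratio Z X Y) = 1" .
  have "Im ((1 - tri_ratio X Y Z) * tri_ratio Z X Y) = 0"
    using assms by (simp add: r divide_simps; simp add: algebra_simps)
  then have "(1 - tri_ratio X Y Z) * tri_ratio Z X Y = 1"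
    using re by (simp add: complex_eq_iff)
  then show "tri_ratio Z X Y = 1 / (1 - tri_ratio X Y Z)"
    using tri_ratio_nz(3)[OF assms(1,4)] by (simp add: field_simps)
  have "Re (tri_ratio X Y Z * tri_ratio Y Z X)
      = ((X + Y - Z) * (Y + Z - X) - s * s) / (4 * X * Y)"
    using assms by (simp add: r field_simps)
  also have "\<dots> = (X + Y - Z) / (2 * X) - 1"
    using assms by (simp add: s divide_simps; simp add: algebra_simps)
  finally have re: "Re (tri_ratio X Y Z * tri_ratio Y Z X) = Re (tri_ratio X Y Z - 1)"
    by (simp add: r)
  have "Im (tri_ratio X Y Z * tri_ratio Y Z X) = Im (tri_ratio X Y Z - 1)"
    using assms by (simp add: r divide_simps; simp add: algebra_simps)
  with re have "tri_ratio X Y Z * tri_ratio Y Z X = tri_ratio X Y Z - 1"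
    by (simp add: complex_eq_iff)
  then show "tri_ratio Y Z X = (tri_ratio X Y Z - 1) / tri_ratio X Y Z"
    using tri_ratio_nz(2)[OF assms(1,4)] by (simp add: field_simps)
qed

text \<open>The three ratios multiply to -1 by \<open>tri_ratio_rotate\<close> and their moduli
  cancel. Hence the sum is pi modulo 2 pi, and three angles in (0, pi) leave only pi.\<close>

lemma tri_angle_sum:
  assumes "X > 0" "Y > 0" "Z > 0" "heron16 X Y Z > 0"
  shows "tri_angle X Y Z + tri_angle Z X Y + tri_angle Y Z X = pi"
proof -
  define S where "S = tri_angle X Y Z + tri_angle Z X Y + tri_angle Y Z X"
  let ?r = "tri_ratio X Y Z"
  have h: "heron16 Z X Y > 0" "heron16 Y Z X > 0" using assms by (simp_all add: heron16_rotate)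
  have "?r * tri_ratio Z X Y * tri_ratio Y Z X = -1"
    unfolding tri_ratio_rotate[OF assms] using tri_ratio_nz[OF assms(1,4)]
    by (simp add: divide_simps; simp add: algebra_simps)
  moreover have "?r * tri_ratio Z X Y * tri_ratio Y Z X = cis S"
  proof -
    have "?r * tri_ratio Z X Y * tri_ratio Y Z X
        = of_real (sqrt Y / sqrt X * (sqrt X / sqrt Z) * (sqrt Z / sqrt Y)) * cis S"
      unfolding tri_ratio_polar[OF assms(1,2,4)] tri_ratio_polar[OF assms(3,1) h(1)]
        tri_ratio_polar[OF assms(2,3) h(2)] S_def cis_mult[symmetric] of_real_mult
      by (simp only: mult_ac)
    then show ?thesis using assms by simp
  qed
  ultimately have "cis S = -1" by simp
  then have "cis (S - pi) = 1" by (simp add: cis_divide [symmetric])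
  then have c: "cos (S - pi) = 1" by (metis cis.simps(1) one_complex.simps(1))
  have "0 < S" "S < 3 * pi"
    using tri_angle_bounds[OF assms(1,2,4)] tri_angle_bounds[OF assms(3,1) h(1)]
      tri_angle_bounds[OF assms(2,3) h(2)] by (auto simp: S_def)
  moreover obtain k :: int where "S - pi = 2 * pi * of_int k"
    using c unfolding cos_one_2pi_int by (auto simp: mult_ac)
  ultimately have "2 * pi * of_int k < 2 * pi * 1" "2 * pi * (-1) < 2 * pi * of_int k" by linarith+
  then have "real_of_int k < 1" "-1 < real_of_int k"
    using pi_gt_zero by (simp_all only: mult_less_cancel_left_pos zero_less_mult_iff zero_less_numeral simp_thms)
  then have "k = 0" by linarith
  with \<open>S - pi = _\<close> show ?thesis by (simp add: S_def)
qed

text \<open>Squared lengths determine a triangle up to reflection, and positive orientation selects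
  the root with positive imaginary part. This allows comparing shapes of the packing with shapes of
  image triangles of a holomorphic map.\<close>

lemma tri_ratio_exact:
  fixes a b c :: complex
  assumes "Im ((c - a) / (b - a)) > 0"
  shows "tri_ratio ((cmod (b - a))\<^sup>2) ((cmod (c - a))\<^sup>2) ((cmod (c - b))\<^sup>2) = (c - a) / (b - a)"
    and "heron16 ((cmod (b - a))\<^sup>2) ((cmod (c - a))\<^sup>2) ((cmod (c - b))\<^sup>2) > 0"
    and "cmod (b - a) > 0" "cmod (c - a) > 0" "cmod (c - b) > 0"
proof -
  define r where "r = (c - a) / (b - a)"
  define X where "X = (cmod (b - a))\<^sup>2"
  have ba: "b \<noteq> a" using assms by auto
  have X: "X > 0" using ba by (simp add: X_def)
  have cr: "c - a = r * (b - a)" using ba by (simp add: r_def)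
  have Y: "(cmod (c - a))\<^sup>2 = X * ((Re r)\<^sup>2 + (Im r)\<^sup>2)"
    by (simp add: cr norm_mult power_mult_distrib X_def cmod_power2)
  have "c - b = (r - 1) * (b - a)" using cr by (simp add: algebra_simps)
  then have Z: "(cmod (c - b))\<^sup>2 = X * ((Re r - 1)\<^sup>2 + (Im r)\<^sup>2)"
    by (simp add: norm_mult power_mult_distrib X_def cmod_power2)
  have N: "X + (cmod (c - a))\<^sup>2 - (cmod (c - b))\<^sup>2 = 2 * X * Re r"
    unfolding Y Z by (simp add: power2_eq_square algebra_simps)
  have H: "heron16 X ((cmod (c - a))\<^sup>2) ((cmod (c - b))\<^sup>2) = (2 * X * Im r)\<^sup>2"
    unfolding heron16_def N unfolding Y by (simp add: power2_eq_square algebra_simps)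
  have i: "Im r > 0" using assms by (simp add: r_def)
  have "tri_ratio X ((cmod (c - a))\<^sup>2) ((cmod (c - b))\<^sup>2) = r"
    unfolding tri_ratio_def N H using X i by (simp add: complex_eq_iff abs_mult)
  then show "tri_ratio ((cmod (b - a))\<^sup>2) ((cmod (c - a))\<^sup>2) ((cmod (c - b))\<^sup>2) = (c - a) / (b - a)"
    by (simp add: X_def r_def)
  show "heron16 ((cmod (b - a))\<^sup>2) ((cmod (c - a))\<^sup>2) ((cmod (c - b))\<^sup>2) > 0"
    unfolding X_def[symmetric] H using X i by simp
  show "cmod (b - a) > 0" using ba by simp
  show "cmod (c - a) > 0" using assms by auto
  show "cmod (c - b) > 0" using assms ba by auto
qed

section \<open>Angles of inversive distance packings\<close>

text \<open>The mean value inequality twice: for \<open>f'\<close> on \<open>S\<close>, then for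
  \<open>f z - f' y * z\<close> on the segment from \<open>y\<close> to \<open>x\<close>. This
  yields \<open>K\<close> where Taylor's formula has K / 2.\<close>

lemma taylor2_bound:
  fixes f f' f'' :: "'a::real_normed_field \<Rightarrow> 'a"
  assumes "convex S" "x \<in> S" "y \<in> S"
    and f: "\<And>z. z \<in> S \<Longrightarrow> (f has_field_derivative f' z) (at z within S)"
    and f': "\<And>z. z \<in> S \<Longrightarrow> (f' has_field_derivative f'' z) (at z within S)"
    and K: "\<And>z. z \<in> S \<Longrightarrow> norm (f'' z) \<le> K"
  shows "norm (f x - f y - f' y * (x - y)) \<le> K * (norm (x - y))\<^sup>2"
proof -
  have sub: "closed_segment y x \<subseteq> S"
    using assms by (simp add: closed_segment_subset)
  have "norm ((f x - f' y * x) - (f y - f' y * y)) \<le> (K * norm (x - y)) * norm (x - y)"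
  proof (rule field_differentiable_bound[of "closed_segment y x" _ "\<lambda>z. f' z - f' y"])
    fix z assume z: "z \<in> closed_segment y x"
    show "((\<lambda>z. f z - f' y * z) has_field_derivative f' z - f' y) (at z within closed_segment y x)"
      by (rule derivative_eq_intros refl DERIV_subset[OF f sub] | use z sub in force)+
    have "norm (f' z - f' y) \<le> K * norm (z - y)"
      using z sub assms by (intro field_differentiable_bound[OF \<open>convex S\<close> f' K]) auto
    also have "\<dots> \<le> K * norm (x - y)"
    proof (rule mult_left_mono)
      show "norm (z - y) \<le> norm (x - y)"
        using segment_bound(1)[OF z] by (simp add: norm_minus_commute)
      show "0 \<le> K" using K[OF assms(2)] norm_ge_zero order_trans by blast
    qed
    finally show "norm (f' z - f' y) \<le> K * norm (x - y)" .
  qed auto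
  moreover have "f x - f y - f' y * (x - y) = (f x - f' y * x) - (f y - f' y * y)"
    by (simp add: algebra_simps)
  ultimately show ?thesis by (simp only: power2_eq_square mult.assoc)
qed

lemma exp_linear_bound:
  fixes t :: real
  assumes "\<bar>t\<bar> \<le> 1"
  shows "\<bar>exp t - 1 - t\<bar> \<le> 3 * t\<^sup>2"
proof -
  have "norm (exp t - exp 0 - exp 0 * (t - 0)) \<le> 3 * (norm (t - 0))\<^sup>2"
  proof (rule taylor2_bound[of "{-1..1}" t 0 exp exp exp 3])
    fix z :: real assume "z \<in> {-1..1}"
    then have "exp z \<le> exp 1" by simp
    then have "exp z \<le> 3" using exp_le by (rule order_trans)
    then show "norm (exp z) \<le> 3" by simp
  qed (use assms in \<open>auto intro: DERIV_subset[OF DERIV_exp]\<close>)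
  then show ?thesis by simp
qed

text \<open>Radii \<open>\<kappa> exp a\<close> and \<open>\<kappa> exp b\<close> at inversive distance \<open>1 / (2\<kappa>) - 1\<close> have squared distance
  \<open>\<kappa> edge_sq \<kappa> a b\<close>. In the limit \<open>\<kappa> = 0\<close> this is Luo's vertex scaling.\<close>

definition edge_sq :: "real \<Rightarrow> real \<Rightarrow> real \<Rightarrow> real"
  where "edge_sq \<kappa> a b = exp (a + b) + \<kappa> * (exp a - exp b)\<^sup>2"

definition weight_angle :: "real \<Rightarrow> real \<Rightarrow> real \<Rightarrow> real \<Rightarrow> real"
  where "weight_angle \<kappa> a b c = tri_angle (edge_sq \<kappa> a b) (edge_sq \<kappa> a c) (edge_sq \<kappa> b c)"

lemma edge_sq_commute: "edge_sq \<kappa> a b = edge_sq \<kappa> b a"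
  by (simp add: edge_sq_def power2_commute add.commute)

lemma edge_sq_pos: "\<kappa> \<ge> 0 \<Longrightarrow> edge_sq \<kappa> a b > 0"
  by (simp add: edge_sq_def add_pos_nonneg)

text \<open>Adding \<open>t\<close> to all weights is a similarity of the packing. Angles therefore
  depend on differences of weights only, and the weight at the vertex may always be taken as
  0.\<close>

lemma edge_sq_shift: "edge_sq \<kappa> (a + t) (b + t) = exp (2 * t) * edge_sq \<kappa> a b"
proof -
  have "exp (a + t + (b + t)) = exp (2 * t) * exp (a + b)"
    by (simp flip: exp_add add: algebra_simps)
  moreover have "(exp (a + t) - exp (b + t))\<^sup>2 = exp (2 * t) * (exp a - exp b)\<^sup>2"
  proof -
    have "exp a * exp t - exp b * exp t = exp t * (exp a - exp b)" by (simp add: algebra_simps)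
    then show ?thesis by (simp only: exp_add power_mult_distrib exp_double)
  qed
  ultimately show ?thesis
    by (simp add: edge_sq_def algebra_simps)
qed

lemma weight_angle_commute: "weight_angle \<kappa> a b c = weight_angle \<kappa> a c b"
  by (simp add: weight_angle_def edge_sq_commute[of \<kappa> b c] tri_angle_swap)

lemma weight_angle_shift: "weight_angle \<kappa> (a + t) (b + t) (c + t) = weight_angle \<kappa> a b c"
  by (simp add: weight_angle_def edge_sq_shift tri_angle_scale)

lemma weight_angle_0: "weight_angle \<kappa> a b c = weight_angle \<kappa> 0 (b - a) (c - a)"
  using weight_angle_shift[of \<kappa> 0 a "b - a" "c - a"] by simp

lemma exp_near_1:
  fixes b :: real
  assumes "\<bar>b\<bar> \<le> 1 / 20"
  shows "9 / 10 \<le> exp b" "exp b \<le> 11 / 10"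
proof -
  have "1 + b \<le> exp b" by (rule exp_ge_add_one_self)
  with assms show "9 / 10 \<le> exp b" by linarith
  have "b\<^sup>2 \<le> (1 / 20)\<^sup>2" using assms by (metis abs_le_square_iff abs_of_nonneg zero_le_divide_1_iff zero_le_numeral)
  then show "exp b \<le> 11 / 10"
    using exp_linear_bound[of b] assms by (auto simp: power2_eq_square abs_if split: if_splits)
qed

text \<open>The window for \<open>Z\<close> is wider because both ends of the third side may move
  against the vertex of weight 0; the ranges are those delivered by
  \<open>edge_sq_near_1\<close>.\<close>

lemma heron16_near_equilateral:
  assumes "9 / 10 \<le> X" "X \<le> 6 / 5" "9 / 10 \<le> Y" "Y \<le> 6 / 5" "4 / 5 \<le> Z" "Z \<le> 5 / 4"
  shows "1 / 2 \<le> X + Y - Z" "X + Y - Z \<le> 8 / 5" "1 / 2 \<le> heron16 X Y Z"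
proof -
  show 1: "1 / 2 \<le> X + Y - Z" "X + Y - Z \<le> 8 / 5" using assms by linarith+
  have "(X + Y - Z)\<^sup>2 \<le> (8 / 5)\<^sup>2" using 1 by (intro power_mono) auto
  moreover have "9 / 10 * (9 / 10) \<le> X * Y" using assms by (intro mult_mono) auto
  ultimately show "1 / 2 \<le> heron16 X Y Z" by (simp add: heron16_def power2_eq_square)
qed

lemma edge_sq_near_1:
  assumes "0 \<le> \<kappa>" "\<kappa> \<le> 1 / 8" "\<bar>b\<bar> \<le> 1 / 20" "\<bar>c\<bar> \<le> 1 / 20"
  shows "9 / 10 \<le> edge_sq \<kappa> 0 b" "edge_sq \<kappa> 0 b \<le> 6 / 5" "4 / 5 \<le> edge_sq \<kappa> b c" "edge_sq \<kappa> b c \<le> 5 / 4"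
proof -
  note e = exp_near_1[OF assms(3)] exp_near_1[OF assms(4)]
  have q: "\<kappa> * x\<^sup>2 \<le> 1 / 8 * (1 / 5)\<^sup>2" "0 \<le> \<kappa> * x\<^sup>2" if "\<bar>x\<bar> \<le> 1 / 5" for x :: real
  proof -
    have "x\<^sup>2 \<le> (1 / 5)\<^sup>2" using that by (metis abs_le_square_iff abs_of_nonneg zero_le_divide_1_iff zero_le_numeral)
    then show "\<kappa> * x\<^sup>2 \<le> 1 / 8 * (1 / 5)\<^sup>2" using assms by (intro mult_mono) auto
  qed (use assms in auto)
  have "\<bar>1 - exp b\<bar> \<le> 1 / 5" "\<bar>exp b - exp c\<bar> \<le> 1 / 5" using e by linarith+
  note q1 = q[OF this(1)] and q2 = q[OF this(2)]
  show "9 / 10 \<le> edge_sq \<kappa> 0 b" "edge_sq \<kappa> 0 b \<le> 6 / 5"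
    using q1 e by (simp_all add: edge_sq_def power2_eq_square)
  have "9 / 10 * (9 / 10) \<le> exp b * exp c" "exp b * exp c \<le> 11 / 10 * (11 / 10)"
    using e by (intro mult_mono; simp)+
  then show "4 / 5 \<le> edge_sq \<kappa> b c" "edge_sq \<kappa> b c \<le> 5 / 4"
    using q2 by (simp_all add: edge_sq_def exp_add power2_eq_square)
qed

lemma heron16_edge_sq_pos:
  assumes "0 \<le> \<kappa>" "\<kappa> \<le> 1 / 8" "\<bar>b - a\<bar> \<le> 1 / 20" "\<bar>c - a\<bar> \<le> 1 / 20"
  shows "heron16 (edge_sq \<kappa> a b) (edge_sq \<kappa> a c) (edge_sq \<kappa> b c) > 0"
proof -
  have "heron16 (edge_sq \<kappa> 0 (b - a)) (edge_sq \<kappa> 0 (c - a)) (edge_sq \<kappa> (b - a) (c - a)) \<ge> 1 / 2"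
    using edge_sq_near_1[OF assms] edge_sq_near_1[OF assms(1,2,4,3)]
    by (intro heron16_near_equilateral) auto
  moreover have "heron16 (edge_sq \<kappa> a b) (edge_sq \<kappa> a c) (edge_sq \<kappa> b c)
    = exp (2 * a) ^ 2 * heron16 (edge_sq \<kappa> 0 (b - a)) (edge_sq \<kappa> 0 (c - a)) (edge_sq \<kappa> (b - a) (c - a))"
    using edge_sq_shift[of \<kappa> 0 a "b - a"] edge_sq_shift[of \<kappa> 0 a "c - a"] edge_sq_shift[of \<kappa> "b - a" a "c - a"]
    by (simp add: heron16_def power2_eq_square algebra_simps)
  ultimately show ?thesis by simp
qed

text \<open>Let d be the growth of exp b. The sides \<open>X\<close> and \<open>Z\<close> lengthen
  by almost the same amount, so the numerator N of the cosine grows by at most d/10, while X in the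
  denominator gains at least 9d/10. Hence the cosine falls.\<close>

lemma weight_angle_mono_aux:
  assumes \<kappa>: "0 \<le> \<kappa>" "\<kappa> \<le> 1 / 8"
    and b: "\<bar>b\<bar> \<le> 1 / 20" "\<bar>b'\<bar> \<le> 1 / 20" "\<bar>c\<bar> \<le> 1 / 20" and le: "b \<le> b'"
  shows "weight_angle \<kappa> 0 b c \<le> weight_angle \<kappa> 0 b' c"
proof -
  define X X' Y Z Z' where "X = edge_sq \<kappa> 0 b" and "X' = edge_sq \<kappa> 0 b'" and "Y = edge_sq \<kappa> 0 c"
    and "Z = edge_sq \<kappa> b c" and "Z' = edge_sq \<kappa> b' c"
  define N N' d where "N = X + Y - Z" and "N' = X' + Y - Z'" and "d = exp b' - exp b"
  note bds = edge_sq_near_1[OF \<kappa> b(1,3), folded X_def Z_def] edge_sq_near_1[OF \<kappa> b(2,3), folded X'_def Z'_def]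
    edge_sq_near_1[OF \<kappa> b(3,3), folded Y_def]
  note e = exp_near_1[OF b(1)] exp_near_1[OF b(2)] exp_near_1[OF b(3)]
  have d: "0 \<le> d" "d \<le> 1 / 5" using le e by (auto simp: d_def)
  note h = heron16_near_equilateral[of X Y Z] heron16_near_equilateral[of X' Y Z']
  have N: "1 / 2 \<le> N" "1 / 2 \<le> N'" and H: "heron16 X Y Z > 0" "heron16 X' Y Z' > 0"
    using h bds by (auto simp: N_def N'_def)
  have X'X: "X' - X = d * (1 + \<kappa> * (exp b + exp b' - 2))"
    by (simp add: X_def X'_def edge_sq_def d_def power2_eq_square algebra_simps)
  have NN: "N' - N = d * ((1 - exp c) * (1 - 2 * \<kappa>))"
    by (simp add: X_def X'_def Z_def Z'_def N_def N'_def edge_sq_def d_def power2_eq_square exp_add algebra_simps)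
  have "- (1 / 8 * (1 / 5)) \<le> \<kappa> * (exp b + exp b' - 2)"
  proof -
    have "\<kappa> * (2 - exp b - exp b') \<le> \<kappa> * (1 / 5)" using \<kappa> e by (intro mult_left_mono) auto
    also have "\<dots> \<le> 1 / 8 * (1 / 5)" using \<kappa> by simp
    finally show ?thesis by (simp add: algebra_simps)
  qed
  then have X1: "X + d * (9 / 10) \<le> X'"
    using X'X d mult_left_mono[of "9/10" "1 + \<kappa> * (exp b + exp b' - 2)" d] by simp
  have "(1 - exp c) * (1 - 2 * \<kappa>) \<le> \<bar>1 - exp c\<bar> * \<bar>1 - 2 * \<kappa>\<bar>"
    by (metis abs_ge_self abs_mult)
  also have "\<dots> \<le> 1 / 10 * 1" using \<kappa> e by (intro mult_mono) linarith+
  finally have N1: "N' \<le> N + d / 10"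
    using NN d mult_left_mono[of "(1 - exp c) * (1 - 2 * \<kappa>)" "1 / 10" d] by simp
  \<comment> \<open>Squared form of N' / sqrt X' \<le> N / sqrt X: the gain d N^2 9/10 coming from
    X' has to outweigh the cross terms of (N + d/10)^2.\<close>
  have "N'\<^sup>2 * X \<le> (N + d / 10)\<^sup>2 * X"
    using N N1 bds by (intro mult_right_mono power_mono) auto
  also have "\<dots> = N\<^sup>2 * X + d * (X * (N / 5 + d / 100))"
    by (simp add: power2_eq_square algebra_simps)
  also have "\<dots> \<le> N\<^sup>2 * X + d * (N\<^sup>2 * (9 / 10))"
  proof -
    have "X * (N / 5 + d / 100) \<le> 6 / 5 * (N / 5 + N / 100)"
      using bds d N by (intro mult_mono) auto
    also have "\<dots> \<le> N * (9 / 20)" using N by simp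
    also have "\<dots> \<le> N * (N * (9 / 10))" using N by (intro mult_left_mono) auto
    finally have "X * (N / 5 + d / 100) \<le> N\<^sup>2 * (9 / 10)" by (simp add: power2_eq_square)
    from mult_left_mono[OF this d(1)] show ?thesis by linarith
  qed
  also have "\<dots> = N\<^sup>2 * (X + d * (9 / 10))" by (simp add: algebra_simps)
  also have "\<dots> \<le> N\<^sup>2 * X'" using X1 by (intro mult_left_mono) auto
  finally have "sqrt (N'\<^sup>2 * X) \<le> sqrt (N\<^sup>2 * X')" by simp
  then have "N' * sqrt X \<le> N * sqrt X'" using N by (simp add: real_sqrt_mult)
  then have "N' / sqrt X' \<le> N / sqrt X" using bds by (simp add: field_simps)
  then have "N' / sqrt X' / (2 * sqrt Y) \<le> N / sqrt X / (2 * sqrt Y)"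
    using bds by (intro divide_right_mono) auto
  then have le: "N' / (2 * (sqrt X' * sqrt Y)) \<le> N / (2 * (sqrt X * sqrt Y))"
    by (simp add: mult_ac)
  have "\<bar>N / (2 * (sqrt X * sqrt Y))\<bar> < 1" "\<bar>N' / (2 * (sqrt X' * sqrt Y))\<bar> < 1"
    unfolding N_def N'_def by (rule tri_cos_less_1; use bds H in linarith)+
  with le have "arccos (N / (2 * (sqrt X * sqrt Y))) \<le> arccos (N' / (2 * (sqrt X' * sqrt Y)))"
    by (intro arccos_le_arccos) linarith+
  then show ?thesis
    by (simp add: weight_angle_def tri_angle_def N_def N'_def X_def X'_def Y_def Z_def Z'_def)
qed

lemma weight_angle_mono_0:
  assumes "0 \<le> \<kappa>" "\<kappa> \<le> 1 / 8"
    and "\<bar>b\<bar> \<le> 1 / 20" "\<bar>b'\<bar> \<le> 1 / 20" "\<bar>c\<bar> \<le> 1 / 20" "\<bar>c'\<bar> \<le> 1 / 20" "b \<le> b'" "c \<le> c'"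
  shows "weight_angle \<kappa> 0 b c \<le> weight_angle \<kappa> 0 b' c'"
proof -
  have "weight_angle \<kappa> 0 b c \<le> weight_angle \<kappa> 0 b' c"
    using assms by (intro weight_angle_mono_aux) auto
  also have "\<dots> \<le> weight_angle \<kappa> 0 b' c'"
    using weight_angle_mono_aux[of \<kappa> c c' b'] assms by (simp add: weight_angle_commute[of _ _ b'])
  finally show ?thesis .
qed

text \<open>By shift invariance, lowering the centre amounts to raising both neighbours. This is the
  maximum principle behind the barriers and Perron's method. It is proved for nearly equal weights,
  which is why differences up to 1/20 are tracked from here on.\<close>

lemma weight_angle_mono:
  assumes "0 \<le> \<kappa>" "\<kappa> \<le> 1 / 8" "a' \<le> a" "b \<le> b'" "c \<le> c'"
    and "\<bar>b - a\<bar> \<le> 1 / 20" "\<bar>b' - a'\<bar> \<le> 1 / 20" "\<bar>c - a\<bar> \<le> 1 / 20" "\<bar>c' - a'\<bar> \<le> 1 / 20"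
  shows "weight_angle \<kappa> a b c \<le> weight_angle \<kappa> a' b' c'"
  unfolding weight_angle_0[of \<kappa> a] weight_angle_0[of \<kappa> a']
  using assms by (intro weight_angle_mono_0) auto

lemma continuous_on_weight_angle [continuous_intros]:
  assumes "continuous_on T f" "continuous_on T g" "continuous_on T k" "0 \<le> \<kappa>" "\<kappa> \<le> 1 / 8"
    and "\<And>x. x \<in> T \<Longrightarrow> \<bar>g x - f x\<bar> \<le> 1 / 20" "\<And>x. x \<in> T \<Longrightarrow> \<bar>k x - f x\<bar> \<le> 1 / 20"
  shows "continuous_on T (\<lambda>x. weight_angle \<kappa> (f x) (g x) (k x))"
  unfolding weight_angle_def tri_angle_def
proof (rule continuous_on_arccos)
  have p: "edge_sq \<kappa> a b > 0" for a b using assms(4) by (rule edge_sq_pos)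
  have q: "edge_sq \<kappa> a b \<noteq> 0" for a b using p[of a b] by simp
  show "continuous_on T (\<lambda>x. (edge_sq \<kappa> (f x) (g x) + edge_sq \<kappa> (f x) (k x) - edge_sq \<kappa> (g x) (k x)) /
          (2 * (sqrt (edge_sq \<kappa> (f x) (g x)) * sqrt (edge_sq \<kappa> (f x) (k x)))))"
    using q assms(1-3) by (intro continuous_intros) (auto simp: edge_sq_def intro!: continuous_intros)
  show "\<forall>x\<in>T. -1 \<le> (edge_sq \<kappa> (f x) (g x) + edge_sq \<kappa> (f x) (k x) - edge_sq \<kappa> (g x) (k x)) /
          (2 * (sqrt (edge_sq \<kappa> (f x) (g x)) * sqrt (edge_sq \<kappa> (f x) (k x)))) \<and>
       (edge_sq \<kappa> (f x) (g x) + edge_sq \<kappa> (f x) (k x) - edge_sq \<kappa> (g x) (k x)) /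
          (2 * (sqrt (edge_sq \<kappa> (f x) (g x)) * sqrt (edge_sq \<kappa> (f x) (k x)))) \<le> 1"
  proof
    fix x assume x: "x \<in> T"
    show "-1 \<le> (edge_sq \<kappa> (f x) (g x) + edge_sq \<kappa> (f x) (k x) - edge_sq \<kappa> (g x) (k x)) /
          (2 * (sqrt (edge_sq \<kappa> (f x) (g x)) * sqrt (edge_sq \<kappa> (f x) (k x)))) \<and>
       (edge_sq \<kappa> (f x) (g x) + edge_sq \<kappa> (f x) (k x) - edge_sq \<kappa> (g x) (k x)) /
          (2 * (sqrt (edge_sq \<kappa> (f x) (g x)) * sqrt (edge_sq \<kappa> (f x) (k x)))) \<le> 1"
      using tri_cos_less_1[OF p p heron16_edge_sq_pos[OF assms(4,5) assms(6)[OF x] assms(7)[OF x]]]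
      by linarith
  qed
qed

section \<open>The angle sum at a hexagonal vertex\<close>

lemma abs_add2_le: "\<bar>a + b\<bar> \<le> E" if "\<bar>a\<bar> \<le> A" "\<bar>b\<bar> \<le> B" "A + B \<le> E" for a b :: real
  using that by linarith

lemma abs_add4_le: "\<bar>a + b + c + d\<bar> \<le> E"
  if "\<bar>a\<bar> \<le> A" "\<bar>b\<bar> \<le> B" "\<bar>c\<bar> \<le> C" "\<bar>d\<bar> \<le> D" "A + B + C + D \<le> E" for a b c d :: real
  using that by linarith

text \<open>For \<kappa> = 0, the cosine of the angle at the vertex of weight 0 when the other two
  vertices have weights \<open>x\<close> and \<open>y\<close>; see
  \<open>weight_angle_0_0\<close>.\<close>

definition stencil_cos :: "real \<Rightarrow> real \<Rightarrow> real"
  where "stencil_cos x y = (exp ((x - y) / 2) + exp ((y - x) / 2)) / 2 - exp ((x + y) / 2) / 2"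

text \<open>Minus the partial derivative of \<open>stencil_cos x y\<close> in \<open>x\<close>. By
  the chain rule for arccos, \<open>stencil_num x y * inv_sin (stencil_cos x y)\<close> is the
  derivative of the angle in \<open>x\<close>.\<close>

definition stencil_num :: "real \<Rightarrow> real \<Rightarrow> real"
  where "stencil_num x y = exp ((x + y) / 2) / 4 - (exp ((x - y) / 2) - exp ((y - x) / 2)) / 4"

text \<open>The reciprocal sine of an angle as a function of its cosine.\<close>

definition inv_sin :: "real \<Rightarrow> real"
  where "inv_sin y = 1 / sqrt (1 - y\<^sup>2)"

lemma weight_angle_0_0: "weight_angle 0 0 x y = arccos (stencil_cos x y)"
proof -
  have sq: "sqrt (exp t) = exp (t / 2)" for t :: real
    by (rule real_sqrt_unique) (simp_all add: power2_eq_square flip: exp_add)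
  define E F where "E = exp (x / 2)" and "F = exp (y / 2)"
  have EF: "E > 0" "F > 0" by (simp_all add: E_def F_def)
  have ex: "exp x = E * E" "exp y = F * F" by (simp_all add: E_def F_def flip: exp_add)
  have exy: "exp (x + y) = E * E * (F * F)" by (simp only: exp_add ex)
  have c: "stencil_cos x y = (E / F + F / E) / 2 - E * F / 2"
    by (simp add: stencil_cos_def E_def F_def diff_divide_distrib add_divide_distrib exp_add exp_diff)
  have "(E * E + F * F - E * E * (F * F)) / (2 * (E * F)) = (E / F + F / E) / 2 - E * F / 2"
    using EF by (simp add: field_simps)
  then have "(exp x + exp y - exp (x + y)) / (2 * (E * F)) = stencil_cos x y"
    by (simp only: ex exy c)
  then show ?thesis by (simp add: weight_angle_def tri_angle_def edge_sq_def sq E_def F_def)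
qed

text \<open>Values at the equilateral triangle, where the cosine is 1/2. The number
  \<open>1 / sqrt 3\<close> becomes the coefficient of the discrete Laplacian in
  \<open>angle_sum_stencil\<close>.\<close>

lemma inv_sin_half: "(inv_sin (1 / 2))\<^sup>2 = 4 / 3" "inv_sin (1 / 2) > 0" "inv_sin (1 / 2) \<le> 6 / 5"
  "inv_sin (1 / 2) / 2 = 1 / sqrt 3"
proof -
  have *: "inv_sin (1 / 2) = 1 / sqrt (3 / 4)" by (simp add: inv_sin_def power2_eq_square)
  have "(1 / sqrt (3 / 4))\<^sup>2 = (4 / 3 :: real)" by (subst power_divide, subst real_sqrt_pow2) auto
  then show a: "(inv_sin (1 / 2))\<^sup>2 = 4 / 3" unfolding * .
  show b: "inv_sin (1 / 2) > 0" unfolding * by simp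
  have "(inv_sin (1 / 2))\<^sup>2 \<le> (6 / 5)\<^sup>2" unfolding a by (simp add: power2_eq_square)
  then show "inv_sin (1 / 2) \<le> 6 / 5" by (rule power2_le_imp_le) simp
  have "(inv_sin (1 / 2) / 2)\<^sup>2 = (1 / sqrt 3)\<^sup>2" unfolding power_divide a by simp
  then show "inv_sin (1 / 2) / 2 = 1 / sqrt 3"
    by (rule power2_eq_imp_eq) (use b in auto)
qed

lemma inv_sin_bound: "y \<in> {3/10..7/10} \<Longrightarrow> 0 < inv_sin y \<and> inv_sin y \<le> 3 / 2"
proof -
  assume y: "y \<in> {3/10..7/10}"
  then have "y\<^sup>2 \<le> (7/10)\<^sup>2" by (intro power_mono) auto
  then have b: "(2/3)\<^sup>2 \<le> 1 - y\<^sup>2" by (simp add: power2_eq_square)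
  then have "2/3 \<le> sqrt (1 - y\<^sup>2)" by (rule real_le_rsqrt)
  then have "1 / sqrt (1 - y\<^sup>2) \<le> 3 / 2" "0 < 1 / sqrt (1 - y\<^sup>2)"
    by (subst pos_divide_le_eq | subst zero_less_divide_iff | linarith | simp)+
  then show ?thesis unfolding inv_sin_def by blast
qed

lemma DERIV_inv_sin: "y\<^sup>2 < 1 \<Longrightarrow> (inv_sin has_real_derivative y * inv_sin y ^ 3) (at y)"
proof -
  assume y: "y\<^sup>2 < 1"
  define r where "r = sqrt (1 - y\<^sup>2)"
  have r: "r > 0" using y by (simp add: r_def)
  have "((\<lambda>y. 1 / sqrt (1 - y\<^sup>2)) has_real_derivative
      - ((inverse (sqrt (1 - y\<^sup>2)) / 2) * (- (2 * y))) / (sqrt (1 - y\<^sup>2) * sqrt (1 - y\<^sup>2))) (at y)"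
    using y by (auto intro!: derivative_eq_intros)
  moreover have "- ((inverse (sqrt (1 - y\<^sup>2)) / 2) * (- (2 * y))) / (sqrt (1 - y\<^sup>2) * sqrt (1 - y\<^sup>2))
      = y * inv_sin y ^ 3"
    unfolding inv_sin_def r_def[symmetric] using r by (simp add: field_simps power3_eq_cube)
  moreover have "inv_sin = (\<lambda>y. 1 / sqrt (1 - y\<^sup>2))" by (rule ext) (simp add: inv_sin_def)
  ultimately show ?thesis by simp
qed

text \<open>The slope at 1/2 is half the cube of \<open>inv_sin (1 / 2)\<close>; its square being
  4/3, this is 2/3 of the value itself.\<close>

lemma inv_sin_taylor:
  assumes "y \<in> {3/10..7/10}"
  shows "\<bar>inv_sin y - inv_sin (1/2) * (1 + 2/3 * (y - 1/2))\<bar> \<le> 15 * (y - 1/2)\<^sup>2"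
proof -
  let ?S = "{3/10..7/10::real}"
  have sq: "z\<^sup>2 \<le> 49/100" if "z \<in> ?S" for z :: real
  proof -
    have "z\<^sup>2 \<le> (7/10)\<^sup>2" using that by (intro power_mono) auto
    then show ?thesis by (simp add: power2_eq_square)
  qed
  have "norm (inv_sin y - inv_sin (1/2) - (1/2 * inv_sin (1/2) ^ 3) * (y - 1/2)) \<le> 15 * (norm (y - 1/2))\<^sup>2"
  proof (rule taylor2_bound[of ?S _ _ inv_sin "\<lambda>y. y * inv_sin y ^ 3" "\<lambda>y. inv_sin y ^ 3 + y * (3 * inv_sin y ^ 2 * (y * inv_sin y ^ 3))"])
    fix z assume z: "z \<in> ?S"
    have z1: "z\<^sup>2 < 1" using sq[OF z] by argo
    show "(inv_sin has_real_derivative z * inv_sin z ^ 3) (at z within ?S)"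
      using DERIV_inv_sin[OF z1] by (rule has_field_derivative_at_within)
    show "((\<lambda>y. y * inv_sin y ^ 3) has_real_derivative inv_sin z ^ 3 + z * (3 * inv_sin z ^ 2 * (z * inv_sin z ^ 3))) (at z within ?S)"
      by (rule has_field_derivative_at_within)
        (auto intro!: derivative_eq_intros DERIV_inv_sin[OF z1] simp: algebra_simps)
    have i: "0 < inv_sin z" "inv_sin z \<le> 3/2" using inv_sin_bound[OF z] by auto
    have "inv_sin z ^ 3 \<le> (3/2)^3" "inv_sin z ^ 5 \<le> (3/2)^5" using i by (intro power_mono; simp)+
    moreover have "z\<^sup>2 * inv_sin z ^ 5 \<le> 49/100 * (3/2)^5"
      using sq[OF z] i by (intro mult_mono power_mono) auto
    moreover have "z * (3 * inv_sin z ^ 2 * (z * inv_sin z ^ 3)) = 3 * (z\<^sup>2 * inv_sin z ^ 5)"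
      by (simp add: power2_eq_square power3_eq_cube eval_nat_numeral algebra_simps)
    ultimately have "inv_sin z ^ 3 + z * (3 * inv_sin z ^ 2 * (z * inv_sin z ^ 3)) \<le> 15"
      by (simp only: power_divide) simp
    moreover have "0 \<le> inv_sin z ^ 3 + z * (3 * inv_sin z ^ 2 * (z * inv_sin z ^ 3))"
      using i z by simp
    ultimately show "norm (inv_sin z ^ 3 + z * (3 * inv_sin z ^ 2 * (z * inv_sin z ^ 3))) \<le> 15"
      by simp
  qed (use assms in auto)
  moreover have "1/2 * inv_sin (1/2) ^ 3 = inv_sin (1/2) * (2/3)"
    using inv_sin_half(1) by (simp add: power3_eq_cube power2_eq_square)
  then have "inv_sin y - inv_sin (1/2) * (1 + 2/3 * (y - 1/2))
      = inv_sin y - inv_sin (1/2) - (1/2 * inv_sin (1/2) ^ 3) * (y - 1/2)"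
    by (simp only:) (simp add: algebra_simps)
  ultimately show ?thesis by (simp only: real_norm_def power2_abs)
qed

lemma stencil_expansions:
  assumes "\<bar>x\<bar> \<le> M" "\<bar>y\<bar> \<le> M" "M \<le> 1/20"
  shows "\<bar>stencil_cos x y - 1/2 + (x + y) / 4\<bar> \<le> 9/2 * M\<^sup>2"
    and "\<bar>stencil_num x y - (1 - x / 2 + 3 * y / 2) / 4\<bar> \<le> 3 * M\<^sup>2"
proof -
  define p q where "p = (x + y) / 2" and "q = (x - y) / 2"
  have pq: "\<bar>p\<bar> \<le> M" "\<bar>q\<bar> \<le> M" using assms by (auto simp: p_def q_def)
  have e: "\<bar>exp t - 1 - t\<bar> \<le> 3 * M\<^sup>2" if "\<bar>t\<bar> \<le> M" for t :: real
  proof -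
    have "t\<^sup>2 \<le> M\<^sup>2" using that by (simp add: abs_le_square_iff[symmetric])
    then show ?thesis using exp_linear_bound[of t] that assms by argo
  qed
  define P Q R where "P = exp p - 1 - p" and "Q = exp q - 1 - q" and "R = exp (- q) - 1 - (- q)"
  have b: "\<bar>P\<bar> \<le> 3 * M\<^sup>2" "\<bar>Q\<bar> \<le> 3 * M\<^sup>2" "\<bar>R\<bar> \<le> 3 * M\<^sup>2"
    unfolding P_def Q_def R_def using pq by (auto intro!: e simp del: diff_minus_eq_add)
  have ex: "exp ((x + y) / 2) = 1 + p + P" "exp ((x - y) / 2) = 1 + q + Q" "exp ((y - x) / 2) = 1 - q + R"
  proof -
    have "(y - x) / 2 = - q" by (simp add: q_def field_simps)
    then show "exp ((y - x) / 2) = 1 - q + R" by (simp add: R_def)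
  qed (simp_all add: P_def Q_def p_def q_def)
  have "stencil_cos x y - 1/2 + (x + y) / 4 = (Q + R - P) / 2"
    unfolding stencil_cos_def ex by (simp add: p_def field_simps)
  then show "\<bar>stencil_cos x y - 1/2 + (x + y) / 4\<bar> \<le> 9/2 * M\<^sup>2" using b by argo
  have "stencil_num x y - (1 - x / 2 + 3 * y / 2) / 4 = (P - Q + R) / 4"
    unfolding stencil_num_def ex by (simp add: p_def q_def field_simps)
  then show "\<bar>stencil_num x y - (1 - x / 2 + 3 * y / 2) / 4\<bar> \<le> 3 * M\<^sup>2" using b by argo
qed

lemma stencil_cos_range:
  assumes "\<bar>x\<bar> \<le> M" "\<bar>y\<bar> \<le> M" "M \<le> 1/20"
  shows "\<bar>stencil_cos x y - 1/2\<bar> \<le> M" "stencil_cos x y \<in> {3/10..7/10}"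
proof -
  have "0 \<le> M" using assms by linarith
  then have "M\<^sup>2 \<le> M * (1/20)" unfolding power2_eq_square using assms by (intro mult_left_mono) auto
  then show *: "\<bar>stencil_cos x y - 1/2\<bar> \<le> M" using stencil_expansions(1)[OF assms] assms by argo
  show "stencil_cos x y \<in> {3/10..7/10}" unfolding atLeastAtMost_iff using * assms by (intro conjI; argo)
qed

text \<open>To first order the factors are (1 + A) / 4 and s (1 + B), and A + B = -2x/3 + 4y/3. This
  linear part cannot be dropped: against increments of size \<rho>^2 it weighs \<rho>^3, more than
  the tolerated \<rho>^4.\<close>

lemma stencil_deriv_expansion:
  assumes "\<bar>x\<bar> \<le> M" "\<bar>y\<bar> \<le> M" "M \<le> 1/20"
  shows "\<bar>stencil_num x y * inv_sin (stencil_cos x y) - inv_sin (1/2) / 4 * (1 - 2/3 * x + 4/3 * y)\<bar> \<le> 10 * M\<^sup>2"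
proof -
  define s A B where "s = inv_sin (1/2)" and "A = - x / 2 + 3 * y / 2" and "B = - (x + y) / 6"
  define r1 r2 where "r1 = stencil_num x y - (1 + A) / 4" and "r2 = inv_sin (stencil_cos x y) - s * (1 + B)"
  have M: "0 \<le> M" using assms by argo
  have s: "0 < s" "s \<le> 6/5" using inv_sin_half by (auto simp: s_def)
  have AB: "\<bar>A\<bar> \<le> 2 * M" "\<bar>B\<bar> \<le> M / 3" using assms by (auto simp: A_def B_def abs_le_iff)
  have r1: "\<bar>r1\<bar> \<le> 3 * M\<^sup>2" using stencil_expansions(2)[OF assms] by (simp add: r1_def A_def algebra_simps)
  have r2: "\<bar>r2\<bar> \<le> 19 * M\<^sup>2"
  proof -
    let ?c = "stencil_cos x y"
    note t = inv_sin_taylor[OF stencil_cos_range(2)[OF assms], folded s_def]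
    have "(?c - 1/2)\<^sup>2 \<le> M\<^sup>2" using stencil_cos_range(1)[OF assms] by (simp add: abs_le_square_iff[symmetric])
    with t have t: "\<bar>inv_sin ?c - s * (1 + 2/3 * (?c - 1/2))\<bar> \<le> 15 * M\<^sup>2" by argo
    have "\<bar>2/3 * (?c - 1/2) - B\<bar> \<le> 3 * M\<^sup>2" using stencil_expansions(1)[OF assms]
      unfolding B_def by argo
    then have "\<bar>s * (2/3 * (?c - 1/2) - B)\<bar> \<le> 6/5 * (3 * M\<^sup>2)" unfolding abs_mult using s by (intro mult_mono) auto
    moreover have "r2 = (inv_sin ?c - s * (1 + 2/3 * (?c - 1/2))) + s * (2/3 * (?c - 1/2) - B)"
      by (simp add: r2_def algebra_simps)
    ultimately show ?thesis using abs_add2_le[OF t, of _ "6/5 * (3 * M\<^sup>2)" "19 * M\<^sup>2"] by simp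
  qed
  have M2: "M\<^sup>2 \<le> 1/400" using power_mono[OF assms(3) M, of 2] by (simp add: power2_eq_square)
  have eq: "stencil_num x y * inv_sin (stencil_cos x y) - s / 4 * (1 - 2/3 * x + 4/3 * y)
     = s / 4 * (A * B) + s * (1 + B) * r1 + (1 + A) / 4 * r2 + r1 * r2"
    by (simp add: r1_def r2_def A_def B_def field_simps)
  have "\<bar>s / 4 * (A * B)\<bar> \<le> (6/5) / 4 * (2 * M * (M / 3))" unfolding abs_mult using s AB M by (intro mult_mono) auto
  moreover have "\<bar>s * (1 + B) * r1\<bar> \<le> (6/5) * (11/10) * (3 * M\<^sup>2)"
    unfolding abs_mult using s AB M r1 assms by (intro mult_mono; (linarith | simp | argo))
  moreover have "\<bar>(1 + A) / 4 * r2\<bar> \<le> (11/10) / 4 * (19 * M\<^sup>2)"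
    unfolding abs_mult using AB M r2 assms by (intro mult_mono; (linarith | simp | argo))
  moreover have "\<bar>r1 * r2\<bar> \<le> (3 * M\<^sup>2) * (19 * (1/400))"
    unfolding abs_mult using r1 r2 M2 by (intro mult_mono) auto
  ultimately show ?thesis unfolding s_def[symmetric] eq
    by (rule abs_add4_le) (simp add: power2_eq_square)
qed

text \<open>The increments are of size \<rho>^2, so one mean value step along the segment from (x,
  y) to (x + e, y + f) suffices: the derivative is known up to O(\<rho>^2), which makes the product
  accurate to O(\<rho>^4).\<close>

lemma weight_angle_increment:
  assumes "\<bar>x\<bar> \<le> 2 * \<rho>" "\<bar>y\<bar> \<le> 2 * \<rho>" "\<bar>e\<bar> \<le> \<rho>\<^sup>2" "\<bar>f\<bar> \<le> \<rho>\<^sup>2" "0 \<le> \<rho>" "\<rho> \<le> 1/100"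
  shows "\<bar>weight_angle 0 0 (x + e) (y + f) - weight_angle 0 0 x y
    - inv_sin (1/2) / 4 * ((1 - 2/3 * x + 4/3 * y) * e + (1 - 2/3 * y + 4/3 * x) * f)\<bar> \<le> 200 * \<rho>^4"
proof -
  define D where "D = (\<lambda>x y. stencil_num x y * inv_sin (stencil_cos x y))"
  define s where "s = inv_sin (1/2)"
  have s: "0 < s" "s \<le> 6/5" using inv_sin_half by (auto simp: s_def)
  have rr: "\<rho>\<^sup>2 \<le> \<rho>" unfolding power2_eq_square using mult_right_mono[of \<rho> 1 \<rho>] assms by simp
  have small: "\<bar>x + \<sigma> * e\<bar> \<le> 3 * \<rho> \<and> \<bar>y + \<sigma> * f\<bar> \<le> 3 * \<rho>" if "0 \<le> \<sigma>" "\<sigma> \<le> 1" for \<sigma>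
  proof -
    have "\<bar>\<sigma> * e\<bar> \<le> 1 * \<rho>\<^sup>2" "\<bar>\<sigma> * f\<bar> \<le> 1 * \<rho>\<^sup>2" unfolding abs_mult using that assms by (intro mult_mono; simp)+
    then show ?thesis using assms rr by (auto simp: abs_le_iff)
  qed
  have "\<exists>\<sigma>. 0 < \<sigma> \<and> \<sigma> < 1 \<and> arccos (stencil_cos (x + 1 * e) (y + 1 * f)) - arccos (stencil_cos (x + 0 * e) (y + 0 * f))
      = (1 - 0) * (D (x + \<sigma> * e) (y + \<sigma> * f) * e + D (y + \<sigma> * f) (x + \<sigma> * e) * f)"
  proof (rule MVT2)
    fix \<sigma> :: real assume \<sigma>: "0 \<le> \<sigma>" "\<sigma> \<le> 1"
    let ?x = "x + \<sigma> * e" and ?y = "y + \<sigma> * f"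
    have c: "stencil_cos ?x ?y \<in> {3/10..7/10}"
      using small[OF \<sigma>] assms by (intro stencil_cos_range(2)[of _ "3 * \<rho>"]) auto
    have "((\<lambda>\<sigma>. stencil_cos (x + \<sigma> * e) (y + \<sigma> * f)) has_real_derivative
        - (stencil_num ?x ?y * e + stencil_num ?y ?x * f)) (at \<sigma>)"
    proof -
      have d: "((\<lambda>\<sigma>. (exp (((x + \<sigma> * e) - (y + \<sigma> * f)) / 2) + exp (((y + \<sigma> * f) - (x + \<sigma> * e)) / 2)) / 2
            - exp (((x + \<sigma> * e) + (y + \<sigma> * f)) / 2) / 2) has_real_derivative
          (exp ((?x - ?y) / 2) * ((e - f) / 2) + exp ((?y - ?x) / 2) * ((f - e) / 2)) / 2
            - exp ((?x + ?y) / 2) * ((e + f) / 2) / 2) (at \<sigma>)"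
        by (auto intro!: derivative_eq_intros simp: field_simps)
      have eq: "(P * ((e - f) / 2) + Q * ((f - e) / 2)) / 2 - R * ((e + f) / 2) / 2
          = - ((R / 4 - (P - Q) / 4) * e + (R / 4 - (Q - P) / 4) * f)" for P Q R :: real
        by (simp add: field_simps)
      show ?thesis using d unfolding stencil_cos_def stencil_num_def eq by (simp only: add.commute[of ?y ?x])
    qed
    then have dA: "((\<lambda>\<sigma>. arccos (stencil_cos (x + \<sigma> * e) (y + \<sigma> * f))) has_real_derivative
        inverse (- sqrt (1 - (stencil_cos ?x ?y)\<^sup>2)) * - (stencil_num ?x ?y * e + stencil_num ?y ?x * f)) (at \<sigma>)"
      using c by (intro DERIV_chain2[OF DERIV_arccos]) auto
    have cc: "stencil_cos ?y ?x = stencil_cos ?x ?y" by (simp add: stencil_cos_def algebra_simps)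
    show "((\<lambda>\<sigma>. arccos (stencil_cos (x + \<sigma> * e) (y + \<sigma> * f))) has_real_derivative
        D ?x ?y * e + D ?y ?x * f) (at \<sigma>)"
    proof -
      have "inverse (- r) * - (u * e + v * f) = u * (1 / r) * e + v * (1 / r) * f" for r u v :: real
        by (cases "r = 0") (simp_all add: field_simps)
      then show ?thesis using dA unfolding D_def inv_sin_def cc by (simp only:)
    qed
  qed auto
  then obtain \<sigma> where \<sigma>: "0 < \<sigma>" "\<sigma> < 1"
    and eq: "arccos (stencil_cos (x + e) (y + f)) - arccos (stencil_cos x y)
      = D (x + \<sigma> * e) (y + \<sigma> * f) * e + D (y + \<sigma> * f) (x + \<sigma> * e) * f" by auto
  let ?x = "x + \<sigma> * e" and ?y = "y + \<sigma> * f"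
  have se: "\<bar>\<sigma> * e\<bar> \<le> 1 * \<rho>\<^sup>2" "\<bar>\<sigma> * f\<bar> \<le> 1 * \<rho>\<^sup>2" unfolding abs_mult using \<sigma> assms by (intro mult_mono; simp)+
  \<comment> \<open>The derivative at the intermediate point is referred back to the base point;
    moving the arguments by \<rho>^2 costs only O(\<rho>^2).\<close>
  have dev: "\<bar>D a b - s / 4 * (1 - 2/3 * a' + 4/3 * b')\<bar> \<le> 91 * \<rho>\<^sup>2"
    if ab: "\<bar>a\<bar> \<le> 3 * \<rho>" "\<bar>b\<bar> \<le> 3 * \<rho>" "\<bar>a - a'\<bar> \<le> \<rho>\<^sup>2" "\<bar>b - b'\<bar> \<le> \<rho>\<^sup>2" for a b a' b'
  proof -
    have d1: "\<bar>D a b - s / 4 * (1 - 2/3 * a + 4/3 * b)\<bar> \<le> 10 * (3 * \<rho>)\<^sup>2"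
      unfolding D_def s_def using ab assms by (intro stencil_deriv_expansion) auto
    have d2: "\<bar>s / 4 * (- 2/3 * (a - a') + 4/3 * (b - b'))\<bar> \<le> (6/5) / 4 * (2 * \<rho>\<^sup>2)"
    proof -
      have "\<bar>- 2/3 * (a - a') + 4/3 * (b - b')\<bar> \<le> 2 * \<rho>\<^sup>2" using ab(3,4) by argo
      then show ?thesis unfolding abs_mult using s by (intro mult_mono) simp_all
    qed
    have eq: "D a b - s / 4 * (1 - 2/3 * a' + 4/3 * b')
      = (D a b - s / 4 * (1 - 2/3 * a + 4/3 * b)) + s / 4 * (- 2/3 * (a - a') + 4/3 * (b - b'))"
      by (simp add: field_simps)
    show ?thesis by (subst eq, rule abs_add2_le[OF d1 d2]) (simp add: power_mult_distrib)
  qed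
  have sx: "\<bar>?x\<bar> \<le> 3 * \<rho>" "\<bar>?y\<bar> \<le> 3 * \<rho>" using small[of \<sigma>] \<sigma> by auto
  have se': "\<bar>?x - x\<bar> \<le> \<rho>\<^sup>2" "\<bar>?y - y\<bar> \<le> \<rho>\<^sup>2" using se by simp_all
  have d1: "\<bar>(D ?x ?y - s / 4 * (1 - 2/3 * x + 4/3 * y)) * e\<bar> \<le> 91 * \<rho>\<^sup>2 * \<rho>\<^sup>2"
    unfolding abs_mult using dev[OF sx(1,2) se'] dev[OF sx(2,1) se'(2,1)] assms by (intro mult_mono) simp_all
  have d2: "\<bar>(D ?y ?x - s / 4 * (1 - 2/3 * y + 4/3 * x)) * f\<bar> \<le> 91 * \<rho>\<^sup>2 * \<rho>\<^sup>2"
    unfolding abs_mult using dev[OF sx(1,2) se'] dev[OF sx(2,1) se'(2,1)] assms by (intro mult_mono) simp_all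
  have eq: "weight_angle 0 0 (x + e) (y + f) - weight_angle 0 0 x y
      - s / 4 * ((1 - 2/3 * x + 4/3 * y) * e + (1 - 2/3 * y + 4/3 * x) * f)
    = (D ?x ?y - s / 4 * (1 - 2/3 * x + 4/3 * y)) * e + (D ?y ?x - s / 4 * (1 - 2/3 * y + 4/3 * x)) * f"
    unfolding weight_angle_0_0 eq by (simp add: algebra_simps)
  have "91 * \<rho>\<^sup>2 * \<rho>\<^sup>2 + 91 * \<rho>\<^sup>2 * \<rho>\<^sup>2 \<le> 200 * \<rho>^4"
    by (simp add: mult.assoc flip: power_add)
  from abs_add2_le[OF d1 d2 this] show ?thesis unfolding s_def[symmetric] eq .
qed

text \<open>Near the equilateral shape the cosine is 4-Lipschitz in the squared sides, and arccos is
  3-Lipschitz on [0, 9/10].\<close>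

lemma tri_angle_lipschitz:
  assumes "9/10 \<le> X" "X \<le> 6/5" "9/10 \<le> Y" "Y \<le> 6/5" "4/5 \<le> Z" "Z \<le> 5/4"
    and "9/10 \<le> X'" "X' \<le> 6/5" "9/10 \<le> Y'" "Y' \<le> 6/5" "4/5 \<le> Z'" "Z' \<le> 5/4"
    and d: "\<bar>X - X'\<bar> \<le> \<eta>" "\<bar>Y - Y'\<bar> \<le> \<eta>" "\<bar>Z - Z'\<bar> \<le> \<eta>"
  shows "\<bar>tri_angle X Y Z - tri_angle X' Y' Z'\<bar> \<le> 12 * \<eta>"
proof -
  have root: "9/10 \<le> sqrt t" "1 / sqrt t \<le> 10/9" if "9/10 \<le> t" for t :: real
  proof -
    show "9/10 \<le> sqrt t" using that by (intro real_le_rsqrt) (simp add: power2_eq_square)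
    then show "1 / sqrt t \<le> 10/9" by (subst pos_divide_le_eq) linarith+
  qed
  have root2: "sqrt t \<le> 11/10" if "t \<le> 6/5" for t :: real
    using that by (intro real_le_lsqrt) (auto simp: power2_eq_square)
  have rlip: "\<bar>1 / sqrt t - 1 / sqrt t'\<bar> \<le> \<eta>" if "9/10 \<le> t" "9/10 \<le> t'" "\<bar>t - t'\<bar> \<le> \<eta>" for t t'
  proof -
    have r: "9/10 \<le> sqrt t" "9/10 \<le> sqrt t'" using root that by auto
    have "(1 / sqrt t - 1 / sqrt t') * (sqrt t * sqrt t' * (sqrt t + sqrt t')) = t' - t"
    proof -
      have "(1 / sqrt t - 1 / sqrt t') * (sqrt t * sqrt t') = sqrt t' - sqrt t"
      proof -
        have "sqrt t \<noteq> 0" "sqrt t' \<noteq> 0" using r by linarith+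
        then show ?thesis using that by (simp add: diff_divide_distrib left_diff_distrib)
      qed
      moreover have "(sqrt t' - sqrt t) * (sqrt t + sqrt t') = t' - t"
        using that by (simp add: algebra_simps)
      ultimately show ?thesis by (metis mult.assoc)
    qed
    then have "\<bar>1 / sqrt t - 1 / sqrt t'\<bar> * \<bar>sqrt t * sqrt t' * (sqrt t + sqrt t')\<bar> = \<bar>t' - t\<bar>"
      by (metis abs_mult)
    moreover have "1 \<le> sqrt t * sqrt t' * (sqrt t + sqrt t')"
    proof -
      have "9/10 * (9/10) * (9/10 + 9/10) \<le> sqrt t * sqrt t' * (sqrt t + sqrt t')"
        using r that by (intro mult_mono add_mono) auto
      then show ?thesis by simp
    qed
    ultimately have "\<bar>1 / sqrt t - 1 / sqrt t'\<bar> * 1 \<le> \<bar>t' - t\<bar>"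
      by (metis abs_ge_zero abs_of_nonneg dual_order.trans mult_left_mono zero_le_one)
    then show ?thesis using that by argo
  qed
  have \<eta>: "0 \<le> \<eta>" using d by argo
  define a b a' b' N N' where "a = 1 / sqrt X" and "b = 1 / sqrt Y" and "a' = 1 / sqrt X'" and "b' = 1 / sqrt Y'"
    and "N = X + Y - Z" and "N' = X' + Y' - Z'"
  have ab: "0 < a" "0 < b" "0 < a'" "0 < b'" "a \<le> 10/9" "b \<le> 10/9" "a' \<le> 10/9" "b' \<le> 10/9"
    using root(2)[OF assms(1)] root(2)[OF assms(3)] root(2)[OF assms(7)] root(2)[OF assms(9)] assms
    unfolding a_def b_def a'_def b'_def by (auto simp del: divide_le_eq_numeral1)
  have dab: "\<bar>a - a'\<bar> \<le> \<eta>" "\<bar>b - b'\<bar> \<le> \<eta>" using assms by (auto simp: a_def b_def a'_def b'_def intro!: rlip)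
  have N: "1/2 \<le> N" "N \<le> 8/5" "1/2 \<le> N'" "N' \<le> 8/5" "\<bar>N - N'\<bar> \<le> 3 * \<eta>"
    using assms by (auto simp: N_def N'_def abs_le_iff)
  have c: "(X + Y - Z) / (2 * (sqrt X * sqrt Y)) = N * a * b / 2"
    "(X' + Y' - Z') / (2 * (sqrt X' * sqrt Y')) = N' * a' * b' / 2"
    by (simp_all add: a_def b_def a'_def b'_def N_def N'_def)
  have "N * a * b - N' * a' * b' = (N - N') * a * b + N' * (a - a') * b + N' * a' * (b - b')"
    by (simp add: algebra_simps)
  moreover have "\<bar>(N - N') * a * b\<bar> \<le> 3 * \<eta> * (10/9) * (10/9)"
    unfolding abs_mult using ab N \<eta> by (intro mult_mono) auto
  moreover have "\<bar>N' * (a - a') * b\<bar> \<le> 8/5 * \<eta> * (10/9)"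
    unfolding abs_mult using ab N \<eta> dab by (intro mult_mono) auto
  moreover have "\<bar>N' * a' * (b - b')\<bar> \<le> 8/5 * (10/9) * \<eta>"
    unfolding abs_mult using ab N \<eta> dab by (intro mult_mono) auto
  ultimately have cd: "\<bar>N * a * b / 2 - N' * a' * b' / 2\<bar> \<le> 4 * \<eta>" using \<eta> by argo
  have rng: "N * a * b / 2 \<in> {0..9/10}" if "1/2 \<le> N" "N \<le> 8/5" "9/10 \<le> X" "9/10 \<le> Y" "a = 1 / sqrt X" "b = 1 / sqrt Y" for N a b X Y
  proof -
    have "9/10 \<le> sqrt (X * Y)"
      using mult_mono[of "9/10" X "9/10" Y] that by (intro real_le_rsqrt) (auto simp: power2_eq_square)
    then have "9/10 \<le> sqrt X * sqrt Y" by (simp add: real_sqrt_mult)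
    moreover have "N * a * b / 2 = N / (2 * (sqrt X * sqrt Y))" using that by simp
    moreover have "N / (2 * (sqrt X * sqrt Y)) \<le> 9/10"
      using that \<open>9/10 \<le> sqrt X * sqrt Y\<close> by (subst pos_divide_le_eq) linarith+
    moreover have "0 \<le> N / (2 * (sqrt X * sqrt Y))" using that \<open>9/10 \<le> sqrt X * sqrt Y\<close> by simp
    ultimately show ?thesis by simp
  qed
  have r: "N * a * b / 2 \<in> {0..9/10}" "N' * a' * b' / 2 \<in> {0..9/10}"
    by (rule rng[OF N(1,2) assms(1,3) a_def b_def], rule rng[OF N(3,4) assms(7,9) a'_def b'_def])
  have "norm (arccos (N * a * b / 2) - arccos (N' * a' * b' / 2)) \<le> 3 * norm (N * a * b / 2 - N' * a' * b' / 2)"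
  proof (rule field_differentiable_bound[of "{0..9/10}" _ "\<lambda>x. inverse (- sqrt (1 - x\<^sup>2))"])
    fix z :: real assume z: "z \<in> {0..9/10}"
    then have "(arccos has_real_derivative inverse (- sqrt (1 - z\<^sup>2))) (at z)" by (intro DERIV_arccos) auto
    then show "(arccos has_real_derivative inverse (- sqrt (1 - z\<^sup>2))) (at z within {0..9/10})"
      by (rule has_field_derivative_at_within)
    have "z\<^sup>2 \<le> (9/10)\<^sup>2" using z by (intro power_mono) auto
    then have "1/3 \<le> sqrt (1 - z\<^sup>2)" by (intro real_le_rsqrt) (simp add: power2_eq_square)
    then have "0 < sqrt (1 - z\<^sup>2)" "1 / sqrt (1 - z\<^sup>2) \<le> 3" by (subst pos_divide_le_eq | linarith)+
    then show "norm (inverse (- sqrt (1 - z\<^sup>2))) \<le> 3"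
      by (simp only: real_norm_def inverse_minus_eq abs_minus_cancel abs_inverse abs_of_pos) (simp only: inverse_eq_divide)
  qed (use r in auto)
  from order_trans[OF this mult_left_mono[OF cd[folded real_norm_def], of 3]]
  show ?thesis unfolding tri_angle_def c by simp
qed

text \<open>The term of \<open>edge_sq\<close> that separates packings from vertex scaling is
  \<kappa> times the square of a difference of size \<rho>, hence O(\<rho>^4) when \<kappa> \<le>
  \<rho>^2. Thus only the case \<kappa> = 0 has to be expanded.\<close>

lemma weight_angle_kappa:
  assumes "\<bar>x\<bar> \<le> 3 * \<rho>" "\<bar>y\<bar> \<le> 3 * \<rho>" "0 \<le> \<rho>" "\<rho> \<le> 1/100" "0 \<le> \<kappa>" "\<kappa> \<le> \<rho>\<^sup>2"
  shows "\<bar>weight_angle \<kappa> 0 x y - weight_angle 0 0 x y\<bar> \<le> 1800 * \<rho>^4"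
proof -
  have \<kappa>: "\<kappa> \<le> 1/8"
  proof -
    have "\<rho>\<^sup>2 \<le> (1/100)\<^sup>2" using assms by (intro power_mono) auto
    with assms show ?thesis by (simp add: power2_eq_square)
  qed
  have ex: "\<bar>exp t - 1\<bar> \<le> 6 * \<rho>" if "\<bar>t\<bar> \<le> 3 * \<rho>" for t :: real
  proof -
    have "\<bar>t\<bar> * \<bar>t\<bar> \<le> \<bar>t\<bar> * (3/100)" using that assms by (intro mult_left_mono) auto
    then have "3 * t\<^sup>2 \<le> \<bar>t\<bar>" by (simp add: power2_eq_square abs_mult_self_eq flip: abs_mult)
    then show ?thesis using exp_linear_bound[of t] that assms by argo
  qed
  have d: "\<bar>edge_sq \<kappa> a b - edge_sq 0 a b\<bar> \<le> 150 * \<rho>^4" if "\<bar>a\<bar> \<le> 3 * \<rho>" "\<bar>b\<bar> \<le> 3 * \<rho>" for a b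
  proof -
    have "\<bar>exp a - exp b\<bar> \<le> 12 * \<rho>" using ex[OF that(1)] ex[OF that(2)] by argo
    then have "\<bar>exp a - exp b\<bar>\<^sup>2 \<le> (12 * \<rho>)\<^sup>2" by (intro power_mono) auto
    then have "(exp a - exp b)\<^sup>2 \<le> (12 * \<rho>)\<^sup>2" by (simp only: power2_abs)
    then have "\<kappa> * (exp a - exp b)\<^sup>2 \<le> \<rho>\<^sup>2 * (12 * \<rho>)\<^sup>2" using assms by (intro mult_mono) auto
    also have "\<dots> = 144 * \<rho>^4" by (simp add: power2_eq_square eval_nat_numeral)
    also have "\<dots> \<le> 150 * \<rho>^4" by simp
    finally show ?thesis using assms by (simp add: edge_sq_def)
  qed
  have "\<bar>0\<bar> \<le> 3 * \<rho>" using assms by simp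
  note d0 = d[OF this assms(1)] d[OF this assms(2)] d[OF assms(1,2)]
  have xy: "\<bar>x\<bar> \<le> 1/20" "\<bar>y\<bar> \<le> 1/20" using assms by linarith+
  have "\<bar>weight_angle \<kappa> 0 x y - weight_angle 0 0 x y\<bar> \<le> 12 * (150 * \<rho>^4)"
    unfolding weight_angle_def
    using edge_sq_near_1[OF assms(5) \<kappa> xy] edge_sq_near_1[OF assms(5) \<kappa> xy(2,1)]
      edge_sq_near_1[of 0, OF _ _ xy] edge_sq_near_1[of 0, OF _ _ xy(2,1)] d0
    by (intro tri_angle_lipschitz) auto
  then show ?thesis by simp
qed

text \<open>A weight that is linear on the lattice (a Doyle spiral) closes up exactly, because the three
  triangles of each orientation around a vertex are similar to one another.\<close>

lemma weight_angle_linear: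
  "weight_angle 0 0 a b + weight_angle 0 0 b (b - a) + weight_angle 0 0 (b - a) (- a)
    + weight_angle 0 0 (- a) (- b) + weight_angle 0 0 (- b) (a - b) + weight_angle 0 0 (a - b) a = 2 * pi"
  if small: "\<bar>a\<bar> \<le> 1/20" "\<bar>b\<bar> \<le> 1/20"
proof -
  have tri: "weight_angle 0 0 a b + weight_angle 0 0 (b - a) (- a) + weight_angle 0 0 (- b) (a - b) = pi"
    if "\<bar>a\<bar> \<le> 1/20" "\<bar>b\<bar> \<le> 1/20" for a b
  proof -
    have "weight_angle 0 0 a b + weight_angle 0 a b 0 + weight_angle 0 b 0 a = pi"
      unfolding weight_angle_def
      using tri_angle_sum[of "edge_sq 0 0 a" "edge_sq 0 0 b" "edge_sq 0 a b"] heron16_edge_sq_pos[of 0 a 0 b] that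
      by (simp add: edge_sq_pos edge_sq_commute)
    then show ?thesis by (simp add: weight_angle_0[of 0 a] weight_angle_0[of 0 b])
  qed
  have "weight_angle 0 0 (- a) (- b) + weight_angle 0 0 (a - b) a + weight_angle 0 0 b (b - a) = pi"
    using tri[of "- a" "- b"] small by simp
  with tri[OF small] show ?thesis by simp
qed

text \<open>The linear weights \<open>a\<close>, \<open>b\<close> contribute exactly 2 pi by
  \<open>weight_angle_linear\<close>. What remains to first order in the perturbations is their sum,
  a discrete Laplacian, and each of the six triangles adds an error of at most 2000
  \<rho>^4.\<close>

lemma angle_sum_stencil:
  assumes "\<bar>a\<bar> \<le> \<rho>" "\<bar>b\<bar> \<le> \<rho>" "0 \<le> \<rho>" "\<rho> \<le> 1/100" "0 \<le> \<kappa>" "\<kappa> \<le> \<rho>\<^sup>2"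
    and e: "\<bar>e0\<bar> \<le> \<rho>\<^sup>2" "\<bar>e1\<bar> \<le> \<rho>\<^sup>2" "\<bar>e2\<bar> \<le> \<rho>\<^sup>2" "\<bar>e3\<bar> \<le> \<rho>\<^sup>2" "\<bar>e4\<bar> \<le> \<rho>\<^sup>2" "\<bar>e5\<bar> \<le> \<rho>\<^sup>2"
  shows "\<bar>weight_angle \<kappa> 0 (a + e0) (b + e1) + weight_angle \<kappa> 0 (b + e1) (b - a + e2)
    + weight_angle \<kappa> 0 (b - a + e2) (- a + e3) + weight_angle \<kappa> 0 (- a + e3) (- b + e4)
    + weight_angle \<kappa> 0 (- b + e4) (a - b + e5) + weight_angle \<kappa> 0 (a - b + e5) (a + e0)
    - 2 * pi - (e0 + e1 + e2 + e3 + e4 + e5) / sqrt 3\<bar> \<le> 12000 * \<rho>^4"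
proof -
  define s where "s = inv_sin (1/2)"
  have rr: "\<rho>\<^sup>2 \<le> \<rho>" unfolding power2_eq_square using mult_right_mono[of \<rho> 1 \<rho>] assms by simp
  have t: "\<bar>weight_angle \<kappa> 0 (x + e) (y + f) - weight_angle 0 0 x y
    - s / 4 * ((1 - 2/3 * x + 4/3 * y) * e + (1 - 2/3 * y + 4/3 * x) * f)\<bar> \<le> 2000 * \<rho>^4"
    if "\<bar>x\<bar> \<le> 2 * \<rho>" "\<bar>y\<bar> \<le> 2 * \<rho>" "\<bar>e\<bar> \<le> \<rho>\<^sup>2" "\<bar>f\<bar> \<le> \<rho>\<^sup>2" for x y e f
  proof -
    have "\<bar>x + e\<bar> \<le> 3 * \<rho>" "\<bar>y + f\<bar> \<le> 3 * \<rho>" using that rr by linarith+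
    then have "\<bar>weight_angle \<kappa> 0 (x + e) (y + f) - weight_angle 0 0 (x + e) (y + f)\<bar> \<le> 1800 * \<rho>^4"
      using assms(3-6) by (intro weight_angle_kappa) simp_all
    from abs_add2_le[OF this weight_angle_increment[OF that assms(3,4), folded s_def], of "2000 * \<rho>^4"]
    show ?thesis by simp
  qed
  have l: "\<bar>a\<bar> \<le> 2 * \<rho>" "\<bar>b\<bar> \<le> 2 * \<rho>" "\<bar>b - a\<bar> \<le> 2 * \<rho>" "\<bar>- a\<bar> \<le> 2 * \<rho>" "\<bar>- b\<bar> \<le> 2 * \<rho>" "\<bar>a - b\<bar> \<le> 2 * \<rho>"
    using assms(1-3) by linarith+
  have lin: "weight_angle 0 0 a b + weight_angle 0 0 b (b - a) + weight_angle 0 0 (b - a) (- a)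
    + weight_angle 0 0 (- a) (- b) + weight_angle 0 0 (- b) (a - b) + weight_angle 0 0 (a - b) a = 2 * pi"
    using assms(1-4) by (intro weight_angle_linear) linarith+
  \<comment> \<open>Each perturbation occurs in the two triangles that share its edge. Their linear
    corrections cancel because the preceding and the following neighbour add up to the neighbour
    itself, as in b + (a - b) = a.\<close>
  have coeff: "(e0 + e1 + e2 + e3 + e4 + e5) / sqrt 3
    = s / 4 * ((1 - 2/3 * a + 4/3 * b) * e0 + (1 - 2/3 * b + 4/3 * a) * e1)
    + s / 4 * ((1 - 2/3 * b + 4/3 * (b - a)) * e1 + (1 - 2/3 * (b - a) + 4/3 * b) * e2)
    + s / 4 * ((1 - 2/3 * (b - a) + 4/3 * (- a)) * e2 + (1 - 2/3 * (- a) + 4/3 * (b - a)) * e3)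
    + s / 4 * ((1 - 2/3 * (- a) + 4/3 * (- b)) * e3 + (1 - 2/3 * (- b) + 4/3 * (- a)) * e4)
    + s / 4 * ((1 - 2/3 * (- b) + 4/3 * (a - b)) * e4 + (1 - 2/3 * (a - b) + 4/3 * (- b)) * e5)
    + s / 4 * ((1 - 2/3 * (a - b) + 4/3 * a) * e5 + (1 - 2/3 * a + 4/3 * (a - b)) * e0)"
  proof -
    have "(e0 + e1 + e2 + e3 + e4 + e5) / sqrt 3 = (s / 2) * (e0 + e1 + e2 + e3 + e4 + e5)"
      using inv_sin_half(4) by (simp add: s_def)
    also have "\<dots> = s / 4 * ((1 - 2/3 * a + 4/3 * b) * e0 + (1 - 2/3 * b + 4/3 * a) * e1)
    + s / 4 * ((1 - 2/3 * b + 4/3 * (b - a)) * e1 + (1 - 2/3 * (b - a) + 4/3 * b) * e2)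
    + s / 4 * ((1 - 2/3 * (b - a) + 4/3 * (- a)) * e2 + (1 - 2/3 * (- a) + 4/3 * (b - a)) * e3)
    + s / 4 * ((1 - 2/3 * (- a) + 4/3 * (- b)) * e3 + (1 - 2/3 * (- b) + 4/3 * (- a)) * e4)
    + s / 4 * ((1 - 2/3 * (- b) + 4/3 * (a - b)) * e4 + (1 - 2/3 * (a - b) + 4/3 * (- b)) * e5)
    + s / 4 * ((1 - 2/3 * (a - b) + 4/3 * a) * e5 + (1 - 2/3 * a + 4/3 * (a - b)) * e0)"
      by (simp add: field_simps)
    finally show ?thesis .
  qed
  have "T1 + T2 + T3 + T4 + T5 + T6 - 2 * pi - (S1 + S2 + S3 + S4 + S5 + S6)
    = (T1 - L1 - S1) + (T2 - L2 - S2) + (T3 - L3 - S3) + (T4 - L4 - S4) + (T5 - L5 - S5 + (T6 - L6 - S6))"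
    if "L1 + L2 + L3 + L4 + L5 + L6 = 2 * pi" for T1 T2 T3 T4 T5 T6 L1 L2 L3 L4 L5 L6 S1 S2 S3 S4 S5 S6 :: real
    using that by linarith
  note eq = this[OF lin]
  show ?thesis unfolding coeff eq
    by (rule abs_add2_le[OF abs_add4_le[OF t[OF l(1,2) e(1,2)] t[OF l(2,3) e(2,3)] t[OF l(3,4) e(3,4)] t[OF l(4,5) e(4,5)] order_refl]
      abs_add2_le[OF t[OF l(5,6) e(5,6)] t[OF l(6,1) e(6,1)] order_refl]]) simp
qed

section \<open>The flatness equation on the hexagonal lattice\<close>

definition lattice_nbrs :: "int \<times> int \<Rightarrow> (int \<times> int) set"
  where "lattice_nbrs v = (case v of (i, j) \<Rightarrow>
    {(i + 1, j), (i, j + 1), (i - 1, j + 1), (i - 1, j), (i, j - 1), (i + 1, j - 1)})"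

definition angle_sum :: "real \<Rightarrow> (int \<times> int \<Rightarrow> real) \<Rightarrow> int \<times> int \<Rightarrow> real"
  where "angle_sum \<kappa> w v = (case v of (i, j) \<Rightarrow>
    weight_angle \<kappa> (w (i, j)) (w (i + 1, j)) (w (i, j + 1))
    + weight_angle \<kappa> (w (i, j)) (w (i, j + 1)) (w (i - 1, j + 1))
    + weight_angle \<kappa> (w (i, j)) (w (i - 1, j + 1)) (w (i - 1, j))
    + weight_angle \<kappa> (w (i, j)) (w (i - 1, j)) (w (i, j - 1))
    + weight_angle \<kappa> (w (i, j)) (w (i, j - 1)) (w (i + 1, j - 1))
    + weight_angle \<kappa> (w (i, j)) (w (i + 1, j - 1)) (w (i + 1, j)))"

lemma angle_sum_mono:
  assumes "0 \<le> \<kappa>" "\<kappa> \<le> 1/8" "w' v \<le> w v" "\<And>x. x \<in> lattice_nbrs v \<Longrightarrow> w x \<le> w' x"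
    and "\<And>x. x \<in> lattice_nbrs v \<Longrightarrow> \<bar>w x - w v\<bar> \<le> 1/20"
    and "\<And>x. x \<in> lattice_nbrs v \<Longrightarrow> \<bar>w' x - w' v\<bar> \<le> 1/20"
  shows "angle_sum \<kappa> w v \<le> angle_sum \<kappa> w' v"
proof -
  obtain i j where v: "v = (i, j)" by fastforce
  have m: "weight_angle \<kappa> (w (i, j)) (w x) (w y) \<le> weight_angle \<kappa> (w' (i, j)) (w' x) (w' y)"
    if "x \<in> lattice_nbrs v" "y \<in> lattice_nbrs v" for x y
    using assms(3) assms(4)[OF that(1)] assms(5)[OF that(1)] assms(6)[OF that(1)]
      assms(4)[OF that(2)] assms(5)[OF that(2)] assms(6)[OF that(2)]
    by (intro weight_angle_mono assms(1,2)) (simp_all add: v)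
  show ?thesis
    unfolding v angle_sum_def prod.case
    by (intro add_mono m) (simp_all add: v lattice_nbrs_def)
qed

lemma continuous_on_angle_sum:
  fixes w :: "'a::topological_space \<Rightarrow> int \<times> int \<Rightarrow> real"
  assumes "0 \<le> \<kappa>" "\<kappa> \<le> 1/8" "\<And>x. continuous_on T (\<lambda>t. w t x)"
    and "\<And>t x. t \<in> T \<Longrightarrow> x \<in> lattice_nbrs v \<Longrightarrow> \<bar>w t x - w t v\<bar> \<le> 1/20"
  shows "continuous_on T (\<lambda>t. angle_sum \<kappa> (w t) v)"
proof -
  obtain i j where v: "v = (i, j)" by fastforce
  show ?thesis
    unfolding v angle_sum_def prod.case
    by (intro continuous_on_add continuous_on_weight_angle assms(1-3))
      (use assms(4) in \<open>simp_all add: v lattice_nbrs_def\<close>)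
qed

lemma continuous_on_stays_greater:
  fixes F :: "real \<Rightarrow> real"
  assumes "continuous_on {a..b} F" "a < b" "c < F a"
  obtains t where "a < t" "t \<le> b" "c < F t"
proof -
  from assms obtain d where d: "d > 0" "\<And>t. t \<in> {a..b} \<Longrightarrow> dist t a < d \<Longrightarrow> dist (F t) (F a) < F a - c"
    unfolding continuous_on_iff by (metis atLeastAtMost_iff diff_gt_0_iff_gt less_eq_real_def)
  define t where "t = min b (a + d / 2)"
  have t: "a < t" "t \<le> b" "dist t a < d" using assms(2) d(1) by (auto simp: t_def dist_real_def)
  then have "dist (F t) (F a) < F a - c" by (intro d) auto
  then have "c < F t" by (auto simp: dist_real_def)
  with t that show ?thesis by blast
qed

text \<open>Perron's method with compactness in place of a supremum: among the weights between
  \<open>lo\<close> and \<open>hi\<close> with all angle sums at least 2 pi, take one of maximal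
  total weight. At a vertex with too large an angle sum the weight could still be raised, against
  maximality. The strict inequality for \<open>hi\<close> guarantees that there is room for
  this.\<close>

lemma angle_sum_solution:
  assumes \<kappa>: "0 \<le> \<kappa>" "\<kappa> \<le> 1/8" and fin: "finite V"
    and le: "\<And>v. lo v \<le> hi v"
    and small: "\<And>v x. v \<in> V \<Longrightarrow> x \<in> lattice_nbrs v \<Longrightarrow> hi x - lo v \<le> 1/20 \<and> hi v - lo x \<le> 1/20"
    and lo: "\<And>v. v \<in> V \<Longrightarrow> 2 * pi \<le> angle_sum \<kappa> lo v"
    and hi: "\<And>v. v \<in> V \<Longrightarrow> angle_sum \<kappa> hi v < 2 * pi"
  obtains w where "\<And>v. lo v \<le> w v" "\<And>v. w v \<le> hi v" "\<And>v. v \<in> V \<Longrightarrow> angle_sum \<kappa> w v = 2 * pi"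
proof -
  note [simp del] = split_paired_All split_paired_Ex
  define B where "B = {w. \<forall>v. lo v \<le> w v \<and> w v \<le> hi v}"
  have near: "\<bar>w x - w v\<bar> \<le> 1/20" if "w \<in> B" "v \<in> V" "x \<in> lattice_nbrs v" for w v x
  proof -
    have "lo x \<le> w x" "w x \<le> hi x" "lo v \<le> w v" "w v \<le> hi v" using that(1) by (auto simp: B_def)
    with small[OF that(2,3)] show ?thesis by linarith
  qed
  \<comment> \<open>The order interval is a product of compact intervals over the whole lattice,
    hence compact by Tychonoff. This is why \<open>lo\<close> and \<open>hi\<close> are bounds at
    every vertex and not just on \<open>V\<close>.\<close>
  have B_eq: "B = PiE UNIV (\<lambda>v. {lo v..hi v})" by (auto simp: B_def PiE_iff)
  have compB: "compact B"
  proof -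
    have "compactin (product_topology (\<lambda>i. euclidean) UNIV) (PiE UNIV (\<lambda>v. {lo v..hi v}))"
      by (subst compactin_PiE) auto
    then show ?thesis by (simp add: B_eq euclidean_product_topology)
  qed
  have closedB: "closed B"
  proof -
    have "B = (\<Inter>v. {w. lo v \<le> w v} \<inter> {w. w v \<le> hi v})" by (auto simp: B_def)
    also have "closed \<dots>"
      by (intro closed_INT ballI closed_Int closed_Collect_le continuous_on_const continuous_on_product_coordinates)
    finally show ?thesis .
  qed
  have cont: "continuous_on B (\<lambda>w. angle_sum \<kappa> w v)" if "v \<in> V" for v
    using \<kappa> near[OF _ that]
    by (intro continuous_on_angle_sum continuous_on_subset[OF continuous_on_product_coordinates]) auto
  define K where "K = B \<inter> (\<Inter>v\<in>V. B \<inter> (\<lambda>w. angle_sum \<kappa> w v) -` {2 * pi..})"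
  have K_iff: "w \<in> K \<longleftrightarrow> w \<in> B \<and> (\<forall>v\<in>V. 2 * pi \<le> angle_sum \<kappa> w v)" for w
    unfolding K_def vimage_def atLeast_def by blast
  have "compact K"
    unfolding K_def
    by (intro compact_Int_closed compB closed_INT ballI continuous_closed_preimage[OF cont] closedB closed_atLeast)
  moreover have "lo \<in> K" using le lo by (auto simp: K_iff B_def)
  moreover have "continuous_on K (\<lambda>w. \<Sum>v\<in>V. w v)"
    by (intro continuous_on_sum continuous_on_subset[OF continuous_on_product_coordinates]) auto
  ultimately obtain w where w: "w \<in> K" and max: "\<And>w'. w' \<in> K \<Longrightarrow> (\<Sum>v\<in>V. w' v) \<le> (\<Sum>v\<in>V. w v)"
    using continuous_attains_sup[of K "\<lambda>w. \<Sum>v\<in>V. w v"] by blast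
  have wB: "w \<in> B" and ge: "\<And>v. v \<in> V \<Longrightarrow> 2 * pi \<le> angle_sum \<kappa> w v"
    using w unfolding K_iff by blast+
  have hiB: "hi \<in> B" using le by (auto simp: B_def)
  show ?thesis
  proof
    show "lo v \<le> w v" "w v \<le> hi v" for v using wB by (auto simp: B_def)
    fix v assume v: "v \<in> V"
    show "angle_sum \<kappa> w v = 2 * pi"
    proof (rule ccontr)
      assume "angle_sum \<kappa> w v \<noteq> 2 * pi"
      with ge[OF v] have gt: "2 * pi < angle_sum \<kappa> w v" by simp
      \<comment> \<open>If w touched \<open>hi\<close> at v, monotonicity would bound its angle sum
        there by that of \<open>hi\<close>, which is below 2 pi.\<close>
      have "w v < hi v"
      proof (rule ccontr)
        assume "\<not> w v < hi v"
        then have "angle_sum \<kappa> w v \<le> angle_sum \<kappa> hi v"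
          using wB near[OF wB v] near[OF hiB v] by (intro angle_sum_mono \<kappa>) (auto simp: B_def)
        with gt hi[OF v] show False by simp
      qed
      have in_B: "w(v := t) \<in> B" if "t \<in> {w v..hi v}" for t
        using wB that le order_trans[of "lo v" "w v" t] by (auto simp: B_def)
      have c: "continuous_on {w v..hi v} (\<lambda>t. angle_sum \<kappa> (w(v := t)) v)"
      proof (intro continuous_on_angle_sum \<kappa>)
        show "continuous_on {w v..hi v} (\<lambda>t. (w(v := t)) x)" for x
          by (cases "x = v") (auto intro: continuous_intros)
      qed (rule near[OF in_B v])
      obtain t where t: "w v < t" "t \<le> hi v" "2 * pi < angle_sum \<kappa> (w(v := t)) v"
        by (rule continuous_on_stays_greater[OF c \<open>w v < hi v\<close>, of "2 * pi"]) (use gt in auto)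
      have tB: "w(v := t) \<in> B" using t by (intro in_B) auto
      \<comment> \<open>At v the constraint survives by continuity, for t close to w v; at any other
        vertex a raised neighbour can only enlarge the angle sum.\<close>
      have "2 * pi \<le> angle_sum \<kappa> (w(v := t)) x" if x: "x \<in> V" for x
      proof (cases "x = v")
        case False
        have "angle_sum \<kappa> w x \<le> angle_sum \<kappa> (w(v := t)) x"
          using t(1) False near[OF wB x] near[OF tB x] by (intro angle_sum_mono \<kappa>) auto
        with ge[OF x] show ?thesis by simp
      qed (use t in auto)
      with tB have "w(v := t) \<in> K" unfolding K_iff by blast
      from max[OF this] have "(\<Sum>x\<in>V. (w(v := t)) x) \<le> (\<Sum>x\<in>V. w x)" .
      moreover have "(\<Sum>x\<in>V. w x) < (\<Sum>x\<in>V. (w(v := t)) x)"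
        using fin v t(1) by (intro sum_strict_mono_ex1) auto
      ultimately show False by simp
    qed
  qed
qed

section \<open>The developing map\<close>

text \<open>\<open>\<sigma>\<close> and \<open>\<delta>\<close> prescribe the shapes of the upward and downward triangles; the factors below turn the
  bottom side of an upward triangle into that of its right and upper neighbour.\<close>

definition step_right :: "(nat \<Rightarrow> nat \<Rightarrow> complex) \<Rightarrow> (nat \<Rightarrow> nat \<Rightarrow> complex) \<Rightarrow> nat \<Rightarrow> nat \<Rightarrow> complex"
  where "step_right \<sigma> \<delta> i j = (\<sigma> i j - 1) / (\<delta> i j * \<sigma> (Suc i) j)"

definition step_up :: "(nat \<Rightarrow> nat \<Rightarrow> complex) \<Rightarrow> (nat \<Rightarrow> nat \<Rightarrow> complex) \<Rightarrow> nat \<Rightarrow> nat \<Rightarrow> complex"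
  where "step_up \<sigma> \<delta> i j = (\<sigma> i j - 1) * (1 / \<delta> i j - 1)"

text \<open>The hypothesis \<open>closing\<close> says that the factors for right-then-up and
  up-then-right agree, so the edge vectors do not depend on the path and may be defined along one.
  Positions are then sums of edge vectors, consistent because every rhombus closes.\<close>

lemma develop:
  fixes \<sigma> \<delta> :: "nat \<Rightarrow> nat \<Rightarrow> complex"
  assumes \<sigma>: "\<And>i j. i + j + 1 \<le> n \<Longrightarrow> \<sigma> i j \<noteq> 0"
    and \<delta>: "\<And>i j. i + j + 2 \<le> n \<Longrightarrow> \<delta> i j \<noteq> 0"
    and closing: "\<And>i j. i + j + 3 \<le> n \<Longrightarrow>
      (\<sigma> i (Suc j) - 1) * (1 - \<delta> i j) * \<delta> (Suc i) j * \<sigma> (Suc i) j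
      = (\<sigma> (Suc i) j - 1) * (1 - \<delta> (Suc i) j) * \<delta> i (Suc j) * \<sigma> (Suc i) (Suc j)"
  obtains E x where "E 0 0 = e0" "x 0 0 = x0"
    "\<And>i j. i + j + 2 \<le> n \<Longrightarrow> E (Suc i) j = step_right \<sigma> \<delta> i j * E i j"
    "\<And>i j. i + j + 2 \<le> n \<Longrightarrow> E i (Suc j) = step_up \<sigma> \<delta> i j * E i j"
    "\<And>i j. i + j + 1 \<le> n \<Longrightarrow> x (Suc i) j - x i j = E i j"
    "\<And>i j. i + j + 1 \<le> n \<Longrightarrow> x i (Suc j) - x i j = \<sigma> i j * E i j"
proof -
  define a b where "a = step_right \<sigma> \<delta>" and "b = step_up \<sigma> \<delta>"
  \<comment> \<open>The chosen path runs along the bottom row and then up the column, so that upward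
    steps hold by definition and rightward steps need an induction on the row.\<close>
  define E where "E = (\<lambda>i j. e0 * (\<Prod>k<i. a k 0) * (\<Prod>m<j. b i m))"
  define x where "x = (\<lambda>i j. x0 + (\<Sum>k<i. E k 0) + (\<Sum>m<j. \<sigma> i m * E i m))"
  have Eb: "E i (Suc j) = b i j * E i j" for i j by (simp add: E_def)
  have comm: "a i (Suc j) * b i j = b (Suc i) j * a i j" if "i + j + 3 \<le> n" for i j
  proof -
    have nz: "\<delta> i (Suc j) * \<sigma> (Suc i) (Suc j) \<noteq> 0" "\<delta> (Suc i) j * \<sigma> (Suc i) j \<noteq> 0"
      "\<delta> i j \<noteq> 0" "\<delta> (Suc i) j \<noteq> 0"
      using that by (auto intro!: \<sigma> \<delta>)
    have "(\<sigma> i (Suc j) - 1) * (1 - \<delta> i j) / (\<delta> i (Suc j) * \<sigma> (Suc i) (Suc j))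
      = (\<sigma> (Suc i) j - 1) * (1 - \<delta> (Suc i) j) / (\<delta> (Suc i) j * \<sigma> (Suc i) j)"
      using nz closing[OF that] by (simp add: frac_eq_eq mult_ac)
    moreover have "a i (Suc j) * b i j = (\<sigma> i j - 1) / \<delta> i j *
        ((\<sigma> i (Suc j) - 1) * (1 - \<delta> i j) / (\<delta> i (Suc j) * \<sigma> (Suc i) (Suc j)))"
      using nz by (simp add: a_def b_def step_right_def step_up_def divide_simps)
    moreover have "b (Suc i) j * a i j = (\<sigma> i j - 1) / \<delta> i j *
        ((\<sigma> (Suc i) j - 1) * (1 - \<delta> (Suc i) j) / (\<delta> (Suc i) j * \<sigma> (Suc i) j))"
      using nz by (simp add: a_def b_def step_right_def step_up_def divide_simps)
    ultimately show ?thesis by simp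
  qed
  have Ea: "E (Suc i) j = a i j * E i j" if "i + j + 2 \<le> n" for i j
    using that
  proof (induction j)
    case 0
    then show ?case by (simp add: E_def)
  next
    case (Suc j)
    have "E (Suc i) (Suc j) = b (Suc i) j * (a i j * E i j)" using Suc by (simp add: Eb)
    also have "\<dots> = a i (Suc j) * b i j * E i j" using comm[of i j] Suc.prems by simp
    finally show ?case by (simp add: Eb)
  qed
  have xu: "x i (Suc j) - x i j = \<sigma> i j * E i j" for i j by (simp add: x_def)
  have xr: "x (Suc i) j - x i j = E i j" if "i + j + 1 \<le> n" for i j
    using that
  proof (induction j)
    case 0
    then show ?case by (simp add: x_def)
  next
    case (Suc j)
    have nz: "\<delta> i j \<noteq> 0" "\<sigma> (Suc i) j \<noteq> 0" using Suc.prems by (auto intro!: \<sigma> \<delta>)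
    \<comment> \<open>The top side of the rhombus is expressed by its other three sides; its
      diagonal vector, divided by \<delta>, is the right side.\<close>
    have "x (Suc i) (Suc j) - x i (Suc j)
      = (x (Suc i) j - x i j) + (x (Suc i) (Suc j) - x (Suc i) j) - (x i (Suc j) - x i j)" by simp
    also have "\<dots> = E i j + \<sigma> (Suc i) j * (a i j * E i j) - \<sigma> i j * E i j"
      using Suc Ea[of i j] by (simp add: xu)
    also have "\<sigma> (Suc i) j * (a i j * E i j) = (\<sigma> i j - 1) / \<delta> i j * E i j"
      using nz by (simp add: a_def step_right_def)
    also have "E i j + (\<sigma> i j - 1) / \<delta> i j * E i j - \<sigma> i j * E i j = b i j * E i j"
      by (simp add: b_def step_up_def algebra_simps diff_divide_distrib)
    finally show ?case by (simp add: Eb)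
  qed
  show ?thesis
    by (rule that[of E x]) (use Ea Eb xu xr in \<open>auto simp: E_def x_def a_def b_def\<close>)
qed

definition up_ratio :: "(int \<times> int \<Rightarrow> int \<times> int \<Rightarrow> real) \<Rightarrow> nat \<Rightarrow> nat \<Rightarrow> complex"
  where "up_ratio S i j = (let u = (int i, int j); v = (int i + 1, int j); w = (int i, int j + 1)
    in tri_ratio (S u v) (S u w) (S v w))"

text \<open>Based at the bottom vertex, with the other two vertices in counterclockwise order. On
  the equilateral lattice both \<open>up_ratio\<close> and \<open>down_ratio\<close> then have the
  value \<open>hex_root\<close>.\<close>

definition down_ratio :: "(int \<times> int \<Rightarrow> int \<times> int \<Rightarrow> real) \<Rightarrow> nat \<Rightarrow> nat \<Rightarrow> complex"
  where "down_ratio S i j = (let u = (int i + 1, int j); v = (int i + 1, int j + 1); w = (int i, int j + 1)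
    in tri_ratio (S u v) (S u w) (S v w))"

definition nondegenerate :: "nat \<Rightarrow> (int \<times> int \<Rightarrow> int \<times> int \<Rightarrow> real) \<Rightarrow> bool"
  where "nondegenerate n S \<longleftrightarrow> (\<forall>u v. S u v = S v u) \<and>
    (\<forall>i j. i + j + 1 \<le> n \<longrightarrow> (let u = (int i, int j); v = (int i + 1, int j); w = (int i, int j + 1)
      in S u v > 0 \<and> S u w > 0 \<and> S v w > 0 \<and> heron16 (S u v) (S u w) (S v w) > 0)) \<and>
    (\<forall>i j. i + j + 2 \<le> n \<longrightarrow> (let u = (int i + 1, int j); v = (int i + 1, int j + 1); w = (int i, int j + 1)
      in S u v > 0 \<and> S u w > 0 \<and> S v w > 0 \<and> heron16 (S u v) (S u w) (S v w) > 0))"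

lemma tri_ratio_norm:
  assumes "X > 0" "Y > 0" "Z > 0" "heron16 X Y Z > 0"
  shows "(cmod (tri_ratio X Y Z))\<^sup>2 = Y / X" "(cmod (tri_ratio X Y Z - 1))\<^sup>2 = Z / X"
proof -
  have 1: "(cmod (tri_ratio X Y Z))\<^sup>2 = Y / X" if "X > 0" "Y > 0" "heron16 X Y Z > 0" for X Y Z
    using that by (simp add: tri_ratio_polar norm_mult norm_divide power_divide)
  show "(cmod (tri_ratio X Y Z))\<^sup>2 = Y / X" by (rule 1[OF assms(1,2,4)])
  have h: "heron16 Z X Y > 0" using assms by (simp add: heron16_rotate)
  have "(cmod (1 / (1 - tri_ratio X Y Z)))\<^sup>2 = X / Z"
    using 1[OF assms(3,1) h] tri_ratio_rotate(1)[OF assms] by simp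
  then have "1 / (cmod (tri_ratio X Y Z - 1))\<^sup>2 = X / Z"
    by (simp add: norm_divide power_divide norm_minus_commute)
  then show "(cmod (tri_ratio X Y Z - 1))\<^sup>2 = Z / X"
    using assms(1,3) by (auto simp: divide_simps split: if_splits) (simp add: mult.commute)
qed

lemma nondegenerateD:
  assumes "nondegenerate n S"
  shows "S u v = S v u"
    and "i + j + 1 \<le> n \<Longrightarrow> S (int i, int j) (int i + 1, int j) > 0"
    and "i + j + 1 \<le> n \<Longrightarrow> S (int i, int j) (int i, int j + 1) > 0"
    and "i + j + 1 \<le> n \<Longrightarrow> S (int i + 1, int j) (int i, int j + 1) > 0"
    and "i + j + 1 \<le> n \<Longrightarrow> heron16 (S (int i, int j) (int i + 1, int j)) (S (int i, int j) (int i, int j + 1)) (S (int i + 1, int j) (int i, int j + 1)) > 0"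
    and "i + j + 2 \<le> n \<Longrightarrow> S (int i + 1, int j) (int i + 1, int j + 1) > 0"
    and "i + j + 2 \<le> n \<Longrightarrow> S (int i + 1, int j) (int i, int j + 1) > 0"
    and "i + j + 2 \<le> n \<Longrightarrow> S (int i + 1, int j + 1) (int i, int j + 1) > 0"
    and "i + j + 2 \<le> n \<Longrightarrow> heron16 (S (int i + 1, int j) (int i + 1, int j + 1)) (S (int i + 1, int j) (int i, int j + 1)) (S (int i + 1, int j + 1) (int i, int j + 1)) > 0"
  using assms unfolding nondegenerate_def Let_def by blast+

lemma ratio_nz:
  assumes "nondegenerate n S"
  shows "i + j + 1 \<le> n \<Longrightarrow> up_ratio S i j \<noteq> 0" "i + j + 1 \<le> n \<Longrightarrow> 1 - up_ratio S i j \<noteq> 0"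
    "i + j + 1 \<le> n \<Longrightarrow> Im (up_ratio S i j) > 0"
    "i + j + 2 \<le> n \<Longrightarrow> down_ratio S i j \<noteq> 0" "i + j + 2 \<le> n \<Longrightarrow> 1 - down_ratio S i j \<noteq> 0"
  using tri_ratio_nz[OF nondegenerateD(2)[OF assms] nondegenerateD(5)[OF assms], of i j]
    tri_ratio_nz[OF nondegenerateD(6)[OF assms] nondegenerateD(9)[OF assms], of i j]
  unfolding up_ratio_def down_ratio_def Let_def by simp_all

text \<open>The six corner ratios at a vertex multiply to \<open>1\<close>.\<close>

lemma closing_of_angle_sum:
  fixes w :: "int \<times> int \<Rightarrow> real" and \<kappa> :: real
  defines "S \<equiv> (\<lambda>u v. edge_sq \<kappa> (w u) (w v))"
  assumes nd: "nondegenerate n S" and ij: "i + j + 3 \<le> n"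
    and sum: "angle_sum \<kappa> w (int i + 1, int j + 1) = 2 * pi"
  defines "\<sigma> \<equiv> up_ratio S" and "\<delta> \<equiv> down_ratio S"
  shows "(\<sigma> i (Suc j) - 1) * (1 - \<delta> i j) * \<delta> (Suc i) j * \<sigma> (Suc i) j
      = (\<sigma> (Suc i) j - 1) * (1 - \<delta> (Suc i) j) * \<delta> i (Suc j) * \<sigma> (Suc i) (Suc j)"
proof -
  define v n0 n1 n2 n3 n4 n5 where "v = (int i + 1, int j + 1)" and "n0 = (int i + 2, int j + 1)"
    and "n1 = (int i + 1, int j + 2)" and "n2 = (int i, int j + 2)" and "n3 = (int i, int j + 1)"
    and "n4 = (int i + 1, int j)" and "n5 = (int i + 2, int j)"
  note vs = v_def n0_def n1_def n2_def n3_def n4_def n5_def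
  have sym: "S x y = S y x" for x y by (rule nondegenerateD(1)[OF nd])
  have \<sigma>: "\<sigma> (Suc i) (Suc j) = tri_ratio (S v n0) (S v n1) (S n0 n1)"
    "\<sigma> i (Suc j) = tri_ratio (S n3 v) (S n3 n2) (S v n2)"
    "\<sigma> (Suc i) j = tri_ratio (S n4 n5) (S n4 v) (S n5 v)"
    and \<delta>: "\<delta> i (Suc j) = tri_ratio (S v n1) (S v n2) (S n1 n2)"
    "\<delta> i j = tri_ratio (S n4 v) (S n4 n3) (S v n3)"
    "\<delta> (Suc i) j = tri_ratio (S n5 n0) (S n5 v) (S n0 v)"
    unfolding \<sigma>_def \<delta>_def up_ratio_def down_ratio_def Let_def vs by (simp_all add: algebra_simps)
  note nd' = nondegenerateD(2-)[OF nd]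
  have pos: "S v n0 > 0" "S v n1 > 0" "S n0 n1 > 0" "S n3 v > 0" "S n3 n2 > 0" "S v n2 > 0"
    "S n4 n5 > 0" "S n4 v > 0" "S n5 v > 0" "S n1 n2 > 0" "S n4 n3 > 0" "S v n3 > 0"
    "S n5 n0 > 0" "S n0 v > 0"
    using nd'(1-3)[of "Suc i" "Suc j"] nd'(1-3)[of i "Suc j"] nd'(1-3)[of "Suc i" j]
      nd'(5-7)[of i "Suc j"] nd'(5-7)[of i j] nd'(5-7)[of "Suc i" j] ij
    unfolding vs by (simp_all add: algebra_simps)
  have H: "heron16 (S v n0) (S v n1) (S n0 n1) > 0" "heron16 (S n3 v) (S n3 n2) (S v n2) > 0"
    "heron16 (S n4 n5) (S n4 v) (S n5 v) > 0" "heron16 (S v n1) (S v n2) (S n1 n2) > 0"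
    "heron16 (S n4 v) (S n4 n3) (S v n3) > 0" "heron16 (S n5 n0) (S n5 v) (S n0 v) > 0"
    using nd'(4)[of "Suc i" "Suc j"] nd'(4)[of i "Suc j"] nd'(4)[of "Suc i" j]
      nd'(8)[of i "Suc j"] nd'(8)[of i j] nd'(8)[of "Suc i" j] ij
    unfolding vs by (simp_all add: algebra_simps)
  have H': "heron16 (S v n2) (S v n3) (S n2 n3) > 0" "heron16 (S v n3) (S v n4) (S n3 n4) > 0"
    "heron16 (S v n4) (S v n5) (S n4 n5) > 0" "heron16 (S v n5) (S v n0) (S n5 n0) > 0"
    using H(2,5) heron16_rotate(1)[of "S v n2" "S n3 v" "S n3 n2"] heron16_rotate(1)[of "S v n3" "S n4 v" "S n4 n3"]
      H(3,6) heron16_rotate(2)[of "S n4 v" "S n5 v" "S n4 n5"] heron16_rotate(2)[of "S n5 v" "S n0 v" "S n5 n0"]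
    by (simp_all add: sym)
  define R where "R = (\<lambda>x y. tri_ratio (S v x) (S v y) (S x y))"
  \<comment> \<open>Three of the lattice triangles around v store their shape at another corner on
    the left or below; \<open>tri_ratio_rotate\<close> brings all ratios to v.\<close>
  have R: "R n0 n1 = \<sigma> (Suc i) (Suc j)" "R n1 n2 = \<delta> i (Suc j)" "R n2 n3 = 1 / (1 - \<sigma> i (Suc j))"
    "R n3 n4 = 1 / (1 - \<delta> i j)" "R n4 n5 = (\<sigma> (Suc i) j - 1) / \<sigma> (Suc i) j"
    "R n5 n0 = (\<delta> (Suc i) j - 1) / \<delta> (Suc i) j"
    unfolding \<sigma> \<delta> R_def
    using tri_ratio_rotate(1)[OF pos(4-6) H(2)] tri_ratio_rotate(1)[OF pos(8,11,12) H(5)]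
      tri_ratio_rotate(2)[OF pos(7-9) H(3)] tri_ratio_rotate(2)[OF pos(13,9,14) H(6)]
    by (simp_all add: sym)
  have pv: "S v n3 > 0" "S v n4 > 0" "S v n5 > 0" using pos by (simp_all add: sym)
  let ?A = "\<lambda>x y. tri_angle (S v x) (S v y) (S x y)" and ?q = "\<lambda>x y. complex_of_real (sqrt (S v y) / sqrt (S v x))"
  have P: "R n0 n1 = ?q n0 n1 * cis (?A n0 n1)" "R n1 n2 = ?q n1 n2 * cis (?A n1 n2)"
    "R n2 n3 = ?q n2 n3 * cis (?A n2 n3)" "R n3 n4 = ?q n3 n4 * cis (?A n3 n4)"
    "R n4 n5 = ?q n4 n5 * cis (?A n4 n5)" "R n5 n0 = ?q n5 n0 * cis (?A n5 n0)"
    unfolding R_def by (rule tri_ratio_polar; use pos pv H H' in blast)+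
  have "?A n0 n1 + ?A n1 n2 + ?A n2 n3 + ?A n3 n4 + ?A n4 n5 + ?A n5 n0 = angle_sum \<kappa> w (int i + 1, int j + 1)"
    unfolding angle_sum_def weight_angle_def S_def vs by (simp add: algebra_simps)
  then have c: "cis (?A n0 n1 + ?A n1 n2 + ?A n2 n3 + ?A n3 n4 + ?A n4 n5 + ?A n5 n0) = 1"
    by (simp add: sum)
  \<comment> \<open>The moduli telescope around the vertex, and the arguments add up to the angle
    sum 2 pi.\<close>
  have "R n0 n1 * R n1 n2 * R n2 n3 * R n3 n4 * R n4 n5 * R n5 n0
    = (?q n0 n1 * ?q n1 n2 * ?q n2 n3 * ?q n3 n4 * ?q n4 n5 * ?q n5 n0)
      * cis (?A n0 n1 + ?A n1 n2 + ?A n2 n3 + ?A n3 n4 + ?A n4 n5 + ?A n5 n0)"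
    unfolding P cis_mult[symmetric] by (simp only: mult_ac)
  also have "\<dots> = of_real ((sqrt (S v n1) / sqrt (S v n0)) * (sqrt (S v n2) / sqrt (S v n1)) * (sqrt (S v n3) / sqrt (S v n2))
      * (sqrt (S v n4) / sqrt (S v n3)) * (sqrt (S v n5) / sqrt (S v n4)) * (sqrt (S v n0) / sqrt (S v n5)))"
    unfolding c by (simp only: of_real_mult mult_1_right)
  also have "\<dots> = 1" using pos(1,2,6) pv by simp
  finally have prod: "\<sigma> (Suc i) (Suc j) * \<delta> i (Suc j) * (1 / (1 - \<sigma> i (Suc j))) * (1 / (1 - \<delta> i j))
      * ((\<sigma> (Suc i) j - 1) / \<sigma> (Suc i) j) * ((\<delta> (Suc i) j - 1) / \<delta> (Suc i) j) = 1"
    unfolding R .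
  have nz: "\<sigma> (Suc i) j \<noteq> 0" "\<delta> (Suc i) j \<noteq> 0" "1 - \<sigma> i (Suc j) \<noteq> 0" "1 - \<delta> i j \<noteq> 0"
    unfolding \<sigma>_def \<delta>_def using ratio_nz[OF nd] ij by auto
  have gen: "s * d * (1 / a) * (1 / b) * (p / t) * (q / u) = 1 \<Longrightarrow> t \<noteq> 0 \<Longrightarrow> u \<noteq> 0 \<Longrightarrow> a \<noteq> 0 \<Longrightarrow> b \<noteq> 0
    \<Longrightarrow> s * d * p * q = a * b * t * u" for s d a b p q t u :: complex
    by (simp add: divide_simps)
  from gen[OF prod nz] show ?thesis by algebra
qed

text \<open>The lengths of the sides crossed on the way cancel, which leaves the quotient of the new
  bottom side by the old one.\<close>

lemma step_norms:
  assumes nd: "nondegenerate n S" and ij: "i + j + 2 \<le> n"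
  shows "(cmod (step_right (up_ratio S) (down_ratio S) i j))\<^sup>2
      = S (int i + 1, int j) (int i + 2, int j) / S (int i, int j) (int i + 1, int j)"
    and "(cmod (step_up (up_ratio S) (down_ratio S) i j))\<^sup>2
      = S (int i, int j + 1) (int i + 1, int j + 1) / S (int i, int j) (int i + 1, int j)"
proof -
  note D = nondegenerateD(2-)[OF nd]
  have ij1: "i + j + 1 \<le> n" "Suc i + j + 1 \<le> n" using ij by auto
  have s: "(cmod (up_ratio S i j - 1))\<^sup>2 = S (int i + 1, int j) (int i, int j + 1) / S (int i, int j) (int i + 1, int j)"
    unfolding up_ratio_def Let_def using D(1-4)[OF ij1(1)] by (intro tri_ratio_norm(2)) auto
  have s': "(cmod (up_ratio S (Suc i) j))\<^sup>2 = S (int i + 1, int j) (int i + 1, int j + 1) / S (int i + 1, int j) (int i + 2, int j)"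
    unfolding up_ratio_def Let_def using D(1-4)[OF ij1(2)] tri_ratio_norm(1) by (simp add: add.commute)
  have d: "(cmod (down_ratio S i j))\<^sup>2 = S (int i + 1, int j) (int i, int j + 1) / S (int i + 1, int j) (int i + 1, int j + 1)"
    "(cmod (down_ratio S i j - 1))\<^sup>2 = S (int i + 1, int j + 1) (int i, int j + 1) / S (int i + 1, int j) (int i + 1, int j + 1)"
    unfolding down_ratio_def Let_def using D(5-8)[OF ij] by (intro tri_ratio_norm; auto)+
  have pos: "S (int i + 1, int j) (int i, int j + 1) > 0" "S (int i, int j) (int i + 1, int j) > 0"
    "S (int i + 1, int j) (int i + 1, int j + 1) > 0" "S (int i + 1, int j) (int i + 2, int j) > 0"
    "S (int i + 1, int j + 1) (int i, int j + 1) > 0"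
    using D(1-3)[OF ij1(1)] D(1)[OF ij1(2)] D(5-7)[OF ij] by (simp_all add: add.commute)
  show "(cmod (step_right (up_ratio S) (down_ratio S) i j))\<^sup>2
      = S (int i + 1, int j) (int i + 2, int j) / S (int i, int j) (int i + 1, int j)"
    unfolding step_right_def norm_divide norm_mult power_divide power_mult_distrib s s' d using pos by simp
  have "1 / down_ratio S i j - 1 = (1 - down_ratio S i j) / down_ratio S i j"
    using ratio_nz(4)[OF nd ij] by (simp add: field_simps)
  then show "(cmod (step_up (up_ratio S) (down_ratio S) i j))\<^sup>2
      = S (int i, int j + 1) (int i + 1, int j + 1) / S (int i, int j) (int i + 1, int j)"
    unfolding step_up_def using pos
    by (simp add: norm_divide norm_mult power_divide power_mult_distrib s d norm_minus_commute[of 1] nondegenerateD(1)[OF nd, of "(int i, int j + 1)"])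
qed

text \<open>By \<open>step_norms\<close> the quotient of developed and prescribed squared length is
  the same for all bottom sides, so a correct first edge makes all lengths correct, with one common
  scale \<open>t\<close>.\<close>

lemma developed_lengths:
  assumes nd: "nondegenerate n S" and E0: "n \<ge> 1 \<Longrightarrow> (cmod (E 0 0))\<^sup>2 = t * S (0, 0) (1, 0)"
    and Er: "\<And>i j. i + j + 2 \<le> n \<Longrightarrow> E (Suc i) j = step_right (up_ratio S) (down_ratio S) i j * E i j"
    and Eu: "\<And>i j. i + j + 2 \<le> n \<Longrightarrow> E i (Suc j) = step_up (up_ratio S) (down_ratio S) i j * E i j"
    and ij: "i + j + 1 \<le> n"
  shows "(cmod (E i j))\<^sup>2 = t * S (int i, int j) (int i + 1, int j)"
    and "(cmod (up_ratio S i j * E i j))\<^sup>2 = t * S (int i, int j) (int i, int j + 1)"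
    and "(cmod (up_ratio S i j * E i j - E i j))\<^sup>2 = t * S (int i + 1, int j) (int i, int j + 1)"
proof -
  note D = nondegenerateD(2-)[OF nd]
  have bottom: "(cmod (E i 0))\<^sup>2 = t * S (int i, 0) (int i + 1, 0)" if "i + 1 \<le> n" for i
    using that
  proof (induction i)
    case 0
    then show ?case using E0 by simp
  next
    case (Suc i)
    have "S (int i, 0) (int i + 1, 0) > 0" using D(1)[of i 0] Suc.prems by simp
    then show ?case
      using Suc step_norms(1)[OF nd, of i 0] Er[of i 0]
      by (simp add: norm_mult power_mult_distrib add.commute)
  qed
  show 1: "(cmod (E i j))\<^sup>2 = t * S (int i, int j) (int i + 1, int j)"
    using ij
  proof (induction j)
    case 0
    then show ?case using bottom by simp
  next
    case (Suc j)
    have "S (int i, int j) (int i + 1, int j) > 0" using D(1)[of i j] Suc.prems by simp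
    then show ?case
      using Suc step_norms(2)[OF nd, of i j] Eu[of i j]
      by (simp add: norm_mult power_mult_distrib add.commute)
  qed
  have s: "(cmod (up_ratio S i j))\<^sup>2 = S (int i, int j) (int i, int j + 1) / S (int i, int j) (int i + 1, int j)"
    "(cmod (up_ratio S i j - 1))\<^sup>2 = S (int i + 1, int j) (int i, int j + 1) / S (int i, int j) (int i + 1, int j)"
    unfolding up_ratio_def Let_def using D(1-4)[OF ij] by (intro tri_ratio_norm; auto)+
  have pos: "S (int i, int j) (int i + 1, int j) > 0" using D(1)[OF ij] .
  show "(cmod (up_ratio S i j * E i j))\<^sup>2 = t * S (int i, int j) (int i, int j + 1)"
    using pos by (simp add: norm_mult power_mult_distrib s 1)
  have "up_ratio S i j * E i j - E i j = (up_ratio S i j - 1) * E i j" by (simp add: algebra_simps)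
  then show "(cmod (up_ratio S i j * E i j - E i j))\<^sup>2 = t * S (int i + 1, int j) (int i, int j + 1)"
    using pos by (simp add: norm_mult power_mult_distrib s 1)
qed

text \<open>Relative errors compound multiplicatively along the path; the exponent counts the i + j
  steps and the error of the first edge.\<close>

lemma product_drift:
  fixes E E' a a' b b' :: "nat \<Rightarrow> nat \<Rightarrow> complex"
  assumes a: "\<And>i j. i + j + 2 \<le> n \<Longrightarrow> E (Suc i) j = a i j * E i j \<and> E' (Suc i) j = a' i j * E' i j \<and> cmod (a i j - a' i j) \<le> \<eta> * cmod (a' i j)"
    and b: "\<And>i j. i + j + 2 \<le> n \<Longrightarrow> E i (Suc j) = b i j * E i j \<and> E' i (Suc j) = b' i j * E' i j \<and> cmod (b i j - b' i j) \<le> \<eta> * cmod (b' i j)"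
    and E0: "cmod (E 0 0 - E' 0 0) \<le> \<eta> * cmod (E' 0 0)" and \<eta>: "0 \<le> \<eta>" and ij: "i + j + 1 \<le> n"
  shows "cmod (E i j - E' i j) \<le> ((1 + \<eta>) ^ (i + j + 1) - 1) * cmod (E' i j)"
proof -
  have step: "cmod (\<alpha> * z - \<alpha>' * z') \<le> ((1 + \<eta>) ^ Suc k - 1) * cmod (\<alpha>' * z')"
    if h: "cmod (\<alpha> - \<alpha>') \<le> \<eta> * cmod \<alpha>'" "cmod (z - z') \<le> ((1 + \<eta>) ^ k - 1) * cmod z'" for \<alpha> \<alpha>' z z' k
  proof -
    have c: "cmod \<alpha> \<le> (1 + \<eta>) * cmod \<alpha>'"
      using h(1) norm_triangle_sub[of \<alpha> \<alpha>'] by (simp add: algebra_simps)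
    have "\<alpha> * z - \<alpha>' * z' = \<alpha> * (z - z') + (\<alpha> - \<alpha>') * z'" by (simp add: algebra_simps)
    then have "cmod (\<alpha> * z - \<alpha>' * z') \<le> cmod \<alpha> * cmod (z - z') + cmod (\<alpha> - \<alpha>') * cmod z'"
      by (metis norm_mult norm_triangle_ineq)
    also have "\<dots> \<le> ((1 + \<eta>) * cmod \<alpha>') * (((1 + \<eta>) ^ k - 1) * cmod z') + (\<eta> * cmod \<alpha>') * cmod z'"
      using c h \<eta> by (intro add_mono mult_mono) auto
    also have "\<dots> = ((1 + \<eta>) ^ Suc k - 1) * cmod (\<alpha>' * z')"
      by (simp add: norm_mult algebra_simps)
    finally show ?thesis .
  qed
  have bottom: "cmod (E i 0 - E' i 0) \<le> ((1 + \<eta>) ^ (i + 1) - 1) * cmod (E' i 0)" if "i + 1 \<le> n" for i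
    using that
  proof (induction i)
    case 0
    then show ?case using E0 by simp
  next
    case (Suc i)
    then show ?case using step[of "a i 0" "a' i 0" "E i 0" "E' i 0" "i + 1"] a[of i 0] by simp
  qed
  show ?thesis
    using ij
  proof (induction j)
    case 0
    then show ?case using bottom by simp
  next
    case (Suc j)
    then show ?case using step[of "b i j" "b' i j" "E i j" "E' i j" "i + j + 1"] b[of i j] by simp
  qed
qed

section \<open>Univalent functions on convex sets\<close>

text \<open>The primitive sixth root of unity h = exp(i pi / 3). As h^2 = h - 1, the six lattice
  directions are 1, h, h - 1 and their negatives.\<close>

definition hex_root :: complex
  where "hex_root = Complex (1/2) (sqrt 3 / 2)"

lemma hex_root_sq: "hex_root * hex_root = hex_root - 1"
  by (simp add: hex_root_def complex_eq_iff)

lemma norm_hex_root [simp]: "cmod hex_root = 1"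
  by (simp add: hex_root_def cmod_def power_divide)

lemma hex_root_parts: "Im hex_root > 0" "hex_root \<noteq> 0" "Re hex_root = 1/2"
  by (auto simp: hex_root_def complex_eq_iff)

lemma norm_hex_root_diff [simp]: "cmod (hex_root - 1) = 1" "cmod (1 - hex_root) = 1"
proof -
  show "cmod (hex_root - 1) = 1" by (simp flip: hex_root_sq add: norm_mult)
  then show "cmod (1 - hex_root) = 1" by (simp add: norm_minus_commute)
qed

lemma compact_norm_bound:
  fixes F :: "complex \<Rightarrow> complex"
  assumes "continuous_on T F" "compact T"
  obtains B where "B \<ge> 0" "\<And>z. z \<in> T \<Longrightarrow> cmod (F z) \<le> B"
proof -
  have "bounded (F ` T)" using assms by (intro compact_imp_bounded compact_continuous_image)
  then obtain B where "\<And>z. z \<in> T \<Longrightarrow> cmod (F z) \<le> B" unfolding bounded_iff by blast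
  then show ?thesis by (intro that[of "\<bar>B\<bar>"]) force+
qed

lemma holomorphic_higher_deriv_bound:
  assumes "F holomorphic_on U" "open U" "T \<subseteq> U" "compact T"
  obtains B where "B \<ge> 0" "\<And>z. z \<in> T \<Longrightarrow> cmod ((deriv ^^ n) F z) \<le> B"
proof (rule compact_norm_bound[of T "(deriv ^^ n) F"])
  show "continuous_on T ((deriv ^^ n) F)"
    using assms by (meson continuous_on_subset holomorphic_higher_deriv holomorphic_on_imp_continuous_on)
qed (use assms that in auto)

lemma taylor_compact:
  assumes "F holomorphic_on U" "open U" "T \<subseteq> U" "compact T" "convex T"
  obtains B where "B \<ge> 0" "\<And>z y. z \<in> T \<Longrightarrow> y \<in> T \<Longrightarrow>
    cmod (F y - (\<Sum>i\<le>n. (deriv ^^ i) F z * (y - z) ^ i / fact i)) \<le> B * cmod (y - z) ^ Suc n"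
proof -
  obtain B where B: "B \<ge> 0" "\<And>z. z \<in> T \<Longrightarrow> cmod ((deriv ^^ Suc n) F z) \<le> B"
    by (rule holomorphic_higher_deriv_bound[OF assms(1-4), where n = "Suc n"]) blast
  show ?thesis
  proof
    show "B / fact n \<ge> 0" using B by simp
    fix z y assume zy: "z \<in> T" "y \<in> T"
    have der: "((deriv ^^ i) F has_field_derivative (deriv ^^ Suc i) F x) (at x within T)" if "x \<in> T" for i x
      by (rule has_field_derivative_at_within[OF has_field_derivative_higher_deriv[OF assms(1,2)]]) (use that assms(3) in blast)
    define D where "D = (\<lambda>i. (deriv ^^ i) F)"
    have "cmod (D 0 y - (\<Sum>i\<le>n. D i z * (y - z) ^ i / fact i)) \<le> B * cmod (y - z) ^ Suc n / fact n"
    proof (rule complex_Taylor[OF \<open>convex T\<close>])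
      show "(D i has_field_derivative D (Suc i) x) (at x within T)" if "x \<in> T" for i x
        unfolding D_def using that by (rule der)
      show "cmod (D (Suc n) x) \<le> B" if "x \<in> T" for x
        unfolding D_def using that by (rule B(2))
    qed (rule zy)+
    then show "cmod (F y - (\<Sum>i\<le>n. (deriv ^^ i) F z * (y - z) ^ i / fact i)) \<le> B / fact n * cmod (y - z) ^ Suc n"
      by (simp add: D_def)
  qed
qed

text \<open>\<open>L\<close> is a logarithm of the derivative, so that Re L = ln |G'| is the
  harmonic weight to be approximated. Univalence on the neighbourhood \<open>U\<close> makes all
  derivative bounds uniform up to the boundary of \<open>T\<close>.\<close>

locale univalent_patch =
  fixes G L :: "complex \<Rightarrow> complex" and U T :: "complex set"
  assumes open_U: "open U" and T_U: "T \<subseteq> U" and compact_T: "compact T" and convex_T: "convex T"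
    and holo_G: "G holomorphic_on U" and inj_G: "inj_on G U"
    and holo_L: "L holomorphic_on U" and exp_L: "\<And>z. z \<in> U \<Longrightarrow> deriv G z = exp (L z)"
begin

lemma first_order:
  obtains B where "B \<ge> 0" "\<And>z y. z \<in> T \<Longrightarrow> y \<in> T \<Longrightarrow> cmod (G y - G z - deriv G z * (y - z)) \<le> B * (cmod (y - z))\<^sup>2"
proof -
  obtain B where B: "B \<ge> 0" "\<And>z y. z \<in> T \<Longrightarrow> y \<in> T \<Longrightarrow>
    cmod (G y - (\<Sum>i\<le>1. (deriv ^^ i) G z * (y - z) ^ i / fact i)) \<le> B * cmod (y - z) ^ Suc 1"
    by (rule taylor_compact[OF holo_G open_U T_U compact_T convex_T, where n = 1]) blast
  show ?thesis
    by (rule that[of B]) (use B in \<open>auto simp: power2_eq_square diff_diff_eq\<close>)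
qed

lemma deriv_bounds:
  obtains m M where "0 < m" "m \<le> M" "\<And>z. z \<in> T \<Longrightarrow> m \<le> cmod (deriv G z)" "\<And>z. z \<in> T \<Longrightarrow> cmod (deriv G z) \<le> M"
proof -
  obtain B where B: "B \<ge> 0" "\<And>z. z \<in> T \<Longrightarrow> cmod (L z) \<le> B"
    by (rule compact_norm_bound[of T L])
      (use compact_T T_U holo_L in \<open>auto intro: holomorphic_on_imp_continuous_on continuous_on_subset\<close>)
  show ?thesis
  proof
    show "0 < exp (- B)" by simp
    show "exp (- B) \<le> exp B" using B(1) by simp
    fix z assume z: "z \<in> T"
    have "\<bar>Re (L z)\<bar> \<le> B" using abs_Re_le_cmod[of "L z"] B(2)[OF z] by linarith
    then have "- B \<le> Re (L z)" "Re (L z) \<le> B" by linarith+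
    moreover have "cmod (deriv G z) = exp (Re (L z))" using exp_L[of z] z T_U by auto
    ultimately show "exp (- B) \<le> cmod (deriv G z)" "cmod (deriv G z) \<le> exp B" by simp_all
  qed
qed

text \<open>Close to the diagonal the linear term dominates, since the derivative is bounded away
  from 0; away from it the difference has a positive minimum by injectivity and compactness.\<close>

lemma bilipschitz:
  obtains m where "m > 0" "\<And>z y. z \<in> T \<Longrightarrow> y \<in> T \<Longrightarrow> m * cmod (y - z) \<le> cmod (G y - G z)"
proof -
  obtain B where B: "B \<ge> 0" "\<And>z y. z \<in> T \<Longrightarrow> y \<in> T \<Longrightarrow> cmod (G y - G z - deriv G z * (y - z)) \<le> B * (cmod (y - z))\<^sup>2"
    by (rule first_order) blast
  obtain m M where m: "0 < m" "\<And>z. z \<in> T \<Longrightarrow> m \<le> cmod (deriv G z)" by (rule deriv_bounds) blast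
  \<comment> \<open>Up to this distance the quadratic error B r stays below half of the lower bound
    m for the derivative.\<close>
  define r where "r = m / (2 * (B + 1))"
  have r: "r > 0" using m B by (simp add: r_def)
  have near: "m / 2 * cmod (y - z) \<le> cmod (G y - G z)" if "z \<in> T" "y \<in> T" "cmod (y - z) \<le> r" for z y
  proof -
    have "B * cmod (y - z) \<le> B * r" using that B by (intro mult_left_mono) auto
    also have "\<dots> \<le> m / 2" using m(1) B(1) by (simp add: r_def field_simps)
    finally have "B * (cmod (y - z))\<^sup>2 \<le> m / 2 * cmod (y - z)"
      using mult_right_mono[of "B * cmod (y - z)" "m / 2" "cmod (y - z)"] by (simp add: power2_eq_square mult.assoc)
    moreover have "m * cmod (y - z) \<le> cmod (deriv G z * (y - z))"
      unfolding norm_mult using m(2)[OF that(1)] by (intro mult_right_mono) auto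
    moreover have "cmod (deriv G z * (y - z)) \<le> cmod (G y - G z) + cmod (G y - G z - deriv G z * (y - z))"
      using norm_triangle_ineq4[of "G y - G z" "G y - G z - deriv G z * (y - z)"] by simp
    ultimately show ?thesis using B(2)[OF that(1,2)] by simp
  qed
  define K where "K = {p \<in> T \<times> T. r \<le> cmod (snd p - fst p)}"
  have compK: "compact K"
  proof -
    have "K = (T \<times> T) \<inter> {p. r \<le> cmod (snd p - fst p)}" by (auto simp: K_def)
    moreover have "closed {p :: complex \<times> complex. r \<le> cmod (snd p - fst p)}"
      by (intro closed_Collect_le continuous_intros)
    ultimately show ?thesis using compact_T by (simp add: compact_Times compact_Int_closed)
  qed
  obtain D where D: "D > 0" "\<And>z y. z \<in> T \<Longrightarrow> y \<in> T \<Longrightarrow> cmod (y - z) \<le> D"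
  proof -
    obtain D where D: "\<And>z. z \<in> T \<Longrightarrow> cmod z \<le> D" "D > 0"
      using compact_imp_bounded[OF compact_T] unfolding bounded_pos by blast
    show ?thesis
    proof (rule that[of "2 * D"])
      show "cmod (y - z) \<le> 2 * D" if "z \<in> T" "y \<in> T" for z y
        using D(1)[OF that(1)] D(1)[OF that(2)] norm_triangle_ineq4[of y z] by linarith
    qed (use D in simp)
  qed
  obtain c where c: "c > 0" "\<And>p. p \<in> K \<Longrightarrow> c \<le> cmod (G (snd p) - G (fst p))"
  proof (cases "K = {}")
    case True
    then show ?thesis by (intro that[of 1]) auto
  next
    case False
    have cG: "continuous_on T G"
      by (rule continuous_on_subset[OF holomorphic_on_imp_continuous_on[OF holo_G] T_U])
    have "continuous_on K (\<lambda>p. G (snd p))" "continuous_on K (\<lambda>p. G (fst p))"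
      by (rule continuous_on_compose2[OF cG]; force simp: K_def intro: continuous_intros)+
    then have "continuous_on K (\<lambda>p. cmod (G (snd p) - G (fst p)))"
      by (intro continuous_on_norm continuous_on_diff)
    then obtain p where p: "p \<in> K" "\<And>q. q \<in> K \<Longrightarrow> cmod (G (snd p) - G (fst p)) \<le> cmod (G (snd q) - G (fst q))"
      using continuous_attains_inf[OF compK False] by blast
    have "fst p \<in> U" "snd p \<in> U" "snd p \<noteq> fst p" using p(1) r T_U by (auto simp: K_def)
    then have "G (snd p) \<noteq> G (fst p)" using inj_G by (auto dest: inj_onD)
    with p show ?thesis by (intro that[of "cmod (G (snd p) - G (fst p))"]) auto
  qed
  define m' where "m' = min (m / 2) (c / D)"
  show ?thesis
  proof
    show "m' > 0" using m c D by (simp add: m'_def)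
    fix z y assume zy: "z \<in> T" "y \<in> T"
    show "m' * cmod (y - z) \<le> cmod (G y - G z)"
    proof (cases "cmod (y - z) \<le> r")
      case True
      have "m' * cmod (y - z) \<le> m / 2 * cmod (y - z)" unfolding m'_def by (intro mult_right_mono min.cobounded1) simp
      with near[OF zy True] show ?thesis by simp
    next
      case False
      have "m' * cmod (y - z) \<le> c / D * D"
        unfolding m'_def using D(2)[OF zy] c D(1) by (intro mult_mono min.cobounded2) auto
      also have "\<dots> = c" using D by simp
      also have "c \<le> cmod (G y - G z)" using c(2)[of "(z, y)"] zy False by (auto simp: K_def)
      finally show ?thesis .
    qed
  qed
qed

text \<open>With the derivative at one end only, the error would be cubic. The product of both end
  derivatives reproduces the cubic term 2 a b \<zeta>^3 of the squared chord, so the discrepancy is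
  of fourth order. This makes vertex scaling by ln |G'| accurate to relative order h^2.\<close>

lemma chord_length:
  obtains B where "B \<ge> 0" "\<And>z y. z \<in> T \<Longrightarrow> y \<in> T \<Longrightarrow> cmod (y - z) \<le> 1 \<Longrightarrow>
    \<bar>(cmod (G y - G z))\<^sup>2 - cmod (deriv G z) * cmod (deriv G y) * (cmod (y - z))\<^sup>2\<bar> \<le> B * cmod (y - z) ^ 4"
proof -
  obtain B1 where B1: "B1 \<ge> 0" "\<And>z y. z \<in> T \<Longrightarrow> y \<in> T \<Longrightarrow>
    cmod (G y - (\<Sum>i\<le>2. (deriv ^^ i) G z * (y - z) ^ i / fact i)) \<le> B1 * cmod (y - z) ^ Suc 2"
    by (rule taylor_compact[OF holo_G open_U T_U compact_T convex_T, where n = 2]) blast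
  have holo_G': "deriv G holomorphic_on U" using holo_G open_U by (rule holomorphic_deriv)
  obtain B2 where B2: "B2 \<ge> 0" "\<And>z y. z \<in> T \<Longrightarrow> y \<in> T \<Longrightarrow>
    cmod (deriv G y - (\<Sum>i\<le>1. (deriv ^^ i) (deriv G) z * (y - z) ^ i / fact i)) \<le> B2 * cmod (y - z) ^ Suc 1"
    by (rule taylor_compact[OF holo_G' open_U T_U compact_T convex_T, where n = 1]) blast
  obtain M1 where M1: "M1 \<ge> 0" "\<And>z. z \<in> T \<Longrightarrow> cmod ((deriv ^^ 1) G z) \<le> M1"
    by (rule holomorphic_higher_deriv_bound[OF holo_G open_U T_U compact_T, where n = 1]) blast
  obtain M2 where M2: "M2 \<ge> 0" "\<And>z. z \<in> T \<Longrightarrow> cmod ((deriv ^^ 2) G z) \<le> M2"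
    by (rule holomorphic_higher_deriv_bound[OF holo_G open_U T_U compact_T, where n = 2]) blast
  define B where "B = M2 * M2 + 2 * M1 * B1 + M2 * B1 + B1 * B1 + M1 * B2"
  show ?thesis
  proof
    show "B \<ge> 0" using M1 M2 B1 B2 by (simp add: B_def)
    fix z y assume zy: "z \<in> T" "y \<in> T" and le1: "cmod (y - z) \<le> 1"
    define \<zeta> a b where "\<zeta> = y - z" and "a = deriv G z" and "b = (deriv ^^ 2) G z / 2"
    define R1 R2 where "R1 = G y - G z - a * \<zeta> - b * \<zeta>\<^sup>2" and "R2 = deriv G y - a - 2 * b * \<zeta>"
    have z1: "cmod \<zeta> \<le> 1" using le1 by (simp add: \<zeta>_def)
    have R1: "cmod R1 \<le> B1 * cmod \<zeta> ^ 3" using B1(2)[OF zy]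
      by (simp add: R1_def \<zeta>_def a_def b_def numeral_2_eq_2 diff_diff_eq add.assoc eval_nat_numeral)
    have R2: "cmod R2 \<le> B2 * cmod \<zeta> ^ 2" using B2(2)[OF zy]
      by (simp add: R2_def \<zeta>_def a_def b_def numeral_2_eq_2 diff_diff_eq power2_eq_square)
    have ab: "cmod a \<le> M1" "cmod b \<le> M2" using M1(2)[OF zy(1)] M2(2)[OF zy(1)] M2(1)
      by (auto simp: a_def b_def norm_divide)
    have pw: "cmod \<zeta> ^ k \<le> cmod \<zeta> ^ 4" if "k \<ge> 4" for k
      using z1 that by (intro power_decreasing) auto
    have eq: "(G y - G z)\<^sup>2 - \<zeta>\<^sup>2 * (deriv G z * deriv G y)
      = b\<^sup>2 * \<zeta> ^ 4 + 2 * a * \<zeta> * R1 + 2 * b * \<zeta>\<^sup>2 * R1 + R1\<^sup>2 - a * \<zeta>\<^sup>2 * R2"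
    proof -
      have g: "G y - G z = a * \<zeta> + b * \<zeta>\<^sup>2 + R1" "deriv G y = a + 2 * b * \<zeta> + R2" "deriv G z = a"
        by (simp_all add: R1_def R2_def a_def)
      show ?thesis unfolding g by (simp add: power2_eq_square eval_nat_numeral algebra_simps)
    qed
    have t1: "cmod (b\<^sup>2 * \<zeta> ^ 4) \<le> M2 * M2 * cmod \<zeta> ^ 4"
      unfolding norm_mult norm_power power2_eq_square using ab M2 by (intro mult_mono) auto
    have t2: "cmod (2 * a * \<zeta> * R1) \<le> 2 * M1 * B1 * cmod \<zeta> ^ 4"
    proof -
      have "cmod (2 * a * \<zeta> * R1) \<le> 2 * M1 * cmod \<zeta> * (B1 * cmod \<zeta> ^ 3)"
        unfolding norm_mult using ab M1 B1 R1 by (intro mult_mono) auto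
      then show ?thesis by (simp add: eval_nat_numeral mult_ac)
    qed
    have t3: "cmod (2 * b * \<zeta>\<^sup>2 * R1) \<le> M2 * B1 * cmod \<zeta> ^ 4"
    proof -
      have b2: "cmod (2 * b) \<le> M2" using M2(2)[OF zy(1)] by (simp add: b_def)
      have "cmod (2 * b * \<zeta>\<^sup>2 * R1) \<le> M2 * cmod \<zeta> ^ 2 * (B1 * cmod \<zeta> ^ 3)"
        unfolding norm_mult[of _ R1] norm_mult[of _ "\<zeta>\<^sup>2"] norm_power using b2 M2 B1 R1 by (intro mult_mono) auto
      also have "\<dots> = M2 * B1 * cmod \<zeta> ^ 5" by (simp add: eval_nat_numeral mult_ac)
      also have "\<dots> \<le> M2 * B1 * cmod \<zeta> ^ 4" using pw[of 5] M2 B1 by (intro mult_left_mono) auto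
      finally show ?thesis .
    qed
    have t4: "cmod (R1\<^sup>2) \<le> B1 * B1 * cmod \<zeta> ^ 4"
    proof -
      have "cmod (R1\<^sup>2) \<le> (B1 * cmod \<zeta> ^ 3)\<^sup>2" unfolding norm_power using R1 by (intro power_mono) auto
      also have "\<dots> = B1 * B1 * cmod \<zeta> ^ 6" by (simp add: eval_nat_numeral mult_ac)
      also have "\<dots> \<le> B1 * B1 * cmod \<zeta> ^ 4" using pw[of 6] B1 by (intro mult_left_mono) auto
      finally show ?thesis .
    qed
    have t5: "cmod (a * \<zeta>\<^sup>2 * R2) \<le> M1 * B2 * cmod \<zeta> ^ 4"
    proof -
      have "cmod (a * \<zeta>\<^sup>2 * R2) \<le> M1 * cmod \<zeta> ^ 2 * (B2 * cmod \<zeta> ^ 2)"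
        unfolding norm_mult norm_power using ab M1 B2 R2 by (intro mult_mono) auto
      then show ?thesis by (simp add: eval_nat_numeral mult_ac)
    qed
    have "cmod ((G y - G z)\<^sup>2 - \<zeta>\<^sup>2 * (deriv G z * deriv G y)) \<le> B * cmod \<zeta> ^ 4"
    proof -
      have "cmod ((G y - G z)\<^sup>2 - \<zeta>\<^sup>2 * (deriv G z * deriv G y)) \<le> M2 * M2 * cmod \<zeta> ^ 4 + 2 * M1 * B1 * cmod \<zeta> ^ 4
          + M2 * B1 * cmod \<zeta> ^ 4 + B1 * B1 * cmod \<zeta> ^ 4 + M1 * B2 * cmod \<zeta> ^ 4"
        unfolding eq
        by (intro order_trans[OF norm_triangle_ineq4] order_trans[OF norm_triangle_ineq] add_mono t1 t2 t3 t4 t5)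
      then show ?thesis by (simp add: B_def algebra_simps)
    qed
    moreover have "\<bar>cmod ((G y - G z)\<^sup>2) - cmod (\<zeta>\<^sup>2 * (deriv G z * deriv G y))\<bar>
        \<le> cmod ((G y - G z)\<^sup>2 - \<zeta>\<^sup>2 * (deriv G z * deriv G y))" by (rule norm_triangle_ineq3)
    ultimately show "\<bar>(cmod (G y - G z))\<^sup>2 - cmod (deriv G z) * cmod (deriv G y) * (cmod (y - z))\<^sup>2\<bar> \<le> B * cmod (y - z) ^ 4"
      by (simp add: norm_mult norm_power \<zeta>_def mult_ac)
  qed
qed

text \<open>In the six-point sum the odd Taylor terms cancel in opposite directions, and the
  quadratic ones because 1 + h^2 + (h - 1)^2 = 0 for h = \<open>hex_root\<close>; this is the
  discrete trace of harmonicity. The fourth order remainder is left.\<close>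

lemma log_stencil:
  obtains C where "C \<ge> 0"
    "\<And>z d. z \<in> T \<Longrightarrow> z + d \<in> T \<Longrightarrow> cmod d \<le> 1 \<Longrightarrow> \<bar>Re (L (z + d)) - Re (L z) - Re (deriv L z * d)\<bar> \<le> C * (cmod d)\<^sup>2"
    "\<And>z. z \<in> T \<Longrightarrow> cmod (deriv L z) \<le> C"
    "\<And>z d. z \<in> T \<Longrightarrow> {z + d, z + d * hex_root, z + d * (hex_root - 1), z - d, z - d * hex_root, z - d * (hex_root - 1)} \<subseteq> T \<Longrightarrow>
      \<bar>Re (L (z + d)) + Re (L (z + d * hex_root)) + Re (L (z + d * (hex_root - 1)))
        + Re (L (z - d)) + Re (L (z - d * hex_root)) + Re (L (z - d * (hex_root - 1))) - 6 * Re (L z)\<bar> \<le> C * cmod d ^ 4"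
proof -
  obtain B1 where B1: "B1 \<ge> 0" "\<And>z y. z \<in> T \<Longrightarrow> y \<in> T \<Longrightarrow>
    cmod (L y - (\<Sum>i\<le>1. (deriv ^^ i) L z * (y - z) ^ i / fact i)) \<le> B1 * cmod (y - z) ^ Suc 1"
    by (rule taylor_compact[OF holo_L open_U T_U compact_T convex_T, where n = 1]) blast
  obtain B3 where B3: "B3 \<ge> 0" "\<And>z y. z \<in> T \<Longrightarrow> y \<in> T \<Longrightarrow>
    cmod (L y - (\<Sum>i\<le>3. (deriv ^^ i) L z * (y - z) ^ i / fact i)) \<le> B3 * cmod (y - z) ^ Suc 3"
    by (rule taylor_compact[OF holo_L open_U T_U compact_T convex_T, where n = 3]) blast
  obtain M1 where M1: "M1 \<ge> 0" "\<And>z. z \<in> T \<Longrightarrow> cmod ((deriv ^^ 1) L z) \<le> M1"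
    by (rule holomorphic_higher_deriv_bound[OF holo_L open_U T_U compact_T, where n = 1]) blast
  define C where "C = B1 + 6 * B3 + M1"
  show ?thesis
  proof
    show "C \<ge> 0" using B1 B3 M1 by (simp add: C_def)
    show "cmod (deriv L z) \<le> C" if "z \<in> T" for z using M1(2)[OF that] B1 B3 by (simp add: C_def)
    show "\<bar>Re (L (z + d)) - Re (L z) - Re (deriv L z * d)\<bar> \<le> C * (cmod d)\<^sup>2" if "z \<in> T" "z + d \<in> T" "cmod d \<le> 1" for z d
    proof -
      have "\<bar>Re (L (z + d) - L z - deriv L z * d)\<bar> \<le> cmod (L (z + d) - L z - deriv L z * d)" by (rule abs_Re_le_cmod)
      also have "\<dots> \<le> B1 * (cmod d)\<^sup>2" using B1(2)[OF that(1,2)] by (simp add: diff_diff_eq power2_eq_square)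
      also have "\<dots> \<le> C * (cmod d)\<^sup>2" using M1 B3 by (intro mult_right_mono) (auto simp: C_def)
      finally show ?thesis by simp
    qed
    fix z d
    assume z: "z \<in> T" and nb: "{z + d, z + d * hex_root, z + d * (hex_root - 1), z - d, z - d * hex_root, z - d * (hex_root - 1)} \<subseteq> T"
    define a b c where "a = deriv L z" and "b = (deriv ^^ 2) L z / 2" and "c = (deriv ^^ 3) L z / 6"
    define R where "R = (\<lambda>\<zeta>. L (z + \<zeta>) - L z - a * \<zeta> - b * \<zeta>\<^sup>2 - c * \<zeta>^3)"
    have R: "\<bar>Re (R \<zeta>)\<bar> \<le> B3 * cmod d ^ 4" if "z + \<zeta> \<in> T" "cmod \<zeta> = cmod d" for \<zeta>
    proof -
      have "cmod (R \<zeta>) \<le> B3 * cmod \<zeta> ^ 4" using B3(2)[OF z that(1)]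
        by (simp add: R_def a_def b_def c_def eval_nat_numeral diff_diff_eq add.assoc mult.assoc fact_numeral)
      then show ?thesis using abs_Re_le_cmod[of "R \<zeta>"] that(2) by simp
    qed
    have n: "cmod (d * hex_root) = cmod d" "cmod (d * (hex_root - 1)) = cmod d" by (simp_all add: norm_mult)
    have Lz: "L (z + \<zeta>) = L z + a * \<zeta> + b * \<zeta>\<^sup>2 + c * \<zeta>^3 + R \<zeta>" for \<zeta> by (simp add: R_def)
    have sq: "(hex_root - 1) * (hex_root - 1) = - hex_root"
      by (simp add: algebra_simps hex_root_sq)
    have sum0: "L (z + d) + L (z + d * hex_root) + L (z + d * (hex_root - 1)) + L (z + - d) + L (z + - (d * hex_root)) + L (z + - (d * (hex_root - 1))) - 6 * L z
      = 2 * b * d\<^sup>2 * (1 + hex_root * hex_root + (hex_root - 1) * (hex_root - 1))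
        + (R d + R (d * hex_root) + R (d * (hex_root - 1)) + R (- d) + R (- (d * hex_root)) + R (- (d * (hex_root - 1))))"
      unfolding Lz by (simp add: power2_eq_square power3_eq_cube algebra_simps)
    have "1 + hex_root * hex_root + (hex_root - 1) * (hex_root - 1) = 0" unfolding sq hex_root_sq by simp
    then have "Re (L (z + d)) + Re (L (z + d * hex_root)) + Re (L (z + d * (hex_root - 1)))
        + Re (L (z - d)) + Re (L (z - d * hex_root)) + Re (L (z - d * (hex_root - 1))) - 6 * Re (L z)
      = Re (R d) + Re (R (d * hex_root)) + Re (R (d * (hex_root - 1))) + Re (R (- d)) + Re (R (- (d * hex_root))) + Re (R (- (d * (hex_root - 1))))"
      using arg_cong[OF sum0, of Re] by simp
    moreover have "\<bar>x1 + x2 + x3 + x4 + x5 + x6\<bar> \<le> 6 * e" if "\<bar>x1\<bar> \<le> e" "\<bar>x2\<bar> \<le> e" "\<bar>x3\<bar> \<le> e" "\<bar>x4\<bar> \<le> e" "\<bar>x5\<bar> \<le> e" "\<bar>x6\<bar> \<le> e"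
      for x1 x2 x3 x4 x5 x6 e :: real using abs_add2_le[OF abs_add4_le[OF that(1-4) order_refl] abs_add2_le[OF that(5,6) order_refl], of "6 * e"]
        by (simp add: add.assoc)
    note this[of "Re (R d)" "B3 * cmod d ^ 4" "Re (R (d * hex_root))" "Re (R (d * (hex_root - 1)))" "Re (R (- d))" "Re (R (- (d * hex_root)))" "Re (R (- (d * (hex_root - 1))))"]
    moreover have "6 * (B3 * cmod d ^ 4) \<le> C * cmod d ^ 4"
    proof -
      have "6 * B3 * cmod d ^ 4 \<le> C * cmod d ^ 4" using M1 B1 by (intro mult_right_mono) (auto simp: C_def)
      then show ?thesis by (simp add: mult.assoc)
    qed
    ultimately show "\<bar>Re (L (z + d)) + Re (L (z + d * hex_root)) + Re (L (z + d * (hex_root - 1)))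
        + Re (L (z - d)) + Re (L (z - d * hex_root)) + Re (L (z - d * (hex_root - 1))) - 6 * Re (L z)\<bar> \<le> C * cmod d ^ 4"
      using R[of d] R[of "d * hex_root"] R[of "d * (hex_root - 1)"] R[of "- d"] R[of "- (d * hex_root)"] R[of "- (d * (hex_root - 1))"] nb n
      by (simp only: norm_minus_cancel diff_conv_add_uminus insert_subset) (meson order_trans)
  qed
qed

end

section \<open>Flat weights between barriers\<close>

definition lat :: "complex \<Rightarrow> complex \<Rightarrow> int \<times> int \<Rightarrow> complex"
  where "lat A d v = A + d * (of_int (fst v) + of_int (snd v) * hex_root)"

definition grid :: "nat \<Rightarrow> (int \<times> int) set"
  where "grid n = {(i, j). 0 \<le> i \<and> 0 \<le> j \<and> i + j \<le> int n}"

definition inner_grid :: "nat \<Rightarrow> (int \<times> int) set"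
  where "inner_grid n = {(i, j). 0 < i \<and> 0 < j \<and> i + j < int n}"

lemma finite_grid [simp]: "finite (grid n)"
  by (rule finite_subset[of _ "{0..int n} \<times> {0..int n}"]) (auto simp: grid_def)

lemma inner_grid_subset: "inner_grid n \<subseteq> grid n"
  by (auto simp: grid_def inner_grid_def)

lemma inner_grid_nbrs: "v \<in> inner_grid n \<Longrightarrow> lattice_nbrs v \<subseteq> grid n"
  by (auto simp: grid_def inner_grid_def lattice_nbrs_def)

lemma norm_lat_nbr:
  assumes "x \<in> lattice_nbrs v"
  shows "cmod (lat A d x - lat A d v) = cmod d"
proof -
  have "lat A d x - lat A d v \<in> {d, d * hex_root, d * (hex_root - 1), - d, - (d * hex_root), - (d * (hex_root - 1))}"
    using assms by (cases v) (auto simp: lattice_nbrs_def lat_def algebra_simps)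
  then have "lat A d x - lat A d v = d \<or> lat A d x - lat A d v = d * hex_root \<or> lat A d x - lat A d v = d * (hex_root - 1)
    \<or> lat A d x - lat A d v = - d \<or> lat A d x - lat A d v = - (d * hex_root) \<or> lat A d x - lat A d v = - (d * (hex_root - 1))"
    by blast
  then show ?thesis by (elim disjE) (simp_all only: norm_mult norm_hex_root norm_hex_root_diff norm_minus_cancel mult_1_right)
qed

lemma lat_in_triangle:
  assumes "v \<in> grid n" "n \<ge> 1"
  shows "lat A (e / of_nat n) v \<in> convex hull {A, A + e, A + e * hex_root}"
proof -
  obtain i j where v: "v = (i, j)" by fastforce
  define s t where "s = real_of_int i / n" and "t = real_of_int j / n"
  have "0 \<le> s" "0 \<le> t" using assms by (auto simp: v grid_def s_def t_def)
  moreover have "s + t \<le> 1"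
  proof -
    have "real_of_int (i + j) \<le> real n" using assms(1) unfolding v grid_def by (simp flip: of_int_add)
    then show ?thesis using assms(2) by (simp add: s_def t_def field_simps)
  qed
  moreover have "lat A (e / of_nat n) v = (1 - s - t) *\<^sub>R A + s *\<^sub>R (A + e) + t *\<^sub>R (A + e * hex_root)"
    using assms(2) by (simp add: lat_def v s_def t_def scaleR_conv_of_real field_simps)
  ultimately show ?thesis
    unfolding convex_hull_3 by (intro CollectI exI[of _ "1 - s - t"] exI[of _ s] exI[of _ t]) auto
qed

lemma triangle_subset_cball:
  assumes "cmod e = 1" "z \<in> convex hull {A, A + e, A + e * hex_root}"
  shows "cmod (z - A) \<le> 1"
proof -
  have "convex hull {A, A + e, A + e * hex_root} \<subseteq> cball A 1"
    using assms(1) by (intro hull_minimal) (auto simp: dist_norm norm_mult)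
  with assms(2) show ?thesis by (auto simp: dist_norm norm_minus_commute)
qed

lemma angle_sum_cong:
  assumes "w v = w' v" "\<And>x. x \<in> lattice_nbrs v \<Longrightarrow> w x = w' x"
  shows "angle_sum \<kappa> w v = angle_sum \<kappa> w' v"
proof -
  obtain i j where v: "v = (i, j)" by fastforce
  have "w (i + 1, j) = w' (i + 1, j)" "w (i, j + 1) = w' (i, j + 1)" "w (i - 1, j + 1) = w' (i - 1, j + 1)"
    "w (i - 1, j) = w' (i - 1, j)" "w (i, j - 1) = w' (i, j - 1)" "w (i + 1, j - 1) = w' (i + 1, j - 1)"
    by (intro assms(2); simp add: v lattice_nbrs_def)+
  with assms(1) show ?thesis by (simp add: v angle_sum_def)
qed

text \<open>These vertices are in counterclockwise order; the opposite labelling is reduced to this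
  one by \<open>approximable_swap\<close>.\<close>

locale univalent_triangle = univalent_patch +
  fixes A e :: complex
  assumes T_eq: "T = convex hull {A, A + e, A + e * hex_root}" and norm_e: "cmod e = 1"
begin

abbreviation pt :: "nat \<Rightarrow> int \<times> int \<Rightarrow> complex"
  where "pt n \<equiv> lat A (e / of_nat n)"

text \<open>Subtracting 1 makes the quadratic term nonpositive on the unit triangle. Positive
  \<open>t\<close> thus yields a lower barrier below Re L, negative \<open>t\<close> an upper one
  above it.\<close>

definition barrier_weight :: "nat \<Rightarrow> real \<Rightarrow> int \<times> int \<Rightarrow> real"
  where "barrier_weight n t v = Re (L (pt n v)) + t / (real n)\<^sup>2 * ((cmod (pt n v - A))\<^sup>2 - 1)"

lemma pt_in_T: "v \<in> grid n \<Longrightarrow> n \<ge> 1 \<Longrightarrow> pt n v \<in> T"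
  unfolding T_eq by (rule lat_in_triangle)

text \<open>\<open>Re L\<close> is harmonic, so it solves the curvature equation up to \<open>O(n\<^sup>-\<^sup>4)\<close>; the quadratic term
  contributes \<open>6 t / (sqrt 3 n\<^sup>4)\<close>, which dominates this error for large \<open>t\<close> of either sign.\<close>

lemma angle_sum_barrier:
  obtains C where "C \<ge> 0"
    "\<And>n t v. n \<ge> 1 \<Longrightarrow> 2 * \<bar>t\<bar> \<le> (real n)\<^sup>2 \<Longrightarrow> 100 * (C + 1) \<le> real n \<Longrightarrow> v \<in> inner_grid n \<Longrightarrow>
      \<bar>angle_sum (1 / (real n)\<^sup>2) (barrier_weight n t) v - 2 * pi - 6 * t / (sqrt 3 * real n ^ 4)\<bar> \<le> C / real n ^ 4"
proof -
  obtain C0 where C0: "C0 \<ge> 0"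
    "\<And>z d. z \<in> T \<Longrightarrow> z + d \<in> T \<Longrightarrow> cmod d \<le> 1 \<Longrightarrow> \<bar>Re (L (z + d)) - Re (L z) - Re (deriv L z * d)\<bar> \<le> C0 * (cmod d)\<^sup>2"
    "\<And>z. z \<in> T \<Longrightarrow> cmod (deriv L z) \<le> C0"
    "\<And>z d. z \<in> T \<Longrightarrow> {z + d, z + d * hex_root, z + d * (hex_root - 1), z - d, z - d * hex_root, z - d * (hex_root - 1)} \<subseteq> T \<Longrightarrow>
      \<bar>Re (L (z + d)) + Re (L (z + d * hex_root)) + Re (L (z + d * (hex_root - 1)))
        + Re (L (z - d)) + Re (L (z - d * hex_root)) + Re (L (z - d * (hex_root - 1))) - 6 * Re (L z)\<bar> \<le> C0 * cmod d ^ 4"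
    by (rule log_stencil) blast
  \<comment> \<open>The first summand is the error of \<open>angle_sum_stencil\<close> for \<rho> =
    (C0 + 1) / n, the second the fourth order error of the six-point sum of Re L.\<close>
  define C where "C = 12000 * (C0 + 1) ^ 4 + C0"
  show ?thesis
  proof
    show "C \<ge> 0" using C0(1) by (simp add: C_def)
    fix n t v
    assume n: "n \<ge> 1" and t: "2 * \<bar>t\<bar> \<le> (real n)\<^sup>2" and nC: "100 * (C + 1) \<le> real n" and v: "v \<in> inner_grid n"
    obtain i j where ij: "v = (i, j)" by fastforce
    define h where "h = 1 / real n"
    define d where "d = e / of_nat n"
    define z where "z = pt n v"
    define \<rho> where "\<rho> = (C0 + 1) * h"
    have h: "0 < h" "h \<le> 1" using n by (auto simp: h_def)
    have hd: "cmod d = h" using n by (simp add: d_def h_def norm_divide norm_e)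
    have th: "2 * \<bar>t\<bar> * h\<^sup>2 \<le> 1" using t n by (simp add: h_def power_divide field_simps)
    have C0C: "C0 \<le> C" using C0(1) by (simp add: C_def)
    have \<rho>: "0 \<le> \<rho>" "\<rho> \<le> 1/100"
    proof -
      show "0 \<le> \<rho>" using C0(1) h by (simp add: \<rho>_def)
      have "100 * (C0 + 1) \<le> 100 * (C + 1)" using C0C by simp
      then have "100 * (C0 + 1) \<le> real n" using nC by (rule order_trans)
      then show "\<rho> \<le> 1/100" using n by (simp add: \<rho>_def h_def field_simps)
    qed
    have zT: "z \<in> T" using v n inner_grid_subset unfolding z_def by (intro pt_in_T) auto
    have zA: "cmod (z - A) \<le> 1" using zT triangle_subset_cball[OF norm_e] unfolding T_eq by blast
    have nb: "pt n x \<in> T" if "x \<in> lattice_nbrs v" for x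
      using that inner_grid_nbrs[OF v] n by (intro pt_in_T) auto
    have P: "pt n (i + 1, j) = z + d" "pt n (i, j + 1) = z + d * hex_root" "pt n (i - 1, j + 1) = z + d * (hex_root - 1)"
      "pt n (i - 1, j) = z + - d" "pt n (i, j - 1) = z + - (d * hex_root)" "pt n (i + 1, j - 1) = z + - (d * (hex_root - 1))"
      unfolding z_def ij d_def[symmetric] by (simp_all add: lat_def algebra_simps)
    have inT: "z + d \<in> T" "z + d * hex_root \<in> T" "z + d * (hex_root - 1) \<in> T" "z + - d \<in> T"
      "z + - (d * hex_root) \<in> T" "z + - (d * (hex_root - 1)) \<in> T"
      unfolding P[symmetric] by (rule nb; simp add: ij lattice_nbrs_def)+
    \<comment> \<open>The differential of the barrier at z is \<zeta> \<mapsto> Re (q \<zeta>); the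
      quadratic term contributes the conjugate of z - A. It supplies the linear part of the stencil,
      bounded by \<rho>.\<close>
    define q where "q = deriv L z + of_real (2 * t * h\<^sup>2) * cnj (z - A)"
    have q: "cmod q \<le> C0 + 1"
    proof -
      have "cmod (of_real (2 * t * h\<^sup>2) :: complex) \<le> 1"
        unfolding norm_of_real using th h by (simp add: abs_mult)
      then have "cmod (of_real (2 * t * h\<^sup>2)) * cmod (cnj (z - A)) \<le> 1 * 1"
        unfolding complex_mod_cnj using zA by (intro mult_mono) simp_all
      then have "cmod (of_real (2 * t * h\<^sup>2) * cnj (z - A)) \<le> 1 * 1"
        unfolding norm_mult .
      then show ?thesis unfolding q_def using C0(3)[OF zT] norm_triangle_ineq[of "deriv L z"] by (smt (verit) mult_1)
    qed
    \<comment> \<open>The second order rest of the barrier along \<zeta>, bounded by \<rho>^2: these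
      are the perturbations in \<open>angle_sum_stencil\<close>.\<close>
    define ee where "ee = (\<lambda>\<zeta>. Re (L (z + \<zeta>)) - Re (L z) - Re (deriv L z * \<zeta>) + t * h\<^sup>2 * (cmod \<zeta>)\<^sup>2)"
    have wdiff: "barrier_weight n t x - barrier_weight n t v = Re (q * \<zeta>) + ee \<zeta>" if "pt n x = z + \<zeta>" for x \<zeta>
    proof -
      have e1: "(cmod (z + \<zeta> - A))\<^sup>2 = (cmod (z - A))\<^sup>2 + 2 * Re (cnj (z - A) * \<zeta>) + (cmod \<zeta>)\<^sup>2"
        unfolding cmod_power2 by (simp add: power2_eq_square algebra_simps)
      have e2: "Re (q * \<zeta>) = Re (deriv L z * \<zeta>) + 2 * t * h\<^sup>2 * Re (cnj (z - A) * \<zeta>)"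
        unfolding q_def by (simp add: distrib_right mult.assoc Re_complex_of_real del: complex_cnj_diff)
      have e3: "t / (real n)\<^sup>2 = t * h\<^sup>2" by (simp add: h_def power_divide)
      show ?thesis unfolding barrier_weight_def that z_def[symmetric] ee_def e1 e2 e3 by algebra
    qed
    have eb: "\<bar>ee \<zeta>\<bar> \<le> \<rho>\<^sup>2" if "z + \<zeta> \<in> T" "cmod \<zeta> = h" for \<zeta>
    proof -
      have "\<bar>Re (L (z + \<zeta>)) - Re (L z) - Re (deriv L z * \<zeta>)\<bar> \<le> C0 * h\<^sup>2"
        using C0(2)[OF zT that(1)] that h by simp
      moreover have "\<bar>t * h\<^sup>2 * (cmod \<zeta>)\<^sup>2\<bar> \<le> 1 * h\<^sup>2"
        unfolding abs_mult using th that(2) by (intro mult_mono) auto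
      ultimately have "\<bar>ee \<zeta>\<bar> \<le> (C0 + 1) * h\<^sup>2" unfolding ee_def by (rule abs_add2_le) (simp add: algebra_simps)
      also have "\<dots> \<le> (C0 + 1)\<^sup>2 * h\<^sup>2"
        using C0(1) by (intro mult_right_mono) (auto simp: power2_eq_square)
      finally show ?thesis by (simp add: \<rho>_def power_mult_distrib)
    qed
    define a b where "a = Re (q * d)" and "b = Re (q * (d * hex_root))"
    have lin: "Re (q * (d * (hex_root - 1))) = b - a" "Re (q * - d) = - a" "Re (q * - (d * hex_root)) = - b"
      "Re (q * - (d * (hex_root - 1))) = a - b"
      by (simp_all add: a_def b_def algebra_simps)
    have ab: "\<bar>a\<bar> \<le> \<rho>" "\<bar>b\<bar> \<le> \<rho>"
    proof -
      have "cmod (q * d) \<le> \<rho>" "cmod (q * (d * hex_root)) \<le> \<rho>"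
        unfolding \<rho>_def norm_mult norm_hex_root hd using q h by (simp_all add: mult_right_mono)
      then show "\<bar>a\<bar> \<le> \<rho>" "\<bar>b\<bar> \<le> \<rho>" unfolding a_def b_def using abs_Re_le_cmod order_trans by blast+
    qed
    have nd: "cmod d = h" "cmod (d * hex_root) = h" "cmod (d * (hex_root - 1)) = h" "cmod (- d) = h"
      "cmod (- (d * hex_root)) = h" "cmod (- (d * (hex_root - 1))) = h"
      by (simp_all add: norm_mult hd)
    have \<kappa>: "0 \<le> 1 / (real n)\<^sup>2" "1 / (real n)\<^sup>2 \<le> \<rho>\<^sup>2"
    proof -
      have "h\<^sup>2 \<le> \<rho>\<^sup>2" using C0(1) h by (intro power_mono) (auto simp: \<rho>_def mult_le_cancel_right1)
      then show "1 / (real n)\<^sup>2 \<le> \<rho>\<^sup>2" by (simp add: h_def power_divide)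
    qed simp
    define \<Sigma> where "\<Sigma> = ee d + ee (d * hex_root) + ee (d * (hex_root - 1)) + ee (- d) + ee (- (d * hex_root)) + ee (- (d * (hex_root - 1)))"
    have main: "\<bar>angle_sum (1 / (real n)\<^sup>2) (barrier_weight n t) v - 2 * pi - \<Sigma> / sqrt 3\<bar> \<le> 12000 * \<rho> ^ 4"
    proof -
      have "angle_sum (1 / (real n)\<^sup>2) (barrier_weight n t) v
        = weight_angle (1 / (real n)\<^sup>2) 0 (a + ee d) (b + ee (d * hex_root))
        + weight_angle (1 / (real n)\<^sup>2) 0 (b + ee (d * hex_root)) (b - a + ee (d * (hex_root - 1)))
        + weight_angle (1 / (real n)\<^sup>2) 0 (b - a + ee (d * (hex_root - 1))) (- a + ee (- d))
        + weight_angle (1 / (real n)\<^sup>2) 0 (- a + ee (- d)) (- b + ee (- (d * hex_root)))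
        + weight_angle (1 / (real n)\<^sup>2) 0 (- b + ee (- (d * hex_root))) (a - b + ee (- (d * (hex_root - 1))))
        + weight_angle (1 / (real n)\<^sup>2) 0 (a - b + ee (- (d * (hex_root - 1)))) (a + ee d)"
        unfolding ij angle_sum_def prod.case
        unfolding weight_angle_0[of _ "barrier_weight n t (i, j)"]
        unfolding ij[symmetric] wdiff[OF P(1)] wdiff[OF P(2)] wdiff[OF P(3)] wdiff[OF P(4)] wdiff[OF P(5)] wdiff[OF P(6)]
        unfolding lin a_def[symmetric] b_def[symmetric] ..
      then show ?thesis unfolding \<Sigma>_def
        by (simp only:) (rule angle_sum_stencil[OF ab \<rho> \<kappa> eb[OF inT(1) nd(1)] eb[OF inT(2) nd(2)] eb[OF inT(3) nd(3)] eb[OF inT(4) nd(4)] eb[OF inT(5) nd(5)] eb[OF inT(6) nd(6)]])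
    qed
    have S: "\<bar>\<Sigma> - 6 * t * h ^ 4\<bar> \<le> C0 * h ^ 4"
    proof -
      have "\<Sigma> - 6 * t * h ^ 4 = Re (L (z + d)) + Re (L (z + d * hex_root)) + Re (L (z + d * (hex_root - 1)))
        + Re (L (z - d)) + Re (L (z - d * hex_root)) + Re (L (z - d * (hex_root - 1))) - 6 * Re (L z)"
        unfolding \<Sigma>_def ee_def nd by (simp add: algebra_simps eval_nat_numeral)
      moreover have "\<bar>Re (L (z + d)) + Re (L (z + d * hex_root)) + Re (L (z + d * (hex_root - 1)))
        + Re (L (z - d)) + Re (L (z - d * hex_root)) + Re (L (z - d * (hex_root - 1))) - 6 * Re (L z)\<bar> \<le> C0 * h ^ 4"
        unfolding hd[symmetric] using inT by (intro C0(4)[OF zT]) simp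
      ultimately show ?thesis by simp
    qed
    have S': "\<bar>(\<Sigma> - 6 * t * h ^ 4) / sqrt 3\<bar> \<le> C0 * h ^ 4"
    proof -
      have "1 \<le> sqrt (3::real)" by simp
      then have "\<bar>\<Sigma> - 6 * t * h ^ 4\<bar> / sqrt 3 \<le> \<bar>\<Sigma> - 6 * t * h ^ 4\<bar> / 1" by (intro divide_left_mono) auto
      with S show ?thesis by simp
    qed
    have eq: "angle_sum (1 / (real n)\<^sup>2) (barrier_weight n t) v - 2 * pi - 6 * t / (sqrt 3 * real n ^ 4)
      = (angle_sum (1 / (real n)\<^sup>2) (barrier_weight n t) v - 2 * pi - \<Sigma> / sqrt 3) + (\<Sigma> - 6 * t * h ^ 4) / sqrt 3"
      by (simp add: h_def power_divide diff_divide_distrib)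
    have le: "12000 * \<rho> ^ 4 + C0 * h ^ 4 \<le> C / real n ^ 4"
      unfolding C_def \<rho>_def power_mult_distrib by (simp add: h_def power_divide add_divide_distrib)
    show "\<bar>angle_sum (1 / (real n)\<^sup>2) (barrier_weight n t) v - 2 * pi - 6 * t / (sqrt 3 * real n ^ 4)\<bar> \<le> C / real n ^ 4"
      unfolding eq by (rule abs_add2_le[OF main S' le])
  qed
qed

text \<open>The amplitude s = C + 1 makes the Laplacian term 6 s / sqrt 3 of the barriers exceed the
  consistency error C, since sqrt 3 \<le> 2. The barriers then have angle sums on the correct sides
  of 2 pi, and \<open>angle_sum_solution\<close> applies between them.\<close>

lemma exists_flat_weight:
  obtains s N where "s > 0" "N \<ge> 1"
    "\<And>n. n \<ge> N \<Longrightarrow> \<exists>w. (\<forall>v\<in>grid n. \<bar>w v - Re (L (pt n v))\<bar> \<le> s / (real n)\<^sup>2)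
      \<and> (\<forall>v\<in>inner_grid n. angle_sum (1 / (real n)\<^sup>2) w v = 2 * pi)"
proof -
  obtain C where C: "C \<ge> 0"
    "\<And>n t v. n \<ge> 1 \<Longrightarrow> 2 * \<bar>t\<bar> \<le> (real n)\<^sup>2 \<Longrightarrow> 100 * (C + 1) \<le> real n \<Longrightarrow> v \<in> inner_grid n \<Longrightarrow>
      \<bar>angle_sum (1 / (real n)\<^sup>2) (barrier_weight n t) v - 2 * pi - 6 * t / (sqrt 3 * real n ^ 4)\<bar> \<le> C / real n ^ 4"
    by (rule angle_sum_barrier) blast
  obtain C0 where C0: "C0 \<ge> 0"
    "\<And>z d. z \<in> T \<Longrightarrow> z + d \<in> T \<Longrightarrow> cmod d \<le> 1 \<Longrightarrow> \<bar>Re (L (z + d)) - Re (L z) - Re (deriv L z * d)\<bar> \<le> C0 * (cmod d)\<^sup>2"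
    "\<And>z. z \<in> T \<Longrightarrow> cmod (deriv L z) \<le> C0"
    by (rule log_stencil) blast
  define s where "s = C + 1"
  have s: "s > 0" using C(1) by (simp add: s_def)
  \<comment> \<open>The summands serve \<open>angle_sum_barrier\<close>, the bound 1/20 on weight
    differences between neighbours, and the requirement 2 s \<le> n^2.\<close>
  define N where "N = nat \<lceil>100 * (C + 1) + 20 * (2 * C0 + 2 * s) + 2 * s\<rceil>"
  have N: "100 * (C + 1) + 20 * (2 * C0 + 2 * s) + 2 * s \<le> real n" if "n \<ge> N" for n
    using that unfolding N_def by (simp add: nat_ceiling_le_eq)
  show ?thesis
  proof
    show "s > 0" by (rule s)
    have "1 \<le> real N" using N[of N] C C0 s by simp
    then show "N \<ge> 1" by simp
    fix n assume "n \<ge> N"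
    note Nn = N[OF this]
    have n: "n \<ge> 1" using \<open>n \<ge> N\<close> \<open>N \<ge> 1\<close> by simp
    have n1: "1 \<le> real n" using n by simp
    have nn: "real n \<le> (real n)\<^sup>2" using n1 by (simp add: power2_eq_square)
    have c1: "100 * (C + 1) \<le> real n" and c3: "20 * (2 * C0 + 2 * s) \<le> real n" and s2: "2 * s \<le> real n"
      using Nn C(1) C0(1) s by argo+
    have c2: "2 * \<bar>s\<bar> \<le> (real n)\<^sup>2" "2 * \<bar>- s\<bar> \<le> (real n)\<^sup>2"
      unfolding abs_minus_cancel abs_of_pos[OF s] using order_trans[OF s2 nn] by blast+
    define \<kappa> where "\<kappa> = 1 / (real n)\<^sup>2"
    have \<kappa>: "0 \<le> \<kappa>" "\<kappa> \<le> 1/8"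
    proof -
      have "8 \<le> (real n)\<^sup>2" using c1 C(1) nn by argo
      then have "1 / (real n)\<^sup>2 \<le> 1 / 8" using n by (intro divide_left_mono) auto
      then show "\<kappa> \<le> 1/8" by (simp add: \<kappa>_def)
    qed (simp add: \<kappa>_def)
    \<comment> \<open>The barriers are ordered on the grid only, where |z - A| \<le> 1 is known; the
      value 0 elsewhere keeps lo \<le> hi on the whole lattice.\<close>
    define lo hi where "lo = (\<lambda>v. if v \<in> grid n then barrier_weight n s v else 0)"
      and "hi = (\<lambda>v. if v \<in> grid n then barrier_weight n (- s) v else 0)"
    have \<psi>: "(cmod (pt n v - A))\<^sup>2 \<le> 1" if "v \<in> grid n" for v
    proof -
      have "cmod (pt n v - A) \<le> 1" using pt_in_T[OF that n] triangle_subset_cball[OF norm_e] unfolding T_eq by blast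
      then show ?thesis by (simp add: power_le_one)
    qed
    have bw: "Re (L (pt n v)) - s / (real n)\<^sup>2 \<le> barrier_weight n s v" "barrier_weight n s v \<le> Re (L (pt n v))"
      "Re (L (pt n v)) \<le> barrier_weight n (- s) v" "barrier_weight n (- s) v \<le> Re (L (pt n v)) + s / (real n)\<^sup>2"
      if "v \<in> grid n" for v
    proof -
      define P where "P = 1 - (cmod (pt n v - A))\<^sup>2"
      have P: "0 \<le> P" "P \<le> 1" using \<psi>[OF that] by (auto simp: P_def)
      have e: "barrier_weight n s v = Re (L (pt n v)) - s / (real n)\<^sup>2 * P"
        "barrier_weight n (- s) v = Re (L (pt n v)) + s / (real n)\<^sup>2 * P"
        by (simp_all add: barrier_weight_def P_def algebra_simps)
      have k: "0 \<le> s / (real n)\<^sup>2" using s by simp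
      have "0 \<le> s / (real n)\<^sup>2 * P" "s / (real n)\<^sup>2 * P \<le> s / (real n)\<^sup>2"
        using mult_nonneg_nonneg[OF k P(1)] mult_left_mono[OF P(2) k] by simp_all
      then show "Re (L (pt n v)) - s / (real n)\<^sup>2 \<le> barrier_weight n s v" "barrier_weight n s v \<le> Re (L (pt n v))"
        "Re (L (pt n v)) \<le> barrier_weight n (- s) v" "barrier_weight n (- s) v \<le> Re (L (pt n v)) + s / (real n)\<^sup>2"
        unfolding e by linarith+
    qed
    have lohi: "lo v \<le> hi v" for v using bw(2,3)[of v] by (auto simp: lo_def hi_def)
    have udiff: "\<bar>Re (L (pt n x)) - Re (L (pt n v))\<bar> \<le> 2 * C0 / real n" if v: "v \<in> inner_grid n" and x: "x \<in> lattice_nbrs v" for v x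
    proof -
      have T: "pt n v \<in> T" "pt n x \<in> T" using v x inner_grid_subset inner_grid_nbrs[OF v] n by (auto intro!: pt_in_T)
      have d: "cmod (pt n x - pt n v) = 1 / real n"
        unfolding norm_lat_nbr[OF x] by (simp add: norm_divide norm_e)
      have "cmod (pt n x - pt n v) \<le> 1" using d n1 by simp
      then have "\<bar>Re (L (pt n x)) - Re (L (pt n v)) - Re (deriv L (pt n v) * (pt n x - pt n v))\<bar> \<le> C0 * (1 / real n)\<^sup>2"
        using C0(2)[OF T(1), of "pt n x - pt n v"] T(2) by (simp add: d)
      also have "\<dots> \<le> C0 * (1 / real n)"
        using C0(1) n1 nn by (intro mult_left_mono) (auto simp: power_divide field_simps)
      finally have 1: "\<bar>Re (L (pt n x)) - Re (L (pt n v)) - Re (deriv L (pt n v) * (pt n x - pt n v))\<bar> \<le> C0 * (1 / real n)" .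
      have "cmod (deriv L (pt n v) * (pt n x - pt n v)) \<le> C0 * (1 / real n)"
        unfolding norm_mult d using C0(3)[OF T(1)] by (intro mult_right_mono) auto
      then have 2: "\<bar>Re (deriv L (pt n v) * (pt n x - pt n v))\<bar> \<le> C0 * (1 / real n)"
        using abs_Re_le_cmod order_trans by blast
      show ?thesis using abs_add2_le[OF 1 2 order_refl] by simp
    qed
    have small: "hi x - lo v \<le> 1/20 \<and> hi v - lo x \<le> 1/20" if v: "v \<in> inner_grid n" and x: "x \<in> lattice_nbrs v" for v x
    proof -
      have g: "v \<in> grid n" "x \<in> grid n" using v x inner_grid_subset inner_grid_nbrs[OF v] by auto
      have "s / (real n)\<^sup>2 \<le> s / real n" using s n1 nn by (intro divide_left_mono) auto
      moreover have "2 * C0 / real n + 2 * (s / real n) \<le> 1/20"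
        using c3 n1 by (simp add: field_simps)
      ultimately show ?thesis
        using bw[OF g(1)] bw[OF g(2)] udiff[OF v x] g by (auto simp: lo_def hi_def abs_le_iff)
    qed
    have cong: "angle_sum \<kappa> lo v = angle_sum \<kappa> (barrier_weight n s) v"
      "angle_sum \<kappa> hi v = angle_sum \<kappa> (barrier_weight n (- s)) v" if "v \<in> inner_grid n" for v
      using that inner_grid_subset[of n] inner_grid_nbrs[OF that]
      by (intro angle_sum_cong; auto simp: lo_def hi_def)+
    have big: "C / real n ^ 4 < 6 * s / (sqrt 3 * real n ^ 4)"
    proof -
      have "sqrt 3 \<le> 2" by (rule real_le_lsqrt) auto
      then have "C * sqrt 3 \<le> C * 2" using C(1) by (intro mult_left_mono) auto
      also have "\<dots> < 6 * s" using C(1) by (simp add: s_def)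
      finally show ?thesis using n1 by (simp add: field_simps)
    qed
    have lo2: "2 * pi \<le> angle_sum \<kappa> lo v" if "v \<in> inner_grid n" for v
      using C(2)[OF n c2(1) c1 that] big unfolding cong[OF that] unfolding \<kappa>_def by linarith
    have hi2: "angle_sum \<kappa> hi v < 2 * pi" if "v \<in> inner_grid n" for v
      using C(2)[OF n c2(2) c1 that] big unfolding cong[OF that] unfolding \<kappa>_def by simp
    have fin: "finite (inner_grid n)" using inner_grid_subset finite_grid by (rule finite_subset)
    obtain w where w: "\<And>v. lo v \<le> w v" "\<And>v. w v \<le> hi v" "\<And>v. v \<in> inner_grid n \<Longrightarrow> angle_sum \<kappa> w v = 2 * pi"
      using angle_sum_solution[OF \<kappa> fin lohi small lo2 hi2] by blast
    have "\<bar>w v - Re (L (pt n v))\<bar> \<le> s / (real n)\<^sup>2" if "v \<in> grid n" for v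
      using w(1)[of v] w(2)[of v] bw[OF that] that by (auto simp: lo_def hi_def abs_le_iff)
    with w(3) show "\<exists>w. (\<forall>v\<in>grid n. \<bar>w v - Re (L (pt n v))\<bar> \<le> s / (real n)\<^sup>2)
      \<and> (\<forall>v\<in>inner_grid n. angle_sum (1 / (real n)\<^sup>2) w v = 2 * pi)"
      unfolding \<kappa>_def by blast
  qed
qed

end

section \<open>Comparison of packings with univalent functions\<close>

lemma heron16_scale: "heron16 (t * X) (t * Y) (t * Z) = t\<^sup>2 * heron16 X Y Z"
  by (simp add: heron16_def power2_eq_square algebra_simps)

lemma tri_ratio_scale: "t > 0 \<Longrightarrow> tri_ratio (t * X) (t * Y) (t * Z) = tri_ratio X Y Z"
proof -
  assume t: "t > 0"
  have "(t * X + t * Y - t * Z) / (2 * (t * X)) = (t * (X + Y - Z)) / (t * (2 * X))" by (simp add: algebra_simps)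
  also have "\<dots> = (X + Y - Z) / (2 * X)" using t by simp
  finally show ?thesis using t by (simp add: tri_ratio_def heron16_scale real_sqrt_mult)
qed

lemma tri_ratio_lipschitz:
  assumes X: "9/10 \<le> X" "X \<le> 6/5" and Y: "9/10 \<le> Y" "Y \<le> 6/5" and Z: "4/5 \<le> Z" "Z \<le> 5/4"
    and X': "9/10 \<le> X'" "X' \<le> 6/5" and Y': "9/10 \<le> Y'" "Y' \<le> 6/5" and Z': "4/5 \<le> Z'" "Z' \<le> 5/4"
    and d: "\<bar>X - X'\<bar> \<le> \<eta>" "\<bar>Y - Y'\<bar> \<le> \<eta>" "\<bar>Z - Z'\<bar> \<le> \<eta>"
  shows "cmod (tri_ratio X Y Z - tri_ratio X' Y' Z') \<le> 20 * \<eta>"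
proof -
  define N N' D D' where "N = X + Y - Z" and "N' = X' + Y' - Z'" and "D = heron16 X Y Z" and "D' = heron16 X' Y' Z'"
  note h = heron16_near_equilateral[OF X Y Z, folded N_def D_def] heron16_near_equilateral[OF X' Y' Z', folded N'_def D'_def]
  have \<eta>: "0 \<le> \<eta>" using d(1) by linarith
  have quot: "\<bar>P / (2 * X) - P' / (2 * X')\<bar> \<le> 5/8 * c + 3/2 * \<eta>"
    if P: "\<bar>P - P'\<bar> \<le> c" "0 \<le> P'" "P' \<le> 12/5" for P P' c
  proof -
    have eq: "P / (2 * X) - P' / (2 * X') = (P - P') / (2 * X) + P' * (X' - X) / (2 * X * X')"
      using X X' by (simp add: divide_simps; simp add: algebra_simps)
    have 1: "\<bar>(P - P') / (2 * X)\<bar> \<le> 5/8 * c"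
    proof -
      have "\<bar>P - P'\<bar> / (2 * X) \<le> c / (8/5)" using P X by (intro frac_le) auto
      then show ?thesis using X by (simp add: abs_divide)
    qed
    have 2: "\<bar>P' * (X' - X) / (2 * X * X')\<bar> \<le> 3/2 * \<eta>"
    proof -
      have "9/10 * (9/10) \<le> X * X'" using X X' by (intro mult_mono) auto
      then have "2 * (9/10 * (9/10)) \<le> 2 * X * X'" by simp
      moreover have "\<bar>P' * (X' - X)\<bar> \<le> 12/5 * \<eta>"
        unfolding abs_mult using P d(1) by (intro mult_mono) (auto simp: abs_minus_commute)
      ultimately have "\<bar>P' * (X' - X)\<bar> / (2 * X * X') \<le> (12/5 * \<eta>) / (2 * (9/10 * (9/10)))"
        using \<eta> by (intro frac_le) auto
      also have "\<dots> \<le> 3/2 * \<eta>" using \<eta> by simp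
      finally show ?thesis using X X' by (simp add: abs_divide)
    qed
    show ?thesis unfolding eq by (rule abs_add2_le[OF 1 2 order_refl])
  qed
  have NN: "\<bar>N - N'\<bar> \<le> 3 * \<eta>" using d unfolding N_def N'_def by argo
  have DD: "\<bar>D - D'\<bar> \<le> 20 * \<eta>"
  proof -
    have "D - D' = 4 * (X - X') * Y + 4 * X' * (Y - Y') + (N' - N) * (N + N')"
      by (simp add: D_def D'_def heron16_def N_def[symmetric] N'_def[symmetric] power2_eq_square algebra_simps)
    moreover have "\<bar>4 * (X - X') * Y\<bar> \<le> 4 * \<eta> * (6/5)"
      unfolding abs_mult using d Y \<eta> by (intro mult_mono) auto
    moreover have "\<bar>4 * X' * (Y - Y')\<bar> \<le> 4 * (6/5) * \<eta>"
      unfolding abs_mult using d X' \<eta> by (intro mult_mono) auto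
    moreover have "\<bar>(N' - N) * (N + N')\<bar> \<le> 3 * \<eta> * (16/5)"
      unfolding abs_mult using NN h \<eta> by (intro mult_mono) (auto simp: abs_minus_commute)
    ultimately show ?thesis using \<eta> by argo
  qed
  have SS: "\<bar>sqrt D - sqrt D'\<bar> \<le> 16 * \<eta>"
  proof -
    have r7: "7/10 \<le> sqrt t" if "1/2 \<le> t" for t :: real
      by (rule real_le_rsqrt) (use that in \<open>simp add: power2_eq_square\<close>)
    have "7/10 \<le> sqrt D" "7/10 \<le> sqrt D'" using h by (blast intro: r7)+
    then have "5/4 \<le> sqrt D + sqrt D'" by simp
    moreover have "(sqrt D - sqrt D') * (sqrt D + sqrt D') = D - D'" using h by (simp add: algebra_simps)
    then have "\<bar>sqrt D - sqrt D'\<bar> * \<bar>sqrt D + sqrt D'\<bar> \<le> 20 * \<eta>" using DD by (metis abs_mult)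
    ultimately have "\<bar>sqrt D - sqrt D'\<bar> * (5/4) \<le> 20 * \<eta>"
      by (meson abs_ge_self abs_ge_zero dual_order.trans mult_left_mono)
    then show ?thesis by simp
  qed
  have sD': "sqrt D' \<le> 12/5"
  proof (rule real_le_lsqrt)
    have "X' * Y' \<le> 6/5 * (6/5)" using X' Y' by (intro mult_mono) auto
    moreover have "N'\<^sup>2 \<ge> 0" by simp
    moreover have "D' = 4 * (X' * Y') - N'\<^sup>2" by (simp add: D'_def heron16_def N'_def)
    moreover have "(12/5)\<^sup>2 = (4 * (6/5 * (6/5)) :: real)" by (simp add: power2_eq_square)
    ultimately show "D' \<le> (12/5)\<^sup>2" by linarith
  qed simp
  have re: "\<bar>N / (2 * X) - N' / (2 * X')\<bar> \<le> 5/8 * (3 * \<eta>) + 3/2 * \<eta>"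
    using h by (intro quot NN) auto
  have im: "\<bar>sqrt D / (2 * X) - sqrt D' / (2 * X')\<bar> \<le> 5/8 * (16 * \<eta>) + 3/2 * \<eta>"
    using h sD' by (intro quot SS) auto
  have "cmod (tri_ratio X Y Z - tri_ratio X' Y' Z') \<le> \<bar>N / (2 * X) - N' / (2 * X')\<bar> + \<bar>sqrt D / (2 * X) - sqrt D' / (2 * X')\<bar>"
    using cmod_le[of "tri_ratio X Y Z - tri_ratio X' Y' Z'"]
    by (simp add: tri_ratio_def N_def N'_def D_def D'_def)
  also have "\<dots> \<le> 20 * \<eta>" using re im \<eta> by simp
  finally show ?thesis .
qed

lemma relative_error_mult:
  fixes x x' y y' :: complex
  assumes "cmod (x - x') \<le> \<alpha> * cmod x'" "cmod (y - y') \<le> \<beta> * cmod y'" "0 \<le> \<alpha>" "0 \<le> \<beta>"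
  shows "cmod (x * y - x' * y') \<le> (\<alpha> + \<beta> + \<alpha> * \<beta>) * cmod (x' * y')"
proof -
  have eq: "x * y - x' * y' = (x - x') * (y - y') + (x - x') * y' + x' * (y - y')" by (simp add: algebra_simps)
  have "cmod (x * y - x' * y') \<le> cmod (x - x') * cmod (y - y') + cmod (x - x') * cmod y' + cmod x' * cmod (y - y')"
    unfolding eq norm_mult[symmetric] by (intro order_trans[OF norm_triangle_ineq] add_mono order_refl)
  also have "\<dots> \<le> (\<alpha> * cmod x') * (\<beta> * cmod y') + (\<alpha> * cmod x') * cmod y' + cmod x' * (\<beta> * cmod y')"
    using assms by (intro add_mono mult_mono) auto
  also have "\<dots> = (\<alpha> + \<beta> + \<alpha> * \<beta>) * cmod (x' * y')" by (simp add: norm_mult algebra_simps)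
  finally show ?thesis .
qed

lemma relative_error_mult3:
  fixes x x' y y' z z' :: complex
  assumes "cmod (x - x') \<le> \<alpha> * cmod x'" "cmod (y - y') \<le> \<alpha> * cmod y'" "cmod (z - z') \<le> \<alpha> * cmod z'"
    and "0 \<le> \<alpha>" "\<alpha> \<le> 1"
  shows "cmod (x * y * z - x' * y' * z') \<le> 7 * \<alpha> * cmod (x' * y' * z')"
proof -
  have a2: "\<alpha> * \<alpha> \<le> \<alpha>" using mult_left_mono[of \<alpha> 1 \<alpha>] assms(4,5) by simp
  have "cmod (x * y - x' * y') \<le> (\<alpha> + \<alpha> + \<alpha> * \<alpha>) * cmod (x' * y')"
    using assms by (intro relative_error_mult) auto
  also have "\<dots> \<le> (3 * \<alpha>) * cmod (x' * y')" using a2 by (intro mult_right_mono) auto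
  finally have "cmod (x * y * z - x' * y' * z') \<le> (3 * \<alpha> + \<alpha> + 3 * \<alpha> * \<alpha>) * cmod (x' * y' * z')"
    using assms by (intro relative_error_mult) auto
  also have "\<dots> \<le> 7 * \<alpha> * cmod (x' * y' * z')" using a2 by (intro mult_right_mono) auto
  finally show ?thesis .
qed

text \<open>Each step is a product of three factors of the form \<sigma> - 1 or 1 / \<delta>. Near
  \<open>hex_root\<close> these have modulus close to 1, so each has relative error at most 5/4
  \<epsilon>, and a threefold product at most seven times that.\<close>

lemma step_relative_error:
  fixes \<sigma> \<delta> \<tau> \<sigma>' \<delta>' \<tau>' :: complex
  assumes "cmod (\<sigma> - \<sigma>') \<le> \<epsilon>" "cmod (\<delta> - \<delta>') \<le> \<epsilon>" "cmod (\<tau> - \<tau>') \<le> \<epsilon>"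
    and "cmod (\<sigma>' - hex_root) \<le> 1/10" "cmod (\<delta>' - hex_root) \<le> 1/10" "cmod (\<tau>' - hex_root) \<le> 1/10" "\<epsilon> \<le> 1/10"
  shows "cmod ((\<sigma> - 1) / (\<delta> * \<tau>) - (\<sigma>' - 1) / (\<delta>' * \<tau>')) \<le> 10 * \<epsilon> * cmod ((\<sigma>' - 1) / (\<delta>' * \<tau>'))"
    and "cmod ((\<sigma> - 1) * (1 / \<delta> - 1) - (\<sigma>' - 1) * (1 / \<delta>' - 1)) \<le> 10 * \<epsilon> * cmod ((\<sigma>' - 1) * (1 / \<delta>' - 1))"
proof -
  have \<epsilon>: "0 \<le> \<epsilon>" using assms(1) norm_ge_zero order_trans by blast
  have low: "9/10 \<le> cmod x'" "9/10 \<le> cmod (x' - 1)" if "cmod (x' - hex_root) \<le> 1/10" for x'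
  proof -
    show "9/10 \<le> cmod x'"
      using that norm_triangle_ineq2[of hex_root x'] by (simp add: norm_minus_commute)
    have "cmod ((hex_root - 1) - (x' - 1)) \<le> 1/10" using that by (simp add: norm_minus_commute)
    then show "9/10 \<le> cmod (x' - 1)"
      using norm_triangle_ineq2[of "hex_root - 1" "x' - 1"] by simp
  qed
  have m1: "cmod ((x - 1) - (x' - 1)) \<le> 5/4 * \<epsilon> * cmod (x' - 1)" if "cmod (x - x') \<le> \<epsilon>" "cmod (x' - hex_root) \<le> 1/10" for x x'
  proof -
    have "5/4 * \<epsilon> * (9/10) \<le> 5/4 * \<epsilon> * cmod (x' - 1)" using \<epsilon> low(2)[OF that(2)] by (intro mult_left_mono) auto
    then show ?thesis using that(1) \<epsilon> by simp
  qed
  have inv: "cmod (1 / x - 1 / x') \<le> 5/4 * \<epsilon> * cmod (1 / x')" if "cmod (x - x') \<le> \<epsilon>" "cmod (x' - hex_root) \<le> 1/10" for x x'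
  proof -
    have x: "4/5 \<le> cmod x" using low(1)[OF that(2)] norm_triangle_ineq2[of x' x] that(1) assms(7) by (simp add: norm_minus_commute)
    have nz: "x \<noteq> 0" "x' \<noteq> 0" using x low(1)[OF that(2)] by auto
    have "cmod (1 / x - 1 / x') = cmod (x - x') / cmod x * cmod (1 / x')"
      using nz by (simp add: field_simps flip: norm_divide norm_mult) (simp add: norm_divide norm_mult norm_minus_commute field_simps)
    also have "\<dots> \<le> (\<epsilon> / (4/5)) * cmod (1 / x')"
      using x that(1) \<epsilon> by (intro mult_right_mono frac_le) auto
    finally show ?thesis by simp
  qed
  have \<alpha>: "0 \<le> 5/4 * \<epsilon>" "5/4 * \<epsilon> \<le> 1" using \<epsilon> assms(7) by auto
  have fin: "7 * (5/4 * \<epsilon>) * c \<le> 10 * \<epsilon> * c" if "0 \<le> c" for c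
    using \<epsilon> that by (intro mult_right_mono) auto
  have "cmod ((\<sigma> - 1) * (1 / \<delta>) * (1 / \<tau>) - (\<sigma>' - 1) * (1 / \<delta>') * (1 / \<tau>')) \<le> 7 * (5/4 * \<epsilon>) * cmod ((\<sigma>' - 1) * (1 / \<delta>') * (1 / \<tau>'))"
    using assms by (intro relative_error_mult3 m1 inv \<alpha>) auto
  also have "\<dots> \<le> 10 * \<epsilon> * cmod ((\<sigma>' - 1) * (1 / \<delta>') * (1 / \<tau>'))" by (rule fin) simp
  finally show "cmod ((\<sigma> - 1) / (\<delta> * \<tau>) - (\<sigma>' - 1) / (\<delta>' * \<tau>')) \<le> 10 * \<epsilon> * cmod ((\<sigma>' - 1) / (\<delta>' * \<tau>'))"
    by simp
  have nz: "\<delta>' \<noteq> 0" "\<delta> \<noteq> 0"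
  proof -
    show "\<delta>' \<noteq> 0" using low(1)[OF assms(5)] by auto
    show "\<delta> \<noteq> 0" using low(1)[OF assms(5)] assms(2,7) by auto
  qed
  \<comment> \<open>Rewritten as a product, the second step fits the same estimate for three
    factors.\<close>
  have e: "1 / \<delta> - 1 = - ((\<delta> - 1) * (1 / \<delta>))" "1 / \<delta>' - 1 = - ((\<delta>' - 1) * (1 / \<delta>'))"
    using nz by (simp_all add: field_simps)
  have "cmod ((\<sigma> - 1) * (\<delta> - 1) * (1 / \<delta>) - (\<sigma>' - 1) * (\<delta>' - 1) * (1 / \<delta>')) \<le> 7 * (5/4 * \<epsilon>) * cmod ((\<sigma>' - 1) * (\<delta>' - 1) * (1 / \<delta>'))"
    using assms by (intro relative_error_mult3 m1 inv \<alpha>) auto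
  also have "\<dots> \<le> 10 * \<epsilon> * cmod ((\<sigma>' - 1) * (\<delta>' - 1) * (1 / \<delta>'))" by (rule fin) simp
  finally have "cmod ((\<sigma> - 1) * (\<delta> - 1) * (1 / \<delta>) - (\<sigma>' - 1) * (\<delta>' - 1) * (1 / \<delta>')) \<le> 10 * \<epsilon> * cmod ((\<sigma>' - 1) * (\<delta>' - 1) * (1 / \<delta>'))" .
  moreover have "(\<sigma> - 1) * (1 / \<delta> - 1) - (\<sigma>' - 1) * (1 / \<delta>' - 1) = - ((\<sigma> - 1) * (\<delta> - 1) * (1 / \<delta>) - (\<sigma>' - 1) * (\<delta>' - 1) * (1 / \<delta>'))"
    unfolding e by (simp only: mult_minus_right mult.assoc minus_diff_minus)
  moreover have "(\<sigma>' - 1) * (1 / \<delta>' - 1) = - ((\<sigma>' - 1) * (\<delta>' - 1) * (1 / \<delta>'))" unfolding e by (simp only: mult_minus_right mult.assoc)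
  ultimately show "cmod ((\<sigma> - 1) * (1 / \<delta> - 1) - (\<sigma>' - 1) * (1 / \<delta>' - 1)) \<le> 10 * \<epsilon> * cmod ((\<sigma>' - 1) * (1 / \<delta>' - 1))"
    by (simp only: norm_minus_cancel)
qed

lemma abs_exp_minus_1_le:
  fixes t :: real
  assumes "\<bar>t\<bar> \<le> 1"
  shows "\<bar>exp t - 1\<bar> \<le> 4 * \<bar>t\<bar>"
proof -
  have "t\<^sup>2 \<le> \<bar>t\<bar>" using assms mult_left_mono[of "\<bar>t\<bar>" 1 "\<bar>t\<bar>"] by (simp add: power2_eq_square abs_mult_self_eq flip: abs_mult)
  then show ?thesis using exp_linear_bound[OF assms] by argo
qed

context univalent_triangle
begin

lemma triangle_compare:
  assumes s: "0 < s"
  obtains K N where "K \<ge> 0" "N \<ge> 1"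
    "\<And>n w a b c. n \<ge> N \<Longrightarrow> (\<And>v. v \<in> grid n \<Longrightarrow> \<bar>w v - Re (L (pt n v))\<bar> \<le> s / (real n)\<^sup>2) \<Longrightarrow>
      {a, b, c} \<subseteq> grid n \<Longrightarrow> cmod (pt n b - pt n a) = 1 / real n \<Longrightarrow> pt n c - pt n a = (pt n b - pt n a) * hex_root \<Longrightarrow>
      heron16 (edge_sq (1 / (real n)\<^sup>2) (w a) (w b)) (edge_sq (1 / (real n)\<^sup>2) (w a) (w c)) (edge_sq (1 / (real n)\<^sup>2) (w b) (w c)) > 0 \<and>
      Im ((G (pt n c) - G (pt n a)) / (G (pt n b) - G (pt n a))) > 0 \<and>
      cmod ((G (pt n c) - G (pt n a)) / (G (pt n b) - G (pt n a)) - hex_root) \<le> 1/10 \<and>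
      cmod (tri_ratio (edge_sq (1 / (real n)\<^sup>2) (w a) (w b)) (edge_sq (1 / (real n)\<^sup>2) (w a) (w c)) (edge_sq (1 / (real n)\<^sup>2) (w b) (w c))
        - (G (pt n c) - G (pt n a)) / (G (pt n b) - G (pt n a))) \<le> K / (real n)\<^sup>2 \<and>
      \<bar>edge_sq (1 / (real n)\<^sup>2) (w a) (w b) - (real n)\<^sup>2 * (cmod (G (pt n b) - G (pt n a)))\<^sup>2\<bar> \<le> K / (real n)\<^sup>2"
proof -
  obtain B1 where B1: "B1 \<ge> 0" "\<And>z y. z \<in> T \<Longrightarrow> y \<in> T \<Longrightarrow> cmod (G y - G z - deriv G z * (y - z)) \<le> B1 * (cmod (y - z))\<^sup>2"
    by (rule first_order) blast
  obtain mb where mb: "mb > 0" "\<And>z y. z \<in> T \<Longrightarrow> y \<in> T \<Longrightarrow> mb * cmod (y - z) \<le> cmod (G y - G z)"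
    by (rule bilipschitz) blast
  obtain m M where mM: "0 < m" "m \<le> M" "\<And>z. z \<in> T \<Longrightarrow> m \<le> cmod (deriv G z)" "\<And>z. z \<in> T \<Longrightarrow> cmod (deriv G z) \<le> M"
    by (rule deriv_bounds) blast
  obtain B where B: "B \<ge> 0" "\<And>z y. z \<in> T \<Longrightarrow> y \<in> T \<Longrightarrow> cmod (y - z) \<le> 1 \<Longrightarrow>
    \<bar>(cmod (G y - G z))\<^sup>2 - cmod (deriv G z) * cmod (deriv G y) * (cmod (y - z))\<^sup>2\<bar> \<le> B * cmod (y - z) ^ 4"
    by (rule chord_length) blast
  obtain C0 where C0: "C0 \<ge> 0"
    "\<And>z d. z \<in> T \<Longrightarrow> z + d \<in> T \<Longrightarrow> cmod d \<le> 1 \<Longrightarrow> \<bar>Re (L (z + d)) - Re (L z) - Re (deriv L z * d)\<bar> \<le> C0 * (cmod d)\<^sup>2"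
    "\<And>z. z \<in> T \<Longrightarrow> cmod (deriv L z) \<le> C0"
    by (rule log_stencil) blast
  \<comment> \<open>Three sources of error: the weight is within \<open>s / n\<^sup>2\<close> of Re
    L, the \<kappa> term of \<open>edge_sq\<close> is bounded crudely by (3M)^2, and
    \<open>chord_length\<close> contributes B. The constant K1 below is the same error relative to
    |G'|^2.\<close>
  define K0 where "K0 = 8 * s * M\<^sup>2 + 9 * M\<^sup>2 + B"
  define K1 where "K1 = K0 / m\<^sup>2"
  define K where "K = 20 * K1 + K0"
  have M0: "0 < M" using mM by simp
  have K0: "0 \<le> K0" using s B(1) by (simp add: K0_def)
  have K1: "0 \<le> K1" using K0 by (simp add: K1_def)
  define N where "N = nat \<lceil>1 + 2 * s + 4 * C0 + 20 * (2 * B1 / mb) + 20 * (16 * C0) + 40 * K1\<rceil>"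
  have N: "1 + 2 * s + 4 * C0 + 20 * (2 * B1 / mb) + 20 * (16 * C0) + 40 * K1 \<le> real n" if "n \<ge> N" for n
    using that unfolding N_def by (simp add: nat_ceiling_le_eq)
  have q0: "0 \<le> 2 * B1 / mb" using B1(1) mb(1) by simp
  show ?thesis
  proof
    show "K \<ge> 0" using K0 K1 by (simp add: K_def)
    have "1 \<le> real N" using N[OF order_refl] s C0(1) q0 K1 by argo
    then show "N \<ge> 1" by simp
    fix n w a b c
    assume n: "n \<ge> N" and w: "\<And>v. v \<in> grid n \<Longrightarrow> \<bar>w v - Re (L (pt n v))\<bar> \<le> s / (real n)\<^sup>2"
      and abc: "{a, b, c} \<subseteq> grid n" and ab: "cmod (pt n b - pt n a) = 1 / real n"
      and ac: "pt n c - pt n a = (pt n b - pt n a) * hex_root"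
    define h where "h = 1 / real n"
    have n1: "n \<ge> 1" "1 \<le> real n" using n \<open>N \<ge> 1\<close> by auto
    have h: "0 < h" "h \<le> 1" "h\<^sup>2 \<le> h" using n1 by (auto simp: h_def power2_eq_square field_simps)
    have hs: "2 * s * h \<le> 1" "4 * C0 * h \<le> 1" "20 * (2 * B1 / mb) * h \<le> 1" "20 * (16 * C0 * h) \<le> 1" "40 * K1 * h \<le> 1"
    proof -
      have k: "k * h \<le> 1" if "k \<le> real n" for k using that n1 by (simp add: h_def field_simps)
      note Nn = N[OF n]
      show "2 * s * h \<le> 1" using Nn s C0(1) q0 K1 by (intro k) argo
      show "4 * C0 * h \<le> 1" using Nn s C0(1) q0 K1 by (intro k) argo
      show "20 * (2 * B1 / mb) * h \<le> 1" using Nn s C0(1) q0 K1 by (intro k) argo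
      have "20 * (16 * C0) * h \<le> 1" using Nn s C0(1) q0 K1 by (intro k) argo
      then show "20 * (16 * C0 * h) \<le> 1" by (simp only: mult.assoc)
      show "40 * K1 * h \<le> 1" using Nn s C0(1) q0 K1 by (intro k) argo
    qed
    have sh: "s / (real n)\<^sup>2 = s * h\<^sup>2" "1 / (real n)\<^sup>2 = h\<^sup>2" "K / (real n)\<^sup>2 = K * h\<^sup>2" "(real n)\<^sup>2 = 1 / h\<^sup>2" "1 / real n = h"
      by (simp_all add: h_def power_divide)
    define S where "S = (\<lambda>x y. edge_sq (h\<^sup>2) (w x) (w y))"
    \<comment> \<open>Squared chords of G in units of the mesh, to be compared with
      \<open>S\<close>.\<close>
    define S' where "S' = (\<lambda>x y. (cmod (G (pt n y) - G (pt n x)))\<^sup>2 / h\<^sup>2)"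
    define u where "u = (\<lambda>v. Re (L (pt n v)))"
    have ptT: "pt n v \<in> T" if "v \<in> grid n" for v using pt_in_T[OF that n1(1)] .
    have G': "cmod (deriv G (pt n v)) = exp (u v)" if "v \<in> grid n" for v
      using exp_L[of "pt n v"] ptT[OF that] T_U by (auto simp: u_def)
    have expM: "exp (u v) \<le> M" "m \<le> exp (u v)" if "v \<in> grid n" for v
      using mM(3,4)[OF ptT[OF that]] G'[OF that] by auto
    have sh2: "s * h\<^sup>2 \<le> 1/2"
    proof -
      have "s * h\<^sup>2 \<le> s * h" using s h(3) by (intro mult_left_mono) auto
      then show ?thesis using hs(1) by argo
    qed
    have close: "\<bar>S x y - S' x y\<bar> \<le> K0 * h\<^sup>2" if x: "x \<in> grid n" and y: "y \<in> grid n" and xy: "cmod (pt n y - pt n x) = h" for x y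
    proof -
      define P where "P = exp (u x) * exp (u y)"
      have P: "0 < P" "P \<le> M\<^sup>2"
        unfolding P_def power2_eq_square using expM(1)[OF x] expM(1)[OF y] M0 by (auto intro!: mult_mono)
      define \<delta> where "\<delta> = (w x - u x) + (w y - u y)"
      have wx: "\<bar>w x - u x\<bar> \<le> s * h\<^sup>2" "\<bar>w y - u y\<bar> \<le> s * h\<^sup>2"
        using w[OF x] w[OF y] unfolding sh(1) u_def .
      have \<delta>: "\<bar>\<delta>\<bar> \<le> 2 * (s * h\<^sup>2)" unfolding \<delta>_def using wx by (rule abs_add2_le) simp
      have "\<bar>exp \<delta> - 1\<bar> \<le> 4 * \<bar>\<delta>\<bar>" using \<delta> sh2 by (intro abs_exp_minus_1_le) linarith
      then have ed: "\<bar>exp \<delta> - 1\<bar> \<le> 8 * (s * h\<^sup>2)" using \<delta> by linarith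
      have "exp (w x + w y) - P = P * (exp \<delta> - 1)"
        by (simp add: P_def \<delta>_def algebra_simps flip: exp_add)
      then have t1: "\<bar>exp (w x + w y) - P\<bar> \<le> M\<^sup>2 * (8 * (s * h\<^sup>2))"
        using P ed by (simp only: abs_mult) (intro mult_mono; simp)
      have ew: "0 < exp (w v)" "exp (w v) \<le> 3 * M" if v: "v \<in> grid n" and wv: "\<bar>w v - u v\<bar> \<le> s * h\<^sup>2" for v
      proof -
        have "w v - u v \<le> 1" using wv sh2 by linarith
        then have "exp (w v - u v) \<le> exp 1" by simp
        then have "exp (w v - u v) \<le> 3" using exp_le by linarith
        then have "exp (w v - u v) * exp (u v) \<le> 3 * M" using expM(1)[OF v] M0 by (intro mult_mono) auto
        then show "exp (w v) \<le> 3 * M" by (simp flip: exp_add)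
      qed simp
      have "\<bar>exp (w x) - exp (w y)\<bar> \<le> 3 * M" using ew[OF x wx(1)] ew[OF y wx(2)] by linarith
      then have "\<bar>exp (w x) - exp (w y)\<bar>\<^sup>2 \<le> (3 * M)\<^sup>2" by (intro power_mono) auto
      then have "h\<^sup>2 * (exp (w x) - exp (w y))\<^sup>2 \<le> h\<^sup>2 * (3 * M)\<^sup>2" unfolding power2_abs by (intro mult_left_mono) auto
      then have t2: "\<bar>h\<^sup>2 * (exp (w x) - exp (w y))\<^sup>2\<bar> \<le> h\<^sup>2 * (9 * M\<^sup>2)" by (simp add: power_mult_distrib)
      have "\<bar>(cmod (G (pt n y) - G (pt n x)))\<^sup>2 - cmod (deriv G (pt n x)) * cmod (deriv G (pt n y)) * (cmod (pt n y - pt n x))\<^sup>2\<bar> \<le> B * cmod (pt n y - pt n x) ^ 4"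
        using xy h by (intro B(2) ptT x y) auto
      then have "\<bar>(cmod (G (pt n y) - G (pt n x)))\<^sup>2 - P * h\<^sup>2\<bar> \<le> B * h ^ 4"
        unfolding xy G'[OF x] G'[OF y] P_def .
      then have "\<bar>(cmod (G (pt n y) - G (pt n x)))\<^sup>2 - P * h\<^sup>2\<bar> / h\<^sup>2 \<le> B * h ^ 4 / h\<^sup>2" by (intro divide_right_mono) auto
      moreover have "\<bar>(cmod (G (pt n y) - G (pt n x)))\<^sup>2 - P * h\<^sup>2\<bar> / h\<^sup>2 = \<bar>S' x y - P\<bar>"
      proof -
        have "S' x y - P = ((cmod (G (pt n y) - G (pt n x)))\<^sup>2 - P * h\<^sup>2) / h\<^sup>2" using h by (simp add: S'_def diff_divide_distrib)
        then show ?thesis by (simp add: abs_divide)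
      qed
      moreover have "B * h ^ 4 / h\<^sup>2 = B * h\<^sup>2" using h by (simp add: eval_nat_numeral)
      ultimately have t3: "\<bar>P - S' x y\<bar> \<le> B * h\<^sup>2" by (simp add: abs_minus_commute)
      have eq: "S x y - S' x y = (exp (w x + w y) - P) + h\<^sup>2 * (exp (w x) - exp (w y))\<^sup>2 + (P - S' x y)"
        by (simp add: S_def edge_sq_def)
      show ?thesis unfolding eq
        by (rule abs_add2_le[OF abs_add2_le[OF t1 t2 order_refl] t3]) (simp add: K0_def algebra_simps)
    qed
    have g: "a \<in> grid n" "b \<in> grid n" "c \<in> grid n" using abc by auto
    have dab: "cmod (pt n b - pt n a) = h" using ab by (simp add: h_def)
    have dac: "cmod (pt n c - pt n a) = h" unfolding ac norm_mult dab by simp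
    have bc: "pt n c - pt n b = (pt n b - pt n a) * (hex_root - 1)" using ac by (simp add: algebra_simps)
    have dbc: "cmod (pt n c - pt n b) = h" unfolding bc norm_mult dab by simp
    \<comment> \<open>This is |G'|^2 at a; the common factor 1/R does not change shapes and brings
      all squared sides close to 1.\<close>
    define R where "R = exp (2 * u a)"
    have R: "R > 0" "m\<^sup>2 \<le> R"
    proof -
      have "m * m \<le> exp (u a) * exp (u a)" using expM(2)[OF g(1)] mM(1) by (intro mult_mono) auto
      then show "m\<^sup>2 \<le> R" by (simp add: R_def power2_eq_square flip: exp_add)
    qed (simp add: R_def)
    have ud: "\<bar>u x - u a\<bar> \<le> 2 * C0 * h" if x: "x \<in> grid n" and dx: "cmod (pt n x - pt n a) \<le> h" for x
    proof -
      define d where "d = pt n x - pt n a"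
      have zd: "pt n a + d = pt n x" by (simp add: d_def)
      have dh: "cmod d \<le> h" using dx by (simp add: d_def)
      then have d1: "cmod d \<le> 1" using h by simp
      have "\<bar>Re (L (pt n a + d)) - Re (L (pt n a)) - Re (deriv L (pt n a) * d)\<bar> \<le> C0 * (cmod d)\<^sup>2"
        using d1 ptT[OF g(1)] ptT[OF x] by (intro C0(2)) (auto simp: zd)
      also have "\<dots> \<le> C0 * h"
      proof -
        have "(cmod d)\<^sup>2 \<le> h\<^sup>2" using dh by (intro power_mono) auto
        then show ?thesis using C0(1) h(3) by (intro mult_left_mono) auto
      qed
      finally have 1: "\<bar>u x - u a - Re (deriv L (pt n a) * d)\<bar> \<le> C0 * h" by (simp add: zd u_def)
      have "cmod (deriv L (pt n a) * d) \<le> C0 * h"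
        unfolding norm_mult using C0(3)[OF ptT[OF g(1)]] dh C0(1) by (intro mult_mono) auto
      then have 2: "\<bar>Re (deriv L (pt n a) * d)\<bar> \<le> C0 * h" using abs_Re_le_cmod order_trans by blast
      show ?thesis using abs_add2_le[OF 1 2 order_refl] by simp
    qed
    have Sn: "\<bar>S' x y / R - 1\<bar> \<le> 1/20 + 1/40 \<and> \<bar>S x y / R - 1\<bar> \<le> 1/10 \<and> \<bar>S x y / R - S' x y / R\<bar> \<le> K1 * h\<^sup>2"
      if x: "x \<in> grid n" and y: "y \<in> grid n" and xy: "cmod (pt n y - pt n x) = h"
        and xa: "cmod (pt n x - pt n a) \<le> h" and ya: "cmod (pt n y - pt n a) \<le> h" for x y
    proof -
      have 1: "\<bar>S x y / R - S' x y / R\<bar> \<le> K1 * h\<^sup>2"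
      proof -
        have "\<bar>S x y / R - S' x y / R\<bar> = \<bar>S x y - S' x y\<bar> / R" using R by (simp add: abs_divide flip: diff_divide_distrib)
        also have "\<dots> \<le> K0 * h\<^sup>2 / m\<^sup>2" using close[OF x y xy] K0 R mM by (intro frac_le) auto
        finally show ?thesis by (simp add: K1_def)
      qed
      have K1h: "K1 * h\<^sup>2 \<le> 1/40"
      proof -
        have "K1 * h\<^sup>2 \<le> K1 * h" using K1 h(3) by (intro mult_left_mono) auto
        then show ?thesis using hs(5) by argo
      qed
      define P where "P = exp (u x) * exp (u y)"
      have "P / R = exp ((u x - u a) + (u y - u a))"
        by (simp add: P_def R_def algebra_simps flip: exp_add exp_diff)
      moreover have dd: "\<bar>(u x - u a) + (u y - u a)\<bar> \<le> 4 * C0 * h"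
        using ud[OF x xa] ud[OF y ya] by (rule abs_add2_le) simp
      moreover have "\<bar>exp ((u x - u a) + (u y - u a)) - 1\<bar> \<le> 4 * \<bar>(u x - u a) + (u y - u a)\<bar>"
        using dd hs(2) by (intro abs_exp_minus_1_le) linarith
      ultimately have PR: "\<bar>P / R - 1\<bar> \<le> 1/20" using hs(4) by argo
      have "\<bar>(cmod (G (pt n y) - G (pt n x)))\<^sup>2 - cmod (deriv G (pt n x)) * cmod (deriv G (pt n y)) * (cmod (pt n y - pt n x))\<^sup>2\<bar> \<le> B * cmod (pt n y - pt n x) ^ 4"
        using xy h by (intro B(2) ptT x y) auto
      then have "\<bar>(cmod (G (pt n y) - G (pt n x)))\<^sup>2 - P * h\<^sup>2\<bar> \<le> B * h ^ 4"
        unfolding xy G'[OF x] G'[OF y] P_def .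
      then have "\<bar>(cmod (G (pt n y) - G (pt n x)))\<^sup>2 - P * h\<^sup>2\<bar> / (h\<^sup>2 * R) \<le> (B * h ^ 4) / (h\<^sup>2 * m\<^sup>2)"
        using h R mM B by (intro frac_le mult_mono) auto
      moreover have "\<bar>(cmod (G (pt n y) - G (pt n x)))\<^sup>2 - P * h\<^sup>2\<bar> / (h\<^sup>2 * R) = \<bar>S' x y / R - P / R\<bar>"
      proof -
        have "S' x y / R - P / R = ((cmod (G (pt n y) - G (pt n x)))\<^sup>2 - P * h\<^sup>2) / (h\<^sup>2 * R)"
          using h R by (simp add: S'_def diff_divide_distrib)
        then show ?thesis using R by (simp add: abs_divide abs_mult)
      qed
      moreover have "(B * h ^ 4) / (h\<^sup>2 * m\<^sup>2) \<le> K1 * h\<^sup>2"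
      proof -
        have "(B * h ^ 4) / (h\<^sup>2 * m\<^sup>2) = B / m\<^sup>2 * h\<^sup>2" using h by (simp add: eval_nat_numeral)
        also have "\<dots> \<le> K1 * h\<^sup>2" unfolding K1_def using s by (intro mult_right_mono divide_right_mono) (auto simp: K0_def)
        finally show ?thesis .
      qed
      ultimately have SP: "\<bar>S' x y / R - P / R\<bar> \<le> 1/40" using K1h by linarith
      have eq: "S' x y / R - 1 = (S' x y / R - P / R) + (P / R - 1)" by simp
      have 2: "\<bar>S' x y / R - 1\<bar> \<le> 1/20 + 1/40" unfolding eq by (rule abs_add2_le[OF SP PR]) simp
      have 3: "\<bar>S x y / R - S' x y / R\<bar> \<le> 1/40" using 1 K1h by linarith
      have "\<bar>S x y / R - 1\<bar> \<le> 1/10" using abs_add2_le[OF 3 2, of "1/10"] by simp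
      with 1 2 show ?thesis by blast
    qed
    have haa: "cmod (pt n a - pt n a) \<le> h" using h by simp
    note Sab = Sn[OF g(1,2) dab haa, unfolded dab, OF order_refl]
    note Sac = Sn[OF g(1,3) dac haa, unfolded dac, OF order_refl]
    have Sbc: "\<bar>S' b c / R - 1\<bar> \<le> 1/20 + 1/40 \<and> \<bar>S b c / R - 1\<bar> \<le> 1/10 \<and> \<bar>S b c / R - S' b c / R\<bar> \<le> K1 * h\<^sup>2"
      using dab dac by (intro Sn[OF g(2,3) dbc]) auto
    have rng: "9/10 \<le> t" "t \<le> 6/5" "4/5 \<le> t" "t \<le> 5/4" if "\<bar>t - 1\<bar> \<le> 1/10" for t :: real
      using that by linarith+
    have w20: "\<bar>t - 1\<bar> \<le> 1/10" if "\<bar>t - 1\<bar> \<le> 1/20 + 1/40" for t :: real using that by simp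
    have r1: "\<bar>S a b / R - 1\<bar> \<le> 1/10" "\<bar>S a c / R - 1\<bar> \<le> 1/10" "\<bar>S b c / R - 1\<bar> \<le> 1/10"
      "\<bar>S' a b / R - 1\<bar> \<le> 1/10" "\<bar>S' a c / R - 1\<bar> \<le> 1/10" "\<bar>S' b c / R - 1\<bar> \<le> 1/10"
      using Sab Sac Sbc w20 by blast+
    have hS: "heron16 (S a b) (S a c) (S b c) > 0"
    proof -
      have "heron16 (S a b / R) (S a c / R) (S b c / R) \<ge> 1/2"
        using r1(1-3)[THEN rng(1)] r1(1-3)[THEN rng(2)] r1(1-3)[THEN rng(3)] r1(1-3)[THEN rng(4)]
        by (intro heron16_near_equilateral)
      moreover have "heron16 (S a b) (S a c) (S b c) = R\<^sup>2 * heron16 (S a b / R) (S a c / R) (S b c / R)"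
        using R(1) by (simp flip: heron16_scale)
      ultimately show ?thesis using R(1) by (simp add: zero_less_mult_iff)
    qed
    have lip: "cmod (tri_ratio (S a b / R) (S a c / R) (S b c / R) - tri_ratio (S' a b / R) (S' a c / R) (S' b c / R)) \<le> 20 * (K1 * h\<^sup>2)"
      using r1[THEN rng(1)] r1[THEN rng(2)] r1[THEN rng(3)] r1[THEN rng(4)] Sab Sac Sbc
      by (intro tri_ratio_lipschitz) blast+
    define r where "r = (G (pt n c) - G (pt n a)) / (G (pt n b) - G (pt n a))"
    \<comment> \<open>The image of a small equilateral triangle is nearly equilateral: the quadratic
      Taylor error 2 B1 h^2 is divided by a chord of length at least mb h.\<close>
    have rw: "cmod (r - hex_root) \<le> 1/10"
    proof -
      have lowb: "mb * h \<le> cmod (G (pt n b) - G (pt n a))" using mb(2)[OF ptT[OF g(1)] ptT[OF g(2)]] dab by simp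
      have nz: "G (pt n b) - G (pt n a) \<noteq> 0" using lowb mb(1) h(1) by (metis mult_pos_pos norm_zero not_less)
      have "r - hex_root = (G (pt n c) - G (pt n a) - hex_root * (G (pt n b) - G (pt n a))) / (G (pt n b) - G (pt n a))"
        using nz by (simp add: r_def diff_divide_distrib)
      moreover have "cmod (G (pt n c) - G (pt n a) - hex_root * (G (pt n b) - G (pt n a))) \<le> 2 * B1 * h\<^sup>2"
      proof -
        have eq: "G (pt n c) - G (pt n a) - hex_root * (G (pt n b) - G (pt n a))
          = (G (pt n c) - G (pt n a) - deriv G (pt n a) * (pt n c - pt n a)) - hex_root * (G (pt n b) - G (pt n a) - deriv G (pt n a) * (pt n b - pt n a))"
          unfolding ac by (simp add: algebra_simps)
        have "cmod (G (pt n c) - G (pt n a) - deriv G (pt n a) * (pt n c - pt n a)) \<le> B1 * h\<^sup>2"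
          using B1(2)[OF ptT[OF g(1)] ptT[OF g(3)]] by (simp add: dac)
        moreover have "cmod (hex_root * (G (pt n b) - G (pt n a) - deriv G (pt n a) * (pt n b - pt n a))) \<le> B1 * h\<^sup>2"
          using B1(2)[OF ptT[OF g(1)] ptT[OF g(2)]] by (simp add: dab norm_mult)
        ultimately have "cmod (G (pt n c) - G (pt n a) - deriv G (pt n a) * (pt n c - pt n a))
            + cmod (hex_root * (G (pt n b) - G (pt n a) - deriv G (pt n a) * (pt n b - pt n a))) \<le> 2 * B1 * h\<^sup>2" by simp
        then show ?thesis unfolding eq by (rule order_trans[OF norm_triangle_ineq4])
      qed
      ultimately have "cmod (r - hex_root) \<le> 2 * B1 * h\<^sup>2 / (mb * h)"
        using lowb mb(1) h(1) B1(1) by (simp add: norm_divide) (intro frac_le; simp)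
      also have "\<dots> = 2 * B1 / mb * h" using h by (simp add: power2_eq_square)
      finally show ?thesis using hs(3) by argo
    qed
    have Imr: "Im r > 0"
    proof -
      have "\<bar>Im (r - hex_root)\<bar> \<le> 1/10" using rw abs_Im_le_cmod order_trans by blast
      moreover have "Im hex_root \<ge> 1/2"
        unfolding hex_root_def by simp
      ultimately show ?thesis unfolding minus_complex.sel by argo
    qed
    have r': "tri_ratio (S' a b / R) (S' a c / R) (S' b c / R) = r"
    proof -
      have t: "tri_ratio ((cmod (G (pt n b) - G (pt n a)))\<^sup>2) ((cmod (G (pt n c) - G (pt n a)))\<^sup>2) ((cmod (G (pt n c) - G (pt n b)))\<^sup>2) = r"
        unfolding r_def using Imr by (intro tri_ratio_exact(1)) (simp add: r_def)
      have "1 / (h\<^sup>2 * R) > 0" using h R by simp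
      from tri_ratio_scale[OF this, of "(cmod (G (pt n b) - G (pt n a)))\<^sup>2" "(cmod (G (pt n c) - G (pt n a)))\<^sup>2" "(cmod (G (pt n c) - G (pt n b)))\<^sup>2"]
      show ?thesis unfolding t by (simp add: S'_def mult.commute)
    qed
    have rS: "tri_ratio (S a b / R) (S a c / R) (S b c / R) = tri_ratio (S a b) (S a c) (S b c)"
      using tri_ratio_scale[of "1 / R" "S a b" "S a c" "S b c"] R(1) by simp
    have fin: "cmod (tri_ratio (S a b) (S a c) (S b c) - r) \<le> K * h\<^sup>2"
    proof -
      have "20 * (K1 * h\<^sup>2) \<le> K * h\<^sup>2" unfolding K_def using K0 by (simp add: algebra_simps)
      then show ?thesis using lip unfolding rS r' by simp
    qed
    have len: "\<bar>S a b - 1 / h\<^sup>2 * (cmod (G (pt n b) - G (pt n a)))\<^sup>2\<bar> \<le> K * h\<^sup>2"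
    proof -
      have "K0 * h\<^sup>2 \<le> K * h\<^sup>2" unfolding K_def using K1 by (intro mult_right_mono) auto
      then show ?thesis using close[OF g(1,2) dab] by (simp add: S'_def)
    qed
    show "heron16 (edge_sq (1 / (real n)\<^sup>2) (w a) (w b)) (edge_sq (1 / (real n)\<^sup>2) (w a) (w c)) (edge_sq (1 / (real n)\<^sup>2) (w b) (w c)) > 0 \<and>
      Im ((G (pt n c) - G (pt n a)) / (G (pt n b) - G (pt n a))) > 0 \<and>
      cmod ((G (pt n c) - G (pt n a)) / (G (pt n b) - G (pt n a)) - hex_root) \<le> 1/10 \<and>
      cmod (tri_ratio (edge_sq (1 / (real n)\<^sup>2) (w a) (w b)) (edge_sq (1 / (real n)\<^sup>2) (w a) (w c)) (edge_sq (1 / (real n)\<^sup>2) (w b) (w c))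
        - (G (pt n c) - G (pt n a)) / (G (pt n b) - G (pt n a))) \<le> K / (real n)\<^sup>2 \<and>
      \<bar>edge_sq (1 / (real n)\<^sup>2) (w a) (w b) - (real n)\<^sup>2 * (cmod (G (pt n b) - G (pt n a)))\<^sup>2\<bar> \<le> K / (real n)\<^sup>2"
      using hS Imr rw fin len
      unfolding S_def r_def h_def[symmetric] by (simp only: h_def power_divide power_one one_power2 div_by_1 divide_divide_eq_right mult_1 times_divide_eq_right mult_1_right simp_thms)
  qed
qed

end

lemma power_1_plus_le:
  fixes \<eta> :: real
  assumes "0 \<le> \<eta>" "real n * \<eta> \<le> 1" "k \<le> n"
  shows "(1 + \<eta>) ^ k - 1 \<le> 4 * (real n * \<eta>)"
proof -
  have "(1 + \<eta>) ^ k \<le> (1 + \<eta>) ^ n" using assms by (intro power_increasing) auto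
  also have "\<dots> \<le> exp \<eta> ^ n" using assms(1) by (intro power_mono exp_ge_add_one_self) auto
  also have "\<dots> = exp (real n * \<eta>)" by (simp add: exp_of_nat_mult)
  finally show ?thesis using abs_exp_minus_1_le[of "real n * \<eta>"] assms by (auto simp: abs_le_iff)
qed

context univalent_triangle
begin

text \<open>Shapes agree with those of \<open>G\<close> up to O(n^-2). Along at most n steps this
  gives edge vectors with relative error O(1/n), and since edges have length O(1/n), an absolute
  error O(n^-2). The comparison is possible step by step because developing the shapes of
  \<open>G\<close> itself returns the chords of \<open>G\<close>.\<close>

lemma exists_packing:
  obtains C N where "C \<ge> 0" "N \<ge> 1"
    "\<And>n. n \<ge> N \<Longrightarrow> \<exists>w x. x (0, 0) = G A \<and>
      (\<forall>v\<in>inner_grid n. angle_sum (1 / (real n)\<^sup>2) w v = 2 * pi) \<and>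
      (\<forall>i j :: nat. i + j + 1 \<le> n \<longrightarrow>
        (cmod (x (int i + 1, int j) - x (int i, int j)))\<^sup>2 = 1 / (real n)\<^sup>2 * edge_sq (1 / (real n)\<^sup>2) (w (int i, int j)) (w (int i + 1, int j)) \<and>
        (cmod (x (int i, int j + 1) - x (int i, int j)))\<^sup>2 = 1 / (real n)\<^sup>2 * edge_sq (1 / (real n)\<^sup>2) (w (int i, int j)) (w (int i, int j + 1)) \<and>
        (cmod (x (int i, int j + 1) - x (int i + 1, int j)))\<^sup>2 = 1 / (real n)\<^sup>2 * edge_sq (1 / (real n)\<^sup>2) (w (int i + 1, int j)) (w (int i, int j + 1)) \<and>
        Im ((x (int i, int j + 1) - x (int i, int j)) / (x (int i + 1, int j) - x (int i, int j))) > 0 \<and>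
        cmod ((x (int i + 1, int j) - x (int i, int j)) - (G (pt n (int i + 1, int j)) - G (pt n (int i, int j)))) \<le> C / (real n)\<^sup>2 \<and>
        cmod ((x (int i, int j + 1) - x (int i, int j)) - (G (pt n (int i, int j + 1)) - G (pt n (int i, int j)))) \<le> C / (real n)\<^sup>2) \<and>
      (\<forall>i j :: nat. i + j + 2 \<le> n \<longrightarrow>
        Im ((x (int i, int j + 1) - x (int i + 1, int j)) / (x (int i + 1, int j + 1) - x (int i + 1, int j))) > 0)"
proof -
  obtain s N1 where s: "s > 0" "N1 \<ge> 1"
    "\<And>n. n \<ge> N1 \<Longrightarrow> \<exists>w. (\<forall>v\<in>grid n. \<bar>w v - Re (L (pt n v))\<bar> \<le> s / (real n)\<^sup>2)
      \<and> (\<forall>v\<in>inner_grid n. angle_sum (1 / (real n)\<^sup>2) w v = 2 * pi)"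
    by (rule exists_flat_weight) blast
  obtain K N2 where K: "K \<ge> 0" "N2 \<ge> 1"
    "\<And>n w a b c. n \<ge> N2 \<Longrightarrow> (\<And>v. v \<in> grid n \<Longrightarrow> \<bar>w v - Re (L (pt n v))\<bar> \<le> s / (real n)\<^sup>2) \<Longrightarrow>
      {a, b, c} \<subseteq> grid n \<Longrightarrow> cmod (pt n b - pt n a) = 1 / real n \<Longrightarrow> pt n c - pt n a = (pt n b - pt n a) * hex_root \<Longrightarrow>
      heron16 (edge_sq (1 / (real n)\<^sup>2) (w a) (w b)) (edge_sq (1 / (real n)\<^sup>2) (w a) (w c)) (edge_sq (1 / (real n)\<^sup>2) (w b) (w c)) > 0 \<and>
      Im ((G (pt n c) - G (pt n a)) / (G (pt n b) - G (pt n a))) > 0 \<and>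
      cmod ((G (pt n c) - G (pt n a)) / (G (pt n b) - G (pt n a)) - hex_root) \<le> 1/10 \<and>
      cmod (tri_ratio (edge_sq (1 / (real n)\<^sup>2) (w a) (w b)) (edge_sq (1 / (real n)\<^sup>2) (w a) (w c)) (edge_sq (1 / (real n)\<^sup>2) (w b) (w c))
        - (G (pt n c) - G (pt n a)) / (G (pt n b) - G (pt n a))) \<le> K / (real n)\<^sup>2 \<and>
      \<bar>edge_sq (1 / (real n)\<^sup>2) (w a) (w b) - (real n)\<^sup>2 * (cmod (G (pt n b) - G (pt n a)))\<^sup>2\<bar> \<le> K / (real n)\<^sup>2"
    by (rule triangle_compare[OF s(1)]) blast
  obtain mb where mb: "mb > 0" "\<And>z y. z \<in> T \<Longrightarrow> y \<in> T \<Longrightarrow> mb * cmod (y - z) \<le> cmod (G y - G z)"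
    by (rule bilipschitz) blast
  obtain B where B: "B \<ge> 0" "\<And>z y. z \<in> T \<Longrightarrow> y \<in> T \<Longrightarrow> cmod (G y - G z - deriv G z * (y - z)) \<le> B * (cmod (y - z))\<^sup>2"
    by (rule first_order) blast
  obtain m M where mM: "0 < m" "m \<le> M" "\<And>z. z \<in> T \<Longrightarrow> m \<le> cmod (deriv G z)" "\<And>z. z \<in> T \<Longrightarrow> cmod (deriv G z) \<le> M"
    by (rule deriv_bounds) blast
  \<comment> \<open>10 K bounds the relative error of one step; \<open>K / mb\<^sup>2\<close> is for
    the first edge, where one divides by the squared chord, at least (mb / n)^2.\<close>
  define K2 where "K2 = 10 * K + K / mb\<^sup>2"
  define C1 where "C1 = 4 * K2 * (M + B)"
  define C where "C = 2 * C1 + K * (M + B)"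
  have K2: "0 \<le> K2" "10 * K \<le> K2" "K / mb\<^sup>2 \<le> K2" using K(1) by (auto simp: K2_def)
  have MB: "0 \<le> M + B" using mM B by simp
  have C1: "0 \<le> C1" using K2 MB by (simp add: C1_def)
  define N where "N = N1 + N2 + nat \<lceil>K2\<rceil> + nat \<lceil>10 * K\<rceil>"
  show ?thesis
  proof
    show "C \<ge> 0" using C1 K(1) MB by (simp add: C_def)
    show "N \<ge> 1" using s(2) by (simp add: N_def)
    fix n assume "n \<ge> N"
    then have n: "n \<ge> N1" "n \<ge> N2" "K2 \<le> real n" "10 * K \<le> real n" "n \<ge> 1"
      using s(2) unfolding N_def by (linarith | simp add: nat_ceiling_le_eq[symmetric])+
    have n1: "1 \<le> real n" using n(5) by simp
    have n0: "real n > 0" using n1 by simp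
    have nn: "real n \<le> (real n)\<^sup>2" using n1 by (simp add: power2_eq_square)
    obtain w where w: "\<And>v. v \<in> grid n \<Longrightarrow> \<bar>w v - Re (L (pt n v))\<bar> \<le> s / (real n)\<^sup>2"
      "\<And>v. v \<in> inner_grid n \<Longrightarrow> angle_sum (1 / (real n)\<^sup>2) w v = 2 * pi"
      using s(3)[OF n(1)] by blast
    define \<kappa> where "\<kappa> = 1 / (real n)\<^sup>2"
    have \<kappa>: "0 \<le> \<kappa>" "0 < \<kappa>" using n0 by (auto simp: \<kappa>_def)
    have \<kappa>1: "\<kappa> \<le> 1 / real n" unfolding \<kappa>_def using nn n0 by (intro divide_left_mono) auto
    define S where "S = (\<lambda>u v. edge_sq \<kappa> (w u) (w v))"
    define Gp where "Gp = (\<lambda>v. G (pt n v))"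
    define \<epsilon> where "\<epsilon> = K * \<kappa>"
    have \<epsilon>: "0 \<le> \<epsilon>" "\<epsilon> \<le> 1/10"
    proof -
      have "K * \<kappa> \<le> K * (1 / real n)" using \<kappa>1 K(1) by (intro mult_left_mono) auto
      also have "\<dots> \<le> 1/10" using n(4) n0 by (simp add: field_simps)
      finally show "\<epsilon> \<le> 1/10" by (simp add: \<epsilon>_def)
    qed (use K(1) \<kappa> in \<open>simp add: \<epsilon>_def\<close>)
    define d where "d = e / of_nat n"
    have pt: "pt n = lat A d" by (simp add: d_def)
    have dn: "cmod d = 1 / real n" by (simp add: d_def norm_divide norm_e)
    have cmp: "heron16 (S a b) (S a c) (S b c) > 0 \<and> Im ((Gp c - Gp a) / (Gp b - Gp a)) > 0 \<and>
      cmod ((Gp c - Gp a) / (Gp b - Gp a) - hex_root) \<le> 1/10 \<and>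
      cmod (tri_ratio (S a b) (S a c) (S b c) - (Gp c - Gp a) / (Gp b - Gp a)) \<le> \<epsilon> \<and>
      \<bar>S a b - (real n)\<^sup>2 * (cmod (Gp b - Gp a))\<^sup>2\<bar> \<le> \<epsilon>"
      if "{a, b, c} \<subseteq> grid n" "cmod (pt n b - pt n a) = 1 / real n" "pt n c - pt n a = (pt n b - pt n a) * hex_root" for a b c
      using K(3)[OF n(2) w(1) that] unfolding S_def Gp_def \<epsilon>_def \<kappa>_def by simp
    have up: "heron16 (S (int i, int j) (int i + 1, int j)) (S (int i, int j) (int i, int j + 1)) (S (int i + 1, int j) (int i, int j + 1)) > 0 \<and>
      Im ((Gp (int i, int j + 1) - Gp (int i, int j)) / (Gp (int i + 1, int j) - Gp (int i, int j))) > 0 \<and>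
      cmod ((Gp (int i, int j + 1) - Gp (int i, int j)) / (Gp (int i + 1, int j) - Gp (int i, int j)) - hex_root) \<le> 1/10 \<and>
      cmod (up_ratio S i j - (Gp (int i, int j + 1) - Gp (int i, int j)) / (Gp (int i + 1, int j) - Gp (int i, int j))) \<le> \<epsilon> \<and>
      \<bar>S (int i, int j) (int i + 1, int j) - (real n)\<^sup>2 * (cmod (Gp (int i + 1, int j) - Gp (int i, int j)))\<^sup>2\<bar> \<le> \<epsilon>"
      if "i + j + 1 \<le> n" for i j
      unfolding up_ratio_def Let_def
    proof (rule cmp)
      show "{(int i, int j), (int i + 1, int j), (int i, int j + 1)} \<subseteq> grid n" using that by (auto simp: grid_def)
      show "cmod (pt n (int i + 1, int j) - pt n (int i, int j)) = 1 / real n"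
        unfolding pt using dn by (simp add: lat_def algebra_simps)
      show "pt n (int i, int j + 1) - pt n (int i, int j) = (pt n (int i + 1, int j) - pt n (int i, int j)) * hex_root"
        unfolding pt by (simp add: lat_def algebra_simps)
    qed
    have down: "heron16 (S (int i + 1, int j) (int i + 1, int j + 1)) (S (int i + 1, int j) (int i, int j + 1)) (S (int i + 1, int j + 1) (int i, int j + 1)) > 0 \<and>
      Im ((Gp (int i, int j + 1) - Gp (int i + 1, int j)) / (Gp (int i + 1, int j + 1) - Gp (int i + 1, int j))) > 0 \<and>
      cmod ((Gp (int i, int j + 1) - Gp (int i + 1, int j)) / (Gp (int i + 1, int j + 1) - Gp (int i + 1, int j)) - hex_root) \<le> 1/10 \<and>
      cmod (down_ratio S i j - (Gp (int i, int j + 1) - Gp (int i + 1, int j)) / (Gp (int i + 1, int j + 1) - Gp (int i + 1, int j))) \<le> \<epsilon> \<and>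
      \<bar>S (int i + 1, int j) (int i + 1, int j + 1) - (real n)\<^sup>2 * (cmod (Gp (int i + 1, int j + 1) - Gp (int i + 1, int j)))\<^sup>2\<bar> \<le> \<epsilon>"
      if "i + j + 2 \<le> n" for i j
      unfolding down_ratio_def Let_def
    proof (rule cmp)
      show "{(int i + 1, int j), (int i + 1, int j + 1), (int i, int j + 1)} \<subseteq> grid n" using that by (auto simp: grid_def)
      show "cmod (pt n (int i + 1, int j + 1) - pt n (int i + 1, int j)) = 1 / real n"
        unfolding pt using dn by (simp add: lat_def algebra_simps norm_mult)
      show "pt n (int i, int j + 1) - pt n (int i + 1, int j) = (pt n (int i + 1, int j + 1) - pt n (int i + 1, int j)) * hex_root"
      proof -
        have "pt n (int i, int j + 1) - pt n (int i + 1, int j) = d * (hex_root - 1)"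
          "pt n (int i + 1, int j + 1) - pt n (int i + 1, int j) = d * hex_root"
          unfolding pt by (simp_all add: lat_def algebra_simps)
        then show ?thesis by (simp only: mult.assoc hex_root_sq)
      qed
    qed
    have Spos: "S u v > 0" for u v unfolding S_def using \<kappa>(1) by (rule edge_sq_pos)
    have nd: "nondegenerate n S"
      unfolding nondegenerate_def Let_def using up down Spos by (auto simp: S_def edge_sq_commute)
    define \<sigma> \<delta> where "\<sigma> = up_ratio S" and "\<delta> = down_ratio S"
    define E' where "E' = (\<lambda>i j :: nat. Gp (int i + 1, int j) - Gp (int i, int j))"
    define \<sigma>' where "\<sigma>' = (\<lambda>i j :: nat. (Gp (int i, int j + 1) - Gp (int i, int j)) / (Gp (int i + 1, int j) - Gp (int i, int j)))"
    define \<delta>' where "\<delta>' = (\<lambda>i j :: nat. (Gp (int i, int j + 1) - Gp (int i + 1, int j)) / (Gp (int i + 1, int j + 1) - Gp (int i + 1, int j)))"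
    \<comment> \<open>The first edge has the direction of the first chord of G and the length
      prescribed by the packing.\<close>
    define e0 where "e0 = of_real (sqrt (S (0, 0) (1, 0)) / real n / cmod (E' 0 0)) * E' 0 0"
    have gT: "v \<in> grid n \<Longrightarrow> pt n v \<in> T" for v using pt_in_T n(5) by blast
    have E'low: "mb / real n \<le> cmod (E' i j)" "E' i j \<noteq> 0" "cmod (E' i j) \<le> (M + B) / real n" if "i + j + 1 \<le> n" for i j
    proof -
      have g: "(int i, int j) \<in> grid n" "(int i + 1, int j) \<in> grid n" using that by (auto simp: grid_def)
      have D: "cmod (pt n (int i + 1, int j) - pt n (int i, int j)) = 1 / real n"
        unfolding pt using dn by (simp add: lat_def algebra_simps)
      show 1: "mb / real n \<le> cmod (E' i j)"
        using mb(2)[OF gT[OF g(1)] gT[OF g(2)]] D by (simp add: E'_def Gp_def)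
      have "0 < mb / real n" using mb(1) n0 by simp
      with 1 show "E' i j \<noteq> 0" by auto
      have b: "cmod (E' i j - deriv G (pt n (int i, int j)) * (pt n (int i + 1, int j) - pt n (int i, int j))) \<le> B * (1 / real n)\<^sup>2"
        using B(2)[OF gT[OF g(1)] gT[OF g(2)]] D by (simp add: E'_def Gp_def)
      have "B * (1 / real n)\<^sup>2 \<le> B * (1 / real n)" using B(1) \<kappa>1 by (intro mult_left_mono) (auto simp: \<kappa>_def power_divide)
      moreover have "cmod (deriv G (pt n (int i, int j)) * (pt n (int i + 1, int j) - pt n (int i, int j))) \<le> M * (1 / real n)"
        unfolding norm_mult D using mM(4)[OF gT[OF g(1)]] by (intro mult_right_mono) auto
      ultimately show "cmod (E' i j) \<le> (M + B) / real n"
        using b norm_triangle_sub[of "E' i j" "deriv G (pt n (int i, int j)) * (pt n (int i + 1, int j) - pt n (int i, int j))"]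
        by (simp add: add_divide_distrib)
    qed
    obtain E x where Ex: "E 0 0 = e0" "x 0 0 = G A"
      "\<And>i j. i + j + 2 \<le> n \<Longrightarrow> E (Suc i) j = step_right \<sigma> \<delta> i j * E i j"
      "\<And>i j. i + j + 2 \<le> n \<Longrightarrow> E i (Suc j) = step_up \<sigma> \<delta> i j * E i j"
      "\<And>i j. i + j + 1 \<le> n \<Longrightarrow> x (Suc i) j - x i j = E i j"
      "\<And>i j. i + j + 1 \<le> n \<Longrightarrow> x i (Suc j) - x i j = \<sigma> i j * E i j"
    proof (rule develop[of n \<sigma> \<delta> e0 "G A"])
      show "\<sigma> i j \<noteq> 0" if "i + j + 1 \<le> n" for i j using ratio_nz(1)[OF nd that] by (simp add: \<sigma>_def)
      show "\<delta> i j \<noteq> 0" if "i + j + 2 \<le> n" for i j using ratio_nz(4)[OF nd that] by (simp add: \<delta>_def)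
      show "(\<sigma> i (Suc j) - 1) * (1 - \<delta> i j) * \<delta> (Suc i) j * \<sigma> (Suc i) j
        = (\<sigma> (Suc i) j - 1) * (1 - \<delta> (Suc i) j) * \<delta> i (Suc j) * \<sigma> (Suc i) (Suc j)" if ij: "i + j + 3 \<le> n" for i j
      proof -
        have "(int i + 1, int j + 1) \<in> inner_grid n" using ij by (auto simp: inner_grid_def)
        from w(2)[OF this] closing_of_angle_sum[of n \<kappa> w i j] nd ij
        show ?thesis unfolding S_def \<sigma>_def \<delta>_def \<kappa>_def by blast
      qed
    qed blast
    define \<eta> where "\<eta> = K2 * \<kappa>"
    have \<eta>: "0 \<le> \<eta>" "10 * \<epsilon> \<le> \<eta>" "real n * \<eta> \<le> 1" "real n * \<eta> = K2 / real n"
    proof -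
      show "0 \<le> \<eta>" using K2 \<kappa> by (simp add: \<eta>_def)
      show "10 * \<epsilon> \<le> \<eta>" unfolding \<eta>_def \<epsilon>_def using mult_right_mono[OF K2(2) \<kappa>(1)] by simp
      show *: "real n * \<eta> = K2 / real n" using n0 by (simp add: \<eta>_def \<kappa>_def power2_eq_square)
      show "real n * \<eta> \<le> 1" unfolding * using n(3) n0 by simp
    qed
    have E0: "cmod (E 0 0 - E' 0 0) \<le> \<eta> * cmod (E' 0 0)"
    proof -
      have i0: "0 + 0 + 1 \<le> n" using n(5) by simp
      define a b where "a = sqrt (S (0, 0) (1, 0)) / real n" and "b = cmod (E' 0 0)"
      have b: "b > 0" "mb / real n \<le> b" using E'low[OF i0] by (auto simp: b_def)
      have a: "0 \<le> a" using Spos[of "(0, 0)" "(1, 0)"] n0 by (simp add: a_def)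
      have "E 0 0 - E' 0 0 = of_real (a / b - 1) * E' 0 0" by (simp add: Ex(1) e0_def a_def b_def algebra_simps)
      then have "cmod (E 0 0 - E' 0 0) = \<bar>a / b - 1\<bar> * b" by (simp only: norm_mult norm_of_real b_def)
      also have "\<dots> = \<bar>a - b\<bar>" 
      proof -
        have "\<bar>a / b - 1\<bar> * b = \<bar>(a / b - 1) * b\<bar>" using b(1) by (simp add: abs_mult)
        also have "(a / b - 1) * b = a - b" using b(1) by (simp add: left_diff_distrib)
        finally show ?thesis .
      qed
      finally have eq: "cmod (E 0 0 - E' 0 0) = \<bar>a - b\<bar>" .
      \<comment> \<open>Only squared lengths are known to be close, so a - b is estimated through (a
        - b) (a + b), with a + b at least b.\<close>
      have ab: "\<bar>a - b\<bar> * b \<le> \<epsilon> * \<kappa>"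
      proof -
        have "\<bar>a - b\<bar> * b \<le> \<bar>a - b\<bar> * (a + b)" using a by (intro mult_left_mono) auto
        also have "\<dots> = \<bar>(a - b) * (a + b)\<bar>" using a b by (simp add: abs_mult)
        also have "(a - b) * (a + b) = a\<^sup>2 - b\<^sup>2" by (simp add: power2_eq_square algebra_simps)
        also have "a\<^sup>2 - b\<^sup>2 = \<kappa> * (S (0, 0) (1, 0) - (real n)\<^sup>2 * b\<^sup>2)"
          using n0 Spos[of "(0, 0)" "(1, 0)"] by (simp add: a_def \<kappa>_def power_divide diff_divide_distrib)
        also have "\<bar>\<dots>\<bar> = \<kappa> * \<bar>S (0, 0) (1, 0) - (real n)\<^sup>2 * b\<^sup>2\<bar>" using \<kappa> by (simp add: abs_mult)
        also have "\<dots> \<le> \<kappa> * \<epsilon>" using up[OF i0] \<kappa> by (intro mult_left_mono) (auto simp: b_def E'_def)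
        finally show ?thesis by (simp add: mult.commute)
      qed
      have "\<epsilon> * \<kappa> \<le> \<eta> * b * b"
      proof -
        have "(mb / real n)\<^sup>2 \<le> b\<^sup>2" using b mb(1) n0 by (intro power_mono) auto
        then have "mb\<^sup>2 * \<kappa> \<le> b * b" by (simp add: \<kappa>_def power_divide power2_eq_square)
        then have "\<eta> * (mb\<^sup>2 * \<kappa>) \<le> \<eta> * (b * b)" using \<eta>(1) by (intro mult_left_mono)
        moreover have "K \<le> K2 * mb\<^sup>2" using K2(3) mb(1) by (simp add: field_simps)
        then have "K * (\<kappa> * \<kappa>) \<le> K2 * mb\<^sup>2 * (\<kappa> * \<kappa>)" using \<kappa> by (intro mult_right_mono) auto
        ultimately show ?thesis by (simp add: \<epsilon>_def \<eta>_def mult_ac)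
      qed
      with ab have "\<bar>a - b\<bar> * b \<le> \<eta> * b * b" by linarith
      then have "\<bar>a - b\<bar> \<le> \<eta> * b" using b(1) by (rule mult_right_le_imp_le)
      then show ?thesis by (simp add: eq b_def)
    qed
    have nzG: "Gp (int i + 1, int j + 1) - Gp (int i + 1, int j) \<noteq> 0" "Gp (int i, int j + 1) - Gp (int i + 1, int j) \<noteq> 0"
      if "i + j + 2 \<le> n" for i j
      using conjunct1[OF conjunct2[OF down[OF that]]] by auto
    \<comment> \<open>Here and in b', all intermediate chords cancel: the steps built from the
      shapes of G carry one chord of G to the next.\<close>
    have a': "step_right \<sigma>' \<delta>' i j * E' i j = E' (Suc i) j" if ij: "i + j + 2 \<le> n" for i j
    proof -
      have e1: "E' i j \<noteq> 0" "E' (Suc i) j \<noteq> 0" using E'low(2) ij by auto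
      define g0 g1 g2 g3 g4 where "g0 = Gp (int i, int j)" and "g1 = Gp (int i + 1, int j)" and "g2 = Gp (int i, int j + 1)"
        and "g3 = Gp (int i + 1, int j + 1)" and "g4 = Gp (int i + 2, int j)"
      note gs = g0_def g1_def g2_def g3_def g4_def
      have nz: "g1 - g0 \<noteq> 0" "g4 - g1 \<noteq> 0" "g3 - g1 \<noteq> 0" "g2 - g1 \<noteq> 0"
        using e1 nzG[OF ij] unfolding E'_def gs by (simp_all add: algebra_simps)
      have "step_right \<sigma>' \<delta>' i j * E' i j = ((g2 - g0) / (g1 - g0) - 1) / ((g2 - g1) / (g3 - g1) * ((g3 - g1) / (g4 - g1))) * (g1 - g0)"
        unfolding step_right_def \<sigma>'_def \<delta>'_def E'_def gs by (simp add: algebra_simps)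
      also have "(g2 - g0) / (g1 - g0) - 1 = (g2 - g1) / (g1 - g0)" using nz by (simp add: field_simps)
      also have "(g2 - g1) / (g1 - g0) / ((g2 - g1) / (g3 - g1) * ((g3 - g1) / (g4 - g1))) * (g1 - g0) = g4 - g1"
        using nz by simp
      also have "\<dots> = E' (Suc i) j" unfolding E'_def gs by (simp add: algebra_simps)
      finally show ?thesis .
    qed
    have b': "step_up \<sigma>' \<delta>' i j * E' i j = E' i (Suc j)" if ij: "i + j + 2 \<le> n" for i j
    proof -
      have e1: "E' i j \<noteq> 0" using E'low(2) ij by auto
      define g0 g1 g2 g3 where "g0 = Gp (int i, int j)" and "g1 = Gp (int i + 1, int j)" and "g2 = Gp (int i, int j + 1)"
        and "g3 = Gp (int i + 1, int j + 1)"
      note gs = g0_def g1_def g2_def g3_def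
      have nz: "g1 - g0 \<noteq> 0" "g3 - g1 \<noteq> 0" "g2 - g1 \<noteq> 0"
        using e1 nzG[OF ij] unfolding E'_def gs by simp_all
      have "step_up \<sigma>' \<delta>' i j * E' i j = ((g2 - g0) / (g1 - g0) - 1) * (1 / ((g2 - g1) / (g3 - g1)) - 1) * (g1 - g0)"
        unfolding step_up_def \<sigma>'_def \<delta>'_def E'_def gs by simp
      also have "(g2 - g0) / (g1 - g0) - 1 = (g2 - g1) / (g1 - g0)" using nz by (simp add: field_simps)
      also have "1 / ((g2 - g1) / (g3 - g1)) - 1 = (g3 - g2) / (g2 - g1)" using nz by (simp add: field_simps)
      also have "(g2 - g1) / (g1 - g0) * ((g3 - g2) / (g2 - g1)) * (g1 - g0) = g3 - g2" using nz by simp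
      also have "\<dots> = E' i (Suc j)" unfolding E'_def gs by (simp add: algebra_simps)
      finally show ?thesis .
    qed
    have rel: "cmod (step_right \<sigma> \<delta> i j - step_right \<sigma>' \<delta>' i j) \<le> \<eta> * cmod (step_right \<sigma>' \<delta>' i j)"
      "cmod (step_up \<sigma> \<delta> i j - step_up \<sigma>' \<delta>' i j) \<le> \<eta> * cmod (step_up \<sigma>' \<delta>' i j)" if ij: "i + j + 2 \<le> n" for i j
    proof -
      have i1: "i + j + 1 \<le> n" "Suc i + j + 1 \<le> n" using ij by auto
      have h: "cmod (\<sigma> i j - \<sigma>' i j) \<le> \<epsilon>" "cmod (\<delta> i j - \<delta>' i j) \<le> \<epsilon>" "cmod (\<sigma> (Suc i) j - \<sigma>' (Suc i) j) \<le> \<epsilon>"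
        "cmod (\<sigma>' i j - hex_root) \<le> 1/10" "cmod (\<delta>' i j - hex_root) \<le> 1/10" "cmod (\<sigma>' (Suc i) j - hex_root) \<le> 1/10"
        using up[OF i1(1)] up[OF i1(2)] down[OF ij] unfolding \<sigma>_def \<sigma>'_def \<delta>_def \<delta>'_def by blast+
      note st = step_relative_error[OF h \<epsilon>(2)]
      show "cmod (step_right \<sigma> \<delta> i j - step_right \<sigma>' \<delta>' i j) \<le> \<eta> * cmod (step_right \<sigma>' \<delta>' i j)"
        unfolding step_right_def by (rule order_trans[OF st(1) mult_right_mono[OF \<eta>(2) norm_ge_zero]])
      show "cmod (step_up \<sigma> \<delta> i j - step_up \<sigma>' \<delta>' i j) \<le> \<eta> * cmod (step_up \<sigma>' \<delta>' i j)"
        unfolding step_up_def by (rule order_trans[OF st(2) mult_right_mono[OF \<eta>(2) norm_ge_zero]])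
    qed
    have drift: "cmod (E i j - E' i j) \<le> C1 * \<kappa>" if ij: "i + j + 1 \<le> n" for i j
    proof -
      have "cmod (E i j - E' i j) \<le> ((1 + \<eta>) ^ (i + j + 1) - 1) * cmod (E' i j)"
        using Ex(3,4) a' b' rel E0 \<eta>(1) ij
        by (intro product_drift[of n E "step_right \<sigma> \<delta>" E' "step_right \<sigma>' \<delta>'" \<eta> "step_up \<sigma> \<delta>" "step_up \<sigma>' \<delta>'"]) simp_all
      also have "\<dots> \<le> (4 * (real n * \<eta>)) * ((M + B) / real n)"
        using power_1_plus_le[OF \<eta>(1,3) ij] E'low(3)[OF ij] \<eta>(1) by (intro mult_mono) auto
      also have "\<dots> = C1 * \<kappa>" unfolding \<eta>(4) C1_def \<kappa>_def by (simp add: power2_eq_square)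
      finally show ?thesis .
    qed
    have drift2: "cmod (\<sigma> i j * E i j - (Gp (int i, int j + 1) - Gp (int i, int j))) \<le> C * \<kappa>" if ij: "i + j + 1 \<le> n" for i j
    proof -
      have s': "cmod (\<sigma>' i j - hex_root) \<le> 1/10" "cmod (\<sigma> i j - \<sigma>' i j) \<le> \<epsilon>"
        using up[OF ij] unfolding \<sigma>'_def \<sigma>_def by blast+
      have "cmod (\<sigma> i j) \<le> cmod hex_root + cmod (\<sigma>' i j - hex_root) + cmod (\<sigma> i j - \<sigma>' i j)"
        using norm_triangle_ineq[of hex_root "\<sigma>' i j - hex_root"] norm_triangle_ineq[of "\<sigma>' i j" "\<sigma> i j - \<sigma>' i j"] by simp
      then have \<sigma>2: "cmod (\<sigma> i j) \<le> 2" using s' \<epsilon>(2) by simp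
      have "Gp (int i, int j + 1) - Gp (int i, int j) = \<sigma>' i j * E' i j" using E'low(2)[OF ij] by (simp add: \<sigma>'_def E'_def)
      then have "\<sigma> i j * E i j - (Gp (int i, int j + 1) - Gp (int i, int j)) = \<sigma> i j * (E i j - E' i j) + (\<sigma> i j - \<sigma>' i j) * E' i j"
        by (simp add: algebra_simps)
      then have "cmod (\<sigma> i j * E i j - (Gp (int i, int j + 1) - Gp (int i, int j))) \<le> cmod (\<sigma> i j) * cmod (E i j - E' i j) + cmod (\<sigma> i j - \<sigma>' i j) * cmod (E' i j)"
        by (metis norm_mult norm_triangle_ineq)
      also have "\<dots> \<le> 2 * (C1 * \<kappa>) + \<epsilon> * ((M + B) / real n)"
        using \<sigma>2 drift[OF ij] s'(2) E'low(3)[OF ij] \<epsilon>(1) by (intro add_mono mult_mono) auto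
      also have "\<dots> \<le> 2 * (C1 * \<kappa>) + \<epsilon> * (M + B)"
      proof -
        have "(M + B) / real n \<le> (M + B) / 1" using MB n1 by (intro divide_left_mono) auto
        from mult_left_mono[OF this \<epsilon>(1)] show ?thesis by simp
      qed
      also have "\<dots> = C * \<kappa>" by (simp add: C_def \<epsilon>_def algebra_simps)
      finally show ?thesis .
    qed
    have drift1: "cmod (E i j - E' i j) \<le> C * \<kappa>" if ij: "i + j + 1 \<le> n" for i j
    proof -
      have "0 \<le> K * (M + B)" using K(1) MB by simp
      then have "C1 \<le> C" using C1 unfolding C_def by linarith
      then have "C1 * \<kappa> \<le> C * \<kappa>" using \<kappa> by (intro mult_right_mono) auto
      with drift[OF ij] show ?thesis by linarith
    qed
    have E0len: "(cmod (E 0 0))\<^sup>2 = \<kappa> * S (0, 0) (1, 0)" if "n \<ge> 1"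
    proof -
      have "E' 0 0 \<noteq> 0" using E'low(2)[of 0 0] that by simp
      then have "cmod (E 0 0) = sqrt (S (0, 0) (1, 0)) / real n"
        using Spos[of "(0, 0)" "(1, 0)"] n0 by (simp add: Ex(1) e0_def norm_mult norm_divide)
      then show ?thesis using Spos[of "(0, 0)" "(1, 0)"] by (simp add: power_divide \<kappa>_def)
    qed
    have len: "(cmod (E i j))\<^sup>2 = \<kappa> * S (int i, int j) (int i + 1, int j)"
      "(cmod (\<sigma> i j * E i j))\<^sup>2 = \<kappa> * S (int i, int j) (int i, int j + 1)"
      "(cmod (\<sigma> i j * E i j - E i j))\<^sup>2 = \<kappa> * S (int i + 1, int j) (int i, int j + 1)" if "i + j + 1 \<le> n" for i j
      using developed_lengths[of n S E \<kappa> i j] nd E0len Ex(3,4) that unfolding \<sigma>_def \<delta>_def by blast+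
    \<comment> \<open>Negative indices are sent to 0 by \<open>nat\<close>; only values on the grid
      are used.\<close>
    define X where "X = (\<lambda>v :: int \<times> int. x (nat (fst v)) (nat (snd v)))"
    have Xn: "X (int i, int j) = x i j" "X (int i + 1, int j) = x (Suc i) j" "X (int i, int j + 1) = x i (Suc j)"
      "X (int i + 1, int j + 1) = x (Suc i) (Suc j)" for i j
      by (simp_all add: X_def nat_add_distrib)
    have A: "X (int i + 1, int j) - X (int i, int j) = E i j" "X (int i, int j + 1) - X (int i, int j) = \<sigma> i j * E i j"
      "X (int i, int j + 1) - X (int i + 1, int j) = \<sigma> i j * E i j - E i j" if "i + j + 1 \<le> n" for i j
      using Ex(5)[OF that] Ex(6)[OF that] unfolding Xn by (simp_all add: algebra_simps)
    have E_nz: "E i j \<noteq> 0" if "i + j + 1 \<le> n" for i j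
    proof -
      have "(cmod (E i j))\<^sup>2 > 0" unfolding len(1)[OF that] using \<kappa>(2) Spos by simp
      then show ?thesis by auto
    qed
    have orient: "Im ((X (int i, int j + 1) - X (int i, int j)) / (X (int i + 1, int j) - X (int i, int j))) > 0" if "i + j + 1 \<le> n" for i j
      unfolding A[OF that] using E_nz[OF that] ratio_nz(3)[OF nd that] by (simp add: \<sigma>_def)
    have orient': "Im ((X (int i, int j + 1) - X (int i + 1, int j)) / (X (int i + 1, int j + 1) - X (int i + 1, int j))) > 0" if ij: "i + j + 2 \<le> n" for i j
    proof -
      have i1: "i + j + 1 \<le> n" "Suc i + j + 1 \<le> n" using ij by auto
      have nz: "\<sigma> (Suc i) j \<noteq> 0" "\<delta> i j \<noteq> 0" "\<sigma> i j - 1 \<noteq> 0"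
        using ratio_nz(1)[OF nd i1(2)] ratio_nz(4)[OF nd ij] ratio_nz(2)[OF nd i1(1)] by (auto simp: \<sigma>_def \<delta>_def)
      have "X (int i + 1, int j + 1) - X (int i + 1, int j) = \<sigma> (Suc i) j * E (Suc i) j"
        using Ex(6)[OF i1(2)] unfolding Xn by simp
      also have "\<dots> = (\<sigma> i j - 1) / \<delta> i j * E i j" using nz by (simp add: Ex(3)[OF ij] step_right_def)
      finally have 1: "X (int i + 1, int j + 1) - X (int i + 1, int j) = (\<sigma> i j - 1) * E i j / \<delta> i j" by simp
      have 2: "X (int i, int j + 1) - X (int i + 1, int j) = (\<sigma> i j - 1) * E i j" unfolding A(3)[OF i1(1)] by (simp add: algebra_simps)
      have "(X (int i, int j + 1) - X (int i + 1, int j)) / (X (int i + 1, int j + 1) - X (int i + 1, int j)) = \<delta> i j"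
        unfolding 1 2 using nz E_nz[OF i1(1)] by simp
      moreover have "Im (\<delta> i j) > 0"
        using nondegenerateD(6,9)[OF nd ij] tri_ratio_nz(1) unfolding \<delta>_def down_ratio_def Let_def by blast
      ultimately show ?thesis by simp
    qed
    show "\<exists>w x. x (0, 0) = G A \<and>
      (\<forall>v\<in>inner_grid n. angle_sum (1 / (real n)\<^sup>2) w v = 2 * pi) \<and>
      (\<forall>i j :: nat. i + j + 1 \<le> n \<longrightarrow>
        (cmod (x (int i + 1, int j) - x (int i, int j)))\<^sup>2 = 1 / (real n)\<^sup>2 * edge_sq (1 / (real n)\<^sup>2) (w (int i, int j)) (w (int i + 1, int j)) \<and>
        (cmod (x (int i, int j + 1) - x (int i, int j)))\<^sup>2 = 1 / (real n)\<^sup>2 * edge_sq (1 / (real n)\<^sup>2) (w (int i, int j)) (w (int i, int j + 1)) \<and>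
        (cmod (x (int i, int j + 1) - x (int i + 1, int j)))\<^sup>2 = 1 / (real n)\<^sup>2 * edge_sq (1 / (real n)\<^sup>2) (w (int i + 1, int j)) (w (int i, int j + 1)) \<and>
        Im ((x (int i, int j + 1) - x (int i, int j)) / (x (int i + 1, int j) - x (int i, int j))) > 0 \<and>
        cmod ((x (int i + 1, int j) - x (int i, int j)) - (G (pt n (int i + 1, int j)) - G (pt n (int i, int j)))) \<le> C / (real n)\<^sup>2 \<and>
        cmod ((x (int i, int j + 1) - x (int i, int j)) - (G (pt n (int i, int j + 1)) - G (pt n (int i, int j)))) \<le> C / (real n)\<^sup>2) \<and>
      (\<forall>i j :: nat. i + j + 2 \<le> n \<longrightarrow>
        Im ((x (int i, int j + 1) - x (int i + 1, int j)) / (x (int i + 1, int j + 1) - x (int i + 1, int j))) > 0)"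
    proof (intro exI[of _ w] exI[of _ X] conjI allI impI ballI)
      show "X (0, 0) = G A" by (simp add: X_def Ex(2))
      fix i j assume ij: "i + j + 1 \<le> n"
      show "(cmod (X (int i + 1, int j) - X (int i, int j)))\<^sup>2 = 1 / (real n)\<^sup>2 * edge_sq (1 / (real n)\<^sup>2) (w (int i, int j)) (w (int i + 1, int j))"
        unfolding A[OF ij] using len(1)[OF ij] unfolding S_def \<kappa>_def .
      show "(cmod (X (int i, int j + 1) - X (int i, int j)))\<^sup>2 = 1 / (real n)\<^sup>2 * edge_sq (1 / (real n)\<^sup>2) (w (int i, int j)) (w (int i, int j + 1))"
        unfolding A[OF ij] using len(2)[OF ij] unfolding S_def \<kappa>_def .
      show "(cmod (X (int i, int j + 1) - X (int i + 1, int j)))\<^sup>2 = 1 / (real n)\<^sup>2 * edge_sq (1 / (real n)\<^sup>2) (w (int i + 1, int j)) (w (int i, int j + 1))"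
        unfolding A[OF ij] using len(3)[OF ij] unfolding S_def \<kappa>_def .
      show "cmod ((X (int i + 1, int j) - X (int i, int j)) - (G (pt n (int i + 1, int j)) - G (pt n (int i, int j)))) \<le> C / (real n)\<^sup>2"
        unfolding A[OF ij] using drift1[OF ij] by (simp add: E'_def Gp_def \<kappa>_def)
      show "cmod ((X (int i, int j + 1) - X (int i, int j)) - (G (pt n (int i, int j + 1)) - G (pt n (int i, int j)))) \<le> C / (real n)\<^sup>2"
        unfolding A[OF ij] using drift2[OF ij] by (simp add: Gp_def \<kappa>_def)
    qed (rule w(2) orient orient' | assumption)+
  qed
qed

end

section \<open>Curvature on the triangular grid\<close>

definition up_face :: "int \<Rightarrow> int \<Rightarrow> (int \<times> int) set"
  where "up_face i j = {(i, j), (i + 1, j), (i, j + 1)}"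

definition down_face :: "int \<Rightarrow> int \<Rightarrow> (int \<times> int) set"
  where "down_face i j = {(i + 1, j), (i + 1, j + 1), (i, j + 1)}"

definition grid_faces :: "nat \<Rightarrow> (int \<times> int) set set"
  where "grid_faces n = {up_face i j | i j. 0 \<le> i \<and> 0 \<le> j \<and> i + j + 1 \<le> int n}
    \<union> {down_face i j | i j. 0 \<le> i \<and> 0 \<le> j \<and> i + j + 2 \<le> int n}"

lemma up_face_inject [simp]: "up_face i j = up_face a b \<longleftrightarrow> i = a \<and> j = b"
proof
  assume eq: "up_face i j = up_face a b"
  have "(i, j) \<in> up_face a b" unfolding eq[symmetric] by (simp add: up_face_def)
  moreover have "(a, b) \<in> up_face i j" unfolding eq by (simp add: up_face_def)
  ultimately show "i = a \<and> j = b" by (auto simp: up_face_def)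
qed simp

lemma down_face_inject [simp]: "down_face i j = down_face a b \<longleftrightarrow> i = a \<and> j = b"
proof
  assume eq: "down_face i j = down_face a b"
  have "(i + 1, j + 1) \<in> down_face a b" unfolding eq[symmetric] by (simp add: down_face_def)
  moreover have "(a + 1, b + 1) \<in> down_face i j" unfolding eq by (simp add: down_face_def)
  ultimately show "i = a \<and> j = b" by (auto simp: down_face_def)
qed simp

lemma up_neq_down [simp]: "up_face i j \<noteq> down_face a b" "down_face a b \<noteq> up_face i j"
proof -
  show "up_face i j \<noteq> down_face a b"
  proof
    assume eq: "up_face i j = down_face a b"
    have "(i, j) \<in> down_face a b" "(i + 1, j) \<in> down_face a b" "(i, j + 1) \<in> down_face a b"
      unfolding eq[symmetric] by (simp_all add: up_face_def)
    then show False by (auto simp: down_face_def)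
  qed
  then show "down_face a b \<noteq> up_face i j" by metis
qed

lemma up_face_in_grid [simp]: "up_face i j \<in> grid_faces n \<longleftrightarrow> 0 \<le> i \<and> 0 \<le> j \<and> i + j + 1 \<le> int n"
  by (auto simp: grid_faces_def)

lemma down_face_in_grid [simp]: "down_face i j \<in> grid_faces n \<longleftrightarrow> 0 \<le> i \<and> 0 \<le> j \<and> i + j + 2 \<le> int n"
  by (auto simp: grid_faces_def)

lemma grid_faces_cases:
  assumes "t \<in> grid_faces n"
  obtains (up) i j where "t = up_face i j" "0 \<le> i" "0 \<le> j" "i + j + 1 \<le> int n"
    | (down) i j where "t = down_face i j" "0 \<le> i" "0 \<le> j" "i + j + 2 \<le> int n"
  using assms unfolding grid_faces_def by blast

lemma grid_faces_subset: "t \<in> grid_faces n \<Longrightarrow> t \<subseteq> grid n"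
  by (auto simp: grid_faces_def grid_def up_face_def down_face_def)

lemma finite_grid_faces [simp]: "finite (grid_faces n)"
  by (rule finite_subset[of _ "Pow (grid n)"]) (use grid_faces_subset in auto)

lemma card_grid_face: "t \<in> grid_faces n \<Longrightarrow> card t = 3"
  by (auto simp: grid_faces_def up_face_def down_face_def)

text \<open>The six candidates around a vertex, filtered by membership. In this form inner, side and
  corner vertices differ only in which candidates survive the arithmetic.\<close>

lemma faces_at:
  "{t \<in> grid_faces n. (i, j) \<in> t} = {t \<in> {up_face i j, up_face (i - 1) j, up_face i (j - 1),
     down_face (i - 1) j, down_face i (j - 1), down_face (i - 1) (j - 1)}. t \<in> grid_faces n}"
proof -
  have "t \<in> {up_face i j, up_face (i - 1) j, up_face i (j - 1),
     down_face (i - 1) j, down_face i (j - 1), down_face (i - 1) (j - 1)}" if "t \<in> grid_faces n" "(i, j) \<in> t" for t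
    using that(1)
  proof (cases rule: grid_faces_cases)
    case (up a b)
    from that(2) consider "a = i" "b = j" | "a = i - 1" "b = j" | "a = i" "b = j - 1"
      unfolding up by (auto simp: up_face_def)
    then show ?thesis unfolding up by cases simp_all
  next
    case (down a b)
    from that(2) consider "a = i - 1" "b = j" | "a = i" "b = j - 1" | "a = i - 1" "b = j - 1"
      unfolding down by (auto simp: down_face_def)
    then show ?thesis unfolding down by cases simp_all
  qed
  moreover have "(i, j) \<in> t" if "t \<in> {up_face i j, up_face (i - 1) j, up_face i (j - 1),
     down_face (i - 1) j, down_face i (j - 1), down_face (i - 1) (j - 1)}" for t
    using that by (elim insertE emptyE) (simp_all add: up_face_def down_face_def)
  ultimately show ?thesis by blast
qed

lemma vertices_of_grid: "n \<ge> 1 \<Longrightarrow> vertices_of (grid_faces n) = grid n"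
proof
  show "vertices_of (grid_faces n) \<subseteq> grid n" using grid_faces_subset by (auto simp: vertices_of_def)
  assume n: "n \<ge> 1"
  show "grid n \<subseteq> vertices_of (grid_faces n)"
  proof
    fix v assume "v \<in> grid n"
    then obtain i j where v: "v = (i, j)" and g: "0 \<le> i" "0 \<le> j" "i + j \<le> int n" by (auto simp: grid_def)
    consider "i + j + 1 \<le> int n" | "i + j = int n" "1 \<le> i" | "i + j = int n" "i = 0" using g by linarith
    then show "v \<in> vertices_of (grid_faces n)"
    proof cases
      case 1
      then have "up_face i j \<in> grid_faces n" using g by simp
      moreover have "v \<in> up_face i j" by (simp add: v up_face_def)
      ultimately show ?thesis unfolding vertices_of_def by blast
    next
      case 2
      then have "up_face (i - 1) j \<in> grid_faces n" using g by simp
      moreover have "v \<in> up_face (i - 1) j" by (simp add: v up_face_def)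
      ultimately show ?thesis unfolding vertices_of_def by blast
    next
      case 3
      then have "up_face i (j - 1) \<in> grid_faces n" using g n by simp
      moreover have "v \<in> up_face i (j - 1)" by (simp add: v up_face_def)
      ultimately show ?thesis unfolding vertices_of_def by blast
    qed
  qed
qed

lemma card_2_subset_3:
  assumes "card e = 2" "e \<subseteq> {a, b, c}"
  shows "e = {a, b} \<or> e = {a, c} \<or> e = {b, c}"
proof -
  obtain x y where "e = {x, y}" "x \<noteq> y" using assms(1) by (auto simp: card_2_iff)
  with assms(2) show ?thesis by auto
qed

text \<open>Upward faces alone suffice, because every side of a downward face is also a side of an
  upward one.\<close>

lemma edges_of_grid:
  "edges_of (grid_faces n) = {e. \<exists>i j. 0 \<le> i \<and> 0 \<le> j \<and> i + j + 1 \<le> int n \<and>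
     (e = {(i, j), (i + 1, j)} \<or> e = {(i, j), (i, j + 1)} \<or> e = {(i + 1, j), (i, j + 1)})}" (is "_ = ?R")
proof
  show "edges_of (grid_faces n) \<subseteq> ?R"
  proof
    fix e assume "e \<in> edges_of (grid_faces n)"
    then obtain t where e: "card e = 2" "e \<subseteq> t" and t: "t \<in> grid_faces n" by (auto simp: edges_of_def)
    from t show "e \<in> ?R"
    proof (cases rule: grid_faces_cases)
      case (up i j)
      then show ?thesis using card_2_subset_3[OF e(1)] e(2) unfolding up_face_def by blast
    next
      case (down i j)
      then consider "e = {(i + 1, j), (i + 1, j + 1)}" | "e = {(i + 1, j), (i, j + 1)}" | "e = {(i + 1, j + 1), (i, j + 1)}"
        using card_2_subset_3[OF e(1)] e(2) unfolding down_face_def by blast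
      then show ?thesis
      proof cases
        case 1
        then have "0 \<le> i + 1 \<and> 0 \<le> j \<and> (i + 1) + j + 1 \<le> int n \<and> e = {(i + 1, j), (i + 1, j + 1)}" using down(2-4) by simp
        then show ?thesis by blast
      next
        case 2
        then have "0 \<le> i \<and> 0 \<le> j \<and> i + j + 1 \<le> int n \<and> e = {(i + 1, j), (i, j + 1)}" using down(2-4) by simp
        then show ?thesis by blast
      next
        case 3
        then have "0 \<le> i \<and> 0 \<le> j + 1 \<and> i + (j + 1) + 1 \<le> int n \<and> e = {(i, j + 1), (i + 1, j + 1)}"
          using down(2-4) by (simp add: insert_commute)
        then show ?thesis by blast
      qed
    qed
  qed
  show "?R \<subseteq> edges_of (grid_faces n)"
  proof
    fix e assume "e \<in> ?R"
    then obtain i j where ij: "0 \<le> i" "0 \<le> j" "i + j + 1 \<le> int n"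
      and e: "e = {(i, j), (i + 1, j)} \<or> e = {(i, j), (i, j + 1)} \<or> e = {(i + 1, j), (i, j + 1)}" by blast
    have "card e = 2" "e \<subseteq> up_face i j" using e by (auto simp: up_face_def)
    moreover have "up_face i j \<in> grid_faces n" using ij by simp
    ultimately show "e \<in> edges_of (grid_faces n)" unfolding edges_of_def by blast
  qed
qed

lemma faces_containing:
  "{t \<in> grid_faces n. {(i, j), (i + 1, j)} \<subseteq> t} = {t \<in> {up_face i j, down_face i (j - 1)}. t \<in> grid_faces n}"
  "{t \<in> grid_faces n. {(i, j), (i, j + 1)} \<subseteq> t} = {t \<in> {up_face i j, down_face (i - 1) j}. t \<in> grid_faces n}"
  "{t \<in> grid_faces n. {(i + 1, j), (i, j + 1)} \<subseteq> t} = {t \<in> {up_face i j, down_face i j}. t \<in> grid_faces n}"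
proof -
  have c: "{t \<in> grid_faces n. e \<subseteq> t} = {t \<in> X. t \<in> grid_faces n}"
    if "\<And>a b. e \<subseteq> up_face a b \<Longrightarrow> up_face a b \<in> X" "\<And>a b. e \<subseteq> down_face a b \<Longrightarrow> down_face a b \<in> X"
      "\<And>t. t \<in> X \<Longrightarrow> e \<subseteq> t" for e X
  proof -
    have "t \<in> X" if "t \<in> grid_faces n" "e \<subseteq> t" for t
      using that by (cases rule: grid_faces_cases) (use \<open>\<And>a b. e \<subseteq> up_face a b \<Longrightarrow> up_face a b \<in> X\<close>
        \<open>\<And>a b. e \<subseteq> down_face a b \<Longrightarrow> down_face a b \<in> X\<close> in blast)+
    with that(3) show ?thesis by blast
  qed
  show "{t \<in> grid_faces n. {(i, j), (i + 1, j)} \<subseteq> t} = {t \<in> {up_face i j, down_face i (j - 1)}. t \<in> grid_faces n}"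
  proof (rule c)
    fix a b
    show "up_face a b \<in> {up_face i j, down_face i (j - 1)}" if "{(i, j), (i + 1, j)} \<subseteq> up_face a b"
    proof -
      have "a = i" "b = j" using that unfolding up_face_def insert_subset by auto
      then show ?thesis by simp
    qed
    show "down_face a b \<in> {up_face i j, down_face i (j - 1)}" if "{(i, j), (i + 1, j)} \<subseteq> down_face a b"
    proof -
      have "down_face a b = down_face i (j - 1)" using that unfolding down_face_inject unfolding down_face_def insert_subset by auto
      then show ?thesis by simp
    qed
  next
    fix t assume "t \<in> {up_face i j, down_face i (j - 1)}"
    then show "{(i, j), (i + 1, j)} \<subseteq> t" by (elim insertE emptyE) (simp_all add: up_face_def down_face_def)
  qed
  show "{t \<in> grid_faces n. {(i, j), (i, j + 1)} \<subseteq> t} = {t \<in> {up_face i j, down_face (i - 1) j}. t \<in> grid_faces n}"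
  proof (rule c)
    fix a b
    show "up_face a b \<in> {up_face i j, down_face (i - 1) j}" if "{(i, j), (i, j + 1)} \<subseteq> up_face a b"
    proof -
      have "a = i" "b = j" using that unfolding up_face_def insert_subset by auto
      then show ?thesis by simp
    qed
    show "down_face a b \<in> {up_face i j, down_face (i - 1) j}" if "{(i, j), (i, j + 1)} \<subseteq> down_face a b"
    proof -
      have "down_face a b = down_face (i - 1) j" using that unfolding down_face_inject unfolding down_face_def insert_subset by auto
      then show ?thesis by simp
    qed
  next
    fix t assume "t \<in> {up_face i j, down_face (i - 1) j}"
    then show "{(i, j), (i, j + 1)} \<subseteq> t" by (elim insertE emptyE) (simp_all add: up_face_def down_face_def)
  qed
  show "{t \<in> grid_faces n. {(i + 1, j), (i, j + 1)} \<subseteq> t} = {t \<in> {up_face i j, down_face i j}. t \<in> grid_faces n}"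
  proof (rule c)
    fix a b
    show "up_face a b \<in> {up_face i j, down_face i j}" if "{(i + 1, j), (i, j + 1)} \<subseteq> up_face a b"
    proof -
      have "a = i" "b = j" using that unfolding up_face_def insert_subset by auto
      then show ?thesis by simp
    qed
    show "down_face a b \<in> {up_face i j, down_face i j}" if "{(i + 1, j), (i, j + 1)} \<subseteq> down_face a b"
    proof -
      have "down_face a b = down_face i j" using that unfolding down_face_inject unfolding down_face_def insert_subset by auto
      then show ?thesis by simp
    qed
  next
    fix t assume "t \<in> {up_face i j, down_face i j}"
    then show "{(i + 1, j), (i, j + 1)} \<subseteq> t" by (elim insertE emptyE) (simp_all add: up_face_def down_face_def)
  qed
qed

text \<open>Every edge has its upward face; it is a boundary edge exactly when the downward
  candidate of \<open>faces_containing\<close> falls outside the grid.\<close>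

lemma boundary_edge_iff:
  assumes "0 \<le> i" "0 \<le> j" "i + j + 1 \<le> int n"
  shows "{(i, j), (i + 1, j)} \<in> boundary_edges (grid_faces n) \<longleftrightarrow> j = 0"
    "{(i, j), (i, j + 1)} \<in> boundary_edges (grid_faces n) \<longleftrightarrow> i = 0"
    "{(i + 1, j), (i, j + 1)} \<in> boundary_edges (grid_faces n) \<longleftrightarrow> i + j + 1 = int n"
proof -
  have edge: "{(i, j), (i + 1, j)} \<in> edges_of (grid_faces n)" "{(i, j), (i, j + 1)} \<in> edges_of (grid_faces n)"
    "{(i + 1, j), (i, j + 1)} \<in> edges_of (grid_faces n)"
    using assms unfolding edges_of_grid by blast+
  have c: "card {t \<in> {a, b}. t \<in> grid_faces n} = (if b \<in> grid_faces n then 2 else 1)"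
    if "a \<in> grid_faces n" "a \<noteq> b" for a b
  proof -
    have "{t \<in> {a, b}. t \<in> grid_faces n} = (if b \<in> grid_faces n then {a, b} else {a})" using that(1) by auto
    then show ?thesis using that(2) by simp
  qed
  have u: "up_face i j \<in> grid_faces n" using assms by simp
  show "{(i, j), (i + 1, j)} \<in> boundary_edges (grid_faces n) \<longleftrightarrow> j = 0"
    unfolding boundary_edges_def mem_Collect_eq faces_containing c[OF u up_neq_down(1)] using edge(1) assms by simp
  show "{(i, j), (i, j + 1)} \<in> boundary_edges (grid_faces n) \<longleftrightarrow> i = 0"
    unfolding boundary_edges_def mem_Collect_eq faces_containing c[OF u up_neq_down(1)] using edge(2) assms by simp
  show "{(i + 1, j), (i, j + 1)} \<in> boundary_edges (grid_faces n) \<longleftrightarrow> i + j + 1 = int n"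
    unfolding boundary_edges_def mem_Collect_eq faces_containing c[OF u up_neq_down(1)] using edge(3) assms by simp
qed

lemma boundary_vertices_grid:
  assumes n: "n \<ge> 1"
  shows "boundary_vertices (grid_faces n) = grid n - inner_grid n"
proof
  show "boundary_vertices (grid_faces n) \<subseteq> grid n - inner_grid n"
  proof
    fix v assume "v \<in> boundary_vertices (grid_faces n)"
    then obtain e where e: "e \<in> boundary_edges (grid_faces n)" "v \<in> e" unfolding boundary_vertices_def by blast
    then have "e \<in> edges_of (grid_faces n)" by (simp add: boundary_edges_def)
    then obtain i j where ij: "0 \<le> i" "0 \<le> j" "i + j + 1 \<le> int n"
      and cs: "e = {(i, j), (i + 1, j)} \<or> e = {(i, j), (i, j + 1)} \<or> e = {(i + 1, j), (i, j + 1)}"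
      unfolding edges_of_grid by blast
    from cs show "v \<in> grid n - inner_grid n"
    proof (elim disjE)
      assume "e = {(i, j), (i + 1, j)}"
      then show ?thesis using e ij boundary_edge_iff(1)[OF ij] by (auto simp: grid_def inner_grid_def)
    next
      assume "e = {(i, j), (i, j + 1)}"
      then show ?thesis using e ij boundary_edge_iff(2)[OF ij] by (auto simp: grid_def inner_grid_def)
    next
      assume "e = {(i + 1, j), (i, j + 1)}"
      then show ?thesis using e ij boundary_edge_iff(3)[OF ij] by (auto simp: grid_def inner_grid_def)
    qed
  qed
  show "grid n - inner_grid n \<subseteq> boundary_vertices (grid_faces n)"
  proof
    fix v assume v: "v \<in> grid n - inner_grid n"
    obtain i j where ij: "v = (i, j)" by fastforce
    have g: "0 \<le> i" "0 \<le> j" "i + j \<le> int n" and b: "i = 0 \<or> j = 0 \<or> i + j = int n"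
      using v by (auto simp: ij grid_def inner_grid_def)
    have mem: "v \<in> boundary_vertices (grid_faces n)" if "e \<in> boundary_edges (grid_faces n)" "v \<in> e" for e
      using that unfolding boundary_vertices_def by blast
    consider "j = 0" "i + 1 \<le> int n" | "j = 0" "i = int n" | "i = 0" "j + 1 \<le> int n" | "i = 0" "j = int n"
      | "i + j = int n" "1 \<le> i" using g b n by linarith
    then show "v \<in> boundary_vertices (grid_faces n)"
    proof cases
      case 1
      then show ?thesis using g boundary_edge_iff(1)[of i j n] by (intro mem[of "{(i, j), (i + 1, j)}"]) (auto simp: ij)
    next
      case 2
      then show ?thesis using g n boundary_edge_iff(1)[of "i - 1" j n] by (intro mem[of "{(i - 1, j), (i, j)}"]) (auto simp: ij)
    next
      case 3
      then show ?thesis using g boundary_edge_iff(2)[of i j n] by (intro mem[of "{(i, j), (i, j + 1)}"]) (auto simp: ij)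
    next
      case 4
      then show ?thesis using g n boundary_edge_iff(2)[of i "j - 1" n] by (intro mem[of "{(i, j - 1), (i, j)}"]) (auto simp: ij)
    next
      case 5
      then show ?thesis using g boundary_edge_iff(3)[of "i - 1" j n] by (intro mem[of "{(i, j), (i - 1, j + 1)}"]) (auto simp: ij)
    qed
  qed
qed

section \<open>Curvature of packing metrics and of the equilateral metric\<close>

lemma corner_angle_tri_angle:
  assumes "distinct [v, x, y]" "l {v, x} \<ge> 0" "l {v, y} \<ge> 0"
  shows "corner_angle l {v, x, y} v = tri_angle ((l {v, x})\<^sup>2) ((l {v, y})\<^sup>2) ((l {x, y})\<^sup>2)"
  unfolding corner_angle_eq[OF assms(1)] tri_angle_def using assms(2,3) by simp

lemma curvature_inner:
  assumes n: "n \<ge> 1" and v: "v \<in> inner_grid n" and k: "k > 0"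
    and l: "\<And>x y. {x, y} \<in> edges_of (grid_faces n) \<Longrightarrow> l {x, y} \<ge> 0 \<and> (l {x, y})\<^sup>2 = k * edge_sq \<kappa> (w x) (w y)"
  shows "curvature (grid_faces n) l v = 2 * pi - angle_sum \<kappa> w v"
proof -
  obtain i j where ij: "v = (i, j)" by fastforce
  have g: "0 < i" "0 < j" "i + j < int n" using v by (auto simp: ij inner_grid_def)
  have nb: "v \<notin> boundary_vertices (grid_faces n)" using boundary_vertices_grid[OF n] v by blast
  have at: "{t. t \<in> grid_faces n \<and> v \<in> t} = {up_face i j, down_face (i - 1) j, up_face (i - 1) j, down_face (i - 1) (j - 1), up_face i (j - 1), down_face i (j - 1)}"
    unfolding ij faces_at using g by auto
  have c: "corner_angle l t v = weight_angle \<kappa> (w v) (w x) (w y)"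
    if t: "t \<in> grid_faces n" "t = {v, x, y}" "distinct [v, x, y]" for t x y
  proof -
    have ed: "{a, b} \<in> edges_of (grid_faces n)" if "a \<in> t" "b \<in> t" "a \<noteq> b" for a b
      unfolding edges_of_def using t(1) that by (intro CollectI conjI bexI[of _ t]) simp_all
    have e: "{v, x} \<in> edges_of (grid_faces n)" "{v, y} \<in> edges_of (grid_faces n)" "{x, y} \<in> edges_of (grid_faces n)"
      by (rule ed; use t(2,3) in simp)+
    have "corner_angle l {v, x, y} v = tri_angle ((l {v, x})\<^sup>2) ((l {v, y})\<^sup>2) ((l {x, y})\<^sup>2)"
      using l[OF e(1)] l[OF e(2)] by (intro corner_angle_tri_angle t(3)) auto
    then show ?thesis using l[OF e(1)] l[OF e(2)] l[OF e(3)] k by (simp add: t(2) tri_angle_scale weight_angle_def)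
  qed
  have "(\<Sum>t | t \<in> grid_faces n \<and> v \<in> t. corner_angle l t v)
    = corner_angle l (up_face i j) v + corner_angle l (down_face (i - 1) j) v + corner_angle l (up_face (i - 1) j) v
      + corner_angle l (down_face (i - 1) (j - 1)) v + corner_angle l (up_face i (j - 1)) v + corner_angle l (down_face i (j - 1)) v"
    unfolding at by simp
  also have "\<dots> = angle_sum \<kappa> w v"
  proof -
    have "corner_angle l (up_face i j) v = weight_angle \<kappa> (w v) (w (i + 1, j)) (w (i, j + 1))"
      by (rule c, use g in simp, use g in \<open>simp add: ij up_face_def insert_commute\<close>, use g in \<open>simp add: ij\<close>)
    moreover have "corner_angle l (down_face (i - 1) j) v = weight_angle \<kappa> (w v) (w (i, j + 1)) (w (i - 1, j + 1))"
      by (rule c, use g in simp, use g in \<open>simp add: ij down_face_def insert_commute\<close>, use g in \<open>simp add: ij\<close>)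
    moreover have "corner_angle l (up_face (i - 1) j) v = weight_angle \<kappa> (w v) (w (i - 1, j + 1)) (w (i - 1, j))"
      by (rule c, use g in simp, use g in \<open>simp add: ij up_face_def insert_commute\<close>, use g in \<open>simp add: ij\<close>)
    moreover have "corner_angle l (down_face (i - 1) (j - 1)) v = weight_angle \<kappa> (w v) (w (i - 1, j)) (w (i, j - 1))"
      by (rule c, use g in simp, use g in \<open>simp add: ij down_face_def insert_commute\<close>, use g in \<open>simp add: ij\<close>)
    moreover have "corner_angle l (up_face i (j - 1)) v = weight_angle \<kappa> (w v) (w (i, j - 1)) (w (i + 1, j - 1))"
      by (rule c, use g in simp, use g in \<open>simp add: ij up_face_def insert_commute\<close>, use g in \<open>simp add: ij\<close>)
    moreover have "corner_angle l (down_face i (j - 1)) v = weight_angle \<kappa> (w v) (w (i + 1, j - 1)) (w (i + 1, j))"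
      by (rule c, use g in simp, use g in \<open>simp add: ij down_face_def insert_commute\<close>, use g in \<open>simp add: ij\<close>)
    ultimately show ?thesis by (simp add: angle_sum_def ij)
  qed
  finally show ?thesis using nb by (simp add: curvature_def)
qed

lemma corner_angle_equilateral:
  assumes "card t = 3" "v \<in> t" "c > 0"
  shows "corner_angle (\<lambda>_. c) t v = pi / 3"
proof -
  have "finite t" using assms(1) card_ge_0_finite by force
  then have "card (t - {v}) = 2" using assms by simp
  then have "corner_angle (\<lambda>_. c) t v = arccos ((2 * c\<^sup>2 - c\<^sup>2) / (2 * c\<^sup>2))"
    by (simp add: corner_angle_def)
  also have "(2 * c\<^sup>2 - c\<^sup>2) / (2 * c\<^sup>2) = cos (pi / 3)" using assms(3) by (simp add: cos_60)
  also have "arccos (cos (pi / 3)) = pi / 3" by (rule arccos_cos) auto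
  finally show ?thesis .
qed

text \<open>All angles are pi/3, and 6, 3 or 1 faces meet at an inner, side or corner vertex; so
  only the corners keep pi - pi/3.\<close>

lemma curvature_equilateral:
  assumes n: "n \<ge> 1" and c: "c > 0" and v: "v \<in> grid n"
  shows "curvature (grid_faces n) (\<lambda>_. c) v = (if v \<in> {(0, 0), (int n, 0), (0, int n)} then 2 * pi / 3 else 0)"
proof -
  obtain i j where ij: "v = (i, j)" by fastforce
  have g: "0 \<le> i" "0 \<le> j" "i + j \<le> int n" using v by (auto simp: ij grid_def)
  have "(\<Sum>t | t \<in> grid_faces n \<and> v \<in> t. corner_angle (\<lambda>_. c) t v) = (\<Sum>t | t \<in> grid_faces n \<and> v \<in> t. pi / 3)"
    by (intro sum.cong refl corner_angle_equilateral c) (auto simp: card_grid_face)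
  then have k: "curvature (grid_faces n) (\<lambda>_. c) v = (if v \<in> inner_grid n then 2 * pi else pi) - real (card {t \<in> grid_faces n. v \<in> t}) * (pi / 3)"
    using v by (simp add: curvature_def boundary_vertices_grid[OF n])
  define m where "m = int n"
  have "(0 < i \<and> 0 < j \<and> i + j < m) \<or> (j = 0 \<and> 0 < i \<and> i < m) \<or> (i = 0 \<and> 0 < j \<and> j < m)
    \<or> (0 < i \<and> 0 < j \<and> i + j = m) \<or> (i = 0 \<and> j = 0) \<or> (i = m \<and> j = 0) \<or> (i = 0 \<and> j = m)"
    using g unfolding m_def[symmetric] by presburger
  then consider (inner) "0 < i" "0 < j" "i + j < int n" | (bottom) "j = 0" "0 < i" "i < int n" | (left) "i = 0" "0 < j" "j < int n"
    | (diag) "0 < i" "0 < j" "i + j = int n" | (c1) "i = 0" "j = 0" | (c2) "i = int n" "j = 0" | (c3) "i = 0" "j = int n"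
    unfolding m_def by blast
  then show ?thesis
  proof cases
    case inner
    then have "{t \<in> grid_faces n. v \<in> t} = {up_face i j, up_face (i - 1) j, up_face i (j - 1),
     down_face (i - 1) j, down_face i (j - 1), down_face (i - 1) (j - 1)}" unfolding ij faces_at by auto
    then have "card {t \<in> grid_faces n. v \<in> t} = 6" by simp
    moreover have "v \<in> inner_grid n" using inner by (simp add: ij inner_grid_def)
    ultimately show ?thesis using inner k by (simp add: ij)
  next
    case bottom
    then have "{t \<in> grid_faces n. v \<in> t} = {up_face i j, up_face (i - 1) j, down_face (i - 1) j}" unfolding ij faces_at by auto
    then have "card {t \<in> grid_faces n. v \<in> t} = 3" by simp
    then show ?thesis using bottom k by (simp add: ij inner_grid_def)
  next
    case left
    then have "{t \<in> grid_faces n. v \<in> t} = {up_face i j, up_face i (j - 1), down_face i (j - 1)}" unfolding ij faces_at by auto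
    then have "card {t \<in> grid_faces n. v \<in> t} = 3" by simp
    then show ?thesis using left k by (simp add: ij inner_grid_def)
  next
    case diag
    then have "{t \<in> grid_faces n. v \<in> t} = {up_face (i - 1) j, up_face i (j - 1), down_face (i - 1) (j - 1)}" unfolding ij faces_at by auto
    then have "card {t \<in> grid_faces n. v \<in> t} = 3" by simp
    then show ?thesis using diag k by (simp add: ij inner_grid_def)
  next
    case c1
    then have "{t \<in> grid_faces n. v \<in> t} = {up_face i j}" unfolding ij faces_at using n by auto
    then have "card {t \<in> grid_faces n. v \<in> t} = 1" by simp
    then show ?thesis using c1 k by (simp add: ij inner_grid_def)
  next
    case c2
    then have "{t \<in> grid_faces n. v \<in> t} = {up_face (i - 1) j}" unfolding ij faces_at using n by auto
    then have "card {t \<in> grid_faces n. v \<in> t} = 1" by simp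
    then show ?thesis using c2 k by (simp add: ij inner_grid_def)
  next
    case c3
    then have "{t \<in> grid_faces n. v \<in> t} = {up_face i (j - 1)}" unfolding ij faces_at using n by auto
    then have "card {t \<in> grid_faces n. v \<in> t} = 1" by simp
    then show ?thesis using c3 k by (simp add: ij inner_grid_def)
  qed
qed

lemma card_triangle_indices:
  "2 * card {(i :: int, j :: int). 0 \<le> i \<and> 0 \<le> j \<and> i + j < int m} = m * (m + 1)"
proof (induction m)
  case 0
  have "{(i :: int, j :: int). 0 \<le> i \<and> 0 \<le> j \<and> i + j < int 0} = {}" by auto
  then show ?case by (simp only: card.empty)
next
  case (Suc m)
  have eq: "{(i :: int, j :: int). 0 \<le> i \<and> 0 \<le> j \<and> i + j < int (Suc m)}
    = {(i, j). 0 \<le> i \<and> 0 \<le> j \<and> i + j < int m} \<union> (\<lambda>i. (i, int m - i)) ` {0..int m}" by auto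
  have "finite {(i :: int, j :: int). 0 \<le> i \<and> 0 \<le> j \<and> i + j < int m}"
    by (rule finite_subset[of _ "{0..int m} \<times> {0..int m}"]) auto
  then have "card {(i :: int, j :: int). 0 \<le> i \<and> 0 \<le> j \<and> i + j < int (Suc m)}
    = card {(i :: int, j :: int). 0 \<le> i \<and> 0 \<le> j \<and> i + j < int m} + card ((\<lambda>i. (i, int m - i)) ` {0..int m})"
    unfolding eq by (intro card_Un_disjoint) auto
  also have "card ((\<lambda>i. (i, int m - i)) ` {0..int m}) = Suc m" by (subst card_image) (auto simp: inj_on_def)
  finally show ?case using Suc by simp
qed

text \<open>There are n (n + 1) / 2 upward and n (n - 1) / 2 downward faces.\<close>

lemma card_grid_faces: "card (grid_faces n) = n\<^sup>2"
proof (cases n)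
  case 0
  have "grid_faces 0 = {}" by (auto simp: grid_faces_def)
  with 0 show ?thesis by simp
next
  case (Suc m)
  define P where "P = (\<lambda>k. {(i :: int, j :: int). 0 \<le> i \<and> 0 \<le> j \<and> i + j < int k})"
  have fin: "finite (P k)" for k
    unfolding P_def by (rule finite_subset[of _ "{0..int k} \<times> {0..int k}"]) auto
  have "grid_faces n = (\<lambda>(i, j). up_face i j) ` P n \<union> (\<lambda>(i, j). down_face i j) ` P m"
    unfolding grid_faces_def P_def Suc by (auto simp: image_iff)
  then have "card (grid_faces n) = card ((\<lambda>(i, j). up_face i j) ` P n) + card ((\<lambda>(i, j). down_face i j) ` P m)"
    using fin by (simp only:) (intro card_Un_disjoint; auto)
  also have "\<dots> = card (P n) + card (P m)"
    by (subst (1 2) card_image) (auto simp: inj_on_def)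
  finally have "2 * card (grid_faces n) = n * (n + 1) + m * (m + 1)"
    using card_triangle_indices[of n] card_triangle_indices[of m] unfolding P_def by simp
  then show ?thesis using Suc by (simp add: power2_eq_square)
qed

lemma triangle_area_equilateral:
  assumes "card t = 3" "c > 0"
  shows "triangle_area (\<lambda>_. c) t = sqrt 3 / 4 * c\<^sup>2"
proof -
  obtain x y z where t: "t = {x, y, z}" "distinct [x, y, z]" using assms(1) by (auto simp: card_3_iff)
  have "triangle_area (\<lambda>_. c) t = sqrt (3 * c / 2 * ((3 * c / 2 - c) * (3 * c / 2 - c) * (3 * c / 2 - c)))"
    unfolding t(1) by (subst triangle_area_eq[OF t(2), where s = "3 * c / 2"]) auto
  also have "3 * c / 2 * ((3 * c / 2 - c) * (3 * c / 2 - c) * (3 * c / 2 - c)) = 3 * (c\<^sup>2 / 4)\<^sup>2"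
    by (simp add: power2_eq_square field_simps)
  also have "sqrt (3 * (c\<^sup>2 / 4)\<^sup>2) = sqrt 3 / 4 * c\<^sup>2" by (simp add: real_sqrt_mult)
  finally show ?thesis .
qed

section \<open>Invariance of combinatorics, curvature and area under injective relabelling of
  vertices\<close>

context
  fixes \<phi> :: "'v \<Rightarrow> 'w" and F :: "'v set set"
  assumes inj: "inj_on \<phi> (vertices_of F)"
begin

lemma face_in_vertices: "t \<in> F \<Longrightarrow> t \<subseteq> vertices_of F"
  by (auto simp: vertices_of_def)

lemma inj_image_faces: "inj_on ((`) \<phi>) (Pow (vertices_of F))"
  using inj by (rule inj_on_image_Pow)

lemma vertices_of_image: "vertices_of ((`) \<phi> ` F) = \<phi> ` vertices_of F"
  by (auto simp: vertices_of_def)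

lemma edges_of_image: "edges_of ((`) \<phi> ` F) = (`) \<phi> ` edges_of F"
proof
  show "edges_of ((`) \<phi> ` F) \<subseteq> (`) \<phi> ` edges_of F"
  proof
    fix e assume "e \<in> edges_of ((`) \<phi> ` F)"
    then obtain t where e: "card e = 2" "t \<in> F" "e \<subseteq> \<phi> ` t" by (auto simp: edges_of_def)
    then obtain d where d: "d \<subseteq> t" "e = \<phi> ` d" by (auto simp: subset_image_iff)
    have "inj_on \<phi> d" using inj d(1) face_in_vertices[OF e(2)] by (meson inj_on_subset subset_trans)
    then have "card d = 2" using e(1) d(2) by (simp add: card_image)
    with d e(2) show "e \<in> (`) \<phi> ` edges_of F" by (auto simp: edges_of_def)
  qed
  show "(`) \<phi> ` edges_of F \<subseteq> edges_of ((`) \<phi> ` F)"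
  proof
    fix e assume "e \<in> (`) \<phi> ` edges_of F"
    then obtain d t where d: "e = \<phi> ` d" "card d = 2" "t \<in> F" "d \<subseteq> t" by (auto simp: edges_of_def)
    have "inj_on \<phi> d" using inj d(4) face_in_vertices[OF d(3)] by (meson inj_on_subset subset_trans)
    then show "e \<in> edges_of ((`) \<phi> ` F)" using d by (auto simp: edges_of_def card_image)
  qed
qed

lemma edge_in_vertices: "e \<in> edges_of F \<Longrightarrow> e \<subseteq> vertices_of F"
  using face_in_vertices by (auto simp: edges_of_def)

lemma faces_above_image:
  assumes "d \<subseteq> vertices_of F"
  shows "{t \<in> (`) \<phi> ` F. \<phi> ` d \<subseteq> t} = (`) \<phi> ` {t \<in> F. d \<subseteq> t}"
proof -
  have "d \<subseteq> t" if "t \<in> F" "\<phi> ` d \<subseteq> \<phi> ` t" for t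
    using that assms inj face_in_vertices[OF that(1)] by (simp add: inj_on_image_subset_iff)
  then show ?thesis by auto
qed

lemma boundary_vertices_image: "boundary_vertices ((`) \<phi> ` F) = \<phi> ` boundary_vertices F"
proof -
  have "boundary_edges ((`) \<phi> ` F) = (`) \<phi> ` boundary_edges F"
  proof -
    have "card {t \<in> (`) \<phi> ` F. \<phi> ` d \<subseteq> t} = card {t \<in> F. d \<subseteq> t}" if "d \<in> edges_of F" for d
      unfolding faces_above_image[OF edge_in_vertices[OF that]]
      by (rule card_image, rule inj_on_subset[OF inj_image_faces]) (use face_in_vertices in auto)
    then show ?thesis by (auto simp: boundary_edges_def edges_of_image)
  qed
  then show ?thesis by (auto simp: boundary_vertices_def)
qed

lemma corner_angle_image:
  assumes "t \<in> F" "v \<in> t"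
  shows "corner_angle l (\<phi> ` t) (\<phi> v) = corner_angle (\<lambda>e. l (\<phi> ` e)) t v"
proof -
  have i: "inj_on \<phi> t" using inj face_in_vertices[OF assms(1)] by (rule inj_on_subset)
  have "\<phi> ` t - {\<phi> v} = \<phi> ` (t - {v})" using i assms(2) by (auto simp: inj_on_def)
  moreover have "inj_on \<phi> (t - {v})" using i by (rule inj_on_subset) auto
  ultimately show ?thesis by (simp add: corner_angle_def sum.reindex prod.reindex)
qed

lemma curvature_image:
  assumes "v \<in> vertices_of F"
  shows "curvature ((`) \<phi> ` F) l (\<phi> v) = curvature F (\<lambda>e. l (\<phi> ` e)) v"
proof -
  have b: "\<phi> v \<in> boundary_vertices ((`) \<phi> ` F) \<longleftrightarrow> v \<in> boundary_vertices F"
  proof -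
    have "boundary_vertices F \<subseteq> vertices_of F"
      using edge_in_vertices by (auto simp: boundary_vertices_def boundary_edges_def)
    then show ?thesis unfolding boundary_vertices_image using inj assms by (auto simp: inj_on_def)
  qed
  have s: "{t. t \<in> (`) \<phi> ` F \<and> \<phi> v \<in> t} = (`) \<phi> ` {t. t \<in> F \<and> v \<in> t}"
    using faces_above_image[of "{v}"] assms by simp
  have "inj_on ((`) \<phi>) {t. t \<in> F \<and> v \<in> t}"
    by (rule inj_on_subset[OF inj_image_faces]) (use face_in_vertices in auto)
  then show ?thesis
    unfolding curvature_def b s by (simp add: sum.reindex corner_angle_image)
qed

text \<open>For a constant length the area of a face depends only on its having three vertices, so
  the sums over its edges need not be reindexed.\<close>

lemma total_area_image: "total_area ((`) \<phi> ` F) (\<lambda>_. c) = total_area F (\<lambda>_. c)"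
  if "\<And>t. t \<in> F \<Longrightarrow> card t = 3" "c > 0"
proof -
  have "inj_on ((`) \<phi>) F" by (rule inj_on_subset[OF inj_image_faces]) (use face_in_vertices in auto)
  then have "total_area ((`) \<phi> ` F) (\<lambda>_. c) = (\<Sum>t\<in>F. triangle_area (\<lambda>_. c) (\<phi> ` t))"
    by (simp add: total_area_def sum.reindex)
  also have "\<dots> = (\<Sum>t\<in>F. triangle_area (\<lambda>_. c) t)"
  proof (rule sum.cong[OF refl])
    fix t assume t: "t \<in> F"
    have "inj_on \<phi> t" using inj face_in_vertices[OF t] by (rule inj_on_subset)
    then have "card (\<phi> ` t) = 3" using that(1)[OF t] by (simp add: card_image)
    then show "triangle_area (\<lambda>_. c) (\<phi> ` t) = triangle_area (\<lambda>_. c) t"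
      using that t by (simp add: triangle_area_equilateral)
  qed
  finally show ?thesis by (simp add: total_area_def)
qed

end

lemma total_area_grid:
  assumes "n \<ge> 1"
  shows "total_area (grid_faces n) (\<lambda>_. 1 / real n) = sqrt 3 / 4"
proof -
  have "total_area (grid_faces n) (\<lambda>_. 1 / real n) = (\<Sum>t\<in>grid_faces n. sqrt 3 / 4 * (1 / real n)\<^sup>2)"
    unfolding total_area_def using assms
    by (intro sum.cong refl triangle_area_equilateral) (auto simp: card_grid_face)
  also have "\<dots> = sqrt 3 / 4" using assms by (simp add: card_grid_faces power_divide)
  finally show ?thesis .
qed

section \<open>Piecewise linear interpolation\<close>

text \<open>The coefficients are indexed by \<open>t\<close> and not by the image, so the
  description holds for f that are not injective and the same coefficients can be used for two
  maps.\<close>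

lemma convex_hull_image_param:
  fixes f :: "'a \<Rightarrow> 'b::real_vector"
  assumes "finite t"
  shows "convex hull (f ` t) = {z. \<exists>c. (\<forall>v\<in>t. 0 \<le> c v) \<and> sum c t = 1 \<and> z = (\<Sum>v\<in>t. c v *\<^sub>R f v)}" (is "_ = ?R")
proof
  show "convex hull (f ` t) \<subseteq> ?R"
  proof (rule hull_minimal)
    show "f ` t \<subseteq> ?R"
    proof
      fix z assume "z \<in> f ` t"
      then obtain v where v: "v \<in> t" "z = f v" by blast
      show "z \<in> ?R"
      proof (intro CollectI exI[of _ "\<lambda>u. if u = v then 1 else 0"] conjI ballI)
        show "(\<Sum>u\<in>t. if u = v then 1 else 0) = (1 :: real)" using v assms by simp
        have "(\<Sum>u\<in>t. (if u = v then 1 else 0) *\<^sub>R f u) = (\<Sum>u\<in>t. if u = v then f v else 0)"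
          by (intro sum.cong) auto
        then show "z = (\<Sum>u\<in>t. (if u = v then 1 else 0) *\<^sub>R f u)" using v assms by simp
      qed simp
    qed
    show "convex ?R"
    proof (rule convexI)
      fix y z and p q :: real
      assume "y \<in> ?R" "z \<in> ?R" and pq: "0 \<le> p" "0 \<le> q" "p + q = 1"
      then obtain c d where c: "\<forall>v\<in>t. 0 \<le> c v" "sum c t = 1" "y = (\<Sum>v\<in>t. c v *\<^sub>R f v)"
        and d: "\<forall>v\<in>t. 0 \<le> d v" "sum d t = 1" "z = (\<Sum>v\<in>t. d v *\<^sub>R f v)" by blast
      show "p *\<^sub>R y + q *\<^sub>R z \<in> ?R"
      proof (intro CollectI exI[of _ "\<lambda>v. p * c v + q * d v"] conjI ballI)
        show "0 \<le> p * c v + q * d v" if "v \<in> t" for v using c(1) d(1) pq that by simp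
        show "(\<Sum>v\<in>t. p * c v + q * d v) = 1" using c(2) d(2) pq by (simp add: sum.distrib flip: sum_distrib_left)
        show "p *\<^sub>R y + q *\<^sub>R z = (\<Sum>v\<in>t. (p * c v + q * d v) *\<^sub>R f v)"
          by (simp add: c(3) d(3) scaleR_sum_right scaleR_left_distrib sum.distrib)
      qed
    qed
  qed
  show "?R \<subseteq> convex hull (f ` t)"
  proof
    fix z assume "z \<in> ?R"
    then obtain c where c: "\<forall>v\<in>t. 0 \<le> c v" "sum c t = 1" "z = (\<Sum>v\<in>t. c v *\<^sub>R f v)" by blast
    show "z \<in> convex hull (f ` t)"
      unfolding c(3) using c(1,2) by (intro convex_sum[OF assms convex_convex_hull]) (auto intro: hull_inc)
  qed
qed

text \<open>Inverse of the chart (a, b) \<mapsto> A + d (a + b hex_root); the term b / 2 removes the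
  real part of b hex_root.\<close>

definition lat_coord :: "complex \<Rightarrow> complex \<Rightarrow> complex \<Rightarrow> real \<times> real"
  where "lat_coord A d z = (let u = (z - A) / d; b = Im u / Im hex_root in (Re u - b / 2, b))"

lemma lat_coord_eq:
  assumes "d \<noteq> 0"
  shows "lat_coord A d (A + d * (of_real a + of_real b * hex_root)) = (a, b)"
proof -
  have "(A + d * (of_real a + of_real b * hex_root) - A) / d = of_real a + of_real b * hex_root"
    using assms by simp
  then show ?thesis using hex_root_parts by (simp add: lat_coord_def Let_def)
qed

text \<open>The hexagon where the three absolute values are at most \<open>1\<close> is the star of a vertex in lattice
  coordinates, so the hat functions are the nodal basis of the triangulated lattice.\<close>

definition hat :: "real \<times> real \<Rightarrow> int \<times> int \<Rightarrow> real"
  where "hat c v = max 0 (1 - max (max \<bar>fst c - of_int (fst v)\<bar> \<bar>snd c - of_int (snd v)\<bar>)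
    \<bar>fst c - of_int (fst v) + (snd c - of_int (snd v))\<bar>)"

text \<open>A sum of hat functions in place of a definition face by face: agreement on common sides
  and continuity need no gluing argument.\<close>

definition pl_interp :: "complex \<Rightarrow> complex \<Rightarrow> nat \<Rightarrow> (int \<times> int \<Rightarrow> complex) \<Rightarrow> complex \<Rightarrow> complex"
  where "pl_interp A d n x z = (\<Sum>v\<in>grid n. hat (lat_coord A d z) v *\<^sub>R x v)"

text \<open>The point reflection exchanges upward and downward triangles, so that
  \<open>hat_down\<close> follows from \<open>hat_up\<close>.\<close>

lemma hat_minus: "hat (- a, - b) (- k, - l) = hat (a, b) (k, l)"
proof -
  have "\<bar>- a + real_of_int k\<bar> = \<bar>a - real_of_int k\<bar>" "\<bar>- b + real_of_int l\<bar> = \<bar>b - real_of_int l\<bar>"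
    "\<bar>(- a + real_of_int k) + (- b + real_of_int l)\<bar> = \<bar>(a - real_of_int k) + (b - real_of_int l)\<bar>" by simp_all
  then show ?thesis by (simp add: hat_def)
qed

lemma hat_zero:
  assumes "1 \<le> \<bar>a - of_int k\<bar> \<or> 1 \<le> \<bar>b - of_int l\<bar> \<or> 1 \<le> \<bar>a - of_int k + (b - of_int l)\<bar>"
  shows "hat (a, b) (k, l) = 0"
proof -
  have "1 \<le> max (max \<bar>a - of_int k\<bar> \<bar>b - of_int l\<bar>) \<bar>a - of_int k + (b - of_int l)\<bar>"
    using assms unfolding le_max_iff_disj by blast
  then show ?thesis unfolding hat_def fst_conv snd_conv by (intro max_absorb1) (simp only: diff_le_0_iff_le)
qed

text \<open>On an upward triangle the hat functions are its barycentric coordinates. Any other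
  lattice point is off by at least 1 in one of the three lattice directions, where the hat
  vanishes.\<close>

lemma hat_up:
  assumes "0 \<le> \<beta>" "0 \<le> \<gamma>" "\<beta> + \<gamma> \<le> 1"
  shows "hat (of_int i + \<beta>, of_int j + \<gamma>) v =
    (if v = (i, j) then 1 - \<beta> - \<gamma> else if v = (i + 1, j) then \<beta> else if v = (i, j + 1) then \<gamma> else 0)"
proof -
  obtain k l where v: "v = (k, l)" by fastforce
  consider "v = (i, j)" | "v = (i + 1, j)" | "v = (i, j + 1)" | "v \<noteq> (i, j)" "v \<noteq> (i + 1, j)" "v \<noteq> (i, j + 1)" by blast
  then show ?thesis
  proof cases
    case 1
    then show ?thesis using assms by (simp add: hat_def)
  next
    case 2
    then show ?thesis using assms by (simp add: hat_def max_def)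
  next
    case 3
    then show ?thesis using assms by (simp add: hat_def max_def)
  next
    case 4
    have "1 \<le> \<bar>of_int i + \<beta> - of_int k\<bar> \<or> 1 \<le> \<bar>of_int j + \<gamma> - of_int l\<bar> \<or> 1 \<le> \<bar>of_int i + \<beta> - of_int k + (of_int j + \<gamma> - of_int l)\<bar>"
    proof -
      have "k \<le> i - 1 \<or> l \<le> j - 1 \<or> k \<ge> i + 2 \<or> l \<ge> j + 2 \<or> (k = i + 1 \<and> l = j + 1)"
        using 4 unfolding v prod.inject by presburger
      then consider "k \<le> i - 1" | "l \<le> j - 1" | "k \<ge> i + 2" | "l \<ge> j + 2" | "k = i + 1" "l = j + 1" by blast
      then show ?thesis
      proof cases
        case 1
        then have "real_of_int k \<le> of_int i - 1" by linarith
        then show ?thesis using assms by linarith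
      next
        case 2
        then have "real_of_int l \<le> of_int j - 1" by linarith
        then show ?thesis using assms by linarith
      next
        case 3
        then have "real_of_int k \<ge> of_int i + 2" by linarith
        then show ?thesis using assms by linarith
      next
        case 4
        then have "real_of_int l \<ge> of_int j + 2" by linarith
        then show ?thesis using assms by linarith
      next
        case 5
        then show ?thesis using assms by simp
      qed
    qed
    then have "hat (of_int i + \<beta>, of_int j + \<gamma>) v = 0" unfolding v by (rule hat_zero)
    then show ?thesis using 4 by (simp only: if_False)
  qed
qed

lemma hat_down:
  assumes "0 \<le> \<alpha>" "0 \<le> \<gamma>" "\<alpha> + \<gamma> \<le> 1"
  shows "hat (of_int i + 1 - \<gamma>, of_int j + 1 - \<alpha>) v =
    (if v = (i + 1, j + 1) then 1 - \<alpha> - \<gamma> else if v = (i + 1, j) then \<alpha> else if v = (i, j + 1) then \<gamma> else 0)"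
proof -
  obtain k l where v: "v = (k, l)" by fastforce
  have "hat (of_int i + 1 - \<gamma>, of_int j + 1 - \<alpha>) v = hat (of_int (- i - 1) + \<gamma>, of_int (- j - 1) + \<alpha>) (- k, - l)"
    using hat_minus[of "of_int i + 1 - \<gamma>" "of_int j + 1 - \<alpha>" k l] by (simp add: v algebra_simps)
  also have "\<dots> = (if (- k, - l) = (- i - 1, - j - 1) then 1 - \<gamma> - \<alpha> else if (- k, - l) = (- i - 1 + 1, - j - 1) then \<gamma>
      else if (- k, - l) = (- i - 1, - j - 1 + 1) then \<alpha> else 0)"
    using assms by (intro hat_up) auto
  also have "\<dots> = (if v = (i + 1, j + 1) then 1 - \<alpha> - \<gamma> else if v = (i + 1, j) then \<alpha> else if v = (i, j + 1) then \<gamma> else 0)"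
    unfolding v by auto
  finally show ?thesis .
qed

lemma hat_barycentric:
  assumes d: "d \<noteq> 0" and t: "t \<in> grid_faces n" and c: "\<forall>v\<in>t. 0 \<le> c v" "sum c t = 1"
  shows "hat (lat_coord A d (\<Sum>v\<in>t. c v *\<^sub>R lat A d v)) v = (if v \<in> t then c v else 0)"
  using t
proof (cases rule: grid_faces_cases)
  case (up i j)
  define \<beta> \<gamma> where "\<beta> = c (i + 1, j)" and "\<gamma> = c (i, j + 1)"
  have s: "c (i, j) = 1 - \<beta> - \<gamma>" using c(2) by (simp add: up up_face_def \<beta>_def \<gamma>_def)
  have b: "0 \<le> \<beta>" "0 \<le> \<gamma>" "\<beta> + \<gamma> \<le> 1" using c(1) s by (auto simp: up up_face_def \<beta>_def \<gamma>_def)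
  have "(\<Sum>v\<in>t. c v *\<^sub>R lat A d v) = (1 - \<beta> - \<gamma>) *\<^sub>R lat A d (i, j) + (\<beta> *\<^sub>R lat A d (i + 1, j) + \<gamma> *\<^sub>R lat A d (i, j + 1))"
    by (simp add: up up_face_def s \<beta>_def[symmetric] \<gamma>_def[symmetric])
  also have "\<dots> = A + d * (of_real (of_int i + \<beta>) + of_real (of_int j + \<gamma>) * hex_root)"
    by (simp add: lat_def scaleR_conv_of_real algebra_simps)
  finally have "lat_coord A d (\<Sum>v\<in>t. c v *\<^sub>R lat A d v) = (of_int i + \<beta>, of_int j + \<gamma>)"
    by (simp only: lat_coord_eq[OF d])
  then show ?thesis by (simp only: hat_up[OF b]) (simp add: up up_face_def s \<beta>_def \<gamma>_def)
next
  case (down i j)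
  define \<alpha> \<gamma> where "\<alpha> = c (i + 1, j)" and "\<gamma> = c (i, j + 1)"
  have s: "c (i + 1, j + 1) = 1 - \<alpha> - \<gamma>" using c(2) by (simp add: down down_face_def \<alpha>_def \<gamma>_def)
  have b: "0 \<le> \<alpha>" "0 \<le> \<gamma>" "\<alpha> + \<gamma> \<le> 1" using c(1) s by (auto simp: down down_face_def \<alpha>_def \<gamma>_def)
  have "(\<Sum>v\<in>t. c v *\<^sub>R lat A d v) = \<alpha> *\<^sub>R lat A d (i + 1, j) + ((1 - \<alpha> - \<gamma>) *\<^sub>R lat A d (i + 1, j + 1) + \<gamma> *\<^sub>R lat A d (i, j + 1))"
    by (simp add: down down_face_def s \<alpha>_def[symmetric] \<gamma>_def[symmetric])
  also have "\<dots> = A + d * (of_real (of_int i + 1 - \<gamma>) + of_real (of_int j + 1 - \<alpha>) * hex_root)"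
    by (simp add: lat_def scaleR_conv_of_real algebra_simps)
  finally have "lat_coord A d (\<Sum>v\<in>t. c v *\<^sub>R lat A d v) = (of_int i + 1 - \<gamma>, of_int j + 1 - \<alpha>)"
    by (simp only: lat_coord_eq[OF d])
  then show ?thesis by (simp only: hat_down[OF b]) (auto simp: down down_face_def s \<alpha>_def \<gamma>_def)
qed

lemma pl_interp_face:
  assumes d: "d \<noteq> 0" and t: "t \<in> grid_faces n" and c: "\<forall>v\<in>t. 0 \<le> c v" "sum c t = 1"
  shows "pl_interp A d n x (\<Sum>v\<in>t. c v *\<^sub>R lat A d v) = (\<Sum>v\<in>t. c v *\<^sub>R x v)"
proof -
  have "pl_interp A d n x (\<Sum>v\<in>t. c v *\<^sub>R lat A d v) = (\<Sum>v\<in>grid n. if v \<in> t then c v *\<^sub>R x v else 0)"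
    unfolding pl_interp_def hat_barycentric[OF d t c] by (intro sum.cong) auto
  also have "\<dots> = (\<Sum>v\<in>t. c v *\<^sub>R x v)"
    using grid_faces_subset[OF t] by (simp add: sum.If_cases Int_absorb1)
  finally show ?thesis .
qed

lemma finite_face: "t \<in> grid_faces n \<Longrightarrow> finite t"
  using card_grid_face card_ge_0_finite by force

text \<open>Besides faces, the subsets \<open>s\<close> cover sides and single vertices;
  coefficients on \<open>s\<close> are extended to \<open>t\<close> by 0.\<close>

lemma pl_interp_image_hull:
  assumes d: "d \<noteq> 0" and t: "t \<in> grid_faces n" and s: "s \<subseteq> t"
  shows "pl_interp A d n x ` (convex hull (lat A d ` s)) = convex hull (x ` s)"
proof -
  have fs: "finite s" using s finite_face[OF t] by (rule finite_subset)
  have ext: "pl_interp A d n x (\<Sum>v\<in>s. c v *\<^sub>R lat A d v) = (\<Sum>v\<in>s. c v *\<^sub>R x v)"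
    if c: "\<forall>v\<in>s. 0 \<le> c v" "sum c s = 1" for c
  proof -
    define e where "e = (\<lambda>v. if v \<in> s then c v else 0)"
    have e1: "(\<Sum>v\<in>t. e v *\<^sub>R f v) = (\<Sum>v\<in>s. c v *\<^sub>R f v)" for f :: "int \<times> int \<Rightarrow> complex"
      unfolding e_def by (rule sum.mono_neutral_cong_right) (use s finite_face[OF t] in auto)
    have e2: "sum e t = 1"
      unfolding e_def using sum.mono_neutral_cong_right[of t s "\<lambda>v. if v \<in> s then c v else 0" c] s finite_face[OF t] c(2) by auto
    have "\<forall>v\<in>t. 0 \<le> e v" using c(1) by (auto simp: e_def)
    from pl_interp_face[OF d t this e2, of A x] show ?thesis by (simp only: e1)
  qed
  show ?thesis
  proof (intro subset_antisym subsetI)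
    fix y assume "y \<in> pl_interp A d n x ` (convex hull (lat A d ` s))"
    then obtain c where "\<forall>v\<in>s. 0 \<le> c v" "sum c s = 1" "y = pl_interp A d n x (\<Sum>v\<in>s. c v *\<^sub>R lat A d v)"
      unfolding convex_hull_image_param[OF fs] by blast
    then show "y \<in> convex hull (x ` s)" unfolding convex_hull_image_param[OF fs] using ext by blast
  next
    fix y assume "y \<in> convex hull (x ` s)"
    then obtain c where c: "\<forall>v\<in>s. 0 \<le> c v" "sum c s = 1" "y = (\<Sum>v\<in>s. c v *\<^sub>R x v)"
      unfolding convex_hull_image_param[OF fs] by blast
    then have "y = pl_interp A d n x (\<Sum>v\<in>s. c v *\<^sub>R lat A d v)" using ext by simp
    moreover have "(\<Sum>v\<in>s. c v *\<^sub>R lat A d v) \<in> convex hull (lat A d ` s)"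
      unfolding convex_hull_image_param[OF fs] using c by blast
    ultimately show "y \<in> pl_interp A d n x ` (convex hull (lat A d ` s))" by blast
  qed
qed

lemma grid_face_at:
  assumes "n \<ge> 1" "v \<in> grid n"
  obtains t where "t \<in> grid_faces n" "v \<in> t"
  using vertices_of_grid[OF assms(1)] assms(2) that unfolding vertices_of_def by blast

lemma pl_interp_lat:
  assumes "d \<noteq> 0" "n \<ge> 1" "v \<in> grid n"
  shows "pl_interp A d n x (lat A d v) = x v"
proof -
  obtain t where t: "t \<in> grid_faces n" "v \<in> t" using assms(2,3) by (rule grid_face_at)
  have "pl_interp A d n x ` (convex hull (lat A d ` {v})) = convex hull (x ` {v})"
    using t by (intro pl_interp_image_hull[OF assms(1) t(1)]) simp
  then show ?thesis by simp
qed

lemma inj_lat: "d \<noteq> 0 \<Longrightarrow> inj (lat A d)"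
proof (rule injI)
  fix u v assume d: "d \<noteq> 0" and eq: "lat A d u = lat A d v"
  have "lat_coord A d (lat A d w) = (of_int (fst w), of_int (snd w))" for w
    using lat_coord_eq[OF d, of A "of_int (fst w)" "of_int (snd w)"] by (simp add: lat_def)
  from this[of u] this[of v] eq show "u = v" by (simp add: prod_eq_iff)
qed

text \<open>The hat values of a point are its barycentric coordinates in every face that contains
  it. For a point of two faces they must therefore vanish off the common vertices.\<close>

lemma lat_hull_Int:
  assumes d: "d \<noteq> 0" and t: "t \<in> grid_faces n" "t' \<in> grid_faces n"
  shows "convex hull (lat A d ` t) \<inter> convex hull (lat A d ` t') = convex hull (lat A d ` (t \<inter> t'))"
proof
  show "convex hull (lat A d ` (t \<inter> t')) \<subseteq> convex hull (lat A d ` t) \<inter> convex hull (lat A d ` t')"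
    by (simp add: hull_mono image_mono)
  show "convex hull (lat A d ` t) \<inter> convex hull (lat A d ` t') \<subseteq> convex hull (lat A d ` (t \<inter> t'))"
  proof
    fix z assume z: "z \<in> convex hull (lat A d ` t) \<inter> convex hull (lat A d ` t')"
    obtain c where c: "\<forall>v\<in>t. 0 \<le> c v" "sum c t = 1" "z = (\<Sum>v\<in>t. c v *\<^sub>R lat A d v)"
      using z unfolding convex_hull_image_param[OF finite_face[OF t(1)]] by blast
    obtain c' where c': "\<forall>v\<in>t'. 0 \<le> c' v" "sum c' t' = 1" "z = (\<Sum>v\<in>t'. c' v *\<^sub>R lat A d v)"
      using z unfolding convex_hull_image_param[OF finite_face[OF t(2)]] by blast
    have eq: "(if v \<in> t then c v else 0) = (if v \<in> t' then c' v else 0)" for v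
      using hat_barycentric[OF d t(1) c(1,2), of A v] hat_barycentric[OF d t(2) c'(1,2), of A v]
      unfolding c(3)[symmetric] c'(3)[symmetric] by simp
    have zero: "c v = 0" if "v \<in> t" "v \<notin> t'" for v using eq[of v] that by simp
    have "sum c (t \<inter> t') = 1" "z = (\<Sum>v\<in>t \<inter> t'. c v *\<^sub>R lat A d v)"
      using c(2,3) zero sum.mono_neutral_right[OF finite_face[OF t(1)], of "t \<inter> t'" c]
        sum.mono_neutral_right[OF finite_face[OF t(1)], of "t \<inter> t'" "\<lambda>v. c v *\<^sub>R lat A d v"] by auto
    then show "z \<in> convex hull (lat A d ` (t \<inter> t'))"
      unfolding convex_hull_image_param[OF finite_Int[OF disjI1[OF finite_face[OF t(1)]]]] using c(1) by blast
  qed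
qed

lemma lat_hull_cover:
  assumes d: "d \<noteq> 0" and n: "n \<ge> 1"
  shows "(\<Union>t\<in>grid_faces n. convex hull (lat A d ` t)) = convex hull {A, A + of_nat n * d, A + of_nat n * d * hex_root}"
proof
  have "lat A d ` t \<subseteq> convex hull {A, A + of_nat n * d, A + of_nat n * d * hex_root}" if "t \<in> grid_faces n" for t
    using lat_in_triangle[of _ n A "of_nat n * d"] grid_faces_subset[OF that] n by auto
  then show "(\<Union>t\<in>grid_faces n. convex hull (lat A d ` t)) \<subseteq> convex hull {A, A + of_nat n * d, A + of_nat n * d * hex_root}"
    by (intro UN_least hull_minimal) auto
  show "convex hull {A, A + of_nat n * d, A + of_nat n * d * hex_root} \<subseteq> (\<Union>t\<in>grid_faces n. convex hull (lat A d ` t))"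
  proof
    fix z assume "z \<in> convex hull {A, A + of_nat n * d, A + of_nat n * d * hex_root}"
    then obtain u p q where upq: "0 \<le> u" "0 \<le> p" "0 \<le> q" "u + p + q = 1"
      and z: "z = u *\<^sub>R A + p *\<^sub>R (A + of_nat n * d) + q *\<^sub>R (A + of_nat n * d * hex_root)"
      unfolding convex_hull_3 by blast
    define a b where "a = real n * p" and "b = real n * q"
    have ab: "0 \<le> a" "0 \<le> b" using upq by (auto simp: a_def b_def)
    have abn: "a + b \<le> real n"
    proof -
      have "real n * (p + q) \<le> real n * 1" using upq by (intro mult_left_mono) auto
      then show ?thesis by (simp add: a_def b_def distrib_left)
    qed
    have zab: "z = A + d * (of_real a + of_real b * hex_root)"
    proof -
      have u: "u = 1 - p - q" using upq by simp
      show ?thesis unfolding z u by (simp add: a_def b_def scaleR_conv_of_real algebra_simps)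
    qed
    define i j \<beta> \<gamma> where "i = \<lfloor>a\<rfloor>" and "j = \<lfloor>b\<rfloor>" and "\<beta> = a - of_int \<lfloor>a\<rfloor>" and "\<gamma> = b - of_int \<lfloor>b\<rfloor>"
    have fr: "0 \<le> \<beta>" "\<beta> < 1" "0 \<le> \<gamma>" "\<gamma> < 1" by (auto simp: \<beta>_def \<gamma>_def) linarith+
    have aij: "a = of_int i + \<beta>" "b = of_int j + \<gamma>" by (auto simp: i_def j_def \<beta>_def \<gamma>_def)
    have ij0: "0 \<le> i" "0 \<le> j" using ab by (auto simp: i_def j_def)
    have sum: "real_of_int (i + j) + (\<beta> + \<gamma>) \<le> real n" using abn by (simp add: aij)
    \<comment> \<open>The fractional parts select the upward or downward half of the rhombus at (i,
      j). In the third case i + j reaches n, which forces both fractional parts to be 0, so z is a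
      lattice point.\<close>
    consider "\<beta> + \<gamma> \<le> 1" "i + j + 1 \<le> int n" | "\<beta> + \<gamma> > 1" | "\<beta> + \<gamma> \<le> 1" "i + j \<ge> int n" by linarith
    then have "\<exists>t\<in>grid_faces n. z \<in> convex hull (lat A d ` t)"
    proof cases
      case 1
      have t: "up_face i j \<in> grid_faces n" using ij0 1 by simp
      have "z = (1 - \<beta> - \<gamma>) *\<^sub>R lat A d (i, j) + \<beta> *\<^sub>R lat A d (i + 1, j) + \<gamma> *\<^sub>R lat A d (i, j + 1)"
        unfolding zab aij by (simp add: lat_def scaleR_conv_of_real algebra_simps)
      then have "z \<in> convex hull {lat A d (i, j), lat A d (i + 1, j), lat A d (i, j + 1)}"
        unfolding convex_hull_3 using fr 1 by (intro CollectI exI[of _ "1 - \<beta> - \<gamma>"] exI[of _ \<beta>] exI[of _ \<gamma>]) auto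
      then have "z \<in> convex hull (lat A d ` up_face i j)" by (simp add: up_face_def)
      with t show ?thesis by blast
    next
      case 2
      have "real_of_int (i + j + 1) < real n" using sum 2 by simp
      then have "i + j + 1 < int n" by linarith
      then have t: "down_face i j \<in> grid_faces n" using ij0 by simp
      have "z = (1 - \<gamma>) *\<^sub>R lat A d (i + 1, j) + (\<beta> + \<gamma> - 1) *\<^sub>R lat A d (i + 1, j + 1) + (1 - \<beta>) *\<^sub>R lat A d (i, j + 1)"
        unfolding zab aij by (simp add: lat_def scaleR_conv_of_real algebra_simps)
      then have "z \<in> convex hull {lat A d (i + 1, j), lat A d (i + 1, j + 1), lat A d (i, j + 1)}"
        unfolding convex_hull_3 using fr 2 by (intro CollectI exI[of _ "1 - \<gamma>"] exI[of _ "\<beta> + \<gamma> - 1"] exI[of _ "1 - \<beta>"]) auto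
      then have "z \<in> convex hull (lat A d ` down_face i j)" by (simp add: down_face_def)
      with t show ?thesis by blast
    next
      case 3
      have "real n \<le> real_of_int (i + j)" using 3(2) by linarith
      then have "\<beta> + \<gamma> \<le> 0" "i + j \<le> int n" using sum fr by linarith+
      then have "\<beta> = 0" "\<gamma> = 0" "(i, j) \<in> grid n" using fr ij0 by (auto simp: grid_def)
      moreover from this have "z = lat A d (i, j)" unfolding zab aij by (simp add: lat_def)
      ultimately show ?thesis using grid_face_at[OF n] by (metis hull_inc imageI)
    qed
    then show "z \<in> (\<Union>t\<in>grid_faces n. convex hull (lat A d ` t))" by blast
  qed
qed

section \<open>Nondegenerate triangles, orientation, and Lipschitz bounds from pieces\<close>

lemma not_affine_dependent_complex:
  assumes "Im ((c - a) / (b - a)) \<noteq> 0"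
  shows "\<not> affine_dependent {a, b, c}" "card {a, b, c} = 3"
proof -
  have ne: "a \<noteq> b" "a \<noteq> c" using assms by auto
  have ne': "b \<noteq> c" using assms ne by (cases "b = c") auto
  note ne = ne ne'
  then show "card {a, b, c} = 3" by simp
  show "\<not> affine_dependent {a, b, c}"
  proof
    assume "affine_dependent {a, b, c}"
    then obtain U where U: "sum U {a, b, c} = 0" "\<exists>v\<in>{a, b, c}. U v \<noteq> 0" "(\<Sum>v\<in>{a, b, c}. U v *\<^sub>R v) = 0"
      by (subst (asm) affine_dependent_explicit_finite) auto
    have Ua: "U a = - U b - U c" using U(1) ne by simp
    have "U b *\<^sub>R (b - a) + U c *\<^sub>R (c - a) = 0"
      using U(3) ne by (simp add: Ua algebra_simps)
    then have "(U b *\<^sub>R (b - a) + U c *\<^sub>R (c - a)) / (b - a) = 0" by simp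
    then have "of_real (U b) + of_real (U c) * ((c - a) / (b - a)) = 0"
      using ne by (simp add: add_divide_distrib scaleR_conv_of_real)
    then have im: "Im (of_real (U b) + of_real (U c) * ((c - a) / (b - a))) = 0"
      and re: "Re (of_real (U b) + of_real (U c) * ((c - a) / (b - a))) = 0" by simp_all
    have "Im (of_real u + of_real v * R) = v * Im R" for u v R by simp
    with im have "U c * Im ((c - a) / (b - a)) = 0" by metis
    then have c0: "U c = 0" using assms by simp
    with re have "U b = 0" by simp
    with c0 Ua U(2) show False by auto
  qed
qed

lemma geodesic_triangulation_image:
  fixes p :: "'v \<Rightarrow> complex"
  assumes "finite F" and t: "\<And>t. t \<in> F \<Longrightarrow> card (p ` t) = 3 \<and> \<not> affine_dependent (p ` t)"
    and int: "\<And>t t'. t \<in> F \<Longrightarrow> t' \<in> F \<Longrightarrow> convex hull (p ` t) \<inter> convex hull (p ` t') = convex hull (p ` (t \<inter> t'))"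
  shows "geodesic_triangulation (\<Union>t\<in>F. convex hull (p ` t)) ((`) p ` F)"
  unfolding geodesic_triangulation_def triangulation_def
proof (intro conjI ballI allI impI)
  show "finite ((\<lambda>t. convex hull t) ` (`) p ` F)" using assms(1) by simp
  fix s assume "s \<in> (`) p ` F"
  then show "card s = 3" "\<not> affine_dependent s" using t by auto
next
  fix S assume "S \<in> (\<lambda>t. convex hull t) ` (`) p ` F"
  then obtain s where s: "s \<in> F" "S = convex hull (p ` s)" by blast
  show "\<exists>n. n simplex S"
    unfolding simplex_def using t[OF s(1)] s(2) by (intro exI[of _ 2] exI[of _ "p ` s"]) auto
next
  fix S S' assume "S \<in> (\<lambda>t. convex hull t) ` (`) p ` F \<and> S' \<in> (\<lambda>t. convex hull t) ` (`) p ` F"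
  then obtain s s' where s: "s \<in> F" "S = convex hull (p ` s)" "s' \<in> F" "S' = convex hull (p ` s')" by blast
  have "S \<inter> S' = convex hull (p ` (s \<inter> s'))" unfolding s(2,4) by (rule int[OF s(1,3)])
  moreover have "p ` (s \<inter> s') \<subseteq> p ` s" by blast
  ultimately show "(S \<inter> S') face_of S"
    unfolding s(2) using face_of_convex_hull_affine_independent[of "p ` s"] t[OF s(1)] by blast
qed auto

text \<open>Im (cnj u * v) is the signed area spanned by u and v, which a linear map multiplies by
  its determinant. Two positively oriented triangles therefore force a positive determinant.\<close>

lemma orientation_preserving_affine_onI:
  fixes a b c a' b' c' :: complex
  assumes or: "Im ((c - a) / (b - a)) > 0" "Im ((c' - a') / (b' - a')) > 0"
    and g: "\<And>\<alpha> \<beta> \<gamma> :: real. 0 \<le> \<alpha> \<Longrightarrow> 0 \<le> \<beta> \<Longrightarrow> 0 \<le> \<gamma> \<Longrightarrow> \<alpha> + \<beta> + \<gamma> = 1 \<Longrightarrow>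
      g (\<alpha> *\<^sub>R a + \<beta> *\<^sub>R b + \<gamma> *\<^sub>R c) = \<alpha> *\<^sub>R a' + \<beta> *\<^sub>R b' + \<gamma> *\<^sub>R c'"
  shows "orientation_preserving_affine_on (convex hull {a, b, c}) g"
proof -
  define r where "r = (c - a) / (b - a)"
  have r: "Im r > 0" using or by (simp add: r_def)
  have ba: "b - a \<noteq> 0" "b' - a' \<noteq> 0" using or by auto
  have cr: "c - a = (b - a) * r" using ba by (simp add: r_def)
  \<comment> \<open>The coordinates of \<zeta> with respect to the real basis b - a, c - a.\<close>
  define q2 q1 where "q2 = (\<lambda>\<zeta>. Im (\<zeta> / (b - a)) / Im r)" and "q1 = (\<lambda>\<zeta>. Re (\<zeta> / (b - a)) - Im (\<zeta> / (b - a)) / Im r * Re r)"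
  define h where "h = (\<lambda>\<zeta>. q1 \<zeta> *\<^sub>R (b' - a') + q2 \<zeta> *\<^sub>R (c' - a'))"
  have lin: "linear h"
  proof (rule linearI)
    show "h (x + y) = h x + h y" for x y
      unfolding h_def q1_def q2_def by (simp add: add_divide_distrib algebra_simps)
    have sc: "k *\<^sub>R x / (b - a) = k *\<^sub>R (x / (b - a))" for k x by (simp add: scaleR_conv_of_real)
    show "h (k *\<^sub>R x) = k *\<^sub>R h x" for k x
      unfolding h_def q1_def q2_def sc by (simp add: algebra_simps)
  qed
  have hv: "h (b - a) = b' - a'" "h (c - a) = c' - a'"
    using ba(1) r by (simp_all add: h_def q1_def q2_def cr)
  have basis: "h \<zeta> = Re \<zeta> *\<^sub>R h 1 + Im \<zeta> *\<^sub>R h \<i>" for \<zeta>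
  proof -
    have "\<zeta> = Re \<zeta> *\<^sub>R 1 + Im \<zeta> *\<^sub>R \<i>" by (simp add: complex_eq_iff)
    then have "h \<zeta> = h (Re \<zeta> *\<^sub>R 1 + Im \<zeta> *\<^sub>R \<i>)" by simp
    then show ?thesis by (simp only: linear_add[OF lin] linear_scale[OF lin])
  qed
  have det: "Im (cnj (h u) * h v) = Im (cnj u * v) * Im (cnj (h 1) * h \<i>)" for u v
    unfolding basis[of u] basis[of v] by (simp add: algebra_simps)
  have Im_mult_of_real_left: "Im (of_real k * R) = k * Im R" for k R by simp
  have cross: "Im (cnj x * y) = (cmod x)\<^sup>2 * Im (y / x)" if "x \<noteq> 0" for x y
  proof -
    have "cnj x * y = (cnj x * x) * (y / x)" using that by simp
    also have "cnj x * x = of_real ((cmod x)\<^sup>2)" by (simp only: complex_norm_square mult.commute[of "cnj x"])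
    finally show ?thesis by (simp only: Im_mult_of_real_left)
  qed
  have "Im (cnj (b' - a') * (c' - a')) > 0" "Im (cnj (b - a) * (c - a)) > 0"
    unfolding cross[OF ba(1)] cross[OF ba(2)] using or ba by auto
  then have pos: "Im (cnj (h 1) * h \<i>) > 0"
    using det[of "b - a" "c - a"] unfolding hv by (simp add: zero_less_mult_iff)
  show ?thesis
    unfolding orientation_preserving_affine_on_def
  proof (intro exI[of _ h] exI[of _ "a' - h a"] conjI ballI lin pos)
    fix z assume "z \<in> convex hull {a, b, c}"
    then obtain \<alpha> \<beta> \<gamma> where abg: "0 \<le> \<alpha>" "0 \<le> \<beta>" "0 \<le> \<gamma>" "\<alpha> + \<beta> + \<gamma> = 1" "z = \<alpha> *\<^sub>R a + \<beta> *\<^sub>R b + \<gamma> *\<^sub>R c"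
      unfolding convex_hull_3 by blast
    have \<alpha>: "\<alpha> = 1 - \<beta> - \<gamma>" using abg by simp
    have "z = a + \<beta> *\<^sub>R (b - a) + \<gamma> *\<^sub>R (c - a)" unfolding abg(5) \<alpha> by (simp add: algebra_simps)
    then have "h z = h a + \<beta> *\<^sub>R (b' - a') + \<gamma> *\<^sub>R (c' - a')"
      by (simp only: linear_add[OF lin] linear_scale[OF lin] hv)
    moreover have "g z = a' + \<beta> *\<^sub>R (b' - a') + \<gamma> *\<^sub>R (c' - a')"
      unfolding abg(5) g[OF abg(1-4)] unfolding \<alpha> by (simp add: algebra_simps)
    ultimately show "g z = h z + (a' - h a)" by simp
  qed
qed

text \<open>Restrict to the segment from \<open>y\<close> to \<open>z\<close>: the preimages of the
  pieces are finitely many closed sets covering the unit interval, where local Lipschitz bounds with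
  one constant combine.\<close>

lemma lipschitz_on_convex_finite_cover:
  fixes k :: "complex \<Rightarrow> complex"
  assumes fin: "finite I" and cl: "\<And>i. i \<in> I \<Longrightarrow> closed (P i)" and cov: "(\<Union>i\<in>I. P i) = D" and "convex D" and M: "0 \<le> M"
    and lip: "\<And>i z y. i \<in> I \<Longrightarrow> z \<in> P i \<Longrightarrow> y \<in> P i \<Longrightarrow> cmod (k z - k y) \<le> M * cmod (z - y)"
    and zy: "z \<in> D" "y \<in> D"
  shows "cmod (k z - k y) \<le> M * cmod (z - y)"
proof -
  define \<pi> where "\<pi> = (\<lambda>s :: real. y + s *\<^sub>R (z - y))"
  define Q where "Q = (\<lambda>i. {0..1} \<inter> \<pi> -` P i)"
  have c: "continuous_on {0..1} \<pi>" unfolding \<pi>_def by (intro continuous_intros)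
  have "(M * cmod (z - y))-lipschitz_on {0..1} (\<lambda>s. k (\<pi> s))"
  proof (rule lipschitz_on_closed_Union[of I _ Q])
    show "closed (Q i)" if "i \<in> I" for i
      unfolding Q_def by (intro continuous_closed_preimage c cl that closed_atLeastAtMost)
    show "(M * cmod (z - y))-lipschitz_on (Q i) (\<lambda>s. k (\<pi> s))" if "i \<in> I" for i
    proof (rule lipschitz_onI)
      fix s t assume st: "s \<in> Q i" "t \<in> Q i"
      have "\<pi> s - \<pi> t = (s - t) *\<^sub>R (z - y)" by (simp add: \<pi>_def algebra_simps)
      then have "cmod (\<pi> s - \<pi> t) = \<bar>s - t\<bar> * cmod (z - y)" by simp
      moreover have "cmod (k (\<pi> s) - k (\<pi> t)) \<le> M * cmod (\<pi> s - \<pi> t)"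
        using st by (intro lip[OF that]) (auto simp: Q_def)
      ultimately show "dist (k (\<pi> s)) (k (\<pi> t)) \<le> M * cmod (z - y) * dist s t"
        by (simp add: dist_norm mult_ac)
    qed (use M in simp)
    show "{0..1} \<subseteq> (\<Union>i\<in>I. Q i)"
    proof
      fix s :: real assume s: "s \<in> {0..1}"
      have "\<pi> s = (1 - s) *\<^sub>R y + s *\<^sub>R z" by (simp add: \<pi>_def algebra_simps)
      then have "\<pi> s \<in> D" using \<open>convex D\<close> zy s by (simp add: convexD_alt)
      then show "s \<in> (\<Union>i\<in>I. Q i)" using cov s by (auto simp: Q_def)
    qed
  qed (use fin M in auto)
  then have "dist (k (\<pi> 1)) (k (\<pi> 0)) \<le> M * cmod (z - y) * dist (1 :: real) 0"
    by (rule lipschitz_onD) auto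
  then show ?thesis by (simp add: \<pi>_def dist_norm)
qed

lemma continuous_on_pl_interp: "d \<noteq> 0 \<Longrightarrow> continuous_on S (pl_interp A d n x)"
  unfolding pl_interp_def hat_def lat_coord_def Let_def
  by (intro continuous_intros) (use hex_root_parts in auto)

section \<open>Realized grids as discrete conformal maps\<close>

lemma interior_triangle_nonempty:
  assumes "e \<noteq> 0"
  shows "interior (convex hull {A, A + e, A + e * hex_root}) \<noteq> {}"
proof -
  have "Im ((A + e * hex_root - A) / (A + e - A)) \<noteq> 0" using assms hex_root_parts by simp
  from not_affine_dependent_complex[OF this] show ?thesis
    using interior_convex_hull_eq_empty[of "{A, A + e, A + e * hex_root}"] by simp
qed

text \<open>Lengths are functions of vertex sets; \<open>diameter\<close> is a ready-made set
  function that gives the Euclidean distance on edges.\<close>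

lemma diameter_doubleton:
  fixes a b :: "'a::real_normed_vector"
  shows "diameter {a, b} = dist a b"
proof (rule antisym)
  show "diameter {a, b} \<le> dist a b"
    unfolding dist_norm by (rule diameter_le) (auto simp: norm_minus_commute)
  show "dist a b \<le> diameter {a, b}"
    by (rule diameter_bounded_bound) auto
qed

text \<open>With inversive distance 1 / (2k) - 1 the mixed term is k exp(a + b) - 2 k^2 exp(a + b),
  and the second part completes the square of k exp a - k exp b.\<close>

lemma packing_length_eq:
  assumes "k > 0"
  shows "sqrt (exp (2 * (ln k + a)) + exp (2 * (ln k + b)) + 2 * (1 / (2 * k) - 1) * exp ((ln k + a) + (ln k + b))) =
    sqrt (k * edge_sq k a b)"
proof -
  have e: "exp (ln k + y) = k * exp y" for y using assms by (simp add: exp_add)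
  have "exp (2 * (ln k + a)) = (k * exp a)\<^sup>2" "exp (2 * (ln k + b)) = (k * exp b)\<^sup>2"
    "exp ((ln k + a) + (ln k + b)) = (k * exp a) * (k * exp b)"
    unfolding e[symmetric] by (simp_all only: exp_double exp_add)
  moreover have "(k * exp a)\<^sup>2 + (k * exp b)\<^sup>2 + 2 * (1 / (2 * k) - 1) * ((k * exp a) * (k * exp b)) = k * edge_sq k a b"
    using assms by (simp add: edge_sq_def exp_add field_simps power2_eq_square)
  ultimately show ?thesis by simp
qed

text \<open>\<open>n \<ge> 3\<close> is what makes the inversive distance
  \<open>n\<^sup>2 / 2 - 1\<close> exceed 1. Injectivity of the interpolation is a separate
  condition because positively oriented faces alone would not exclude overlaps.\<close>

locale grid_realization =
  fixes A d :: complex and n :: nat and x :: "int \<times> int \<Rightarrow> complex" and w :: "int \<times> int \<Rightarrow> real"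
  assumes n3: "n \<ge> 3" and norm_d: "cmod d = 1 / real n"
    and flat: "\<And>v. v \<in> inner_grid n \<Longrightarrow> angle_sum (1 / (real n)\<^sup>2) w v = 2 * pi"
    and edge: "\<And>u v. {u, v} \<in> edges_of (grid_faces n) \<Longrightarrow> (dist (x u) (x v))\<^sup>2 = 1 / (real n)\<^sup>2 * edge_sq (1 / (real n)\<^sup>2) (w u) (w v)"
    and up: "\<And>i j. up_face i j \<in> grid_faces n \<Longrightarrow> Im ((x (i, j + 1) - x (i, j)) / (x (i + 1, j) - x (i, j))) > 0"
    and down: "\<And>i j. down_face i j \<in> grid_faces n \<Longrightarrow> Im ((x (i, j + 1) - x (i + 1, j)) / (x (i + 1, j + 1) - x (i + 1, j))) > 0"
    and inj_interp: "inj_on (pl_interp A d n x) (convex hull {A, A + of_nat n * d, A + of_nat n * d * hex_root})"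
begin

abbreviation "T \<equiv> convex hull {A, A + of_nat n * d, A + of_nat n * d * hex_root}"
abbreviation "g \<equiv> pl_interp A d n x"
abbreviation "F \<equiv> (`) x ` grid_faces n"
abbreviation "I \<equiv> \<lambda>_ :: complex set. (real n)\<^sup>2 / 2 - 1"

lemma n_pos: "n \<ge> 1" "real n > 0" and d_nz: "d \<noteq> 0"
  using n3 norm_d by auto

lemma lat_in_T: "v \<in> grid n \<Longrightarrow> lat A d v \<in> T"
  using lat_in_triangle[of v n A "of_nat n * d"] n_pos by simp

lemma inj_x: "inj_on x (grid n)"
proof (rule inj_onI)
  fix u v assume uv: "u \<in> grid n" "v \<in> grid n" "x u = x v"
  then have "g (lat A d u) = g (lat A d v)" by (simp add: pl_interp_lat[OF d_nz n_pos(1)])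
  then have "lat A d u = lat A d v" by (rule inj_onD[OF inj_interp _ lat_in_T[OF uv(1)] lat_in_T[OF uv(2)]])
  then show "u = v" using inj_lat[OF d_nz] by (auto dest: injD)
qed

lemma inj_x_vertices: "inj_on x (vertices_of (grid_faces n))"
  unfolding vertices_of_grid[OF n_pos(1)] by (rule inj_x)

lemma face_orientation:
  assumes "t \<in> grid_faces n"
  obtains a b c where "t = {a, b, c}" "Im ((x c - x a) / (x b - x a)) > 0"
    "Im ((lat A d c - lat A d a) / (lat A d b - lat A d a)) > 0"
  using assms
proof (cases rule: grid_faces_cases)
  case (up i j)
  have "(lat A d (i, j + 1) - lat A d (i, j)) / (lat A d (i + 1, j) - lat A d (i, j)) = (d * hex_root) / d"
    by (rule arg_cong2[where f = "(/)"]) (simp_all add: lat_def algebra_simps)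
  then have "Im ((lat A d (i, j + 1) - lat A d (i, j)) / (lat A d (i + 1, j) - lat A d (i, j))) > 0"
    using d_nz hex_root_parts by simp
  then show ?thesis
    using that[of "(i, j)" "(i + 1, j)" "(i, j + 1)"] grid_realization.up[OF grid_realization_axioms] assms
    by (simp add: up(1)) (simp add: up_face_def)
next
  case (down i j)
  have "(lat A d (i, j + 1) - lat A d (i + 1, j)) / (lat A d (i + 1, j + 1) - lat A d (i + 1, j)) = (d * (hex_root - 1)) / (d * hex_root)"
    by (rule arg_cong2[where f = "(/)"]) (simp_all add: lat_def algebra_simps)
  also have "\<dots> = hex_root" unfolding hex_root_sq[symmetric] using d_nz hex_root_parts by simp
  finally have "Im ((lat A d (i, j + 1) - lat A d (i + 1, j)) / (lat A d (i + 1, j + 1) - lat A d (i + 1, j))) > 0"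
    using hex_root_parts by simp
  then show ?thesis
    using that[of "(i + 1, j)" "(i + 1, j + 1)" "(i, j + 1)"] grid_realization.down[OF grid_realization_axioms] assms
    by (simp add: down(1)) (simp add: down_face_def)
qed

lemma geodesic_lattice: "geodesic_triangulation T ((`) (lat A d) ` grid_faces n)"
proof -
  have "geodesic_triangulation (\<Union>t\<in>grid_faces n. convex hull (lat A d ` t)) ((`) (lat A d) ` grid_faces n)"
  proof (rule geodesic_triangulation_image)
    fix t assume "t \<in> grid_faces n"
    then obtain a b c where t: "t = {a, b, c}" and "Im ((lat A d c - lat A d a) / (lat A d b - lat A d a)) > 0"
      by (rule face_orientation) blast
    then have "Im ((lat A d c - lat A d a) / (lat A d b - lat A d a)) \<noteq> 0" by simp
    from not_affine_dependent_complex[OF this]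
    show "card (lat A d ` t) = 3 \<and> \<not> affine_dependent (lat A d ` t)" by (simp add: t)
  qed (use lat_hull_Int[OF d_nz] in auto)
  then show ?thesis by (simp only: lat_hull_cover[OF d_nz n_pos(1)])
qed

lemma face_nondegenerate:
  assumes "t \<in> grid_faces n"
  shows "card (x ` t) = 3" "\<not> affine_dependent (x ` t)"
proof -
  obtain a b c where t: "t = {a, b, c}" and "Im ((x c - x a) / (x b - x a)) > 0"
    using assms by (rule face_orientation) blast
  then have "Im ((x c - x a) / (x b - x a)) \<noteq> 0" by simp
  from not_affine_dependent_complex[OF this]
  show "card (x ` t) = 3" "\<not> affine_dependent (x ` t)" by (simp_all add: t)
qed

text \<open>Faces of the realization are images of lattice faces under one injective map, so their
  intersections are computed in the lattice.\<close>

lemma geodesic_image: "geodesic_triangulation (g ` T) F"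
proof -
  have hull: "convex hull (x ` s) = g ` (convex hull (lat A d ` s))" if "t \<in> grid_faces n" "s \<subseteq> t" for s t
    using pl_interp_image_hull[OF d_nz that] by simp
  have sub: "convex hull (lat A d ` t) \<subseteq> T" if "t \<in> grid_faces n" for t
    using that lat_hull_cover[OF d_nz n_pos(1), of A] by blast
  have "geodesic_triangulation (\<Union>t\<in>grid_faces n. convex hull (x ` t)) F"
  proof (rule geodesic_triangulation_image)
    fix s t assume st: "s \<in> grid_faces n" "t \<in> grid_faces n"
    have "g ` (convex hull (lat A d ` s)) \<inter> g ` (convex hull (lat A d ` t)) = g ` (convex hull (lat A d ` (s \<inter> t)))"
      unfolding lat_hull_Int[OF d_nz st, symmetric]
      by (rule inj_on_image_Int[OF inj_interp sub[OF st(1)] sub[OF st(2)], symmetric])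
    then show "convex hull (x ` s) \<inter> convex hull (x ` t) = convex hull (x ` (s \<inter> t))"
      using hull[OF st(1)] hull[OF st(2)] by (simp add: hull[OF st(1), of "s \<inter> t"])
  qed (use face_nondegenerate in auto)
  also have "(\<Union>t\<in>grid_faces n. convex hull (x ` t)) = g ` (\<Union>t\<in>grid_faces n. convex hull (lat A d ` t))"
    unfolding image_UN using hull by (intro SUP_cong) auto
  finally show ?thesis by (simp only: lat_hull_cover[OF d_nz n_pos(1)])
qed

lemma homeomorphic_disk: "g ` T homeomorphic (cball 0 1 :: complex set)"
proof -
  have comp: "compact T" by (simp add: compact_convex_hull)
  have "interior T \<noteq> {}" using d_nz n_pos by (intro interior_triangle_nonempty) auto
  then have "T homeomorphic (cball 0 1 :: complex set)"
    using homeomorphic_convex_compact_cball[OF convex_convex_hull comp, of 1 0] by simp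
  moreover have "T homeomorphic g ` T"
    by (rule homeomorphic_compact[OF comp continuous_on_pl_interp[OF d_nz] refl inj_interp])
  ultimately show ?thesis using homeomorphic_sym homeomorphic_trans by blast
qed

lemma corners: "{(0, 0), (int n, 0), (0, int n)} \<subseteq> grid n - inner_grid n"
  by (auto simp: grid_def inner_grid_def)

lemma weighted_disk: "weighted_triangulated_disk (g ` T) F I (x (0, 0)) (x (int n, 0)) (x (0, int n))"
  unfolding weighted_triangulated_disk_def triangulated_polygonal_disk_def
proof (intro conjI geodesic_image homeomorphic_disk ballI)
  have "3\<^sup>2 \<le> (real n)\<^sup>2" using n3 by (intro power_mono) auto
  then show "1 < (real n)\<^sup>2 / 2 - 1" by simp
  show "{x (0, 0), x (int n, 0), x (0, int n)} \<subseteq> boundary_vertices F"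
    unfolding boundary_vertices_image[OF inj_x_vertices] boundary_vertices_grid[OF n_pos(1)] using corners by blast
  show "distinct [x (0, 0), x (int n, 0), x (0, int n)]"
    using corners n_pos by (auto dest!: inj_onD[OF inj_x])
qed

lemma edges_of_F:
  assumes "{u, v} \<in> edges_of F"
  obtains a b where "{a, b} \<in> edges_of (grid_faces n)" "a \<noteq> b" "u = x a" "v = x b" "x a \<noteq> x b"
proof -
  obtain e where e: "e \<in> edges_of (grid_faces n)" "{u, v} = x ` e"
    using assms unfolding edges_of_image[OF inj_x_vertices] by blast
  have "card e = 2" "card {u, v} = 2" using e(1) assms by (auto simp: edges_of_def)
  then obtain a b where ab: "e = {a, b}" "a \<noteq> b" by (auto simp: card_2_iff)
  have uv: "u \<noteq> v" using \<open>card {u, v} = 2\<close> by auto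
  have "{b, a} = {a, b}" by blast
  with e ab have ed: "{a, b} \<in> edges_of (grid_faces n)" "{b, a} \<in> edges_of (grid_faces n)" by simp_all
  have "(u = x a \<and> v = x b) \<or> (u = x b \<and> v = x a)" using e(2) by (simp add: ab doubleton_eq_iff)
  then show ?thesis using that ed ab(2) uv by metis
qed

lemma pl_metric_dist: "pl_metric F diameter"
  unfolding pl_metric_def
proof (intro conjI ballI allI impI)
  fix e assume e: "e \<in> edges_of F"
  then have "card e = 2" by (simp add: edges_of_def)
  then obtain u v where "e = {u, v}" "u \<noteq> v" by (auto simp: card_2_iff)
  then show "0 < diameter e" by (simp add: diameter_doubleton)
next
  fix a b c assume abc: "{a, b, c} \<in> F \<and> distinct [a, b, c]"
  then have "\<not> affine_dependent {a, b, c}" using face_nondegenerate by fastforce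
  then have "\<not> collinear {a, b, c}" using abc by (simp add: collinear_3_eq_affine_dependent)
  then have "\<not> between (a, c) b" by (metis between_imp_collinear insert_commute)
  then have "dist a c \<noteq> dist a b + dist b c" by (simp add: between)
  then show "diameter {a, c} < diameter {a, b} + diameter {b, c}"
    using dist_triangle[of a c b] by (simp add: diameter_doubleton)
qed

lemma pl_metric_const: "c > 0 \<Longrightarrow> pl_metric F (\<lambda>_. c)"
  by (simp add: pl_metric_def)

abbreviation "y \<equiv> inv_into (grid n) x"

lemma y_x: "v \<in> grid n \<Longrightarrow> y (x v) = v"
  using inj_x by (rule inv_into_f_f)

lemma edge_in_grid: "{a, b} \<in> edges_of (grid_faces n) \<Longrightarrow> a \<in> grid n \<and> b \<in> grid n"
  using edge_in_vertices[OF inj_x_vertices, of "{a, b}"] unfolding vertices_of_grid[OF n_pos(1)] by simp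

lemma label_dist: "packing_label F I diameter (\<lambda>p. ln (1 / (real n)\<^sup>2) + w (y p))"
  unfolding packing_label_def
proof (intro allI impI)
  fix u v assume "{u, v} \<in> edges_of F"
  then obtain a b where ab: "{a, b} \<in> edges_of (grid_faces n)" "u = x a" "v = x b" by (rule edges_of_F) blast
  have k: "1 / (real n)\<^sup>2 > 0" "(real n)\<^sup>2 / 2 - 1 = 1 / (2 * (1 / (real n)\<^sup>2)) - 1" using n_pos by auto
  have "diameter {u, v} = sqrt ((dist (x a) (x b))\<^sup>2)" by (simp add: diameter_doubleton ab)
  also have "\<dots> = sqrt (1 / (real n)\<^sup>2 * edge_sq (1 / (real n)\<^sup>2) (w a) (w b))" by (simp only: edge[OF ab(1)])
  finally show "diameter {u, v} = sqrt (exp (2 * (ln (1 / (real n)\<^sup>2) + w (y u))) + exp (2 * (ln (1 / (real n)\<^sup>2) + w (y v))) +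
      2 * ((real n)\<^sup>2 / 2 - 1) * exp (ln (1 / (real n)\<^sup>2) + w (y u) + (ln (1 / (real n)\<^sup>2) + w (y v))))"
    using edge_in_grid[OF ab(1)] unfolding k(2) packing_length_eq[OF k(1)] by (simp only: ab y_x)
qed

text \<open>For weight 0 the factor \<open>edge_sq\<close> is 1 and the length is the square root of
  \<open>1 / n\<^sup>2\<close>. This is the reason for the choice of the inversive distance: the
  equilateral subdivision is a packing for the same \<open>I\<close>.\<close>

lemma label_const: "packing_label F I (\<lambda>_. 1 / real n) (\<lambda>p. ln (1 / (real n)\<^sup>2) + 0)"
  unfolding packing_label_def
proof (intro allI impI)
  have k: "1 / (real n)\<^sup>2 > 0" "(real n)\<^sup>2 / 2 - 1 = 1 / (2 * (1 / (real n)\<^sup>2)) - 1" using n_pos by auto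
  show "1 / real n = sqrt (exp (2 * (ln (1 / (real n)\<^sup>2) + 0)) + exp (2 * (ln (1 / (real n)\<^sup>2) + 0)) +
      2 * ((real n)\<^sup>2 / 2 - 1) * exp (ln (1 / (real n)\<^sup>2) + 0 + (ln (1 / (real n)\<^sup>2) + 0)))"
    unfolding k(2) packing_length_eq[OF k(1)] by (simp add: edge_sq_def real_sqrt_divide)
qed

lemma flat_dist: "flat_metric F diameter"
  unfolding flat_metric_def
proof (intro conjI pl_metric_dist ballI)
  fix v assume "v \<in> vertices_of F - boundary_vertices F"
  then obtain a where a: "v = x a" "a \<in> inner_grid n"
    unfolding boundary_vertices_image[OF inj_x_vertices] boundary_vertices_grid[OF n_pos(1)]
      vertices_of_image[OF inj_x_vertices] vertices_of_grid[OF n_pos(1)] by blast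
  have "curvature F diameter (x a) = curvature (grid_faces n) (\<lambda>e. diameter (x ` e)) a"
    using a(2) inner_grid_subset by (intro curvature_image[OF inj_x_vertices]) (auto simp: vertices_of_grid[OF n_pos(1)])
  also have "\<dots> = 2 * pi - angle_sum (1 / (real n)\<^sup>2) w a"
  proof (rule curvature_inner[OF n_pos(1) a(2)])
    show "1 / (real n)\<^sup>2 > 0" using n_pos by simp
    fix u v assume "{u, v} \<in> edges_of (grid_faces n)"
    from edge[OF this] show "0 \<le> diameter (x ` {u, v}) \<and> (diameter (x ` {u, v}))\<^sup>2 = 1 / (real n)\<^sup>2 * edge_sq (1 / (real n)\<^sup>2) (w u) (w v)"
      by (simp add: diameter_doubleton)
  qed
  finally show "curvature F diameter v = 0" by (simp add: a flat)
qed

lemma euclidean_packing: "euclidean_packing_metric F I diameter"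
  unfolding euclidean_packing_metric_def packing_metric_def
  using pl_metric_dist label_dist flat_dist diameter_doubleton by blast

text \<open>The factor -w undoes the weight of the realization. What remains is the curvature and
  the area of the equilateral grid, which are explicit.\<close>

lemma uniformized:
  "uniformizes F I diameter (x (0, 0)) (x (int n, 0)) (x (0, int n)) (\<lambda>p. - w (y p)) (\<lambda>_. 1 / real n)"
  unfolding uniformizes_def
proof (intro conjI ballI)
  show "conformal_change F I (\<lambda>p. - w (y p)) diameter (\<lambda>_. 1 / real n)"
    unfolding conformal_change_def using label_dist label_const
    by (intro exI[of _ "\<lambda>p. ln (1 / (real n)\<^sup>2) + w (y p)"]) simp
  show "packing_metric F I (\<lambda>_. 1 / real n)"
    unfolding packing_metric_def using label_const pl_metric_const n_pos by auto
  show "total_area F (\<lambda>_. 1 / real n) = sqrt 3 / 4"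
    using total_area_image[OF inj_x_vertices, of "1 / real n"] total_area_grid[OF n_pos(1)] n_pos card_grid_face by simp
  have curv: "curvature F (\<lambda>_. 1 / real n) (x v) = (if v \<in> {(0, 0), (int n, 0), (0, int n)} then 2 * pi / 3 else 0)" if "v \<in> grid n" for v
    using curvature_image[OF inj_x_vertices, of v "\<lambda>_. 1 / real n"] that curvature_equilateral[OF n_pos(1) _ that, of "1 / real n"] n_pos
    by (simp add: vertices_of_grid)
  show "curvature F (\<lambda>_. 1 / real n) v = 2 * pi / 3" if v: "v \<in> {x (0, 0), x (int n, 0), x (0, int n)}" for v
    using v curv corners by auto
  show "curvature F (\<lambda>_. 1 / real n) v = 0" if v: "v \<in> vertices_of F - {x (0, 0), x (int n, 0), x (0, int n)}" for v
    using v curv unfolding vertices_of_image[OF inj_x_vertices] vertices_of_grid[OF n_pos(1)] by auto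
qed

lemma conformal_map:
  "discrete_conformal_map A (A + of_nat n * d) (A + of_nat n * d * hex_root) F I diameter (x (0, 0)) (x (int n, 0)) (x (0, int n)) g"
  unfolding discrete_conformal_map_def
proof (intro exI conjI)
  \<comment> \<open>The combinatorial isomorphism sends a realized vertex back to its lattice
    point.\<close>
  define \<phi> where "\<phi> = (\<lambda>p. lat A d (y p))"
  have \<phi>: "\<phi> (x v) = lat A d v" if "v \<in> grid n" for v by (simp add: \<phi>_def y_x[OF that])
  have vF: "vertices_of F = x ` grid n" by (simp only: vertices_of_image[OF inj_x_vertices] vertices_of_grid[OF n_pos(1)])
  have im: "(\<lambda>t. \<phi> ` t) ` F = (`) (lat A d) ` grid_faces n"
    unfolding image_image by (intro image_cong refl \<phi>) (use grid_faces_subset in blast)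
  show "uniformizes F I diameter (x (0, 0)) (x (int n, 0)) (x (0, int n)) (\<lambda>p. - w (y p)) (\<lambda>_. 1 / real n)" by (rule uniformized)
  show "inj_on \<phi> (vertices_of F)" unfolding vF by (rule inj_onI) (metis \<phi> image_iff inj_lat[OF d_nz, THEN injD])
  show "(`) (lat A d) ` grid_faces n = (\<lambda>t. \<phi> ` t) ` F" by (rule im[symmetric])
  show "geodesic_triangulation T ((`) (lat A d) ` grid_faces n)" by (rule geodesic_lattice)
  show "\<phi> (x (0, 0)) = A" "\<phi> (x (int n, 0)) = A + of_nat n * d" "\<phi> (x (0, int n)) = A + of_nat n * d * hex_root"
    using corners by (simp_all add: \<phi> lat_def)
  show "\<forall>v v'. {v, v'} \<in> edges_of F \<longrightarrow> dist (\<phi> v) (\<phi> v') = 1 / real n"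
  proof (intro allI impI)
    fix u v assume "{u, v} \<in> edges_of F"
    then obtain a b where ab: "{a, b} \<in> edges_of (grid_faces n)" "u = x a" "v = x b" by (rule edges_of_F) blast
    then obtain i j where "{a, b} = {(i, j), (i + 1, j)} \<or> {a, b} = {(i, j), (i, j + 1)} \<or> {a, b} = {(i + 1, j), (i, j + 1)}"
      unfolding edges_of_grid by blast
    then have "cmod (lat A d a - lat A d b) = cmod d"
    proof (elim disjE)
      assume "{a, b} = {(i, j), (i + 1, j)}"
      then have "{lat A d a - lat A d b, lat A d b - lat A d a} = {d, - d}" by (auto simp: doubleton_eq_iff lat_def algebra_simps)
      then show ?thesis by (auto simp: doubleton_eq_iff)
    next
      assume "{a, b} = {(i, j), (i, j + 1)}"
      then have "{lat A d a - lat A d b, lat A d b - lat A d a} = {d * hex_root, - (d * hex_root)}" by (auto simp: doubleton_eq_iff lat_def algebra_simps)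
      then show ?thesis by (auto simp: doubleton_eq_iff norm_mult)
    next
      assume "{a, b} = {(i + 1, j), (i, j + 1)}"
      then have "{lat A d a - lat A d b, lat A d b - lat A d a} = {d * (hex_root - 1), - (d * (hex_root - 1))}" by (auto simp: doubleton_eq_iff lat_def algebra_simps)
      then show ?thesis by (auto simp: doubleton_eq_iff norm_mult simp del: minus_mult_right)
    qed
    then show "dist (\<phi> u) (\<phi> v) = 1 / real n" using edge_in_grid[OF ab(1)] norm_d by (simp add: ab \<phi> dist_norm)
  qed
  show "\<forall>v\<in>vertices_of F. g (\<phi> v) = v" unfolding vF by (auto simp: \<phi> pl_interp_lat[OF d_nz n_pos(1)])
  show "\<forall>t\<in>(`) (lat A d) ` grid_faces n. orientation_preserving_affine_on (convex hull t) g"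
  proof (safe)
    fix t assume t: "t \<in> grid_faces n"
    obtain a b c where abc: "t = {a, b, c}" and or: "Im ((x c - x a) / (x b - x a)) > 0"
      "Im ((lat A d c - lat A d a) / (lat A d b - lat A d a)) > 0" using t by (rule face_orientation) blast
    have "card {a, b, c} = 3" using card_grid_face[OF t] by (simp add: abc)
    then have ne: "a \<noteq> b" "a \<noteq> c" "b \<noteq> c" by (auto simp: card_insert_if split: if_splits)
    have "orientation_preserving_affine_on (convex hull {lat A d a, lat A d b, lat A d c}) g"
    proof (rule orientation_preserving_affine_onI[OF or(2,1)])
      fix p q r :: real assume pqr: "0 \<le> p" "0 \<le> q" "0 \<le> r" "p + q + r = 1"
      define f where "f = (\<lambda>v. if v = a then p else if v = b then q else r)"
      have "g (\<Sum>v\<in>t. f v *\<^sub>R lat A d v) = (\<Sum>v\<in>t. f v *\<^sub>R x v)"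
        using pqr ne by (intro pl_interp_face[OF d_nz t]) (auto simp: f_def abc)
      then show "g (p *\<^sub>R lat A d a + q *\<^sub>R lat A d b + r *\<^sub>R lat A d c) = p *\<^sub>R x a + q *\<^sub>R x b + r *\<^sub>R x c"
        using ne by (simp add: f_def abc add.assoc)
    qed
    then show "orientation_preserving_affine_on (convex hull (lat A d ` t)) g" by (simp add: abc)
  qed
qed

end

section \<open>Closeness of the interpolation\<close>

text \<open>For q the modulus on the right, 4 q^2 = (2s + t)^2 + 3 t^2, and the same with s and t
  exchanged; so each coordinate is at most 2q.\<close>

lemma hex_coordinates_bound: "\<bar>s\<bar> + \<bar>t\<bar> \<le> 4 * cmod (of_real s + of_real t * hex_root)"
proof -
  define q where "q = cmod (of_real s + of_real t * hex_root)"
  have q: "q\<^sup>2 = s\<^sup>2 + s * t + t\<^sup>2"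
    unfolding q_def cmod_power2 by (simp add: hex_root_def power_divide algebra_simps power2_eq_square)
  have "q \<ge> 0" by (simp add: q_def)
  have "(2 * q)\<^sup>2 = (2 * s + t)\<^sup>2 + 3 * t\<^sup>2" "(2 * q)\<^sup>2 = (2 * t + s)\<^sup>2 + 3 * s\<^sup>2"
    by (simp add: power_mult_distrib q, simp add: power2_eq_square algebra_simps)+
  moreover have "0 \<le> (2 * s + t)\<^sup>2" "0 \<le> (2 * t + s)\<^sup>2" "0 \<le> s\<^sup>2" "0 \<le> t\<^sup>2" by simp_all
  ultimately have "\<bar>t\<bar>\<^sup>2 \<le> (2 * q)\<^sup>2" "\<bar>s\<bar>\<^sup>2 \<le> (2 * q)\<^sup>2" unfolding power2_abs by linarith+
  moreover have "0 \<le> 2 * q" using \<open>q \<ge> 0\<close> by simp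
  ultimately have "\<bar>t\<bar> \<le> 2 * q" "\<bar>s\<bar> \<le> 2 * q" by (blast intro: power2_le_imp_le)+
  then show ?thesis by (simp add: q_def)
qed

text \<open>On one face both maps are close to the linear map given by the derivative at the corner
  \<open>a\<close>. The edge vectors contribute 4 (B + C) h, the variation of the derivative L h,
  and the Taylor error at \<open>y\<close> 2 B h. The result is a Lipschitz bound for the
  difference, stronger than smallness of its values.\<close>

lemma affine_smooth_difference:
  fixes G G' :: "complex \<Rightarrow> complex"
  assumes first: "\<And>z y. z \<in> T \<Longrightarrow> y \<in> T \<Longrightarrow> cmod (G y - G z - G' z * (y - z)) \<le> B * (cmod (y - z))\<^sup>2"
    and lip: "\<And>z y. z \<in> T \<Longrightarrow> y \<in> T \<Longrightarrow> cmod (G' y - G' z) \<le> L * cmod (y - z)"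
    and nonneg: "B \<ge> 0" "L \<ge> 0" "C \<ge> 0" and h: "cmod \<delta> = h"
    and T: "a \<in> T" "a + \<delta> \<in> T" "a + \<delta> * hex_root \<in> T" "z \<in> T" "y \<in> T"
    and z: "z = a + \<delta> * (of_real \<beta> + of_real \<gamma> * hex_root)" "0 \<le> \<beta>" "0 \<le> \<gamma>" "\<beta> + \<gamma> \<le> 1"
    and y: "y = a + \<delta> * (of_real \<beta>' + of_real \<gamma>' * hex_root)" "0 \<le> \<beta>'" "0 \<le> \<gamma>'" "\<beta>' + \<gamma>' \<le> 1"
    and X: "cmod (X - (G (a + \<delta>) - G a)) \<le> C * h\<^sup>2"
    and Y: "cmod (Y - (G (a + \<delta> * hex_root) - G a)) \<le> C * h\<^sup>2"
  shows "cmod ((\<beta> - \<beta>') *\<^sub>R X + (\<gamma> - \<gamma>') *\<^sub>R Y - (G z - G y)) \<le> (L + 6 * B + 4 * C) * h * cmod (z - y)"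
proof -
  define s t where "s = \<beta> - \<beta>'" and "t = \<gamma> - \<gamma>'"
  have h0: "h \<ge> 0" using h by auto
  have zy: "z - y = \<delta> * (of_real s + of_real t * hex_root)" by (simp add: z(1) y(1) s_def t_def algebra_simps)
  have st: "(\<bar>s\<bar> + \<bar>t\<bar>) * h \<le> 4 * cmod (z - y)"
    unfolding zy norm_mult h using mult_right_mono[OF hex_coordinates_bound[of s t] h0] by (simp add: mult_ac)
  have dist: "cmod (\<delta> * (of_real p + of_real q * hex_root)) \<le> h" if "0 \<le> p" "0 \<le> q" "p + q \<le> 1" for p q
  proof -
    have "cmod (of_real p + of_real q * hex_root) \<le> p + q"
      using norm_triangle_ineq[of "of_real p" "of_real q * hex_root"] that by (simp add: norm_mult)
    then have "cmod (of_real p + of_real q * hex_root) \<le> 1" using that by linarith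
    then show ?thesis using h0 mult_left_mono[of _ 1 h] by (simp add: norm_mult h)
  qed
  have ya: "cmod (y - a) \<le> h" and za: "cmod (z - a) \<le> h"
    unfolding y(1) z(1) using dist[OF y(2-4)] dist[OF z(2-4)] by simp_all
  have zy2: "cmod (z - y) \<le> 2 * h" using norm_triangle_ineq4[of "z - a" "y - a"] ya za by simp
  have X': "cmod (X - G' a * \<delta>) \<le> (B + C) * h\<^sup>2"
    using norm_triangle_ineq[of "X - (G (a + \<delta>) - G a)" "G (a + \<delta>) - G a - G' a * \<delta>"] X first[OF T(1,2)]
    by (simp add: h algebra_simps)
  have Y': "cmod (Y - G' a * (\<delta> * hex_root)) \<le> (B + C) * h\<^sup>2"
    using norm_triangle_ineq[of "Y - (G (a + \<delta> * hex_root) - G a)" "G (a + \<delta> * hex_root) - G a - G' a * (\<delta> * hex_root)"] Y first[OF T(1,3)]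
    by (simp add: h norm_mult algebra_simps)
  \<comment> \<open>Everything is compared with the derivative at a, except that the increment of G
    is expanded at y; the change of derivative from a to y is the third term.\<close>
  have "s *\<^sub>R X + t *\<^sub>R Y - (G z - G y) = s *\<^sub>R (X - G' a * \<delta>) + t *\<^sub>R (Y - G' a * (\<delta> * hex_root))
      - (G' y - G' a) * (z - y) - (G z - G y - G' y * (z - y))"
    unfolding zy by (simp add: scaleR_conv_of_real algebra_simps)
  also have "cmod \<dots> \<le> cmod (s *\<^sub>R (X - G' a * \<delta>)) + cmod (t *\<^sub>R (Y - G' a * (\<delta> * hex_root)))
      + cmod ((G' y - G' a) * (z - y)) + cmod (G z - G y - G' y * (z - y))"
    by (intro norm_triangle_le_diff add_mono norm_triangle_ineq norm_triangle_ineq4[THEN order_trans] order_refl)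
  also have "\<dots> \<le> \<bar>s\<bar> * ((B + C) * h\<^sup>2) + \<bar>t\<bar> * ((B + C) * h\<^sup>2) + L * h * cmod (z - y) + B * (2 * h) * cmod (z - y)"
  proof (intro add_mono)
    show "cmod (s *\<^sub>R (X - G' a * \<delta>)) \<le> \<bar>s\<bar> * ((B + C) * h\<^sup>2)"
      unfolding norm_scaleR by (intro mult_left_mono X') simp
    show "cmod (t *\<^sub>R (Y - G' a * (\<delta> * hex_root))) \<le> \<bar>t\<bar> * ((B + C) * h\<^sup>2)"
      unfolding norm_scaleR by (intro mult_left_mono Y') simp
    have "cmod (G' y - G' a) \<le> L * h"
      using lip[OF T(1,5)] mult_left_mono[OF ya nonneg(2)] by linarith
    then show "cmod ((G' y - G' a) * (z - y)) \<le> L * h * cmod (z - y)"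
      unfolding norm_mult by (rule mult_right_mono) simp
    have "(cmod (z - y))\<^sup>2 \<le> (2 * h) * cmod (z - y)"
      unfolding power2_eq_square by (intro mult_right_mono zy2) simp
    then have "B * (cmod (z - y))\<^sup>2 \<le> B * ((2 * h) * cmod (z - y))" by (rule mult_left_mono) (rule nonneg)
    then show "cmod (G z - G y - G' y * (z - y)) \<le> B * (2 * h) * cmod (z - y)"
      using first[OF T(5,4)] by (simp add: mult_ac)
  qed
  also have "\<bar>s\<bar> * ((B + C) * h\<^sup>2) + \<bar>t\<bar> * ((B + C) * h\<^sup>2) = (B + C) * h * ((\<bar>s\<bar> + \<bar>t\<bar>) * h)"
    by (simp add: power2_eq_square algebra_simps)
  also have "\<dots> \<le> (B + C) * h * (4 * cmod (z - y))"
    using st nonneg h0 by (intro mult_left_mono) auto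
  also have "(B + C) * h * (4 * cmod (z - y)) + L * h * cmod (z - y) + B * (2 * h) * cmod (z - y) = (L + 6 * B + 4 * C) * h * cmod (z - y)"
    by (simp add: algebra_simps)
  finally show ?thesis by (simp add: s_def t_def)
qed

context univalent_triangle
begin

text \<open>The difference of the interpolation and \<open>G\<close> is M/n-Lipschitz and vanishes
  at \<open>A\<close>. Once M/n is below the constant of \<open>bilipschitz\<close>, the
  interpolation is injective; once it is below \<epsilon>, it is uniformly \<epsilon>-close, as
  points of \<open>T\<close> are within distance 1 of \<open>A\<close>.\<close>

lemma exists_realization:
  assumes "\<epsilon> > 0"
  obtains n x w where "grid_realization A (e / of_nat n) n x w"
    "\<And>z. z \<in> T \<Longrightarrow> cmod (pl_interp A (e / of_nat n) n x z - G z) < \<epsilon>"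
proof -
  obtain C N where CN: "C \<ge> 0" "N \<ge> 1"
    and pack: "\<And>n. n \<ge> N \<Longrightarrow> \<exists>w x. x (0, 0) = G A \<and>
      (\<forall>v\<in>inner_grid n. angle_sum (1 / (real n)\<^sup>2) w v = 2 * pi) \<and>
      (\<forall>i j :: nat. i + j + 1 \<le> n \<longrightarrow>
        (cmod (x (int i + 1, int j) - x (int i, int j)))\<^sup>2 = 1 / (real n)\<^sup>2 * edge_sq (1 / (real n)\<^sup>2) (w (int i, int j)) (w (int i + 1, int j)) \<and>
        (cmod (x (int i, int j + 1) - x (int i, int j)))\<^sup>2 = 1 / (real n)\<^sup>2 * edge_sq (1 / (real n)\<^sup>2) (w (int i, int j)) (w (int i, int j + 1)) \<and>
        (cmod (x (int i, int j + 1) - x (int i + 1, int j)))\<^sup>2 = 1 / (real n)\<^sup>2 * edge_sq (1 / (real n)\<^sup>2) (w (int i + 1, int j)) (w (int i, int j + 1)) \<and>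
        Im ((x (int i, int j + 1) - x (int i, int j)) / (x (int i + 1, int j) - x (int i, int j))) > 0 \<and>
        cmod ((x (int i + 1, int j) - x (int i, int j)) - (G (pt n (int i + 1, int j)) - G (pt n (int i, int j)))) \<le> C / (real n)\<^sup>2 \<and>
        cmod ((x (int i, int j + 1) - x (int i, int j)) - (G (pt n (int i, int j + 1)) - G (pt n (int i, int j)))) \<le> C / (real n)\<^sup>2) \<and>
      (\<forall>i j :: nat. i + j + 2 \<le> n \<longrightarrow>
        Im ((x (int i, int j + 1) - x (int i + 1, int j)) / (x (int i + 1, int j + 1) - x (int i + 1, int j))) > 0)"
    by (rule exists_packing) blast
  obtain B where B: "B \<ge> 0" "\<And>z y. z \<in> T \<Longrightarrow> y \<in> T \<Longrightarrow> cmod (G y - G z - deriv G z * (y - z)) \<le> B * (cmod (y - z))\<^sup>2"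
    by (rule first_order) blast
  obtain K where K0: "K \<ge> 0" "\<And>z y. z \<in> T \<Longrightarrow> y \<in> T \<Longrightarrow>
    cmod (deriv G y - (\<Sum>i\<le>0. (deriv ^^ i) (deriv G) z * (y - z) ^ i / fact i)) \<le> K * cmod (y - z) ^ Suc 0"
    by (rule taylor_compact[OF holomorphic_deriv[OF holo_G open_U] open_U T_U compact_T convex_T, where n = 0]) blast
  have K: "cmod (deriv G y - deriv G z) \<le> K * cmod (y - z)" if "z \<in> T" "y \<in> T" for z y
    using K0(2)[OF that] by simp
  obtain m where m: "m > 0" "\<And>z y. z \<in> T \<Longrightarrow> y \<in> T \<Longrightarrow> m * cmod (y - z) \<le> cmod (G y - G z)"
    by (rule bilipschitz) blast
  \<comment> \<open>C is doubled because the third side of an upward face, needed for downward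
    faces, is a difference of two controlled edge vectors.\<close>
  define M where "M = K + 6 * B + 4 * (2 * C)"
  have M: "M \<ge> 0" using K0(1) B(1) CN by (simp add: M_def)
  obtain n where n: "real n > max (M / m) (M / \<epsilon>) + real N + 3" using reals_Archimedean2 by blast
  have "0 \<le> max (M / m) (M / \<epsilon>)" using M m assms by (simp add: le_max_iff_disj)
  then have n3: "n \<ge> 3" "n \<ge> N" "n \<ge> 1" using n by linarith+
  have n0: "real n > 0" using n3 by simp
  have "M / m < real n" "M / \<epsilon> < real n" using n by linarith+
  then have Mm: "M / real n < m" "M / real n < \<epsilon>" using m(1) assms n0 by (simp_all add: field_simps)
  obtain w x where x0: "x (0, 0) = G A" and fl: "\<And>v. v \<in> inner_grid n \<Longrightarrow> angle_sum (1 / (real n)\<^sup>2) w v = 2 * pi"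
    and up0: "\<And>i j :: nat. i + j + 1 \<le> n \<Longrightarrow>
        (cmod (x (int i + 1, int j) - x (int i, int j)))\<^sup>2 = 1 / (real n)\<^sup>2 * edge_sq (1 / (real n)\<^sup>2) (w (int i, int j)) (w (int i + 1, int j)) \<and>
        (cmod (x (int i, int j + 1) - x (int i, int j)))\<^sup>2 = 1 / (real n)\<^sup>2 * edge_sq (1 / (real n)\<^sup>2) (w (int i, int j)) (w (int i, int j + 1)) \<and>
        (cmod (x (int i, int j + 1) - x (int i + 1, int j)))\<^sup>2 = 1 / (real n)\<^sup>2 * edge_sq (1 / (real n)\<^sup>2) (w (int i + 1, int j)) (w (int i, int j + 1)) \<and>
        Im ((x (int i, int j + 1) - x (int i, int j)) / (x (int i + 1, int j) - x (int i, int j))) > 0 \<and>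
        cmod ((x (int i + 1, int j) - x (int i, int j)) - (G (pt n (int i + 1, int j)) - G (pt n (int i, int j)))) \<le> C / (real n)\<^sup>2 \<and>
        cmod ((x (int i, int j + 1) - x (int i, int j)) - (G (pt n (int i, int j + 1)) - G (pt n (int i, int j)))) \<le> C / (real n)\<^sup>2"
    and down0: "\<And>i j :: nat. i + j + 2 \<le> n \<Longrightarrow>
        Im ((x (int i, int j + 1) - x (int i + 1, int j)) / (x (int i + 1, int j + 1) - x (int i + 1, int j))) > 0"
    using pack[OF n3(2)] by blast
  define d where "d = e / of_nat n"
  have d: "cmod d = 1 / real n" "d \<noteq> 0" using norm_e n0 by (auto simp: d_def norm_divide)
  have nd: "of_nat n * d = e" using n0 by (simp add: d_def)
  have T: "T = convex hull {A, A + of_nat n * d, A + of_nat n * d * hex_root}" by (simp add: T_eq nd)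
  define g where "g = pl_interp A d n x"
  note up1 = up0[of "nat i" "nat j" for i j, folded d_def]
  have up: "(cmod (x (i + 1, j) - x (i, j)))\<^sup>2 = 1 / (real n)\<^sup>2 * edge_sq (1 / (real n)\<^sup>2) (w (i, j)) (w (i + 1, j))"
    "(cmod (x (i, j + 1) - x (i, j)))\<^sup>2 = 1 / (real n)\<^sup>2 * edge_sq (1 / (real n)\<^sup>2) (w (i, j)) (w (i, j + 1))"
    "(cmod (x (i, j + 1) - x (i + 1, j)))\<^sup>2 = 1 / (real n)\<^sup>2 * edge_sq (1 / (real n)\<^sup>2) (w (i + 1, j)) (w (i, j + 1))"
    "Im ((x (i, j + 1) - x (i, j)) / (x (i + 1, j) - x (i, j))) > 0"
    "cmod ((x (i + 1, j) - x (i, j)) - (G (lat A d (i + 1, j)) - G (lat A d (i, j)))) \<le> C / (real n)\<^sup>2"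
    "cmod ((x (i, j + 1) - x (i, j)) - (G (lat A d (i, j + 1)) - G (lat A d (i, j)))) \<le> C / (real n)\<^sup>2"
    if "0 \<le> i" "0 \<le> j" "i + j + 1 \<le> int n" for i j
  proof -
    have eq: "int (nat i) = i" "int (nat j) = j" "nat i + nat j + 1 \<le> n" using that by auto
    note q = up1[OF eq(3), unfolded eq(1,2)]
    show "(cmod (x (i + 1, j) - x (i, j)))\<^sup>2 = 1 / (real n)\<^sup>2 * edge_sq (1 / (real n)\<^sup>2) (w (i, j)) (w (i + 1, j))"
      using q by (elim conjE)
    show "(cmod (x (i, j + 1) - x (i, j)))\<^sup>2 = 1 / (real n)\<^sup>2 * edge_sq (1 / (real n)\<^sup>2) (w (i, j)) (w (i, j + 1))"
      using q by (elim conjE)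
    show "(cmod (x (i, j + 1) - x (i + 1, j)))\<^sup>2 = 1 / (real n)\<^sup>2 * edge_sq (1 / (real n)\<^sup>2) (w (i + 1, j)) (w (i, j + 1))"
      using q by (elim conjE)
    show "Im ((x (i, j + 1) - x (i, j)) / (x (i + 1, j) - x (i, j))) > 0" using q by (elim conjE)
    show "cmod ((x (i + 1, j) - x (i, j)) - (G (lat A d (i + 1, j)) - G (lat A d (i, j)))) \<le> C / (real n)\<^sup>2"
      using q by (elim conjE)
    show "cmod ((x (i, j + 1) - x (i, j)) - (G (lat A d (i, j + 1)) - G (lat A d (i, j)))) \<le> C / (real n)\<^sup>2"
      using q by (elim conjE)
  qed
  have down: "Im ((x (i, j + 1) - x (i + 1, j)) / (x (i + 1, j + 1) - x (i + 1, j))) > 0"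
    if "0 \<le> i" "0 \<le> j" "i + j + 2 \<le> int n" for i j
  proof -
    have eq: "int (nat i) = i" "int (nat j) = j" "nat i + nat j + 2 \<le> n" using that by auto
    show ?thesis by (rule down0[OF eq(3), unfolded eq(1,2)])
  qed
  have edge: "(dist (x u) (x v))\<^sup>2 = 1 / (real n)\<^sup>2 * edge_sq (1 / (real n)\<^sup>2) (w u) (w v)"
    if uv: "{u, v} \<in> edges_of (grid_faces n)" for u v
  proof -
    obtain i j where ij: "0 \<le> i" "0 \<le> j" "i + j + 1 \<le> int n"
      and e: "{u, v} = {(i, j), (i + 1, j)} \<or> {u, v} = {(i, j), (i, j + 1)} \<or> {u, v} = {(i + 1, j), (i, j + 1)}"
      using uv unfolding edges_of_grid by blast
    obtain a b where ab: "{u, v} = {a, b}" and len: "(cmod (x b - x a))\<^sup>2 = 1 / (real n)\<^sup>2 * edge_sq (1 / (real n)\<^sup>2) (w a) (w b)"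
      using e up(1-3)[OF ij] by blast
    from ab consider "u = a" "v = b" | "u = b" "v = a" by (auto simp: doubleton_eq_iff)
    then show ?thesis
      by cases (simp_all add: len dist_norm norm_minus_commute[of "x a"] edge_sq_commute[of _ "w b"])
  qed
  have hull_T: "convex hull (lat A d ` t) \<subseteq> T" if "t \<in> grid_faces n" for t
    using lat_hull_cover[OF d(2) n3(3), of A] that unfolding T by blast
  have face: "\<exists>a b c \<delta>. t = {a, b, c} \<and> a \<noteq> b \<and> a \<noteq> c \<and> b \<noteq> c \<and> cmod \<delta> = 1 / real n \<and>
      lat A d b = lat A d a + \<delta> \<and> lat A d c = lat A d a + \<delta> * hex_root \<and>
      cmod ((x b - x a) - (G (lat A d b) - G (lat A d a))) \<le> 2 * C * (1 / real n)\<^sup>2 \<and>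
      cmod ((x c - x a) - (G (lat A d c) - G (lat A d a))) \<le> 2 * C * (1 / real n)\<^sup>2"
    if "t \<in> grid_faces n" for t
  proof -
    have C2: "C / (real n)\<^sup>2 \<le> 2 * C * (1 / real n)\<^sup>2" using CN n0 by (simp add: power_divide field_simps)
    from that show ?thesis
    proof (cases rule: grid_faces_cases)
      case ij: (up i j)
      show ?thesis
        using up(5,6)[OF ij(2-4)] C2 d(1)
        by (intro exI[of _ "(i, j)"] exI[of _ "(i + 1, j)"] exI[of _ "(i, j + 1)"] exI[of _ d])
          (simp add: ij(1) up_face_def lat_def algebra_simps)
    next
      case ij: (down i j)
      have r: "0 \<le> i + 1" "i + 1 + j + 1 \<le> int n" and r': "i + j + 1 \<le> int n" using ij by auto
      have E: "cmod ((x (i + 1, j + 1) - x (i + 1, j)) - (G (lat A d (i + 1, j + 1)) - G (lat A d (i + 1, j)))) \<le> 2 * C * (1 / real n)\<^sup>2"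
        using up(6)[OF r(1) ij(3) r(2)] C2 by linarith
      have E': "cmod ((x (i, j + 1) - x (i + 1, j)) - (G (lat A d (i, j + 1)) - G (lat A d (i + 1, j)))) \<le> 2 * C * (1 / real n)\<^sup>2"
      proof -
        have eq: "(x (i, j + 1) - x (i + 1, j)) - (G (lat A d (i, j + 1)) - G (lat A d (i + 1, j)))
          = ((x (i, j + 1) - x (i, j)) - (G (lat A d (i, j + 1)) - G (lat A d (i, j))))
            - ((x (i + 1, j) - x (i, j)) - (G (lat A d (i + 1, j)) - G (lat A d (i, j))))" by simp
        have "cmod ((x (i, j + 1) - x (i + 1, j)) - (G (lat A d (i, j + 1)) - G (lat A d (i + 1, j)))) \<le> C / (real n)\<^sup>2 + C / (real n)\<^sup>2"
          unfolding eq by (rule order_trans[OF norm_triangle_ineq4 add_mono[OF up(6)[OF ij(2,3) r'] up(5)[OF ij(2,3) r']]])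
        then show ?thesis by (simp add: power_divide)
      qed
      have l: "lat A d (i + 1, j + 1) = lat A d (i + 1, j) + d * hex_root"
        "lat A d (i, j + 1) = lat A d (i + 1, j) + d * hex_root * hex_root"
        unfolding mult.assoc hex_root_sq by (simp_all add: lat_def algebra_simps)
      show ?thesis
        using E E' l d(1)
        by (intro exI[of _ "(i + 1, j)"] exI[of _ "(i + 1, j + 1)"] exI[of _ "(i, j + 1)"] exI[of _ "d * hex_root"])
          (auto simp: ij(1) down_face_def norm_mult)
    qed
  qed
  have local_lip: "cmod ((g z - G z) - (g y - G y)) \<le> M / real n * cmod (z - y)"
    if t: "t \<in> grid_faces n" and z: "z \<in> convex hull (lat A d ` t)" and y: "y \<in> convex hull (lat A d ` t)" for t z y
  proof -
    obtain a b c \<delta> where abc: "t = {a, b, c}" "a \<noteq> b" "a \<noteq> c" "b \<noteq> c" and \<delta>: "cmod \<delta> = 1 / real n"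
      "lat A d b = lat A d a + \<delta>" "lat A d c = lat A d a + \<delta> * hex_root"
      and E: "cmod ((x b - x a) - (G (lat A d b) - G (lat A d a))) \<le> 2 * C * (1 / real n)\<^sup>2"
        "cmod ((x c - x a) - (G (lat A d c) - G (lat A d a))) \<le> 2 * C * (1 / real n)\<^sup>2"
      using face[OF t] by blast
    have coord: "\<exists>\<beta> \<gamma>. 0 \<le> \<beta> \<and> 0 \<le> \<gamma> \<and> \<beta> + \<gamma> \<le> 1 \<and> z = lat A d a + \<delta> * (of_real \<beta> + of_real \<gamma> * hex_root) \<and>
        g z = x a + \<beta> *\<^sub>R (x b - x a) + \<gamma> *\<^sub>R (x c - x a)" if "z \<in> convex hull (lat A d ` t)" for z
    proof -
      have "z \<in> convex hull {lat A d a, lat A d b, lat A d c}" using that by (simp add: abc)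
      then obtain \<alpha> \<beta> \<gamma> where p: "0 \<le> \<alpha>" "0 \<le> \<beta>" "0 \<le> \<gamma>" "\<alpha> + \<beta> + \<gamma> = 1"
        and z: "z = \<alpha> *\<^sub>R lat A d a + \<beta> *\<^sub>R lat A d b + \<gamma> *\<^sub>R lat A d c"
        unfolding convex_hull_3 by blast
      define f where "f = (\<lambda>v. if v = a then \<alpha> else if v = b then \<beta> else \<gamma>)"
      have s: "(\<Sum>v\<in>t. f v *\<^sub>R u v) = \<alpha> *\<^sub>R u a + \<beta> *\<^sub>R u b + \<gamma> *\<^sub>R u c" for u :: "int \<times> int \<Rightarrow> complex"
        using abc by (simp add: f_def add.assoc)
      have "g (\<Sum>v\<in>t. f v *\<^sub>R lat A d v) = (\<Sum>v\<in>t. f v *\<^sub>R x v)"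
        unfolding g_def using p abc by (intro pl_interp_face[OF d(2) t]) (auto simp: f_def)
      then have gz: "g z = \<alpha> *\<^sub>R x a + \<beta> *\<^sub>R x b + \<gamma> *\<^sub>R x c" by (simp only: s z)
      have \<alpha>: "\<alpha> = 1 - \<beta> - \<gamma>" using p by simp
      show ?thesis
      proof (intro exI conjI)
        show "z = lat A d a + \<delta> * (of_real \<beta> + of_real \<gamma> * hex_root)"
          unfolding z \<alpha> \<delta>(2,3) by (simp add: scaleR_conv_of_real algebra_simps)
        show "g z = x a + \<beta> *\<^sub>R (x b - x a) + \<gamma> *\<^sub>R (x c - x a)"
          unfolding gz \<alpha> by (simp add: algebra_simps)
      qed (use p in auto)
    qed
    obtain \<beta> \<gamma> where cz: "0 \<le> \<beta>" "0 \<le> \<gamma>" "\<beta> + \<gamma> \<le> 1" "z = lat A d a + \<delta> * (of_real \<beta> + of_real \<gamma> * hex_root)"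
        "g z = x a + \<beta> *\<^sub>R (x b - x a) + \<gamma> *\<^sub>R (x c - x a)" using coord[OF z] by blast
    obtain \<beta>' \<gamma>' where cy: "0 \<le> \<beta>'" "0 \<le> \<gamma>'" "\<beta>' + \<gamma>' \<le> 1" "y = lat A d a + \<delta> * (of_real \<beta>' + of_real \<gamma>' * hex_root)"
        "g y = x a + \<beta>' *\<^sub>R (x b - x a) + \<gamma>' *\<^sub>R (x c - x a)" using coord[OF y] by blast
    have vT: "lat A d a \<in> T" "lat A d b \<in> T" "lat A d c \<in> T"
      using hull_T[OF t] by (auto simp: abc hull_inc)
    have C': "2 * C \<ge> 0" using CN by simp
    have "cmod ((\<beta> - \<beta>') *\<^sub>R (x b - x a) + (\<gamma> - \<gamma>') *\<^sub>R (x c - x a) - (G z - G y))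
        \<le> (K + 6 * B + 4 * (2 * C)) * (1 / real n) * cmod (z - y)"
      by (rule affine_smooth_difference[OF B(2) K B(1) K0(1) C' \<delta>(1) vT(1) vT(2)[unfolded \<delta>(2)] vT(3)[unfolded \<delta>(3)] _ _
          cz(4,1-3) cy(4,1-3) E(1)[unfolded \<delta>(2)] E(2)[unfolded \<delta>(3)]]) (use hull_T[OF t] z y in auto)
    moreover have "(g z - G z) - (g y - G y) = (\<beta> - \<beta>') *\<^sub>R (x b - x a) + (\<gamma> - \<gamma>') *\<^sub>R (x c - x a) - (G z - G y)"
      unfolding cz(5) cy(5) by (simp add: algebra_simps)
    ultimately show ?thesis by (simp only: M_def times_divide_eq_right mult_1_right)
  qed
  have lip: "cmod ((g z - G z) - (g y - G y)) \<le> M / real n * cmod (z - y)" if "z \<in> T" "y \<in> T" for z y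
  proof (rule lipschitz_on_convex_finite_cover[of "grid_faces n" "\<lambda>t. convex hull (lat A d ` t)" T])
    show "closed (convex hull (lat A d ` t))" if "t \<in> grid_faces n" for t
      by (intro compact_imp_closed finite_imp_compact_convex_hull finite_imageI finite_face[OF that])
    show "(\<Union>t\<in>grid_faces n. convex hull (lat A d ` t)) = T" unfolding T by (rule lat_hull_cover[OF d(2) n3(3)])
    show "convex T" by (rule convex_T)
  qed (use local_lip M n0 that in auto)
  have AT: "A \<in> T" by (simp add: T_eq hull_inc)
  have gA: "g A = G A"
    using pl_interp_lat[OF d(2) n3(3), of "(0, 0)" A x] x0 by (simp add: g_def grid_def lat_def)
  have close: "cmod (g z - G z) < \<epsilon>" if "z \<in> T" for z
  proof -
    have "cmod (g z - G z) \<le> M / real n * cmod (z - A)" using lip[OF that AT] gA by simp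
    also have "\<dots> \<le> M / real n * 1"
      using triangle_subset_cball[OF norm_e that[unfolded T_eq]] M n0 by (intro mult_left_mono) auto
    finally show ?thesis using Mm by simp
  qed
  have inj: "inj_on g T"
  proof (rule inj_onI)
    fix z y assume zy: "z \<in> T" "y \<in> T" "g z = g y"
    have "m * cmod (z - y) \<le> M / real n * cmod (z - y)"
      using m(2)[OF zy(2,1)] lip[OF zy(1,2)] zy(3) by (simp add: norm_minus_commute)
    then have "(m - M / real n) * cmod (z - y) \<le> 0" by (simp add: left_diff_distrib)
    then have "cmod (z - y) \<le> 0" using Mm by (simp add: mult_le_0_iff)
    then show "z = y" by simp
  qed
  have "grid_realization A d n x w"
    by unfold_locales (use n3 d fl edge up down inj in \<open>auto simp: g_def T[symmetric]\<close>)
  then show ?thesis using that close unfolding d_def g_def by blast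
qed

end

section \<open>Exhaustion of the domain\<close>

text \<open>\<open>f ` R\<close> is connected, meets \<open>g ` T\<close> and avoids the frontier of \<open>g ` T\<close>, which by invariance of
  domain lies in the image of the boundary of \<open>T\<close>.\<close>

lemma image_absorbs_compact:
  fixes f :: "complex \<Rightarrow> complex"
  assumes T: "compact T" "convex T" "interior T \<noteq> {}" and f: "continuous_on T f" "inj_on f T"
    and S: "compact S" "S \<subseteq> f ` interior T"
  obtains \<eta> where "\<eta> > 0" "\<And>g. continuous_on T g \<Longrightarrow> inj_on g T \<Longrightarrow> (\<And>z. z \<in> T \<Longrightarrow> cmod (g z - f z) < \<eta>) \<Longrightarrow> S \<subseteq> g ` T"
proof -
  obtain fi where fi: "homeomorphism T (f ` T) f fi"
    using homeomorphism_compact[OF T(1) f(1) refl f(2)] by blast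
  obtain c r where r: "r > 0" "cball c r \<subseteq> interior T"
    using T(3) open_interior[of T] unfolding open_contains_cball by blast
  have intT: "interior T \<subseteq> T" by (rule interior_subset)
  have S': "S \<subseteq> f ` T" using S(2) intT by blast
  have fiS: "fi ` S \<subseteq> interior T"
  proof
    fix z assume "z \<in> fi ` S"
    then obtain u where "u \<in> interior T" "z = fi (f u)" using S(2) by blast
    then show "z \<in> interior T" using fi intT by (auto simp: homeomorphism_def)
  qed
  \<comment> \<open>A connected compact set that contains the preimage of S and a ball around c; the
    ball provides the point where both images meet.\<close>
  define R where "R = convex hull (fi ` S \<union> cball c r)"
  have "compact (fi ` S)"
    using S(1) fi S' by (intro compact_continuous_image) (auto simp: homeomorphism_def intro: continuous_on_subset)
  then have compR: "compact R" unfolding R_def by (intro compact_convex_hull compact_Un compact_cball)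
  have R: "R \<subseteq> interior T" unfolding R_def using fiS r(2) T(2) by (intro hull_minimal) auto
  have cR: "cball c r \<subseteq> R" "fi ` S \<subseteq> R" unfolding R_def using hull_subset[of "fi ` S \<union> cball c r" convex] by auto
  have contR: "continuous_on R f" using f(1) R intT by (meson continuous_on_subset subset_trans)
  have connR: "connected (f ` R)"
    unfolding R_def[symmetric] using contR by (rule connected_continuous_image) (simp add: R_def convex_connected)
  have SR: "S \<subseteq> f ` R"
  proof
    fix y assume y: "y \<in> S"
    then have "y = f (fi y)" using fi S' by (auto simp: homeomorphism_def)
    then show "y \<in> f ` R" using cR(2) y by blast
  qed
  have "compact (f ` (T - interior T))"
    using T(1) f(1) by (intro compact_continuous_image compact_diff) (auto intro: continuous_on_subset)
  moreover have "f ` R \<inter> f ` (T - interior T) = {}"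
    using f(2) R intT by (auto simp: inj_on_def)
  ultimately obtain \<eta>1 where \<eta>1: "\<eta>1 > 0" "\<And>y z. y \<in> f ` R \<Longrightarrow> z \<in> f ` (T - interior T) \<Longrightarrow> \<eta>1 \<le> dist y z"
    using separate_compact_closed[OF compact_continuous_image[OF contR compR]] compact_imp_closed by meson
  have bT: "ball c r \<subseteq> T" using r(2) intT ball_subset_cball by blast
  have "open (f ` ball c r)"
    using f bT by (intro invariance_of_domain) (auto intro: continuous_on_subset inj_on_subset)
  moreover have "f c \<in> f ` ball c r" using r(1) by simp
  \<comment> \<open>Closeness \<eta>2 puts g c into the image of the ball, so that the two images do
    meet.\<close>
  ultimately obtain \<eta>2 where \<eta>2: "\<eta>2 > 0" "ball (f c) \<eta>2 \<subseteq> f ` ball c r" using open_contains_ball by meson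
  show ?thesis
  proof (rule that[of "min \<eta>1 \<eta>2"])
    show "min \<eta>1 \<eta>2 > 0" using \<eta>1 \<eta>2 by simp
    fix g assume g: "continuous_on T g" "inj_on g T" and close: "\<And>z. z \<in> T \<Longrightarrow> cmod (g z - f z) < min \<eta>1 \<eta>2"
    have "open (g ` interior T)"
      using g intT by (intro invariance_of_domain) (auto intro: continuous_on_subset inj_on_subset)
    then have int: "g ` interior T \<subseteq> interior (g ` T)" using intT by (intro interior_maximal image_mono)
    have "closed (g ` T)" using T(1) g(1) by (intro compact_imp_closed compact_continuous_image)
    then have fr: "frontier (g ` T) = g ` T - interior (g ` T)" by (simp add: frontier_def)
    have "f ` R \<inter> frontier (g ` T) = {}"
    proof (rule ccontr)
      assume "f ` R \<inter> frontier (g ` T) \<noteq> {}"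
      then obtain y where y: "y \<in> f ` R" "y \<in> g ` T" "y \<notin> interior (g ` T)" unfolding fr by auto
      from y(2) obtain z where "y = g z" "z \<in> T" by (rule imageE)
      with y have z: "z \<in> T" "g z \<in> f ` R" "g z \<notin> interior (g ` T)" by simp_all
      then have "z \<in> T - interior T" using int by blast
      then have "\<eta>1 \<le> dist (g z) (f z)" using \<eta>1(2)[OF z(2)] by blast
      with close[OF z(1)] show False by (simp add: dist_norm)
    qed
    moreover have "f ` R \<inter> g ` T \<noteq> {}"
    proof -
      have c: "c \<in> T" using bT r(1) by auto
      have "g c \<in> ball (f c) \<eta>2" using close[OF c] by (simp add: dist_norm norm_minus_commute)
      then have "g c \<in> f ` R" using \<eta>2(2) cR(1) ball_subset_cball by blast
      with c show ?thesis by blast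
    qed
    ultimately have "f ` R \<subseteq> g ` T" using connected_Int_frontier[OF connR] by blast
    with SR show "S \<subseteq> g ` T" by blast
  qed
qed

text \<open>The contraction towards an interior point maps all of \<open>T\<close>, and hence a
  neighbourhood, into the interior where \<open>f\<close> is holomorphic. Uniform continuity of
  \<open>f\<close> on \<open>T\<close> makes the change small.\<close>

lemma univalent_approximation:
  assumes T_eq: "T = convex hull {A, A + e, A + e * hex_root}" and norm_e: "cmod e = 1"
    and f: "continuous_on T f" "inj_on f T" "f holomorphic_on interior T" and "\<epsilon> > 0"
  obtains G L U where "univalent_triangle G L U T A e" "G ` T \<subseteq> f ` interior T"
    "\<And>z. z \<in> T \<Longrightarrow> cmod (G z - f z) < \<epsilon>"
proof -
  have T: "compact T" "convex T" unfolding T_eq by (simp_all add: compact_convex_hull finite_imp_compact)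
  have "interior T \<noteq> {}" unfolding T_eq using norm_e by (intro interior_triangle_nonempty) auto
  then obtain c where c: "c \<in> interior T" by blast
  have "uniformly_continuous_on T f" using f(1) T(1) by (rule compact_uniformly_continuous)
  then obtain \<delta> where \<delta>: "\<delta> > 0" "\<And>z y. z \<in> T \<Longrightarrow> y \<in> T \<Longrightarrow> dist y z < \<delta> \<Longrightarrow> dist (f y) (f z) < \<epsilon>"
    unfolding uniformly_continuous_on_def using \<open>\<epsilon> > 0\<close> by metis
  \<comment> \<open>Points of T are at distance at most 2 from c, so the contraction moves them by
    at most 2 s < \<delta>.\<close>
  define s where "s = min (1/2) (\<delta> / 4)"
  have s: "0 < s" "s < 1" "s \<le> 1" "2 * s < \<delta>" using \<delta>(1) by (auto simp: s_def min_def)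
  define h where "h = (\<lambda>z. z - s *\<^sub>R (z - c))"
  have h_int: "h z \<in> interior T" if "z \<in> T" for z
    unfolding h_def by (rule mem_interior_convex_shrink[OF T(2) c that s(1,3)])
  have h_inj: "h z = h y \<Longrightarrow> z = y" for z y
  proof -
    assume "h z = h y"
    then have "(1 - s) *\<^sub>R (z - y) = 0" by (simp add: h_def algebra_simps)
    then show "z = y" using s by simp
  qed
  have h_holo: "h holomorphic_on X" for X
    unfolding h_def scaleR_conv_of_real by (intro holomorphic_intros)
  define U where "U = h -` interior T"
  have openU: "open U"
    unfolding U_def using h_holo[of UNIV] by (intro open_vimage open_interior) (rule holomorphic_on_imp_continuous_on)
  have convU: "convex U"
  proof (rule convexI)
    fix x y and u v :: real assume xy: "x \<in> U" "y \<in> U" "0 \<le> u" "0 \<le> v" "u + v = 1"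
    have u: "u = 1 - v" using xy by simp
    have "h (u *\<^sub>R x + v *\<^sub>R y) = u *\<^sub>R h x + v *\<^sub>R h y"
      unfolding h_def u by (simp add: algebra_simps)
    moreover have "u *\<^sub>R h x + v *\<^sub>R h y \<in> interior T"
      using convexD[OF convex_interior[OF T(2)]] xy by (simp add: U_def)
    ultimately show "u *\<^sub>R x + v *\<^sub>R y \<in> U" by (simp add: U_def)
  qed
  have TU: "T \<subseteq> U" using h_int by (auto simp: U_def)
  define G where "G = f \<circ> h"
  have holoG: "G holomorphic_on U"
    unfolding G_def by (rule holomorphic_on_compose_gen[OF h_holo f(3)]) (auto simp: U_def)
  have injG: "inj_on G U"
  proof (rule inj_onI)
    fix z y assume "z \<in> U" "y \<in> U" "G z = G y"
    then have "f (h z) = f (h y)" "h z \<in> T" "h y \<in> T" using interior_subset[of T] by (auto simp: U_def G_def)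
    then have "h z = h y" by (rule inj_onD[OF f(2)])
    then show "z = y" by (rule h_inj)
  qed
  have cU: "c \<in> U" using c interior_subset[of T] TU by blast
  \<comment> \<open>A univalent function has no critical points, and U is convex as the affine
    preimage of a convex set; so the derivative has a holomorphic logarithm.\<close>
  obtain L where L: "L holomorphic_on U" "\<And>z. z \<in> U \<Longrightarrow> exp (L z) = deriv G z"
  proof (rule holomorphic_logarithm_exists[OF convU openU holomorphic_deriv[OF holoG openU] _ cU])
    show "deriv G z \<noteq> 0" if "z \<in> U" for z by (rule holomorphic_injective_imp_regular[OF holoG openU injG that])
  qed (rule that)
  show ?thesis
  proof
    show "univalent_triangle G L U T A e"
      by unfold_locales (use openU TU T holoG injG L norm_e in \<open>auto simp: T_eq\<close>)
    show "G ` T \<subseteq> f ` interior T" using h_int by (auto simp: G_def)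
    fix z assume z: "z \<in> T"
    have "cmod (z - c) \<le> 2"
      using triangle_subset_cball[OF norm_e z[unfolded T_eq]] triangle_subset_cball[OF norm_e, of c A] c interior_subset[of T]
        norm_triangle_ineq4[of "z - A" "c - A"] by (auto simp: T_eq)
    then have "s * cmod (z - c) \<le> s * 2" using s by (intro mult_left_mono) auto
    then have "s * cmod (z - c) < \<delta>" using s(4) by linarith
    then have "dist (h z) z < \<delta>" using s(1) by (simp add: h_def dist_norm)
    from \<delta>(2)[OF z _ this] h_int[OF z] interior_subset[of T]
    show "cmod (G z - f z) < \<epsilon>" by (auto simp: G_def dist_norm)
  qed
qed

lemma packing_approximation:
  assumes T_eq: "T = convex hull {A, A + e, A + e * hex_root}" and norm_e: "cmod e = 1"
    and f: "continuous_on T f" "inj_on f T" "f holomorphic_on interior T" and "\<epsilon> > 0"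
    and S: "compact S" "S \<subseteq> f ` interior T"
  obtains n x w where "grid_realization A (e / of_nat n) n x w"
    "S \<subseteq> pl_interp A (e / of_nat n) n x ` T" "pl_interp A (e / of_nat n) n x ` T \<subseteq> f ` interior T"
    "\<And>z. z \<in> T \<Longrightarrow> cmod (pl_interp A (e / of_nat n) n x z - f z) < \<epsilon>"
proof -
  have T: "compact T" "convex T" unfolding T_eq by (simp_all add: compact_convex_hull finite_imp_compact)
  have intT: "interior T \<noteq> {}" unfolding T_eq using norm_e by (intro interior_triangle_nonempty) auto
  obtain \<eta> where \<eta>: "\<eta> > 0" "\<And>g. continuous_on T g \<Longrightarrow> inj_on g T \<Longrightarrow> (\<And>z. z \<in> T \<Longrightarrow> cmod (g z - f z) < \<eta>) \<Longrightarrow> S \<subseteq> g ` T"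
    by (rule image_absorbs_compact[OF T intT f(1,2) S]) blast
  define \<epsilon>' where "\<epsilon>' = min \<epsilon> \<eta> / 2"
  have \<epsilon>': "\<epsilon>' > 0" "2 * \<epsilon>' \<le> \<epsilon>" "2 * \<epsilon>' \<le> \<eta>" using \<open>\<epsilon> > 0\<close> \<eta>(1) by (auto simp: \<epsilon>'_def)
  obtain G L U where G: "univalent_triangle G L U T A e" "G ` T \<subseteq> f ` interior T" "\<And>z. z \<in> T \<Longrightarrow> cmod (G z - f z) < \<epsilon>'"
    using univalent_approximation[OF T_eq norm_e f \<epsilon>'(1)] by blast
  interpret G: univalent_triangle G L U T A e by (rule G(1))
  have "continuous_on T G"
    using holomorphic_on_imp_continuous_on[OF G.holo_G] G.T_U by (rule continuous_on_subset)
  then have "compact (G ` T)" using T(1) by (rule compact_continuous_image)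
  moreover have "open (f ` interior T)"
    using f(1,2) interior_subset[of T] by (intro invariance_of_domain) (auto intro: continuous_on_subset inj_on_subset)
  ultimately obtain \<delta> where \<delta>: "\<delta> > 0" "(\<Union>y\<in>G ` T. ball y \<delta>) \<subseteq> f ` interior T"
    using compact_subset_open_imp_ball_epsilon_subset G(2) by metis
  have "min \<epsilon>' \<delta> > 0" using \<epsilon>' \<delta> by simp
  then obtain n x w where gr: "grid_realization A (e / of_nat n) n x w"
    and close: "\<And>z. z \<in> T \<Longrightarrow> cmod (pl_interp A (e / of_nat n) n x z - G z) < min \<epsilon>' \<delta>"
    by (rule G.exists_realization) blast
  define g where "g = pl_interp A (e / of_nat n) n x"
  interpret R: grid_realization A "e / of_nat n" n x w by (rule gr)
  have ne: "of_nat n * (e / of_nat n) = e" using R.n_pos by simp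
  have gf: "cmod (g z - f z) < 2 * \<epsilon>'" if "z \<in> T" for z
    using norm_triangle_ineq[of "g z - G z" "G z - f z"] close[OF that] G(3)[OF that] by (simp add: g_def)
  show ?thesis
  proof (rule that[OF gr]; fold g_def)
    have "continuous_on T g" unfolding g_def by (rule continuous_on_pl_interp[OF R.d_nz])
    moreover have "inj_on g T" using R.inj_interp by (simp only: ne T_eq g_def)
    ultimately show "S \<subseteq> g ` T"
    proof (rule \<eta>(2))
      show "cmod (g z - f z) < \<eta>" if "z \<in> T" for z using gf[OF that] \<epsilon>' by linarith
    qed
    show "g ` T \<subseteq> f ` interior T"
    proof
      fix y assume "y \<in> g ` T"
      then obtain z where z: "z \<in> T" "y = g z" by blast
      then have "y \<in> ball (G z) \<delta>" using close[OF z(1)] by (simp add: g_def dist_norm norm_minus_commute)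
      then show "y \<in> f ` interior T" using \<delta>(2) z(1) by blast
    qed
    show "cmod (g z - f z) < \<epsilon>" if "z \<in> T" for z using gf[OF that] \<epsilon>' by linarith
  qed
qed

section \<open>Assembly of the sequence and reduction of the orientation\<close>

definition approximable ::
  "complex \<Rightarrow> complex \<Rightarrow> complex \<Rightarrow> complex set \<Rightarrow> complex \<Rightarrow> complex \<Rightarrow> complex \<Rightarrow> (complex \<Rightarrow> complex) \<Rightarrow> bool"
  where "approximable A B C \<Omega> p q r f \<longleftrightarrow> (\<exists>(\<Omega>n :: nat \<Rightarrow> complex set) (Tn :: nat \<Rightarrow> complex set set)
      (In :: nat \<Rightarrow> complex set \<Rightarrow> real) (ln :: nat \<Rightarrow> complex set \<Rightarrow> real)
      (pn :: nat \<Rightarrow> complex) (qn :: nat \<Rightarrow> complex) (rn :: nat \<Rightarrow> complex)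
      (fn :: nat \<Rightarrow> complex \<Rightarrow> complex).
    (\<forall>n. weighted_triangulated_disk (\<Omega>n n) (Tn n) (In n) (pn n) (qn n) (rn n)) \<and>
    (\<forall>n. euclidean_packing_metric (Tn n) (In n) (ln n)) \<and>
    \<Omega> = (\<Union>n. \<Omega>n n) \<and> (\<forall>n. \<Omega>n n \<subseteq> \<Omega>n (Suc n)) \<and>
    pn \<longlonglongrightarrow> p \<and> qn \<longlonglongrightarrow> q \<and> rn \<longlonglongrightarrow> r \<and>
    (\<forall>n. discrete_conformal_map_exists (Tn n) (In n) (ln n) (pn n) (qn n) (rn n)) \<and>
    (\<forall>n. discrete_conformal_map A B C (Tn n) (In n) (ln n) (pn n) (qn n) (rn n) (fn n)) \<and>
    uniform_limit (convex hull {A, B, C}) fn f sequentially)"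

text \<open>Each image is compact in \<Omega>, so the next one can be required to cover it together
  with the next set of a compact exhaustion. Dependent choice then gives increasing images with
  union \<Omega>.\<close>

lemma approximable_hex_triangle:
  assumes norm_e: "cmod e = 1"
    and rm: "riemann_mapping A (A + e) (A + e * hex_root) \<Omega> p q r f"
  shows "approximable A (A + e) (A + e * hex_root) \<Omega> p q r f"
proof -
  define T where T_eq: "T = convex hull {A, A + e, A + e * hex_root}"
  have compT: "compact T" unfolding T_eq by (simp add: compact_convex_hull finite_imp_compact)
  obtain fi where fi: "homeomorphism T (closure \<Omega>) f fi" and f3: "f holomorphic_on interior T"
    and im: "f ` interior T = \<Omega>" and pqr: "f A = p" "f (A + e) = q" "f (A + e * hex_root) = r"
    using rm unfolding riemann_mapping_def T_eq[symmetric] by blast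
  have "inj_on f T" using fi by (intro inj_on_inverseI[of T fi]) (auto simp: homeomorphism_def)
  with fi f3 have f: "continuous_on T f" "inj_on f T" "f holomorphic_on interior T"
    by (simp_all add: homeomorphism_def)
  have open_\<Omega>: "open \<Omega>"
    unfolding im[symmetric] using f(1,2) interior_subset[of T]
    by (intro invariance_of_domain) (auto intro: continuous_on_subset inj_on_subset)
  obtain K :: "nat \<Rightarrow> complex set" where K: "\<And>k. compact (K k)" "\<And>k. K k \<subseteq> \<Omega>" "\<Union>(range K) = \<Omega>"
    by (rule open_Union_compact_subsets[OF open_\<Omega>]) blast
  define gf where "gf = (\<lambda>(n, x :: int \<times> int \<Rightarrow> complex, w :: int \<times> int \<Rightarrow> real). pl_interp A (e / of_nat n) n x)"
  \<comment> \<open>The clause on K k makes the union exhaust \<Omega>, the last one makes the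
    convergence uniform; monotonicity is added in the choice below.\<close>
  define good where "good = (\<lambda>(k :: nat) \<sigma>. (case \<sigma> of (n, x, w) \<Rightarrow> grid_realization A (e / of_nat n) n x w) \<and>
    K k \<subseteq> gf \<sigma> ` T \<and> gf \<sigma> ` T \<subseteq> \<Omega> \<and> (\<forall>z\<in>T. cmod (gf \<sigma> z - f z) < 1 / real (Suc k)))"
  have step: "\<exists>\<sigma>. good k \<sigma> \<and> S \<subseteq> gf \<sigma> ` T" if "compact S" "S \<subseteq> \<Omega>" for S k
  proof -
    have KS: "compact (K k \<union> S)" "K k \<union> S \<subseteq> f ` interior T" using K that im by auto
    have k: "1 / real (Suc k) > 0" by simp
    obtain n x w
      where "grid_realization A (e / of_nat n) n x w"
        "K k \<union> S \<subseteq> pl_interp A (e / of_nat n) n x ` T" "pl_interp A (e / of_nat n) n x ` T \<subseteq> f ` interior T"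
        "\<And>z. z \<in> T \<Longrightarrow> cmod (pl_interp A (e / of_nat n) n x z - f z) < 1 / real (Suc k)"
      by (rule packing_approximation[OF T_eq norm_e f k KS]) (rule that)
    then show ?thesis by (intro exI[of _ "(n, x, w)"]) (simp add: good_def gf_def im)
  qed
  have compact_image: "compact (gf \<sigma> ` T)" if "good k \<sigma>" for k \<sigma>
  proof -
    obtain n x w where \<sigma>: "\<sigma> = (n, x, w)" by (cases \<sigma>)
    have "grid_realization A (e / of_nat n) n x w" using that by (simp add: good_def \<sigma>)
    then have "e / of_nat n \<noteq> 0" by (rule grid_realization.d_nz)
    then show ?thesis using compT by (simp add: \<sigma> gf_def compact_continuous_image continuous_on_pl_interp)
  qed
  have "\<exists>\<sigma>. \<forall>k. good k (\<sigma> k) \<and> gf (\<sigma> k) ` T \<subseteq> gf (\<sigma> (Suc k)) ` T"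
  proof (rule dependent_nat_choice)
    show "\<exists>\<sigma>. good 0 \<sigma>" using step[of "{}" 0] by auto
    fix \<sigma> k assume \<sigma>: "good k \<sigma>"
    then have "gf \<sigma> ` T \<subseteq> \<Omega>" by (simp add: good_def)
    with compact_image[OF \<sigma>] show "\<exists>\<tau>. good (Suc k) \<tau> \<and> gf \<sigma> ` T \<subseteq> gf \<tau> ` T"
      by (rule step)
  qed
  then obtain \<sigma> where \<sigma>: "\<And>k. good k (\<sigma> k)" and mono: "\<And>k. gf (\<sigma> k) ` T \<subseteq> gf (\<sigma> (Suc k)) ` T" by blast
  define N x w where "N = (\<lambda>k. fst (\<sigma> k))" and "x = (\<lambda>k. fst (snd (\<sigma> k)))" and "w = (\<lambda>k. snd (snd (\<sigma> k)))"
  define g where "g = (\<lambda>k. pl_interp A (e / of_nat (N k)) (N k) (x k))"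
  have g: "gf (\<sigma> k) = g k" for k by (simp add: gf_def g_def N_def x_def case_prod_unfold)
  have R: "grid_realization A (e / of_nat (N k)) (N k) (x k) (w k)" for k
    using \<sigma>[of k] by (simp add: good_def N_def x_def w_def case_prod_unfold)
  have ne: "of_nat (N k) * (e / of_nat (N k)) = e" for k using grid_realization.n_pos[OF R[of k]] by simp
  have K': "K k \<subseteq> g k ` T" and sub: "g k ` T \<subseteq> \<Omega>" and close: "\<And>z. z \<in> T \<Longrightarrow> cmod (g k z - f z) < 1 / real (Suc k)" for k
    using \<sigma>[of k] by (auto simp: good_def g)
  have lim: "uniform_limit T g f sequentially"
  proof (rule uniform_limitI)
    fix \<epsilon> :: real assume "\<epsilon> > 0"
    then have "eventually (\<lambda>k. 1 / real (Suc k) < \<epsilon>) sequentially"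
      using LIMSEQ_inverse_real_of_nat by (intro order_tendstoD(2)[of _ 0]) (simp_all add: inverse_eq_divide)
    then show "\<forall>\<^sub>F k in sequentially. \<forall>z\<in>T. dist (g k z) (f z) < \<epsilon>"
      by eventually_elim (use close in \<open>force simp: dist_norm intro: less_trans\<close>)
  qed
  \<comment> \<open>The marked vertices are values of the interpolation at the fixed corners of T,
    so their convergence is a special case of uniform convergence.\<close>
  have corner: "x k v = g k (lat A (e / of_nat (N k)) v)" if "v \<in> grid (N k)" for k v
    unfolding g_def using pl_interp_lat[OF grid_realization.d_nz[OF R] grid_realization.n_pos(1)[OF R] that] by simp
  have corners: "x k (0, 0) = g k A" "x k (int (N k), 0) = g k (A + e)" "x k (0, int (N k)) = g k (A + e * hex_root)" for k
  proof -
    have "lat A (e / of_nat (N k)) (0, 0) = A" "lat A (e / of_nat (N k)) (int (N k), 0) = A + e"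
      "lat A (e / of_nat (N k)) (0, int (N k)) = A + e * hex_root"
      using grid_realization.n_pos(2)[OF R[of k]] by (simp_all add: lat_def)
    then show "x k (0, 0) = g k A" "x k (int (N k), 0) = g k (A + e)" "x k (0, int (N k)) = g k (A + e * hex_root)"
      by (simp_all add: corner grid_def)
  qed
  have vT: "A \<in> T" "A + e \<in> T" "A + e * hex_root \<in> T" by (simp_all add: T_eq hull_inc)
  have gk: "pl_interp A (e / of_nat (N k)) (N k) (x k) = g k" for k by (simp add: g_def)
  define F I where "F = (\<lambda>k. (`) (x k) ` grid_faces (N k))" and "I = (\<lambda>k (_ :: complex set). (real (N k))\<^sup>2 / 2 - 1)"
  have A1: "weighted_triangulated_disk (g k ` T) (F k) (I k) (g k A) (g k (A + e)) (g k (A + e * hex_root))" for k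
    using grid_realization.weighted_disk[OF R[of k]] by (simp only: ne T_eq[symmetric] corners F_def I_def gk)
  have A2: "euclidean_packing_metric (F k) (I k) diameter" for k
    using grid_realization.euclidean_packing[OF R[of k]] by (simp only: F_def I_def)
  have A3: "discrete_conformal_map_exists (F k) (I k) diameter (g k A) (g k (A + e)) (g k (A + e * hex_root))" for k
    using grid_realization.uniformized[OF R[of k]] unfolding discrete_conformal_map_exists_def corners F_def I_def by blast
  have A4: "discrete_conformal_map A (A + e) (A + e * hex_root) (F k) (I k) diameter (g k A) (g k (A + e)) (g k (A + e * hex_root)) (g k)" for k
    using grid_realization.conformal_map[OF R[of k]] by (simp only: ne corners F_def I_def gk)
  have U: "\<Omega> = (\<Union>k. g k ` T)"
  proof
    show "\<Omega> \<subseteq> (\<Union>k. g k ` T)" unfolding K(3)[symmetric] by (intro UN_mono order_refl K')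
    show "(\<Union>k. g k ` T) \<subseteq> \<Omega>" by (intro UN_least sub)
  qed
  have M: "g k ` T \<subseteq> g (Suc k) ` T" for k using mono[of k] by (simp only: g)
  show ?thesis
    unfolding approximable_def T_eq[symmetric]
  proof (intro exI conjI allI)
    show "(\<lambda>k. g k A) \<longlonglongrightarrow> p" "(\<lambda>k. g k (A + e)) \<longlonglongrightarrow> q" "(\<lambda>k. g k (A + e * hex_root)) \<longlonglongrightarrow> r"
      using vT[THEN tendsto_uniform_limitI[OF lim]] by (simp_all only: pqr)
  qed (rule A1 A2 A3 A4 U M lim)+
qed

text \<open>The marked points enter only as a set or matched with \<open>A\<close>,
  \<open>B\<close>, \<open>C\<close>, and preservation of orientation is asked of the map on each
  triangle, not of the labelling. So exchanging both pairs of labels changes nothing.\<close>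

lemma approximable_swap:
  assumes "approximable A C B \<Omega> p r q f"
  shows "approximable A B C \<Omega> p q r f"
proof -
  have swap: "{a, c, b} = {a, b, c}" for a b c :: complex by blast
  have weighted: "weighted_triangulated_disk D F I p q r" if "weighted_triangulated_disk D F I p r q" for D F I and p q r :: complex
    using that unfolding weighted_triangulated_disk_def swap[of p r q] by auto
  have unif: "uniformizes F I l p r q w ls \<longleftrightarrow> uniformizes F I l p q r w ls" for F I l w ls and p q r :: complex
    unfolding uniformizes_def swap[of p r q] by (rule refl)
  have map: "discrete_conformal_map A B C F I l p q r g" if "discrete_conformal_map A C B F I l p r q g" for F I l g and p q r :: complex
    using that unfolding discrete_conformal_map_def swap[of A C B] unif[of F I l p r q] by (elim exE conjE) (intro exI conjI; assumption)
  have ex: "discrete_conformal_map_exists F I l p q r" if "discrete_conformal_map_exists F I l p r q" for F I l and p q r :: complex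
    using that unfolding discrete_conformal_map_exists_def unif[of F I l p r q] .
  from assms obtain \<Omega>n Tn In ln pn rn qn fn where h:
    "\<forall>n :: nat. weighted_triangulated_disk (\<Omega>n n) (Tn n) (In n) (pn n) (rn n) (qn n)"
    "\<forall>n. euclidean_packing_metric (Tn n) (In n) (ln n)"
    "\<Omega> = (\<Union>n. \<Omega>n n)" "\<forall>n. \<Omega>n n \<subseteq> \<Omega>n (Suc n)" "pn \<longlonglongrightarrow> p" "rn \<longlonglongrightarrow> r" "qn \<longlonglongrightarrow> q"
    "\<forall>n. discrete_conformal_map_exists (Tn n) (In n) (ln n) (pn n) (rn n) (qn n)"
    "\<forall>n. discrete_conformal_map A C B (Tn n) (In n) (ln n) (pn n) (rn n) (qn n) (fn n)"
    "uniform_limit (convex hull {A, B, C}) fn f sequentially"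
    unfolding approximable_def swap[of A C B] by (elim exE conjE) (rule that)
  then show ?thesis
    unfolding approximable_def by (intro exI[of _ \<Omega>n] exI[of _ Tn] exI[of _ In] exI[of _ ln] exI[of _ pn] exI[of _ qn] exI[of _ rn] exI[of _ fn] conjI allI)
      (rule h(2)[THEN spec] h(3-7,10) h(4)[THEN spec] weighted[OF h(1)[THEN spec]] ex[OF h(8)[THEN spec]] map[OF h(9)[THEN spec]])+
qed

text \<open>The quotient of two sides has distance 1 from both 0 and 1, which leaves
  \<open>hex_root\<close> and its conjugate. The conjugate is the inverse, so that case becomes the
  first one with \<open>B\<close> and \<open>C\<close> exchanged.\<close>

lemma equilateral_cases:
  assumes "dist A B = 1" "dist B C = 1" "dist C A = (1 :: real)"
  shows "C = A + (B - A) * hex_root \<or> B = A + (C - A) * hex_root"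
proof -
  define e r where "e = B - A" and "r = (C - A) / (B - A)"
  have e: "cmod e = 1" "e \<noteq> 0" using assms(1) by (auto simp: e_def dist_norm norm_minus_commute)
  have C: "C - A = e * r" using e by (simp add: r_def e_def)
  have "C - B = e * (r - 1)" using C by (simp add: e_def algebra_simps)
  then have "cmod r = 1" "cmod (r - 1) = 1"
    using assms(2,3) e(1) C by (simp_all add: dist_norm norm_mult norm_minus_commute[of B C])
  then have eq: "(Re r)\<^sup>2 + (Im r)\<^sup>2 = 1" "(Re r - 1)\<^sup>2 + (Im r)\<^sup>2 = 1"
    by (simp_all add: cmod_def)
  then have re: "Re r = 1/2" by (simp add: power2_eq_square algebra_simps)
  then have "(Im r)\<^sup>2 = (sqrt 3 / 2)\<^sup>2" using eq(1) unfolding re by (simp add: power_divide)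
  then have "Im r = sqrt 3 / 2 \<or> Im r = - (sqrt 3 / 2)" by (simp only: power2_eq_iff)
  then show ?thesis
  proof
    assume "Im r = sqrt 3 / 2"
    then have "r = hex_root" using re by (simp add: complex_eq_iff hex_root_def)
    then show ?thesis using C by (simp add: e_def algebra_simps)
  next
    assume "Im r = - (sqrt 3 / 2)"
    then have "r * hex_root = 1" using re by (simp add: complex_eq_iff hex_root_def)
    then have "(C - A) * hex_root = e" using C by (simp add: mult.assoc)
    then show ?thesis by (simp add: e_def)
  qed
qed

theorem theorem1p2:
  fixes \<Omega> :: "complex set" and p q r A B C :: complex and f :: "complex \<Rightarrow> complex"
  assumes "jordan_domain \<Omega>"
    and "{p, q, r} \<subseteq> frontier \<Omega>" and "distinct [p, q, r]"
    and "dist A B = 1" and "dist B C = 1" and "dist C A = 1"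
    and "counterclockwise (interior (convex hull {A, B, C})) A B C \<longleftrightarrow> counterclockwise \<Omega> p q r"
    and "riemann_mapping A B C \<Omega> p q r f"
  shows "\<exists>(\<Omega>n :: nat \<Rightarrow> complex set) (Tn :: nat \<Rightarrow> complex set set)
      (In :: nat \<Rightarrow> complex set \<Rightarrow> real) (ln :: nat \<Rightarrow> complex set \<Rightarrow> real)
      (pn :: nat \<Rightarrow> complex) (qn :: nat \<Rightarrow> complex) (rn :: nat \<Rightarrow> complex)
      (fn :: nat \<Rightarrow> complex \<Rightarrow> complex).
    (\<forall>n. weighted_triangulated_disk (\<Omega>n n) (Tn n) (In n) (pn n) (qn n) (rn n)) \<and>
    (\<forall>n. euclidean_packing_metric (Tn n) (In n) (ln n)) \<and>
    \<Omega> = (\<Union>n. \<Omega>n n) \<and> (\<forall>n. \<Omega>n n \<subseteq> \<Omega>n (Suc n)) \<and>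
    pn \<longlonglongrightarrow> p \<and> qn \<longlonglongrightarrow> q \<and> rn \<longlonglongrightarrow> r \<and>
    (\<forall>n. discrete_conformal_map_exists (Tn n) (In n) (ln n) (pn n) (qn n) (rn n)) \<and>
    (\<forall>n. discrete_conformal_map A B C (Tn n) (In n) (ln n) (pn n) (qn n) (rn n) (fn n)) \<and>
    uniform_limit (convex hull {A, B, C}) fn f sequentially"
proof -
  have "approximable A B C \<Omega> p q r f"
    using equilateral_cases[OF assms(4-6)]
  proof
    assume C: "C = A + (B - A) * hex_root"
    have "cmod (B - A) = 1" using assms(4) by (simp add: dist_norm norm_minus_commute)
    then show ?thesis using approximable_hex_triangle[of "B - A" A \<Omega> p q r f] assms(8) C by simp
  next
    \<comment> \<open>Clockwise labelling: the construction is applied to A, C, B with p, r, q, and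
      the labels are then exchanged back.\<close>
    assume B: "B = A + (C - A) * hex_root"
    have n: "cmod (C - A) = 1" using assms(6) by (simp add: dist_norm)
    have "{A, C, B} = {A, B, C}" by blast
    then have "riemann_mapping A C B \<Omega> p r q f" using assms(8) unfolding riemann_mapping_def by simp
    then have "approximable A C B \<Omega> p r q f" using approximable_hex_triangle[of "C - A" A \<Omega> p r q f] n B by simp
    then show ?thesis by (rule approximable_swap)
  qed
  then show ?thesis unfolding approximable_def .
qed

end
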